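(* There exists a (generically defined) Poisson structure on the space $\mathcal{P}_n$ of twisted $n$-gons modulo projective equivalence which has corank $2$ when $n$ is odd and corank $4$ when $n$ is even. The exceptional monodromy functions (namely $O_n,E_n$ when $n$ is odd, and $O_n,E_n,O_{n/2},E_{n/2}$ when $n$ is even) generically span the null space of the Poisson structure, and the remaining monodromy invariants (the functions $O_k,E_k$ with $1\le k\le[n/2]$, excluding $k=n/2$ when $n$ is even) Poisson-commute. Finally, the Poisson structure is invariant under the pentagram map $T$.
   Context: Let $n\ge 3$. All indices of $n$-periodic sequences are read mod $n$. Twisted polygons. A twisted $n$-gon is a map $\phi:\mathbb{Z}\to\mathbb{RP}^2$ such that $\phi(k+n)=M(\phi(k))$ for all $k$, for some projective transformation $M$ of $\mathbb{RP}^2$ (the monodromy), and such that every three consecutive points $v_{i-1},v_i,v_{i+1}$ (where $v_i=\phi(i)$) are non-collinear. Two twisted $n$-gons $\phi_1,\phi_2$ are equivalent if $\Psi\circ\phi_1=\phi_2$ for some projective transformation $\Psi$. $\mathcal{P}_n$ is the space of equivalence classes. Corner invariants. Write $(p,q)$ for the line through $p\neq q$, and for four collinear points with affine parameters $t_1,\dots,t_4$ put $[t_1,t_2,t_3,t_4]=\frac{(t_1-t_2)(t_3-t_4)}{(t_1-t_3)(t_2-t_4)}$. Define $$x_i=[v_{i-2},\,v_{i-1},\,(v_{i-2},v_{i-1})\cap(v_i,v_{i+1}),\,(v_{i-2},v_{i-1})\cap(v_{i+1},v_{i+2})],$$ $$y_i=[(v_{i-2},v_{i-1})\cap(v_{i+1},v_{i+2}),\,(v_{i-1},v_i)\cap(v_{i+1},v_{i+2}),\,v_{i+1},\,v_{i+2}].$$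 These are $n$-periodic, projectively invariant, generically defined, and $(x_1,y_1,\dots,x_n,y_n)$ are local coordinates at generic points of $\mathcal{P}_n$. All functions, brackets and maps on $\mathcal{P}_n$ are understood as generically defined, expressed in these coordinates. Pentagram map. $T$ sends the class of $\phi$ to the class of $i\mapsto (v_{i-1},v_{i+1})\cap(v_i,v_{i+2})$; it is a generically defined (rational) map of $\mathcal{P}_n$. Invariance of the bracket means $\{T^*f,T^*g\}=T^*\{f,g\}$. Monodromy invariants. Put $O_n=\prod_{i=1}^n x_i$, $E_n=\prod_{i=1}^n y_i$. Let $X_i=x_iy_ix_{i+1}$. Call $X_i,X_j$ consecutive if $j\in\{i-2,i-1,i,i+1,i+2\}$; call $X_i,x_j$ consecutive if $j\in\{i-1,i,i+1,i+2\}$; call $x_i,x_{i+1}$ consecutive. A monomial $O=X_{i_1}\cdots X_{i_s}x_{j_1}\cdots x_{j_t}$ (product of distinct factors) is admissible if no two of its factors are consecutive; put $|O|=s+t$, $\mathrm{sign}(O)=(-1)^t$. For $1\le k\le [n/2]$ set $O_k=\sum_{|O|=k}\mathrm{sign}(O)\,O$, the sum over admissible monomials. $E_k$ is defined in the same way with $X_i,x_j$ replaced by $Y_i=y_ix_{i+1}y_{i+1}$ and $y_j$ (and the same consecutivity rules). For $n$ even, up to sign, $O_{n/2}=\prod_{i\text{ even}}x_i+\prod_{i\text{ odd}}x_i$ and $E_{n/2}=\prod_{i\text{ even}}y_i+\prod_{i\text{ odd}}y_i$. The monodromy invariants are $O_n,E_n$ and $O_k,E_k$, $1\le k\le[n/2]$.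 The corank of a Poisson structure is the codimension of its generic symplectic leaves. "Generically span the null space" means that at generic points the differentials of these functions span the kernel of the Poisson tensor (they are Casimir functions). *)

theory Defs
  imports "HOL-Analysis.Analysis" "Berlekamp_Zassenhaus.Finite_Field"
begin

section \<open>The real projective plane\<close>

text \<open>
  A point of the projective plane is a one-dimensional linear subspace of three-dimensional
  space, a line is a two-dimensional one.  The intersection of two distinct lines is then the
  set-theoretic intersection of the subspaces; whenever two lines coincide, the intersection
  fails to be a point.
\<close>

definition proj_point :: "(real^3) set \<Rightarrow> bool" where
  "proj_point p \<longleftrightarrow> subspace p \<and> dim p = 1"

definition proj_line :: "(real^3) set \<Rightarrow> bool" where
  "proj_line l \<longleftrightarrow> subspace l \<and> dim l = 2"

definition join :: "(real^3) set \<Rightarrow> (real^3) set \<Rightarrow> (real^3) set" where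
  "join p q = span (p \<union> q)"

definition proj_collinear :: "(real^3) set \<Rightarrow> (real^3) set \<Rightarrow> (real^3) set \<Rightarrow> bool" where
  "proj_collinear p q r \<longleftrightarrow> (\<exists>l. proj_line l \<and> p \<subseteq> l \<and> q \<subseteq> l \<and> r \<subseteq> l)"

text \<open>
  Projective transformations are the maps \<open>p \<mapsto> f ` p\<close> for an invertible linear map \<open>f\<close>.
\<close>

definition invertible_linear :: "(real^3 \<Rightarrow> real^3) \<Rightarrow> bool" where
  "invertible_linear f \<longleftrightarrow> linear f \<and> bij f"

text \<open>
  \<open>is_cross_ratio p\<^sub>1 p\<^sub>2 p\<^sub>3 p\<^sub>4 r\<close>: the cross ratio of the four collinear points is defined and
  equal to \<open>r\<close>.  The points of the line through \<open>span {a}\<close> and \<open>span {b}\<close> other than \<open>span {b}\<close>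
  have the affine parameter \<open>t\<close> of their representative \<open>a + t b\<close>.  The value \<open>r\<close> does not
  depend on the choice of \<open>a\<close> and \<open>b\<close>.
\<close>

definition is_cross_ratio ::
    "(real^3) set \<Rightarrow> (real^3) set \<Rightarrow> (real^3) set \<Rightarrow> (real^3) set \<Rightarrow> real \<Rightarrow> bool" where
  "is_cross_ratio p1 p2 p3 p4 r \<longleftrightarrow>
     (\<exists>a b t1 t2 t3 t4. a \<noteq> b \<and> independent {a, b} \<and>
        p1 = span {a + t1 *\<^sub>R b} \<and> p2 = span {a + t2 *\<^sub>R b} \<and>
        p3 = span {a + t3 *\<^sub>R b} \<and> p4 = span {a + t4 *\<^sub>R b} \<and>
        t1 \<noteq> t3 \<and> t2 \<noteq> t4 \<and>
        r = ((t1 - t2) * (t3 - t4)) / ((t1 - t3) * (t2 - t4)))"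


section \<open>Twisted polygons, corner invariants and the pentagram map\<close>

type_synonym polygon = "int \<Rightarrow> (real^3) set"

definition twisted_polygon :: "nat \<Rightarrow> polygon \<Rightarrow> bool" where
  "twisted_polygon n \<phi> \<longleftrightarrow>
     (\<forall>k. proj_point (\<phi> k)) \<and>
     (\<exists>M. invertible_linear M \<and> (\<forall>k. \<phi> (k + int n) = M ` \<phi> k)) \<and>
     (\<forall>i. \<not> proj_collinear (\<phi> (i - 1)) (\<phi> i) (\<phi> (i + 1)))"

definition proj_equivalence :: "nat \<Rightarrow> (polygon \<times> polygon) set" where
  "proj_equivalence n = {(\<phi>, \<psi>). twisted_polygon n \<phi> \<and> twisted_polygon n \<psi> \<and>
     (\<exists>f. invertible_linear f \<and> (\<forall>k. \<psi> k = f ` \<phi> k))}"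

definition twisted_moduli :: "nat \<Rightarrow> polygon set set" where
  "twisted_moduli n = {\<phi>. twisted_polygon n \<phi>} // proj_equivalence n"

definition pentagram :: "polygon \<Rightarrow> polygon" where
  "pentagram \<phi> i = join (\<phi> (i - 1)) (\<phi> (i + 1)) \<inter> join (\<phi> i) (\<phi> (i + 2))"

text \<open>
  The image of a class under the pentagram map; it is the empty set, and hence not a member of
  \<open>twisted_moduli n\<close>, if the pentagram map is not defined at this class.
\<close>

definition pentagram_class :: "nat \<Rightarrow> polygon set \<Rightarrow> polygon set" where
  "pentagram_class n C = proj_equivalence n `` (pentagram ` C)"

text \<open>
  The index type \<open>'n mod_ring\<close> is the ring of integers modulo \<open>n = CARD('n)\<close>, so that index
  arithmetic in \<open>x $ i\<close> and \<open>y $ i\<close> is arithmetic modulo \<open>n\<close>.  A pair \<open>(x, y)\<close> holds the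
  coordinates \<open>x\<^sub>i\<close>, \<open>y\<^sub>i\<close>.
\<close>

type_synonym 'n coords = "(real, 'n mod_ring) vec \<times> (real, 'n mod_ring) vec"

definition has_corner_invariants :: "polygon \<Rightarrow> ('n::nontriv) coords \<Rightarrow> bool" where
  "has_corner_invariants v c \<longleftrightarrow>
     (\<forall>i::int.
        is_cross_ratio
          (v (i - 2))
          (v (i - 1))
          (join (v (i - 2)) (v (i - 1)) \<inter> join (v i) (v (i + 1)))
          (join (v (i - 2)) (v (i - 1)) \<inter> join (v (i + 1)) (v (i + 2)))
          (fst c $ of_int i) \<and>
        is_cross_ratio
          (join (v (i - 2)) (v (i - 1)) \<inter> join (v (i + 1)) (v (i + 2)))
          (join (v (i - 1)) (v i) \<inter> join (v (i + 1)) (v (i + 2)))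
          (v (i + 1))
          (v (i + 2))
          (snd c $ of_int i))"

definition class_coords :: "polygon set \<Rightarrow> ('n::nontriv) coords \<Rightarrow> bool" where
  "class_coords C c \<longleftrightarrow> (\<forall>\<phi>\<in>C. has_corner_invariants \<phi> c)"

definition generically :: "('a::topological_space \<Rightarrow> bool) \<Rightarrow> bool" where
  "generically Q \<longleftrightarrow> (\<exists>G. open G \<and> closure G = UNIV \<and> (\<forall>c\<in>G. Q c))"

text \<open>
  \<open>corner_chart U\<close>: the open dense set \<open>U\<close> of coordinate values is in bijection, via the corner
  invariants, with a set of classes of twisted \<open>n\<close>-gons.
\<close>

definition corner_chart :: "('n::nontriv) coords set \<Rightarrow> bool" where
  "corner_chart U \<longleftrightarrow> open U \<and> closure U = UNIV \<and>
     (\<forall>c\<in>U. \<exists>!C. C \<in> twisted_moduli CARD('n) \<and> class_coords C c)"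


section \<open>Poisson structures on open subsets of a Euclidean space\<close>

primrec Ck_on :: "nat \<Rightarrow> 'a::real_normed_vector set \<Rightarrow> ('a \<Rightarrow> 'b::real_normed_vector) \<Rightarrow> bool"
  where
  "Ck_on 0 U f \<longleftrightarrow> continuous_on U f"
| "Ck_on (Suc k) U f \<longleftrightarrow> (\<forall>x\<in>U. f differentiable at x) \<and>
     (\<forall>v. Ck_on k U (\<lambda>x. frechet_derivative f (at x) v))"

text \<open>Only meaningful for open \<open>U\<close>; it is only used in Euclidean spaces.\<close>

definition smooth_on :: "'a::real_normed_vector set \<Rightarrow> ('a \<Rightarrow> 'b::real_normed_vector) \<Rightarrow> bool" where
  "smooth_on U f \<longleftrightarrow> (\<forall>k. Ck_on k U f)"

text \<open>Differentials are identified with vectors by means of the Euclidean inner product.\<close>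

definition grad :: "('a::euclidean_space \<Rightarrow> real) \<Rightarrow> 'a \<Rightarrow> 'a" where
  "grad f c = (THE D. GDERIV f c :> D)"

definition bracket :: "('a::euclidean_space \<Rightarrow> 'a \<Rightarrow> 'a \<Rightarrow> real) \<Rightarrow>
    ('a \<Rightarrow> real) \<Rightarrow> ('a \<Rightarrow> real) \<Rightarrow> 'a \<Rightarrow> real" where
  "bracket P f g c = P c (grad f c) (grad g c)"

text \<open>
  A Poisson structure is a smooth bivector field \<open>P\<close> whose bracket satisfies the Jacobi identity;
  the Leibniz rule holds for every bracket of the form above.
\<close>

definition poisson_structure_on ::
    "'a::euclidean_space set \<Rightarrow> ('a \<Rightarrow> 'a \<Rightarrow> 'a \<Rightarrow> real) \<Rightarrow> bool" where
  "poisson_structure_on U P \<longleftrightarrow> open U \<and>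
     (\<forall>c\<in>U. bilinear (P c) \<and> (\<forall>v w. P c v w = - P c w v)) \<and>
     (\<forall>v w. smooth_on U (\<lambda>c. P c v w)) \<and>
     (\<forall>V f g h. open V \<and> V \<subseteq> U \<and> smooth_on V f \<and> smooth_on V g \<and> smooth_on V h \<longrightarrow>
        (\<forall>c\<in>V. bracket P f (bracket P g h) c + bracket P g (bracket P h f) c +
                bracket P h (bracket P f g) c = 0))"

definition null_space :: "('a::euclidean_space \<Rightarrow> 'a \<Rightarrow> 'a \<Rightarrow> real) \<Rightarrow> 'a \<Rightarrow> 'a set" where
  "null_space P c = {v. \<forall>w. P c v w = 0}"

definition hamiltonian_field ::
    "('a::euclidean_space \<Rightarrow> 'a \<Rightarrow> 'a \<Rightarrow> real) \<Rightarrow> ('a \<Rightarrow> real) \<Rightarrow> 'a \<Rightarrow> 'a" where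
  "hamiltonian_field P h c = (\<Sum>b\<in>Basis. P c (grad h c) b *\<^sub>R b)"

definition hamiltonian_arc ::
    "'a::euclidean_space set \<Rightarrow> ('a \<Rightarrow> 'a \<Rightarrow> 'a \<Rightarrow> real) \<Rightarrow> 'a \<Rightarrow> 'a \<Rightarrow> bool" where
  "hamiltonian_arc U P p q \<longleftrightarrow>
     (\<exists>V h \<gamma>. open V \<and> V \<subseteq> U \<and> smooth_on V h \<and> \<gamma> 0 = p \<and> \<gamma> 1 = q \<and>
        (\<forall>t\<in>{0..1::real}. \<gamma> t \<in> V \<and>
           (\<gamma> has_vector_derivative hamiltonian_field P h (\<gamma> t)) (at t within {0..1})))"

text \<open>
  The symplectic leaf through \<open>p\<close>: all points that can be joined to \<open>p\<close> by finitely many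
  trajectories of local Hamiltonian vector fields.
\<close>

definition symplectic_leaf ::
    "'a::euclidean_space set \<Rightarrow> ('a \<Rightarrow> 'a \<Rightarrow> 'a \<Rightarrow> real) \<Rightarrow> 'a \<Rightarrow> 'a set" where
  "symplectic_leaf U P p = {q. (hamiltonian_arc U P)\<^sup>*\<^sup>* p q}"

text \<open>
  For a symplectic leaf \<open>L\<close> the set of velocities at \<open>q\<close> of smooth curves that run in \<open>L\<close> is the
  tangent space of \<open>L\<close> at \<open>q\<close>.  Leaves are immersed submanifolds that need not be embedded, but
  a smooth curve of the ambient space that runs in a leaf is also smooth as a curve in the leaf.
\<close>

definition velocities :: "'a::euclidean_space set \<Rightarrow> 'a \<Rightarrow> 'a set" where
  "velocities L q = {v. \<exists>\<gamma> \<epsilon>. 0 < \<epsilon> \<and> smooth_on {-\<epsilon><..<\<epsilon>::real} \<gamma> \<and> \<gamma> ` {-\<epsilon><..<\<epsilon>} \<subseteq> L \<and>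
     \<gamma> 0 = q \<and> (\<gamma> has_vector_derivative v) (at 0)}"

definition has_codimension :: "'a::euclidean_space set \<Rightarrow> nat \<Rightarrow> bool" where
  "has_codimension L k \<longleftrightarrow> (\<forall>q\<in>L. dim (velocities L q) + k = DIM('a))"

definition has_corank ::
    "'a::euclidean_space set \<Rightarrow> ('a \<Rightarrow> 'a \<Rightarrow> 'a \<Rightarrow> real) \<Rightarrow> nat \<Rightarrow> bool" where
  "has_corank U P k \<longleftrightarrow> generically (\<lambda>p. p \<in> U \<and> has_codimension (symplectic_leaf U P p) k)"


section \<open>The pentagram map in corner coordinates and invariance\<close>

text \<open>
  \<open>F\<close>, on the open dense set \<open>W\<close>, is the expression of the pentagram map in the corner
  coordinates from \<open>U\<close>.
\<close>

definition pentagram_in_coords ::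
    "('n::nontriv) coords set \<Rightarrow> 'n coords set \<Rightarrow> ('n coords \<Rightarrow> 'n coords) \<Rightarrow> bool" where
  "pentagram_in_coords U W F \<longleftrightarrow>
     open W \<and> closure W = UNIV \<and> W \<subseteq> U \<and> F ` W \<subseteq> U \<and> smooth_on W F \<and>
     (\<forall>c\<in>W. \<forall>C\<in>twisted_moduli CARD('n). class_coords C c \<longrightarrow>
        pentagram_class CARD('n) C \<in> twisted_moduli CARD('n) \<and>
        class_coords (pentagram_class CARD('n) C) (F c))"

definition bracket_invariant_on ::
    "('a::euclidean_space \<Rightarrow> 'a \<Rightarrow> 'a \<Rightarrow> real) \<Rightarrow> 'a set \<Rightarrow> ('a \<Rightarrow> 'a) \<Rightarrow> bool" where
  "bracket_invariant_on P W F \<longleftrightarrow>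
     (\<forall>V f g. open V \<and> smooth_on V f \<and> smooth_on V g \<longrightarrow>
        (\<forall>c\<in>W. F c \<in> V \<longrightarrow> bracket P (f \<circ> F) (g \<circ> F) c = bracket P f g (F c)))"


section \<open>Monodromy invariants\<close>

text \<open>
  A product of distinct factors \<open>X\<^sub>i\<close> (\<open>i \<in> I\<close>) and \<open>x\<^sub>j\<close> (\<open>j \<in> J\<close>) is given by the pair \<open>(I, J)\<close>
  of its index sets.
\<close>

definition admissible :: "('n::nontriv) mod_ring set \<Rightarrow> 'n mod_ring set \<Rightarrow> bool" where
  "admissible I J \<longleftrightarrow>
     (\<forall>i\<in>I. \<forall>j\<in>I. i \<noteq> j \<longrightarrow> j \<notin> {i - 2, i - 1, i, i + 1, i + 2}) \<and>
     (\<forall>i\<in>I. \<forall>j\<in>J. j \<notin> {i - 1, i, i + 1, i + 2}) \<and>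
     (\<forall>i\<in>J. \<forall>j\<in>J. j \<noteq> i + 1)"

definition admissible_sum ::
    "nat \<Rightarrow> (('n::nontriv) mod_ring \<Rightarrow> real) \<Rightarrow> ('n mod_ring \<Rightarrow> real) \<Rightarrow> real" where
  "admissible_sum k X x =
     (\<Sum>(I, J)\<in>{(I, J). admissible I J \<and> card I + card J = k}.
        (-1) ^ card J * ((\<Prod>i\<in>I. X i) * (\<Prod>j\<in>J. x j)))"

definition O_inv :: "nat \<Rightarrow> ('n::nontriv) coords \<Rightarrow> real" where
  "O_inv k = (\<lambda>(x, y). admissible_sum k (\<lambda>i. x $ i * y $ i * x $ (i + 1)) (\<lambda>j. x $ j))"

definition E_inv :: "nat \<Rightarrow> ('n::nontriv) coords \<Rightarrow> real" where
  "E_inv k = (\<lambda>(x, y). admissible_sum k (\<lambda>i. y $ i * x $ (i + 1) * y $ (i + 1)) (\<lambda>j. y $ j))"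

text \<open>The invariants \<open>O\<^sub>n\<close> and \<open>E\<^sub>n\<close>, which are not instances of the sums above.\<close>

definition O_full :: "('n::nontriv) coords \<Rightarrow> real" where
  "O_full = (\<lambda>(x, y). \<Prod>i\<in>UNIV. x $ i)"

definition E_full :: "('n::nontriv) coords \<Rightarrow> real" where
  "E_full = (\<lambda>(x, y). \<Prod>i\<in>UNIV. y $ i)"

definition exceptional_invariants :: "(('n::nontriv) coords \<Rightarrow> real) set" where
  "exceptional_invariants = {O_full, E_full} \<union>
     (if even CARD('n) then {O_inv (CARD('n) div 2), E_inv (CARD('n) div 2)} else {})"

definition remaining_invariants :: "(('n::nontriv) coords \<Rightarrow> real) set" where
  "remaining_invariants =
     (\<Union>k\<in>{k. 1 \<le> k \<and> k \<le> CARD('n) div 2 \<and> \<not> (even CARD('n) \<and> k = CARD('n) div 2)}.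
        {O_inv k, E_inv k})"

end

theory Submission
  imports Defs
begin

text \<open>
  The bracket is \<open>{x\<^sub>i, x\<^sub>i\<^sub>+\<^sub>1} = - x\<^sub>i x\<^sub>i\<^sub>+\<^sub>1\<close>, \<open>{y\<^sub>i, y\<^sub>i\<^sub>+\<^sub>1} = y\<^sub>i y\<^sub>i\<^sub>+\<^sub>1\<close>, all other
  brackets of coordinates being zero. It has constant coefficients in the logarithms of the coordinates.
  This gives the Jacobi identity and the null space. Logarithmic Casimirs are constant on a leaf, and exponential
  curves in the directions orthogonal to the null space stay in it, so its dimension can be read off.

  A twisted polygon with corner invariants \<open>x, y\<close> lifts to vectors with
  \<open>V\<^sub>i\<^sub>+\<^sub>3 = V\<^sub>i\<^sub>+\<^sub>2 - y\<^sub>i\<^sub>+\<^sub>1 V\<^sub>i\<^sub>+\<^sub>1 + x\<^sub>i\<^sub>+\<^sub>1 y\<^sub>i\<^sub>+\<^sub>1 y\<^sub>i V\<^sub>i\<close>, uniquely up to a linear map, and the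
  vectors \<open>V\<^sub>i\<^sub>+\<^sub>2 + y\<^sub>i V\<^sub>i\<close> are a lift of the same kind of its image under the pentagram map. The new
  coefficients are the formulas for the map in coordinates.

  The bracket of two invariants is a sum over pairs of admissible monomials, weighted by the number of signed
  adjacencies between their factors. Two admissible monomials of the same family decompose into chains of
  overlapping factors, and exchanging the two monomials along one chain is an involution that
  reverses the sign. For monomials of different families, an adjacency of a
  single letter \<open>u\<close> and a triple belongs to a chain of consecutive factors \<open>u T \<dots> T\<close>, which covers the same letters
  as \<open>T \<dots> T u\<close>; sliding \<open>u\<close> through the triples reverses the sign.
\<close>

section \<open>Exchange along chains of overlapping factors\<close>

text \<open>The opposite signs of the x and y parts of the bracket fit the pentagram map: its
  factors \<open>1 - x y\<close> have the same logarithmic derivative in both letters, so products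
  of such derivatives cancel between the two parts. The kernel of either part consists of the
  vectors of period two in the cyclic index: one dimension for odd n, two for even n. Lifts are
  normalized by leading coefficient 1 and not by a determinant. The scale factors are solved along
  the integers and may fail to be periodic, so n divisible by 3 is no special case; the
  coefficients, being made of cross ratios, are periodic. For n = 3 and n = 4 two factors can be
  adjacent on both sides at once. Adjacency is therefore an oriented relation and is counted with
  sign. Within one family, chains whose ends come from the same monomial cancel in the count. The
  other chains have equally many factors from both monomials, so the exchange preserves both
  degrees. Between the families, a chain with a letter at each end is counted once in each direction
  and cancels.\<close>

text \<open>The tiles of two sets are put into one set, with a flag telling which set they come from.\<close>

definition indep_conf :: "('t \<Rightarrow> 't \<Rightarrow> bool) \<Rightarrow> ('t \<times> bool) set \<Rightarrow> bool" where
  "indep_conf N V \<longleftrightarrow> (\<forall>v\<in>V. \<forall>u\<in>V. snd v = snd u \<longrightarrow> \<not> N (fst v) (fst u))"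

definition conf_edge :: "('t \<Rightarrow> 't \<Rightarrow> bool) \<Rightarrow> ('t \<times> bool) set \<Rightarrow> (('t \<times> bool) \<times> ('t \<times> bool)) set" where
  "conf_edge N V = {(v, u). v \<in> V \<and> u \<in> V \<and> snd v \<noteq> snd u \<and> N (fst v) (fst u)}"

text \<open>For the converse relation \<open>e\<inverse>\<close> this describes the last elements of
  chains, so that one notion serves for both ends.\<close>

definition chain_start :: "('a \<times> 'a) set \<Rightarrow> 'a set \<Rightarrow> 'a \<Rightarrow> bool" where
  "chain_start e V s \<longleftrightarrow> s \<in> V \<and> (\<forall>v. (v, s) \<notin> e)"

text \<open>Otherwise every element reachable from \<open>s\<close> has a successor. Choosing
  successors is an injective self-map of a finite set, hence onto, and \<open>s\<close> itself would
  have a predecessor.\<close>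

lemma chain_end_exists:
  assumes "finite V" "e \<subseteq> V \<times> V" "single_valued e" "single_valued (e\<inverse>)" "chain_start e V s"
  shows "\<exists>t. (s, t) \<in> e\<^sup>* \<and> chain_start (e\<inverse>) V t"
proof (rule ccontr)
  assume no: "\<not> ?thesis"
  define K where "K = {v. (s, v) \<in> e\<^sup>*}"
  have KV: "K \<subseteq> V"
  proof
    fix v assume "v \<in> K"
    then have "(s, v) \<in> e\<^sup>*" by (simp add: K_def)
    then show "v \<in> V" using assms(2,5) by (induction) (auto simp: chain_start_def)
  qed
  then have finK: "finite K" using assms(1) finite_subset by blast
  have "\<forall>v\<in>K. \<exists>u. (v, u) \<in> e"
    using no KV by (auto simp: K_def chain_start_def)
  then obtain f where f: "\<forall>v\<in>K. (v, f v) \<in> e" by metis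
  have fK: "f ` K \<subseteq> K" using f by (auto simp: K_def intro: rtrancl_into_rtrancl)
  have inj: "inj_on f K"
    using f assms(4) by (intro inj_onI) (metis converse_iff single_valued_def)
  have "f ` K = K" using finK fK inj by (simp add: endo_inj_surj)
  moreover have "s \<in> K" by (simp add: K_def)
  ultimately obtain v where "v \<in> K" "f v = s" by (metis imageE)
  then show False using f assms(5) by (auto simp: chain_start_def)
qed

lemma chain_end_unique:
  assumes "single_valued e" "(s, t) \<in> e\<^sup>*" "(s, t') \<in> e\<^sup>*"
    "chain_start (e\<inverse>) V t" "chain_start (e\<inverse>) V t'"
  shows "t = t'"
proof -
  have "(t, t') \<in> e\<^sup>* \<or> (t', t) \<in> e\<^sup>*"
    using single_valued_confluent[OF assms(1,2,3)] .
  moreover have "\<And>a b. (a, b) \<in> e\<^sup>* \<Longrightarrow> chain_start (e\<inverse>) V a \<Longrightarrow> a = b"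
    by (auto simp: chain_start_def elim: converse_rtranclE)
  ultimately show ?thesis using assms(4,5) by metis
qed

text \<open>A maximal path is recorded by its two ends, which determine it when the relation is
  single-valued both ways. Closed cycles have no ends and do not appear.\<close>

definition max_chains :: "('a \<times> 'a) set \<Rightarrow> 'a set \<Rightarrow> ('a \<times> 'a) set" where
  "max_chains e V = {(s, t). (s, t) \<in> e\<^sup>* \<and> chain_start e V s \<and> chain_start (e\<inverse>) V t}"

lemma card_chain_starts:
  assumes "finite V" "e \<subseteq> V \<times> V" "single_valued e" "single_valued (e\<inverse>)"
  shows "card {s. chain_start e V s \<and> Q s} = card {(s, t). (s, t) \<in> max_chains e V \<and> Q s}"
proof -
  have "bij_betw fst {(s, t). (s, t) \<in> max_chains e V \<and> Q s} {s. chain_start e V s \<and> Q s}"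
  proof (rule bij_betw_imageI)
    show "inj_on fst {(s, t). (s, t) \<in> max_chains e V \<and> Q s}"
      using chain_end_unique[OF assms(3)]
      by (auto simp: inj_on_def max_chains_def)
    show "fst ` {(s, t). (s, t) \<in> max_chains e V \<and> Q s} = {s. chain_start e V s \<and> Q s}"
      using chain_end_exists[OF assms] by (force simp: max_chains_def image_iff)
  qed
  from bij_betw_same_card[OF this] show ?thesis by simp
qed

lemma max_chains_converse: "max_chains (e\<inverse>) V = (max_chains e V)\<inverse>"
  by (auto simp: max_chains_def rtrancl_converse)

lemma card_chain_ends:
  assumes "finite V" "e \<subseteq> V \<times> V" "single_valued e" "single_valued (e\<inverse>)"
  shows "card {t. chain_start (e\<inverse>) V t \<and> Q t} = card {(s, t). (s, t) \<in> max_chains e V \<and> Q t}"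
proof -
  have "card {t. chain_start (e\<inverse>) V t \<and> Q t} = card {(t, s). (t, s) \<in> max_chains (e\<inverse>) V \<and> Q t}"
    using assms by (intro card_chain_starts) auto
  also have "\<dots> = card (prod.swap ` {(s, t). (s, t) \<in> max_chains e V \<and> Q t})"
    by (rule arg_cong[where f=card]) (auto simp: max_chains_converse image_iff)
  also have "\<dots> = card {(s, t). (s, t) \<in> max_chains e V \<and> Q t}"
    by (rule card_image) (auto simp: inj_on_def)
  finally show ?thesis .
qed

text \<open>Each element is either the source of exactly one edge or the last element of its
  chain.\<close>

lemma card_sources:
  assumes "finite V" "e \<subseteq> V \<times> V" "single_valued e"
  shows "card {(v, u). (v, u) \<in> e \<and> Q v} + card {v. chain_start (e\<inverse>) V v \<and> Q v} = card {v \<in> V. Q v}"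
proof -
  have fe: "finite e" using assms(1,2) by (meson finite_SigmaI finite_subset)
  have "card {(v, u). (v, u) \<in> e \<and> Q v} = card (fst ` {(v, u). (v, u) \<in> e \<and> Q v})"
    using assms(3) by (intro card_image[symmetric]) (auto simp: inj_on_def single_valued_def)
  moreover have "{v \<in> V. Q v} = fst ` {(v, u). (v, u) \<in> e \<and> Q v} \<union> {v. chain_start (e\<inverse>) V v \<and> Q v}"
    using assms(2) by (force simp: chain_start_def image_iff)
  moreover have "fst ` {(v, u). (v, u) \<in> e \<and> Q v} \<inter> {v. chain_start (e\<inverse>) V v \<and> Q v} = {}"
    by (auto simp: chain_start_def)
  moreover have "finite (fst ` {(v, u). (v, u) \<in> e \<and> Q v})"
    by (rule finite_imageI) (rule finite_subset[OF _ fe], auto)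
  moreover have "finite {v. chain_start (e\<inverse>) V v \<and> Q v}"
    by (rule finite_subset[OF _ assms(1)]) (auto simp: chain_start_def)
  ultimately show ?thesis by (metis (no_types, lifting) card_Un_disjoint)
qed

lemma card_eq_matched:
  assumes "single_valued e" "single_valued (e\<inverse>)"
    "\<forall>v\<in>A. \<exists>u\<in>B. (v, u) \<in> e" "\<forall>u\<in>B. \<exists>v\<in>A. (v, u) \<in> e"
  shows "card A = card B"
proof -
  obtain f where f: "\<forall>v\<in>A. f v \<in> B \<and> (v, f v) \<in> e" using assms(3) by metis
  have "bij_betw f A B"
  proof (rule bij_betw_imageI)
    show "inj_on f A"
      using f assms(2) by (intro inj_onI) (metis converse_iff single_valued_def)
    have "u \<in> f ` A" if "u \<in> B" for u
      using that f assms(1,4) by (metis imageI single_valued_def)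
    then show "f ` A = B" using f by blast
  qed
  then show ?thesis by (rule bij_betw_same_card)
qed

text \<open>\<open>N a b\<close> is to be read as: \<open>a\<close> and \<open>b\<close> are in
  conflict and \<open>a\<close> comes first. Two tiles that follow the same tile conflict with each
  other, so an independent set contains at most one of them. This makes \<open>conf_edge\<close> a
  partial bijection.\<close>

locale overlap_relation =
  fixes N :: "'t::finite \<Rightarrow> 't \<Rightarrow> bool"
  assumes succ_N: "\<And>a b b'. N a b \<Longrightarrow> N a b' \<Longrightarrow> b = b' \<or> N b b' \<or> N b' b"
    and pred_N: "\<And>a a' b. N a b \<Longrightarrow> N a' b \<Longrightarrow> a = a' \<or> N a a' \<or> N a' a"
begin

lemma edge_subset: "conf_edge N V \<subseteq> V \<times> V"
  by (auto simp: conf_edge_def)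

lemma edge_sv:
  assumes "indep_conf N V"
  shows "single_valued (conf_edge N V)" "single_valued ((conf_edge N V)\<inverse>)"
proof -
  have "u = u'" if "(v, u) \<in> conf_edge N V" "(v, u') \<in> conf_edge N V" for v u u'
  proof -
    have "snd u = snd u'" "fst u = fst u'"
      using that assms succ_N[of "fst v" "fst u" "fst u'"] by (auto simp: conf_edge_def indep_conf_def)
    then show ?thesis by (simp add: prod_eq_iff)
  qed
  then show "single_valued (conf_edge N V)" by (auto simp: single_valued_def)
  have "u = u'" if "(u, v) \<in> conf_edge N V" "(u', v) \<in> conf_edge N V" for v u u'
  proof -
    have "snd u = snd u'" "fst u = fst u'"
      using that assms pred_N[of "fst u" "fst v" "fst u'"] by (auto simp: conf_edge_def indep_conf_def)
    then show ?thesis by (simp add: prod_eq_iff)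
  qed
  then show "single_valued ((conf_edge N V)\<inverse>)" by (auto simp: single_valued_def)
qed

definition confs :: "nat \<Rightarrow> nat \<Rightarrow> ('t \<times> bool) set set" where
  "confs k l = {V. indep_conf N V \<and> card {v \<in> V. snd v} = k \<and> card {v \<in> V. \<not> snd v} = l}"

text \<open>Edges join different flags, so this counts the edges from flag \<open>False\<close> to
  flag \<open>True\<close> minus those in the other direction.\<close>

definition imbalance :: "('t \<times> bool) set \<Rightarrow> int" where
  "imbalance V = int (card {(v, u). (v, u) \<in> conf_edge N V \<and> snd u})
     - int (card {(v, u). (v, u) \<in> conf_edge N V \<and> snd v})"

definition typed_chains :: "('t \<times> bool) set \<Rightarrow> bool \<Rightarrow> (('t \<times> bool) \<times> ('t \<times> bool)) set" where
  "typed_chains V b = {(s, t). (s, t) \<in> max_chains (conf_edge N V) V \<and> snd s = b \<and> snd t = (\<not> b)}"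

text \<open>The elements with flag \<open>True\<close> are counted in two ways: each has an outgoing
  edge or ends a chain, and each has an incoming edge or starts a chain. The comparison leaves the
  chains ending with \<open>True\<close> minus the chains starting with \<open>True\<close>, and
  chains with both properties cancel.\<close>

lemma imbalance_chains:
  assumes "indep_conf N V"
  shows "imbalance V = int (card (typed_chains V False)) - int (card (typed_chains V True))"
proof -
  let ?e = "conf_edge N V" and ?M = "max_chains (conf_edge N V) V"
  note sv = edge_sv[OF assms] edge_subset finite[of V]
  have 1: "card {(v, u). (v, u) \<in> ?e \<and> snd v} + card {(s, t). (s, t) \<in> ?M \<and> snd t} = card {v \<in> V. snd v}"
    using card_sources[of V ?e snd] card_chain_ends[of V ?e snd] sv by simp
  have "card {(u, v). (u, v) \<in> ?e\<inverse> \<and> snd u} + card {v. chain_start ((?e\<inverse>)\<inverse>) V v \<and> snd v} = card {v \<in> V. snd v}"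
    using sv by (intro card_sources) auto
  moreover have "card {(u, v). (u, v) \<in> ?e\<inverse> \<and> snd u} = card (prod.swap ` {(v, u). (v, u) \<in> ?e \<and> snd u})"
    by (rule arg_cong[where f=card]) (auto simp: image_iff)
  moreover have "\<dots> = card {(v, u). (v, u) \<in> ?e \<and> snd u}"
    by (rule card_image) (auto simp: inj_on_def)
  ultimately have 2: "card {(v, u). (v, u) \<in> ?e \<and> snd u} + card {(s, t). (s, t) \<in> ?M \<and> snd s} = card {v \<in> V. snd v}"
    using card_chain_starts[of V ?e snd] sv by simp
  let ?B = "{(s, t). (s, t) \<in> ?M \<and> snd s \<and> snd t}"
  have "{(s, t). (s, t) \<in> ?M \<and> snd t} = ?B \<union> typed_chains V False"
    "{(s, t). (s, t) \<in> ?M \<and> snd s} = ?B \<union> typed_chains V True"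
    "?B \<inter> typed_chains V False = {}" "?B \<inter> typed_chains V True = {}"
    by (auto simp: typed_chains_def)
  then have "card {(s, t). (s, t) \<in> ?M \<and> snd t} = card ?B + card (typed_chains V False)"
    "card {(s, t). (s, t) \<in> ?M \<and> snd s} = card ?B + card (typed_chains V True)"
    by (simp_all add: card_Un_disjoint)
  with 1 2 show ?thesis by (simp add: imbalance_def)
qed

definition chain_set :: "('t \<times> bool) set \<Rightarrow> 't \<times> bool \<Rightarrow> ('t \<times> bool) set" where
  "chain_set V s = {v. (s, v) \<in> (conf_edge N V)\<^sup>*}"

definition toggle :: "('t \<times> bool) set \<Rightarrow> 't \<times> bool \<Rightarrow> 't \<times> bool" where
  "toggle K v = (if v \<in> K then (fst v, \<not> snd v) else v)"

text \<open>One chain with ends of different flags is fixed. Its set \<open>K\<close> of elements is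
  a whole component of the edge relation, and \<open>toggle K\<close> is the exchange of the two
  monomials along it.\<close>

context
  fixes V :: "('t \<times> bool) set" and s t :: "'t \<times> bool" and b :: bool
  assumes conf: "indep_conf N V" and st: "(s, t) \<in> typed_chains V b"
begin

abbreviation "ce \<equiv> conf_edge N V"
abbreviation "K \<equiv> chain_set V s"

lemma K_subset: "K \<subseteq> V"
proof
  fix v assume "v \<in> K"
  then have "(s, v) \<in> ce\<^sup>*" by (simp add: chain_set_def)
  then show "v \<in> V" using st by induction (auto simp: typed_chains_def max_chains_def chain_start_def conf_edge_def)
qed

lemma K_closed: "(v, u) \<in> ce \<Longrightarrow> v \<in> K \<longleftrightarrow> u \<in> K"
proof
  assume e: "(v, u) \<in> ce" and "u \<in> K"
  then have "(s, u) \<in> ce\<^sup>*" by (simp add: chain_set_def)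
  moreover have "\<forall>v. (v, s) \<notin> ce"
    using st by (simp add: typed_chains_def max_chains_def chain_start_def)
  then have "u \<noteq> s" using e by metis
  ultimately obtain v' where "(s, v') \<in> ce\<^sup>*" "(v', u) \<in> ce" by (metis rtranclE)
  moreover have "v' = v"
    using calculation(2) e edge_sv(2)[OF conf] unfolding single_valued_def by blast
  ultimately show "v \<in> K" by (simp add: chain_set_def)
qed (auto simp: chain_set_def intro: rtrancl_into_rtrancl)

lemma K_neighbour:
  assumes "v \<in> K"
  shows "\<exists>u\<in>V. snd u \<noteq> snd v \<and> (N (fst v) (fst u) \<or> N (fst u) (fst v))"
proof (cases "v = s")
  case True
  have "s \<noteq> t" "(s, t) \<in> ce\<^sup>*" using st by (auto simp: typed_chains_def max_chains_def)
  then obtain u where "(s, u) \<in> ce" by (meson converse_rtranclE)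
  then show ?thesis using True by (auto simp: conf_edge_def)
next
  case False
  then obtain u where "(u, v) \<in> ce" using assms by (auto simp: chain_set_def elim: rtranclE)
  then show ?thesis by (auto simp: conf_edge_def)
qed

text \<open>The chain has at least two elements, so each of its tiles conflicts with a tile of the
  other flag. A second copy of the tile carrying that flag would violate independence. Hence
  flipping flags on \<open>K\<close> never merges two elements.\<close>

lemma K_once: "v \<in> K \<Longrightarrow> (fst v, \<not> snd v) \<notin> V"
proof
  assume v: "v \<in> K" and w: "(fst v, \<not> snd v) \<in> V"
  from K_neighbour[OF v] obtain u
    where "u \<in> V" "snd u = (\<not> snd v)" "N (fst v) (fst u) \<or> N (fst u) (fst v)" by blast
  with w conf show False unfolding indep_conf_def by (metis fst_conv snd_conv)
qed

lemma toggle_inj: "inj_on (toggle K) V"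
proof (rule inj_onI)
  fix v u assume "v \<in> V" "u \<in> V" "toggle K v = toggle K u"
  then show "v = u"
    using K_once[of v] K_once[of u] by (cases v; cases u) (auto simp: toggle_def split: if_splits)
qed

text \<open>\<open>K\<close> is closed under edges in both directions, so two conflicting elements
  are flipped together or not at all.\<close>

lemma toggle_iso:
  assumes "v \<in> V" "u \<in> V"
  shows "(toggle K v, toggle K u) \<in> conf_edge N (toggle K ` V) \<longleftrightarrow> (v, u) \<in> ce"
    and "snd (toggle K v) = snd (toggle K u) \<Longrightarrow> \<not> N (fst (toggle K v)) (fst (toggle K u))"
proof -
  have *: "snd v \<noteq> snd u \<Longrightarrow> N (fst v) (fst u) \<Longrightarrow> (v, u) \<in> ce" using assms by (simp add: conf_edge_def)
  have **: "snd v = snd u \<Longrightarrow> \<not> N (fst v) (fst u)" using assms conf by (simp add: indep_conf_def)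
  show "(toggle K v, toggle K u) \<in> conf_edge N (toggle K ` V) \<longleftrightarrow> (v, u) \<in> ce"
    using * ** K_closed[of v u] assms
    by (auto simp: conf_edge_def toggle_def)
  show "snd (toggle K v) = snd (toggle K u) \<Longrightarrow> \<not> N (fst (toggle K v)) (fst (toggle K u))"
    using * ** K_closed[of v u] by (auto simp: toggle_def split: if_splits)
qed

lemma toggle_conf: "indep_conf N (toggle K ` V)"
  using toggle_iso(2) by (auto simp: indep_conf_def)

lemma toggle_edge: "conf_edge N (toggle K ` V) = map_prod (toggle K) (toggle K) ` ce"
proof -
  have "conf_edge N (toggle K ` V) \<subseteq> map_prod (toggle K) (toggle K) ` ce"
  proof clarify
    fix a1 a2 b1 b2 assume e: "((a1, a2), (b1, b2)) \<in> conf_edge N (toggle K ` V)"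
    then obtain v u where "v \<in> V" "u \<in> V" "(a1, a2) = toggle K v" "(b1, b2) = toggle K u"
      by (auto simp: conf_edge_def)
    with e toggle_iso(1)[of v u] show "((a1, a2), (b1, b2)) \<in> map_prod (toggle K) (toggle K) ` ce"
      by (metis map_prod_imageI)
  qed
  moreover have "map_prod (toggle K) (toggle K) ` ce \<subseteq> conf_edge N (toggle K ` V)"
    using toggle_iso(1) edge_subset by fastforce
  ultimately show ?thesis by blast
qed

lemma toggle_rtrancl:
  assumes "(v, u) \<in> ce\<^sup>*"
  shows "(toggle K v, toggle K u) \<in> (conf_edge N (toggle K ` V))\<^sup>*"
  using assms by induction (auto simp: toggle_edge intro: rtrancl_into_rtrancl)

lemma toggle_rtrancl_conv:
  assumes "(toggle K v, w) \<in> (conf_edge N (toggle K ` V))\<^sup>*" "v \<in> V"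
  shows "\<exists>u\<in>V. w = toggle K u \<and> (v, u) \<in> ce\<^sup>*"
  using assms
proof induction
  case (step y z)
  then obtain u where u: "u \<in> V" "y = toggle K u" "(v, u) \<in> ce\<^sup>*" by blast
  obtain u1 u2 where e: "(u1, u2) \<in> ce" "y = toggle K u1" "z = toggle K u2"
    using step.hyps(2) by (auto simp: toggle_edge)
  then have "u1 \<in> V" "u2 \<in> V" by (auto simp: conf_edge_def)
  then have "u1 = u" using u e toggle_inj by (auto simp: inj_on_def)
  then show ?case using u e \<open>u2 \<in> V\<close> rtrancl_into_rtrancl[of v u ce u2] by blast
qed auto

lemma s_in: "s \<in> K" "t \<in> K" "s \<in> V" "t \<in> V"
  using st K_subset by (auto simp: chain_set_def typed_chains_def max_chains_def)

lemma toggle_chain_set: "chain_set (toggle K ` V) (toggle K s) = toggle K ` K"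
proof
  show "toggle K ` K \<subseteq> chain_set (toggle K ` V) (toggle K s)"
    using toggle_rtrancl[of s] by (auto simp: chain_set_def)
  show "chain_set (toggle K ` V) (toggle K s) \<subseteq> toggle K ` K"
    using toggle_rtrancl_conv[of s] s_in(3) by (fastforce simp: chain_set_def)
qed

lemma toggle_chains: "(toggle K s, toggle K t) \<in> typed_chains (toggle K ` V) (\<not> b)"
proof -
  have m: "(s, t) \<in> ce\<^sup>*" "\<forall>v. (v, s) \<notin> ce" "\<forall>v. (t, v) \<notin> ce" "snd s = b" "snd t = (\<not> b)"
    using st by (auto simp: typed_chains_def max_chains_def chain_start_def)
  have "(v, toggle K s) \<notin> conf_edge N (toggle K ` V)" for v
  proof
    assume "(v, toggle K s) \<in> conf_edge N (toggle K ` V)"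
    moreover then obtain v' where "v' \<in> V" "v = toggle K v'" by (auto simp: conf_edge_def)
    ultimately show False using toggle_iso(1)[of v' s] s_in m by auto
  qed
  moreover have "(toggle K t, v) \<notin> conf_edge N (toggle K ` V)" for v
  proof
    assume "(toggle K t, v) \<in> conf_edge N (toggle K ` V)"
    moreover then obtain v' where "v' \<in> V" "v = toggle K v'" by (auto simp: conf_edge_def)
    ultimately show False using toggle_iso(1)[of t v'] s_in m by auto
  qed
  ultimately show ?thesis
    using toggle_rtrancl[OF m(1)] m s_in by (auto simp: typed_chains_def max_chains_def chain_start_def) (auto simp: toggle_def)
qed

lemma toggle_toggle: "toggle (toggle K ` K) ` toggle K ` V = V"
proof -
  have *: "toggle (toggle K ` K) (toggle K v) = v" if "v \<in> V" for v
  proof (cases "v \<in> K")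
    case True
    then have "toggle K v \<in> toggle K ` K" by blast
    then show ?thesis using True by (auto simp: toggle_def)
  next
    case False
    then have "toggle K v \<notin> toggle K ` K" using toggle_inj that K_subset by (auto simp: inj_on_def)
    then show ?thesis using False by (auto simp: toggle_def)
  qed
  then show ?thesis by (auto simp: image_image)
qed

text \<open>Flags alternate along the chain, which starts with \<open>b\<close> and ends with its
  negation. So the edges leaving the elements of flag \<open>b\<close> match them with the elements
  of the other flag.\<close>

lemma K_balanced: "card {v \<in> K. snd v} = card {v \<in> K. \<not> snd v}"
proof -
  have m: "(s, t) \<in> ce\<^sup>*" "chain_start ce V s" "chain_start (ce\<inverse>) V t" "snd s = b" "snd t = (\<not> b)"
    using st by (auto simp: typed_chains_def max_chains_def)
  have nxt: "\<exists>u\<in>K. (v, u) \<in> ce" if "v \<in> K" "snd v = b" for v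
  proof (rule ccontr)
    assume "\<not> ?thesis"
    then have no: "\<forall>u. (v, u) \<notin> ce" using that by (metis K_closed)
    then have "chain_start (ce\<inverse>) V v" using that K_subset by (auto simp: chain_start_def)
    then have "v = t" using chain_end_unique[OF edge_sv(1)[OF conf] _ m(1) _ m(3), of v] that by (auto simp: chain_set_def)
    then show False using that m by simp
  qed
  have prv: "\<exists>u\<in>K. (u, v) \<in> ce" if "v \<in> K" "snd v \<noteq> b" for v
  proof -
    have "v \<noteq> s" using that(2) m(4) by metis
    have "(s, v) \<in> ce\<^sup>*" using that by (simp add: chain_set_def)
    then show ?thesis
    proof (cases rule: rtranclE)
      case base
      then show ?thesis using \<open>v \<noteq> s\<close> by simp
    next
      case (step u)
      then show ?thesis unfolding chain_set_def by blast
    qed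
  qed
  have flip: "snd u \<noteq> snd v" if "(v, u) \<in> ce" for v u
    using that by (auto simp: conf_edge_def)
  have "card {v \<in> K. snd v = b} = card {v \<in> K. snd v \<noteq> b}"
  proof (rule card_eq_matched[OF edge_sv[OF conf]])
    show "\<forall>v\<in>{v \<in> K. snd v = b}. \<exists>u\<in>{v \<in> K. snd v \<noteq> b}. (v, u) \<in> ce"
    proof
      fix v assume "v \<in> {v \<in> K. snd v = b}"
      then have v: "v \<in> K" "snd v = b" by auto
      then obtain u where "u \<in> K" "(v, u) \<in> ce" using nxt by blast
      with flip v show "\<exists>u\<in>{v \<in> K. snd v \<noteq> b}. (v, u) \<in> ce" by blast
    qed
    show "\<forall>u\<in>{v \<in> K. snd v \<noteq> b}. \<exists>v\<in>{v \<in> K. snd v = b}. (v, u) \<in> ce"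
    proof
      fix u assume "u \<in> {v \<in> K. snd v \<noteq> b}"
      then have u: "u \<in> K" "snd u \<noteq> b" by auto
      then obtain v where v: "v \<in> K" "(v, u) \<in> ce" using prv by blast
      then have "snd v = b" using flip u by blast
      with v show "\<exists>v\<in>{v \<in> K. snd v = b}. (v, u) \<in> ce" by blast
    qed
  qed
  then show ?thesis by (cases b) auto
qed

lemma toggle_card: "card {v \<in> toggle K ` V. snd v = q} = card {v \<in> V. snd v = q}"
proof -
  have sp: "card {v \<in> X. snd v = q} = card {v \<in> X \<inter> K. snd v = q} + card {v \<in> X - K. snd v = q}" for X :: "('t \<times> bool) set"
    by (subst card_Un_disjoint[symmetric]) (auto intro!: arg_cong[where f=card])
  have tog: "snd (toggle K v) = q \<longleftrightarrow> snd v \<noteq> q" if "v \<in> K" for v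
    using that by (auto simp: toggle_def)
  have fixd: "toggle K v = v" if "v \<notin> K" for v
    using that by (simp add: toggle_def)
  have "toggle K ` V = toggle K ` (K \<union> (V - K))" using K_subset by (simp add: Un_absorb1)
  also have "toggle K ` (K \<union> (V - K)) = toggle K ` K \<union> toggle K ` (V - K)" by (rule image_Un)
  also have "toggle K ` (V - K) = id ` (V - K)"
    by (rule image_cong) (simp_all add: fixd)
  finally have "toggle K ` V = toggle K ` K \<union> (V - K)" by simp
  then have "{v \<in> toggle K ` V. snd v = q} = {v \<in> toggle K ` K. snd v = q} \<union> {v \<in> V - K. snd v = q}"
    by (simp only: Un_iff Collect_disj_eq conj_disj_distribR)
  also have "{v \<in> toggle K ` K. snd v = q} = toggle K ` {v \<in> K. snd (toggle K v) = q}"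
    by (rule Compr_image_eq)
  also have "{v \<in> K. snd (toggle K v) = q} = {v \<in> K. snd v \<noteq> q}"
    by (rule Collect_cong) (simp only: tog cong: conj_cong)
  finally have "{v \<in> toggle K ` V. snd v = q} = toggle K ` {v \<in> K. snd v \<noteq> q} \<union> {v \<in> V - K. snd v = q}" .
  moreover have "toggle K ` {v \<in> K. snd v \<noteq> q} \<inter> {v \<in> V - K. snd v = q} = {}"
  proof -
    have "toggle K v \<notin> V" if "v \<in> K" for v
      using K_once[OF that] that by (simp add: toggle_def)
    then show ?thesis by blast
  qed
  ultimately have "card {v \<in> toggle K ` V. snd v = q} = card (toggle K ` {v \<in> K. snd v \<noteq> q}) + card {v \<in> V - K. snd v = q}"
    by (simp add: card_Un_disjoint)
  moreover have "card (toggle K ` {v \<in> K. snd v \<noteq> q}) = card {v \<in> K. snd v \<noteq> q}"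
    by (intro card_image inj_on_subset[OF toggle_inj]) (use K_subset in auto)
  moreover have "card {v \<in> K. snd v \<noteq> q} = card {v \<in> K. snd v = q}"
    using K_balanced by (cases q) auto
  ultimately show ?thesis using sp[of V] K_subset by (simp add: Int_absorb1)
qed

lemma toggle_prod: "(\<Prod>v\<in>toggle K ` V. w (fst v)) = (\<Prod>v\<in>V. w (fst v))"
  using toggle_inj by (simp add: prod.reindex) (auto simp: toggle_def intro!: prod.cong)

end

text \<open>By \<open>imbalance_chains\<close> this is a sum over configurations with a marked
  chain. Exchanging along the marked chain keeps the weight and both degrees and swaps the two types
  of chain, which have opposite signs.\<close>

theorem sum_imbalance_zero:
  fixes w :: "'t \<Rightarrow> real"
  shows "(\<Sum>V\<in>confs k l. of_int (imbalance V) * (\<Prod>v\<in>V. w (fst v))) = 0"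
proof -
  define wt where "wt V = (\<Prod>v\<in>V. w (fst v))" for V :: "('t \<times> bool) set"
  have tr: "(\<Sum>V\<in>confs k l. of_nat (card (typed_chains V b)) * wt V)
      = (\<Sum>(V, c)\<in>Sigma (confs k l) (\<lambda>V. typed_chains V b). wt V)" for b
    by (subst sum.Sigma[symmetric]) (auto simp: finite_subset)
  \<comment> \<open>The ends of the marked chain are carried along, so that a second application
    undoes the exchange.\<close>
  let ?f = "\<lambda>(V, (s, t)). (toggle (chain_set V s) ` V, (toggle (chain_set V s) s, toggle (chain_set V s) t))"
  let ?D = "\<lambda>b. Sigma (confs k l) (\<lambda>V. typed_chains V b)"
  have inv: "?f x \<in> ?D (\<not> b)" "?f (?f x) = x" "(case ?f x of (V, c) \<Rightarrow> wt V) = (case x of (V, c) \<Rightarrow> wt V)"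
    if "x \<in> ?D b" for x b
  proof -
    obtain V s t where x: "x = (V, (s, t))" by (metis prod.exhaust)
    with that have V: "V \<in> confs k l" "indep_conf N V" and st: "(s, t) \<in> typed_chains V b" by (auto simp: confs_def)
    note [simp] = toggle_chain_set[OF V(2) st]
    have "toggle (chain_set V s) ` V \<in> confs k l"
      using toggle_conf[OF V(2) st] toggle_card[OF V(2) st, of True]
        toggle_card[OF V(2) st, of False] V(1) by (simp add: confs_def)
    then show "?f x \<in> ?D (\<not> b)"
      using toggle_chains[OF V(2) st] by (simp add: x)
    have "toggle (toggle (chain_set V s) ` chain_set V s) (toggle (chain_set V s) v) = v" if "v \<in> chain_set V s" for v
    proof -
      have "toggle (chain_set V s) v \<in> toggle (chain_set V s) ` chain_set V s" using that by blast
      then show ?thesis using that by (simp add: toggle_def)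
    qed
    then show "?f (?f x) = x"
      using toggle_toggle[OF V(2) st] s_in[OF V(2) st] by (simp add: x)
    show "(case ?f x of (V, c) \<Rightarrow> wt V) = (case x of (V, c) \<Rightarrow> wt V)"
      using toggle_prod[OF V(2) st, of w] by (simp add: x wt_def)
  qed
  have "(\<Sum>(V, c)\<in>?D False. wt V) = (\<Sum>(V, c)\<in>?D True. wt V)"
    by (rule sum.reindex_bij_witness[where i="?f" and j="?f"])
       (use inv[where b=True] inv[where b=False] in simp_all)
  moreover have "(\<Sum>V\<in>confs k l. of_int (imbalance V) * wt V)
      = (\<Sum>V\<in>confs k l. of_nat (card (typed_chains V False)) * wt V) - (\<Sum>V\<in>confs k l. of_nat (card (typed_chains V True)) * wt V)"
    by (subst sum_subtractf[symmetric], rule sum.cong) (auto simp: confs_def imbalance_chains algebra_simps)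
  ultimately show ?thesis unfolding tr by (simp add: wt_def)
qed

end

section \<open>Sliding a letter through a chain of triples\<close>

text \<open>Intended for the letters \<open>x\<^sub>i\<close>, \<open>y\<^sub>i\<close> on a circle
  of length \<open>N = 2 n\<close>. A triple is centred at a letter of the other kind than its outer
  letters. So two factors of one family are at even distance if both are single letters or both are
  centres, and at odd distance otherwise. The offsets in \<open>conf\<close> are the consecutivity
  rules of one family measured in letters; factors of different families are never compared.\<close>

locale cyclic_positions =
  fixes N :: int and sh :: "'p::finite \<Rightarrow> int \<Rightarrow> 'p"
  assumes N_ge: "6 \<le> N"
    and sh_sh: "sh (sh p a) b = sh p (a + b)"
    and sh_eq_iff: "sh p a = sh p b \<longleftrightarrow> N dvd (a - b)"
    and sh_trans: "\<exists>a. q = sh p a"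
begin

lemma sh_0 [simp]: "sh p 0 = p"
proof -
  obtain a where "p = sh p a" using sh_trans by blast
  then show ?thesis by (metis add.commute add_0 sh_sh)
qed

lemma bij_sh: "bij (\<lambda>p. sh p a)"
  by (rule o_bij[of "\<lambda>p. sh p (- a)"]) (auto simp: sh_sh)

text \<open>\<open>S\<close> consists of single letters, \<open>T\<close> of the middle letters of triples.\<close>

definition conf :: "'p set \<Rightarrow> 'p set \<Rightarrow> bool" where
  "conf S T \<longleftrightarrow> (\<forall>p\<in>T. \<forall>a\<in>{-4,-2,2,4}. sh p a \<notin> T) \<and> (\<forall>p\<in>T. \<forall>a\<in>{-3,-1,1,3}. sh p a \<notin> S)
     \<and> (\<forall>p\<in>S. \<forall>a\<in>{-2,2}. sh p a \<notin> S)"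

lemma confI:
  assumes "\<And>p a. p \<in> T \<Longrightarrow> a \<in> {2,4} \<Longrightarrow> sh p a \<notin> T"
    "\<And>p a. p \<in> T \<Longrightarrow> a \<in> {-3,-1,1,3} \<Longrightarrow> sh p a \<notin> S"
    "\<And>p. p \<in> S \<Longrightarrow> sh p 2 \<notin> S"
  shows "conf S T"
proof -
  have "sh p a \<notin> T" if "p \<in> T" "- a \<in> {2,4}" for p a
    using assms(1)[of "sh p a" "- a"] that by (auto simp: sh_sh)
  moreover have "sh p (-2) \<notin> S" if "p \<in> S" for p
    using assms(3)[of "sh p (-2)"] that by (auto simp: sh_sh)
  ultimately show ?thesis using assms unfolding conf_def by auto
qed

text \<open>The chains \<open>u T \<dots> T\<close> and \<open>T \<dots> T u\<close> on the positions \<open>m, \<dots>, m + 3k\<close>, maximal in both directions.\<close>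

definition left_chain :: "'p \<Rightarrow> nat \<Rightarrow> 'p set \<Rightarrow> 'p set \<Rightarrow> bool" where
  "left_chain m k S T \<longleftrightarrow> m \<in> S \<and> (\<forall>j<k. sh m (2 + 3 * int j) \<in> T) \<and>
     sh m (2 + 3 * int k) \<notin> T \<and> sh m (3 * int k + 1) \<notin> S"

definition right_chain :: "'p \<Rightarrow> nat \<Rightarrow> 'p set \<Rightarrow> 'p set \<Rightarrow> bool" where
  "right_chain m k S T \<longleftrightarrow> sh m (3 * int k) \<in> S \<and> (\<forall>j<k. sh m (1 + 3 * int j) \<in> T) \<and>
     sh m (-2) \<notin> T \<and> sh m (-1) \<notin> S"

text \<open>The chain \<open>u T ... T u\<close>. It is seen from both of its letters and therefore
  enters both adjacency counts.\<close>

definition two_sided :: "'p \<Rightarrow> nat \<Rightarrow> 'p set \<Rightarrow> 'p set \<Rightarrow> bool" where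
  "two_sided m k S T \<longleftrightarrow> m \<in> S \<and> (\<forall>j<k. sh m (2 + 3 * int j) \<in> T) \<and> sh m (3 * int k + 1) \<in> S"

text \<open>The letter jumps from offset \<open>0\<close> to offset \<open>3 k\<close>, and in
  \<open>slideT\<close> every triple moves back by one position, so the same letters remain
  covered.\<close>

definition slideS :: "'p \<Rightarrow> nat \<Rightarrow> 'p set \<Rightarrow> 'p set" where
  "slideS m k S = insert (sh m (3 * int k)) (S - {m})"

definition slideT :: "'p \<Rightarrow> nat \<Rightarrow> 'p set \<Rightarrow> 'p set" where
  "slideT m k T = (T - (\<lambda>j. sh m (2 + 3 * int j)) ` {..<k}) \<union> (\<lambda>j. sh m (1 + 3 * int j)) ` {..<k}"

definition unslideS :: "'p \<Rightarrow> nat \<Rightarrow> 'p set \<Rightarrow> 'p set" where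
  "unslideS m k S = insert m (S - {sh m (3 * int k)})"

definition unslideT :: "'p \<Rightarrow> nat \<Rightarrow> 'p set \<Rightarrow> 'p set" where
  "unslideT m k T = (T - (\<lambda>j. sh m (1 + 3 * int j)) ` {..<k}) \<union> (\<lambda>j. sh m (2 + 3 * int j)) ` {..<k}"

text \<open>A chain cannot wrap around the circle. Centres advance in steps of 3, and the three
  positions just before \<open>m\<close> are closed to them: the outer two by the letter at
  \<open>m\<close>, the middle one by the centre at \<open>m + 2\<close>.\<close>

lemma chain_length:
  assumes c: "conf S T" and m: "m \<in> S" and T: "\<forall>j<k. sh m (2 + 3 * int j) \<in> T" and k: "k \<ge> 1"
  shows "3 * int k \<le> N - 3"
proof -
  have "sh m 2 \<in> T" using T k by (metis mult_zero_right of_nat_0 add.right_neutral less_eq_Suc_le One_nat_def)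
  have N: "sh m (a + N) = sh m a" for a by (simp add: sh_eq_iff)
  have 1: "sh m (N - 1) \<notin> T" "sh m (N - 3) \<notin> T"
  proof -
    show "sh m (N - 1) \<notin> T"
    proof
      assume "sh m (N - 1) \<in> T"
      then have "sh (sh m (N - 1)) 1 \<notin> S" using c by (auto simp: conf_def)
      then show False using m N[of 0] by (simp add: sh_sh)
    qed
    show "sh m (N - 3) \<notin> T"
    proof
      assume "sh m (N - 3) \<in> T"
      then have "sh (sh m (N - 3)) 3 \<notin> S" using c by (auto simp: conf_def)
      then show False using m N[of 0] by (simp add: sh_sh)
    qed
  qed
  have 2: "sh m (N - 2) \<notin> T"
  proof
    assume "sh m (N - 2) \<in> T"
    then have "sh (sh m (N - 2)) 4 \<notin> T" using c by (auto simp: conf_def)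
    then show False using \<open>sh m 2 \<in> T\<close> N[of 2] by (simp add: sh_sh add.commute)
  qed
  have "2 + 3 * int j \<le> N - 4" if "j < k" for j
    using that
  proof (induction j)
    case 0
    then show ?case using N_ge by simp
  next
    case (Suc j)
    then have "sh m (2 + 3 * int (Suc j)) \<in> T" "2 + 3 * int j \<le> N - 4" using T by auto
    moreover from this have "2 + 3 * int (Suc j) \<noteq> N - 1" "2 + 3 * int (Suc j) \<noteq> N - 2" "2 + 3 * int (Suc j) \<noteq> N - 3"
      using 1 2 by metis+
    ultimately show ?case by simp
  qed
  from this[of "k - 1"] show ?thesis using k by (simp add: of_nat_diff)
qed

context
  fixes S T :: "'p set" and m :: 'p and k :: nat
  assumes c: "conf S T" and k: "k \<ge> 1" and ch: "left_chain m k S T"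
begin

lemma slide_facts:
  shows t_t: "sh m o1 \<in> T \<Longrightarrow> o2 - o1 \<in> {-4,-2,2,4} \<Longrightarrow> sh m o2 \<notin> T"
    and t_s: "sh m o1 \<in> T \<Longrightarrow> o2 - o1 \<in> {-3,-1,1,3} \<Longrightarrow> sh m o2 \<notin> S"
    and s_t: "sh m o1 \<in> S \<Longrightarrow> o2 - o1 \<in> {-3,-1,1,3} \<Longrightarrow> sh m o2 \<notin> T"
    and s_s: "sh m o1 \<in> S \<Longrightarrow> o2 - o1 \<in> {-2,2} \<Longrightarrow> sh m o2 \<notin> S"
proof -
  have e: "sh m o2 = sh (sh m o1) (o2 - o1)" "sh m o1 = sh (sh m o2) (o1 - o2)" for o1 o2
    by (simp_all add: sh_sh)
  show "sh m o1 \<in> T \<Longrightarrow> o2 - o1 \<in> {-4,-2,2,4} \<Longrightarrow> sh m o2 \<notin> T"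
    using c e[of o2 o1] by (metis conf_def)
  show "sh m o1 \<in> T \<Longrightarrow> o2 - o1 \<in> {-3,-1,1,3} \<Longrightarrow> sh m o2 \<notin> S"
    using c e[of o2 o1] by (metis conf_def)
  show "sh m o2 \<notin> T" if "sh m o1 \<in> S" "o2 - o1 \<in> {-3,-1,1,3}"
  proof
    assume "sh m o2 \<in> T"
    moreover have "o1 - o2 \<in> {-3,-1,1,3}" using that(2) by auto
    ultimately show False using c e[of o1 o2] that(1) by (metis conf_def)
  qed
  show "sh m o1 \<in> S \<Longrightarrow> o2 - o1 \<in> {-2,2} \<Longrightarrow> sh m o2 \<notin> S"
    using c e[of o2 o1] by (metis conf_def)
qed

lemma k_bound: "3 * int k \<le> N - 3"
  using chain_length[OF c] ch k by (auto simp: left_chain_def)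

lemma window_inj:
  assumes "sh m a = sh m b" "0 \<le> a" "a < N" "0 \<le> b" "b < N"
  shows "a = b"
proof -
  have "N dvd (a - b)" using assms(1) sh_eq_iff by blast
  then show ?thesis using assms dvd_imp_le_int[of "a - b" N] by (cases "a = b") auto
qed

lemma s0: "sh m 0 \<in> S" using ch by (simp add: left_chain_def)
lemma tj: "j < k \<Longrightarrow> sh m (2 + 3 * int j) \<in> T" using ch by (simp add: left_chain_def)
lemma tj': "1 \<le> j \<Longrightarrow> j \<le> k \<Longrightarrow> sh m (3 * int j - 1) \<in> T"
  using tj[of "j - 1"] by (simp add: of_nat_diff algebra_simps)
lemma tk: "sh m (2 + 3 * int k) \<notin> T" "sh m (3 * int k + 1) \<notin> S" using ch by (simp_all add: left_chain_def)

lemma new_T_cases: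
  assumes "sh m x \<in> slideT m k T"
  obtains (old) "sh m x \<in> T" "\<And>j. j < k \<Longrightarrow> sh m x \<noteq> sh m (2 + 3 * int j)"
  | (new) j where "j < k" "sh m x = sh m (1 + 3 * int j)"
  using assms by (auto simp: slideT_def)

lemma new_S_cases:
  assumes "sh m x \<in> slideS m k S"
  obtains (old) "sh m x \<in> S" "sh m x \<noteq> m" | (new) "sh m x = sh m (3 * int k)"
  using assms by (auto simp: slideS_def)

lemma shift_eq: "sh m x = sh m y \<Longrightarrow> sh m (x + a) = sh m (y + a)"
  by (simp add: sh_eq_iff)

lemma shift_eq': "sh m (x + a) = sh m y \<Longrightarrow> sh m x = sh m (y - a)"
  by (simp add: sh_eq_iff algebra_simps)

text \<open>The places forbidden by a moved centre at \<open>1 + 3 j\<close> were already closed by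
  the old factors around it: behind, by the centre at \<open>3 j - 1\<close>, or by the letter at
  \<open>0\<close> if \<open>j = 0\<close>; ahead, by the centre at \<open>5 + 3 j\<close>, or at
  the end of the chain by its maximality.\<close>

lemma slide_T_T:
  assumes x: "sh m x \<in> slideT m k T" and a: "a \<in> {2,4}"
  shows "sh m (x + a) \<notin> slideT m k T"
proof
  assume y: "sh m (x + a) \<in> slideT m k T"
  from x show False
  proof (cases rule: new_T_cases)
    case old
    note o = this
    from y show False
    proof (cases rule: new_T_cases)
      case old
      then show False using t_t[of x "x + a"] o a by auto
    next
      case (new j)
      then have e: "sh m x = sh m (1 + 3 * int j - a)" by (rule_tac shift_eq')
      show False
      proof (cases "j = 0")
        case True
        then show False using e o s_t[OF s0, of "1 - a"] a by auto
      next
        case False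
        then have "sh m (3 * int j - 1) \<in> T" using tj' new by simp
        moreover have "sh m x \<noteq> sh m (3 * int j - 1)"
          using o(2)[of "j - 1"] False new by (simp add: of_nat_diff algebra_simps)
        ultimately show False using t_t[of "3 * int j - 1" "1 + 3 * int j - a"] e o a by auto
      qed
    qed
  next
    case (new j)
    note n = this
    from y show False
    proof (cases rule: new_T_cases)
      case old
      then have o: "sh m (1 + 3 * int j + a) \<in> T" using shift_eq[OF n(2), of a] by simp
      show False
      proof (cases "j + 1 < k")
        case True
        then have t: "sh m (5 + 3 * int j) \<in> T" using tj[of "j + 1"] by (simp add: algebra_simps)
        have "sh m (1 + 3 * int j + a) \<noteq> sh m (5 + 3 * int j)"
          using old(2)[OF True] shift_eq[OF n(2), of a] by (simp add: algebra_simps)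
        then show False using t_t[OF t, of "1 + 3 * int j + a"] o a by auto
      next
        case False
        then have jk: "int k = int j + 1" using n(1) by auto
        show False
        proof (cases "a = 4")
          case True
          then have "1 + 3 * int j + a = 2 + 3 * int k" using jk by simp
          then show False using o tk(1) by metis
        next
          case False
          then have a2: "a = 2" using a by simp
          show False
          proof (cases "j = 0")
            case True
            then show False using o a2 s_t[OF s0, of 3] by simp
          next
            case False
            then have "sh m (3 * int j - 1) \<in> T" using tj' n by simp
            then show False using t_t[of "3 * int j - 1" "1 + 3 * int j + a"] o a2 by auto
          qed
        qed
      qed
    next
      case (new i)
      \<comment> \<open>Both centres have moved by one, so the clash would have existed before the
        slide.\<close>
      have "sh m (2 + 3 * int j + a) = sh m (2 + 3 * int i)"
        using new(2) n(2) shift_eq[of "x + a" "1 + 3 * int i" 1] shift_eq[of x "1 + 3 * int j" "a + 1"]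
        by (simp add: algebra_simps)
      then show False using t_t[OF tj[OF n(1)], of "2 + 3 * int j + a"] tj[OF new(1)] a by auto
    qed
  qed
qed

lemma slide_T_S:
  assumes x: "sh m x \<in> slideT m k T" and a: "a \<in> {-3,-1,1,3}"
  shows "sh m (x + a) \<notin> slideS m k S"
proof
  assume y: "sh m (x + a) \<in> slideS m k S"
  from x show False
  proof (cases rule: new_T_cases)
    case old
    note o = this
    from y show False
    proof (cases rule: new_S_cases)
      case old
      then show False using t_s[of x "x + a"] o a by auto
    next
      case new
      then have e: "sh m x = sh m (3 * int k - a)" by (rule_tac shift_eq')
      have t: "sh m (3 * int k - 1) \<in> T" using tj'[of k] k by simp
      have "sh m x \<noteq> sh m (3 * int k - 1)"
        using o(2)[of "k - 1"] k by (simp add: of_nat_diff algebra_simps)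
      then show False using t_t[OF t, of "3 * int k - a"] e o a by auto
    qed
  next
    case (new j)
    note n = this
    from y show False
    proof (cases rule: new_S_cases)
      case old
      then have o: "sh m (1 + 3 * int j + a) \<in> S" "sh m (1 + 3 * int j + a) \<noteq> m"
        using shift_eq[OF n(2), of a] by simp_all
      consider "a = -3 \<or> a = -1" | "a = 1" | "a = 3" using a by auto
      then show False
      proof cases
        case 1
        show False
        proof (cases "j = 0")
          case True
          then show False using 1 o s_s[OF s0, of "-2"] by auto
        next
          case False
          then have "sh m (3 * int j - 1) \<in> T" using tj' n by simp
          then show False using t_s[of "3 * int j - 1" "1 + 3 * int j + a"] o 1 by auto
        qed
      next
        case 2
        show False
        proof (cases "j + 1 < k")
          case True
          then have "sh m (5 + 3 * int j) \<in> T" using tj[of "j + 1"] by (simp add: algebra_simps)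
          then show False using t_s[of "5 + 3 * int j" "1 + 3 * int j + a"] o 2 by auto
        next
          case False
          show False
          proof (cases "j = 0")
            case True
            then show False using 2 o s_s[OF s0, of 2] by auto
          next
            case False
            then have "sh m (3 * int j - 1) \<in> T" using tj' n by simp
            then show False using t_s[of "3 * int j - 1" "1 + 3 * int j + a"] o 2 by auto
          qed
        qed
      next
        case 3
        show False
        proof (cases "j + 1 < k")
          case True
          then have "sh m (5 + 3 * int j) \<in> T" using tj[of "j + 1"] by (simp add: algebra_simps)
          then show False using t_s[of "5 + 3 * int j" "1 + 3 * int j + a"] o 3 by auto
        next
          case False
          then have "int k = int j + 1" using n(1) by auto
          then show False using o tk(2) 3 by (simp add: algebra_simps)
        qed
      qed
    next
      case new
      then have "sh m (3 * int k) = sh m (1 + 3 * int j + a)"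
        using shift_eq[OF n(2), of a] by metis
      then have "N dvd 3 * int k - (1 + 3 * int j + a)" by (simp add: sh_eq_iff)
      \<comment> \<open>Since \<open>3 \<le> 3 (k - j) \<le> N - 3\<close> and \<open>1 + a\<close>
        is one of -2, 0, 2, 4, divisibility by \<open>N\<close> forces equality, and then
        \<open>1 + a\<close> would be a positive multiple of 3.\<close>
      then have d: "N dvd 3 * (int k - int j) - (1 + a)" by (simp add: algebra_simps)
      have r: "3 \<le> 3 * (int k - int j)" "3 * (int k - int j) \<le> N - 3" using n(1) k_bound by auto
      show False
      proof (cases "3 * (int k - int j) - (1 + a) = 0")
        case True
        then have "3 dvd (1 + a)" by (metis dvd_triv_left eq_iff_diff_eq_0)
        then show False using a True r by auto
      next
        case False
        then have "N \<le> \<bar>3 * (int k - int j) - (1 + a)\<bar>" using d dvd_imp_le_int[of _ N] N_ge by auto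
        then show False using a r N_ge by auto
      qed
    qed
  qed
qed

lemma slide_S_S:
  assumes x: "sh m x \<in> slideS m k S" and a: "a \<in> {-2, 2}"
  shows "sh m (x + a) \<notin> slideS m k S"
proof
  assume y: "sh m (x + a) \<in> slideS m k S"
  have t: "sh m (3 * int k - 1) \<in> T" using tj'[of k] k by simp
  from x show False
  proof (cases rule: new_S_cases)
    case old
    note o = this
    from y show False
    proof (cases rule: new_S_cases)
      case old
      then show False using s_s[of x "x + a"] o a by auto
    next
      case new
      then have e: "sh m x = sh m (3 * int k - a)" by (rule_tac shift_eq')
      then show False using t_s[OF t, of "3 * int k - a"] o a by auto
    qed
  next
    case new
    note n = this
    from y show False
    proof (cases rule: new_S_cases)
      case old
      then show False using t_s[OF t, of "3 * int k + a"] shift_eq[OF n, of a] a by auto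
    next
      case new
      then have "sh m (3 * int k + a) = sh m (3 * int k)" using shift_eq[OF n, of a] by simp
      then have "N dvd a" by (simp add: sh_eq_iff)
      then show False using a N_ge dvd_imp_le_int[of a N] by auto
    qed
  qed
qed

lemma slide_conf: "conf (slideS m k S) (slideT m k T)"
proof (rule confI)
  fix p a assume "p \<in> slideT m k T" "a \<in> {2::int, 4}"
  moreover obtain x where "p = sh m x" using sh_trans by blast
  ultimately show "sh p a \<notin> slideT m k T" using slide_T_T by (simp add: sh_sh)
next
  fix p a assume "p \<in> slideT m k T" "a \<in> {-3,-1,1,3::int}"
  moreover obtain x where "p = sh m x" using sh_trans by blast
  ultimately show "sh p a \<notin> slideS m k S" using slide_T_S by (simp add: sh_sh)
next
  fix p assume "p \<in> slideS m k S"
  moreover obtain x where "p = sh m x" using sh_trans by blast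
  ultimately show "sh p 2 \<notin> slideS m k S" using slide_S_S by (simp add: sh_sh)
qed

text \<open>Maximality on the left comes for free: a centre at \<open>m - 2\<close> or a letter at
  \<open>m - 1\<close> would have been in conflict with the centre at \<open>m + 2\<close>. The
  bound \<open>k_bound\<close> keeps the moved factors away from these places.\<close>

lemma slide_right_chain: "right_chain m k (slideS m k S) (slideT m k T)"
proof -
  have t2: "sh m 2 \<in> T" using tj[of 0] k by simp
  have "sh m (-2) \<notin> slideT m k T"
  proof
    assume "sh m (-2) \<in> slideT m k T"
    then show False
    proof (cases rule: new_T_cases)
      case old
      then show False using t_t[OF t2, of "-2"] by simp
    next
      case (new j)
      then have "sh m (1 + 3 * int j) = sh m (-2)" by metis
      then have "N dvd 3 + 3 * int j" by (simp add: sh_eq_iff algebra_simps)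
      then have "N \<le> 3 + 3 * int j" by (rule zdvd_imp_le) simp
      then show False using new(1) k_bound by simp
    qed
  qed
  moreover have "sh m (-1) \<notin> slideS m k S"
  proof
    assume "sh m (-1) \<in> slideS m k S"
    then show False
    proof (cases rule: new_S_cases)
      case old
      then show False using t_s[OF t2, of "-1"] by simp
    next
      case new
      then have "sh m (3 * int k) = sh m (-1)" by metis
      then have "N dvd 1 + 3 * int k" by (simp add: sh_eq_iff algebra_simps)
      then have "N \<le> 1 + 3 * int k" by (rule zdvd_imp_le) simp
      then show False using k_bound by simp
    qed
  qed
  ultimately show ?thesis by (auto simp: right_chain_def slideS_def slideT_def)
qed

lemma slide_new_S: "sh m (3 * int k) \<notin> S"
proof -
  have "sh m (3 * int k - 1) \<in> T" using tj'[of k] k by simp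
  then show ?thesis by (rule t_s) simp
qed

lemma slide_new_T:
  assumes "j < k"
  shows "sh m (1 + 3 * int j) \<notin> T"
proof (cases "j = 0")
  case True
  then show ?thesis using s_t[OF s0, of 1] by simp
next
  case False
  then have "sh m (3 * int j - 1) \<in> T" using tj'[of j] assms by simp
  then show ?thesis by (rule t_t) simp
qed

lemma unslide_slide: "unslideS m k (slideS m k S) = S" "unslideT m k (slideT m k T) = T"
proof -
  have "m \<in> S" using s0 by simp
  then show "unslideS m k (slideS m k S) = S"
    using slide_new_S unfolding unslideS_def slideS_def by blast
  have "(\<lambda>j. sh m (1 + 3 * int j)) ` {..<k} \<inter> T = {}" using slide_new_T by blast
  moreover have "(\<lambda>j. sh m (2 + 3 * int j)) ` {..<k} \<subseteq> T" using tj by blast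
  ultimately show "unslideT m k (slideT m k T) = T"
    unfolding unslideT_def slideT_def by blast
qed

lemma chain_inj: "inj_on (\<lambda>j. sh m (i + 3 * int j)) {..<k}" if "i \<in> {1,2}"
proof (rule inj_onI)
  fix a b assume "a \<in> {..<k}" "b \<in> {..<k}" "sh m (i + 3 * int a) = sh m (i + 3 * int b)"
  then show "a = b"
    using window_inj[of "i + 3 * int a" "i + 3 * int b"] k_bound that by auto
qed

text \<open>\<open>f\<close> will be the indicator of one kind of letter, and a triple is tested at
  a letter next to its centre, that is, by its outer letters. Each moved triple changes family, but
  together with the move of the single letter these changes telescope, so both degrees are
  preserved.\<close>

lemma slide_count:
  fixes f :: "'p \<Rightarrow> nat"
  assumes f: "\<And>p. f (sh p 2) = f p"
  shows "(\<Sum>p\<in>slideS m k S. f p) + (\<Sum>p\<in>slideT m k T. f (sh p 1)) = (\<Sum>p\<in>S. f p) + (\<Sum>p\<in>T. f (sh p 1))"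
proof -
  let ?C = "(\<lambda>j. sh m (2 + 3 * int j)) ` {..<k}" and ?D = "(\<lambda>j. sh m (1 + 3 * int j)) ` {..<k}"
  have "(\<Sum>p\<in>slideT m k T. f (sh p 1)) = (\<Sum>p\<in>T - ?C. f (sh p 1)) + (\<Sum>p\<in>?D. f (sh p 1))"
    unfolding slideT_def using slide_new_T by (intro sum.union_disjoint) auto
  moreover have "(\<Sum>p\<in>?D. f (sh p 1)) = (\<Sum>j<k. f (sh m (2 + 3 * int j)))"
    using chain_inj[of 1] by (simp add: sum.reindex sh_sh algebra_simps)
  moreover have "(\<Sum>p\<in>T. f (sh p 1)) = (\<Sum>p\<in>T - ?C. f (sh p 1)) + (\<Sum>p\<in>?C. f (sh p 1))"
    by (subst sum.subset_diff[of ?C]) (use tj in auto)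
  moreover have "(\<Sum>p\<in>?C. f (sh p 1)) = (\<Sum>j<k. f (sh m (3 + 3 * int j)))"
    using chain_inj[of 2] by (simp add: sum.reindex sh_sh algebra_simps)
  moreover have "(\<Sum>p\<in>slideS m k S. f p) = f (sh m (3 * int k)) + (\<Sum>p\<in>S - {m}. f p)"
    unfolding slideS_def using slide_new_S by simp
  moreover have "(\<Sum>p\<in>S. f p) = f m + (\<Sum>p\<in>S - {m}. f p)"
    using s0 by (simp add: sum.remove)
  moreover have "f (sh m (2 + 3 * int j)) = f (sh m (3 * int j))" for j
    using f[of "sh m (3 * int j)"] by (simp add: sh_sh add.commute)
  moreover have "f (sh m (3 * int k)) + (\<Sum>j<k. f (sh m (3 * int j))) = f m + (\<Sum>j<k. f (sh m (3 + 3 * int j)))" for k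
    by (induction k) (auto simp: algebra_simps)
  ultimately show ?thesis by simp
qed

text \<open>Both chains cover the letters \<open>m, ..., m + 3 k\<close> once each and contain one
  single letter, so product and sign agree.\<close>

lemma slide_weight:
  fixes u :: "'p \<Rightarrow> real"
  shows "(\<Prod>p\<in>slideS m k S. - u p) * (\<Prod>p\<in>slideT m k T. u (sh p (-1)) * u p * u (sh p 1))
    = (\<Prod>p\<in>S. - u p) * (\<Prod>p\<in>T. u (sh p (-1)) * u p * u (sh p 1))"
proof -
  let ?C = "(\<lambda>j. sh m (2 + 3 * int j)) ` {..<k}" and ?D = "(\<lambda>j. sh m (1 + 3 * int j)) ` {..<k}"
  let ?v = "\<lambda>p. u (sh p (-1)) * u p * u (sh p 1)"
  have "(\<Prod>p\<in>slideT m k T. ?v p) = (\<Prod>p\<in>T - ?C. ?v p) * (\<Prod>p\<in>?D. ?v p)"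
    unfolding slideT_def using slide_new_T by (intro prod.union_disjoint) auto
  moreover have "(\<Prod>p\<in>?D. ?v p) = (\<Prod>j<k. u (sh m (3 * int j)) * u (sh m (1 + 3 * int j)) * u (sh m (2 + 3 * int j)))"
    using chain_inj[of 1] by (simp add: prod.reindex sh_sh algebra_simps)
  moreover have "(\<Prod>p\<in>T. ?v p) = (\<Prod>p\<in>T - ?C. ?v p) * (\<Prod>p\<in>?C. ?v p)"
    by (subst prod.subset_diff[of ?C]) (use tj in auto)
  moreover have "(\<Prod>p\<in>?C. ?v p) = (\<Prod>j<k. u (sh m (1 + 3 * int j)) * u (sh m (2 + 3 * int j)) * u (sh m (3 + 3 * int j)))"
    using chain_inj[of 2] by (simp add: prod.reindex sh_sh algebra_simps)
  moreover have "(\<Prod>p\<in>slideS m k S. - u p) = - u (sh m (3 * int k)) * (\<Prod>p\<in>S - {m}. - u p)"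
    unfolding slideS_def using slide_new_S by simp
  moreover have "(\<Prod>p\<in>S. - u p) = - u m * (\<Prod>p\<in>S - {m}. - u p)"
    using s0 by (simp add: prod.remove)
  moreover have "u (sh m (3 * int k)) * (\<Prod>j<k. u (sh m (3 * int j)) * u (sh m (1 + 3 * int j)) * u (sh m (2 + 3 * int j)))
     = u m * (\<Prod>j<k. u (sh m (1 + 3 * int j)) * u (sh m (2 + 3 * int j)) * u (sh m (3 + 3 * int j)))" for k
    by (induction k) (auto simp: algebra_simps)
  ultimately show ?thesis by (simp add: algebra_simps)
qed

end

text \<open>Reversing the cyclic order turns chains that end with their letter into chains that
  begin with it. The other end \<open>m + 3 k\<close> becomes the base point and sliding back
  becomes sliding forward, so each fact about \<open>slideS\<close> and \<open>slideT\<close> has a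
  mirror image without a second proof.\<close>

lemma reflected: "cyclic_positions N (\<lambda>p a. sh p (- a))"
proof
  show "\<exists>a. q = sh p (- a)" for p q
    using sh_trans[of q p] by (metis minus_minus)
  show "(sh p (- a) = sh p (- b)) = (N dvd a - b)" for p a b
    by (simp add: sh_eq_iff dvd_minus_iff[of N "a - b", symmetric] del: dvd_minus_iff)
qed (use N_ge in \<open>simp_all add: sh_sh\<close>)

lemma conf_reflected: "cyclic_positions.conf (\<lambda>p a. sh p (- a)) S T = conf S T"
  unfolding conf_def cyclic_positions.conf_def[OF reflected] by auto

text \<open>The substitution \<open>j \<mapsto> k - 1 - j\<close>: the reflection lists the triples
  of a chain in the opposite order.\<close>

lemma image_reversed:
  fixes h :: "int \<Rightarrow> 'b"
  shows "(\<lambda>j. h (3 * int k - c - 3 * int j)) ` {..<k} = (\<lambda>j. h (3 - c + 3 * int j)) ` {..<k}"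
proof -
  have "(\<lambda>j. h (3 - c + 3 * int j)) ` {..<k} = (\<lambda>j. h (3 - c + 3 * int j)) ` (\<lambda>j. k - 1 - j) ` {..<k}"
  proof (rule arg_cong[where f="\<lambda>A. (\<lambda>j. h (3 - c + 3 * int j)) ` A"])
    show "{..<k} = (\<lambda>j. k - 1 - j) ` {..<k}"
    proof safe
      fix x assume "x < k"
      then show "x \<in> (\<lambda>j. k - 1 - j) ` {..<k}" by (intro image_eqI[of _ _ "k - 1 - x"]) auto
    qed auto
  qed
  also have "\<dots> = (\<lambda>j. h (3 * int k - c - 3 * int j)) ` {..<k}"
    unfolding image_image by (rule image_cong) (auto simp: of_nat_diff algebra_simps)
  finally show ?thesis by simp
qed

lemma ball_reversed:
  "(\<forall>j<k. P (3 * int k - c - 3 * int j)) \<longleftrightarrow> (\<forall>j<k. P (3 - c + 3 * int j))"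
proof -
  have "(\<forall>j<k. P (3 * int k - c - 3 * int j)) \<longleftrightarrow> (\<forall>b\<in>(\<lambda>j. P (3 * int k - c - 3 * int j)) ` {..<k}. b)"
    by auto
  also have "\<dots> \<longleftrightarrow> (\<forall>j<k. P (3 - c + 3 * int j))"
    unfolding image_reversed by auto
  finally show ?thesis .
qed

lemma left_chain_reflected:
  "cyclic_positions.left_chain (\<lambda>p a. sh p (- a)) (sh m (3 * int k)) k S T = right_chain m k S T"
  using ball_reversed[of k "\<lambda>x. sh m x \<in> T" 2]
  unfolding cyclic_positions.left_chain_def[OF reflected] right_chain_def
  by (simp add: sh_sh algebra_simps)

lemma right_chain_reflected:
  "cyclic_positions.right_chain (\<lambda>p a. sh p (- a)) (sh m (3 * int k)) k S T = left_chain m k S T"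
  using ball_reversed[of k "\<lambda>x. sh m x \<in> T" 1]
  unfolding cyclic_positions.right_chain_def[OF reflected] left_chain_def
  by (simp add: sh_sh algebra_simps)

lemma slide_reflected:
  "cyclic_positions.slideS (\<lambda>p a. sh p (- a)) (sh m (3 * int k)) k S = unslideS m k S"
  "cyclic_positions.slideT (\<lambda>p a. sh p (- a)) (sh m (3 * int k)) k T = unslideT m k T"
  "cyclic_positions.unslideS (\<lambda>p a. sh p (- a)) (sh m (3 * int k)) k S = slideS m k S"
  "cyclic_positions.unslideT (\<lambda>p a. sh p (- a)) (sh m (3 * int k)) k T = slideT m k T"
  using image_reversed[of "\<lambda>x. sh m x" k 1] image_reversed[of "\<lambda>x. sh m x" k 2]
  unfolding cyclic_positions.slideS_def[OF reflected] cyclic_positions.slideT_def[OF reflected]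
    cyclic_positions.unslideS_def[OF reflected] cyclic_positions.unslideT_def[OF reflected]
    slideS_def slideT_def unslideS_def unslideT_def
  by (simp_all add: sh_sh algebra_simps)

lemma unslide_chain:
  assumes "conf S T" "1 \<le> k" "right_chain m k S T"
  shows "conf (unslideS m k S) (unslideT m k T)" "left_chain m k (unslideS m k S) (unslideT m k T)"
    "slideS m k (unslideS m k S) = S" "slideT m k (unslideT m k T) = T"
proof -
  let ?m = "sh m (3 * int k)"
  have c: "cyclic_positions.conf (\<lambda>p a. sh p (- a)) S T"
    "cyclic_positions.left_chain (\<lambda>p a. sh p (- a)) ?m k S T"
    using assms by (simp_all add: conf_reflected left_chain_reflected)
  note rule = c(1) assms(2) c(2)
  show "conf (unslideS m k S) (unslideT m k T)"
    using cyclic_positions.slide_conf[OF reflected rule] by (simp add: slide_reflected conf_reflected)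
  show "left_chain m k (unslideS m k S) (unslideT m k T)"
    using cyclic_positions.slide_right_chain[OF reflected rule] by (simp add: slide_reflected right_chain_reflected)
  show "slideS m k (unslideS m k S) = S" "slideT m k (unslideT m k T) = T"
    using cyclic_positions.unslide_slide[OF reflected rule] by (simp_all add: slide_reflected)
qed

section \<open>Counting adjacencies by maximal chains\<close>

definition conf_weight :: "('p \<Rightarrow> real) \<Rightarrow> 'p set \<times> 'p set \<Rightarrow> real" where
  "conf_weight u = (\<lambda>(S, T). (\<Prod>p\<in>S. - u p) * (\<Prod>p\<in>T. u (sh p (-1)) * u p * u (sh p 1)))"

definition counted :: "('p \<Rightarrow> nat) \<Rightarrow> nat \<Rightarrow> 'p set \<times> 'p set \<Rightarrow> bool" where
  "counted f a = (\<lambda>(S, T). (\<Sum>p\<in>S. f p) + (\<Sum>p\<in>T. f (sh p 1)) = a)"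

text \<open>Sliding is the bijection; \<open>slide_count\<close> keeps the two degrees and
  \<open>slide_weight\<close> keeps the weight.\<close>

lemma sum_left_right:
  fixes a b :: nat
  assumes "1 \<le> k" "\<And>p. f (sh p 2) = f p" "\<And>p. g (sh p 2) = g p"
  defines "CF \<equiv> {(S, T). conf S T \<and> counted f a (S, T) \<and> counted g b (S, T)}"
  shows "(\<Sum>(S, T)\<in>{(S, T). (S, T) \<in> CF \<and> left_chain m k S T}. conf_weight u (S, T))
    = (\<Sum>(S, T)\<in>{(S, T). (S, T) \<in> CF \<and> right_chain m k S T}. conf_weight u (S, T))"
proof (rule sum.reindex_bij_witness[where j="\<lambda>(S, T). (slideS m k S, slideT m k T)"
      and i="\<lambda>(S, T). (unslideS m k S, unslideT m k T)"], goal_cases)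
  case (1 x)
  then obtain S T where x: "x = (S, T)" "conf S T" "left_chain m k S T" by (auto simp: CF_def)
  then show ?case using unslide_slide[OF x(2) assms(1) x(3)] by simp
next
  case (2 x)
  then obtain S T where x: "x = (S, T)" "conf S T" "left_chain m k S T" by (auto simp: CF_def)
  then show ?case using 2 slide_conf[OF x(2) assms(1) x(3)] slide_right_chain[OF x(2) assms(1) x(3)]
      slide_count[OF x(2) assms(1) x(3), of f] slide_count[OF x(2) assms(1) x(3), of g] assms(2,3)
    by (simp add: CF_def counted_def)
next
  case (3 x)
  then obtain S T where x: "x = (S, T)" "conf S T" "right_chain m k S T" by (auto simp: CF_def)
  then show ?case using unslide_chain[OF x(2) assms(1) x(3)] by simp
next
  case (4 x)
  then obtain S T where x: "x = (S, T)" "conf S T" "right_chain m k S T" by (auto simp: CF_def)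
  note u = unslide_chain[OF x(2) assms(1) x(3)]
  show ?case using 4 u x(1)
      slide_count[OF u(1) assms(1) u(2), of f] slide_count[OF u(1) assms(1) u(2), of g] assms(2,3)
    by (simp add: CF_def counted_def)
next
  case (5 x)
  then obtain S T where x: "x = (S, T)" "conf S T" "left_chain m k S T" by (auto simp: CF_def)
  then show ?case using slide_weight[OF x(2) assms(1) x(3), of u] by (simp add: conf_weight_def)
qed

lemma two_sided_end:
  assumes "conf S T" "two_sided m k S T"
  shows "sh m (2 + 3 * int k) \<notin> T"
proof
  assume "sh m (2 + 3 * int k) \<in> T"
  then have "sh (sh m (2 + 3 * int k)) (-1) \<notin> S" using assms(1) by (auto simp: conf_def)
  then show False using assms(2) by (simp add: two_sided_def sh_sh add.commute)
qed

text \<open>Following the triples forward from the letter \<open>m\<close> stops at a definite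
  length. There the chain is either free or closed by a second letter, and exactly one summand is 1.
  Adjacencies can thus be counted by chains.\<close>

lemma unique_chain:
  assumes c: "conf S T"
  shows "(if m \<in> S \<and> sh m 2 \<in> T then 1 else 0 :: nat)
    = (\<Sum>k=1..nat N. of_bool (left_chain m k S T) + of_bool (two_sided m k S T))"
proof (cases "m \<in> S \<and> sh m 2 \<in> T")
  case False
  then have "\<not> left_chain m k S T \<and> \<not> two_sided m k S T" if "k \<in> {1..nat N}" for k
    using that by (force simp: left_chain_def two_sided_def)
  then show ?thesis using False by simp
next
  case True
  \<comment> \<open>The first missing triple; the search ends because \<open>chain_length\<close>
    forbids a chain of length \<open>nat N\<close>.\<close>
  define k where "k = (LEAST k. sh m (2 + 3 * int k) \<notin> T)"
  have "\<exists>k. sh m (2 + 3 * int k) \<notin> T"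
  proof (rule ccontr)
    assume "\<not> ?thesis"
    moreover have "1 \<le> nat N" using N_ge by linarith
    ultimately have "3 * int (nat N) \<le> N - 3"
      using chain_length[OF c, of m "nat N"] True by blast
    then show False using N_ge by simp
  qed
  then have k: "sh m (2 + 3 * int k) \<notin> T" unfolding k_def by (rule LeastI_ex)
  have lt: "sh m (2 + 3 * int j) \<in> T" if "j < k" for j
    using not_less_Least[of j "\<lambda>k. sh m (2 + 3 * int k) \<notin> T"] that unfolding k_def by blast
  have k1: "1 \<le> k" using k True by (cases k) auto
  have kN: "k \<le> nat N" using chain_length[OF c, of m k] True lt k1 by auto
  have un: "of_bool (left_chain m i S T) + of_bool (two_sided m i S T) = (if i = k then 1 else 0 :: nat)" for i
  proof (cases "i = k")
    case True
    then show ?thesis using k lt \<open>m \<in> S \<and> sh m 2 \<in> T\<close>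
      by (auto simp: left_chain_def two_sided_def)
  next
    case False
    have "\<not> left_chain m i S T"
      using False lt[of i] k by (auto simp: left_chain_def) (metis linorder_neqE_nat)
    moreover have "\<not> two_sided m i S T"
    proof
      assume t: "two_sided m i S T"
      from two_sided_end[OF c this] lt[of i] have "\<not> i < k" by blast
      then show False using False t k by (auto simp: two_sided_def)
    qed
    ultimately show ?thesis using False by simp
  qed
  show ?thesis using True k1 kN by (simp add: un)
qed

lemma card_left:
  assumes "conf S T"
  shows "card {p \<in> S. sh p 2 \<in> T} = (\<Sum>m\<in>UNIV. \<Sum>k=1..nat N. of_bool (left_chain m k S T) + of_bool (two_sided m k S T))"
proof -
  have "card {p \<in> S. sh p 2 \<in> T} = card {p \<in> UNIV. p \<in> S \<and> sh p 2 \<in> T}" by simp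
  then show ?thesis
    unfolding unique_chain[OF assms, symmetric] card_eq_sum sum.inter_filter[OF finite] .
qed

lemma two_sided_reflected:
  "cyclic_positions.two_sided (\<lambda>p a. sh p (- a)) (sh m (3 * int k + 1)) k S T = two_sided m k S T"
  using ball_reversed[of k "\<lambda>x. sh m x \<in> T" 1]
  unfolding cyclic_positions.two_sided_def[OF reflected] two_sided_def
  by (auto simp add: sh_sh algebra_simps)

lemma card_right:
  assumes "conf S T"
  shows "card {p \<in> S. sh p (-2) \<in> T} = (\<Sum>m\<in>UNIV. \<Sum>k=1..nat N. of_bool (right_chain m k S T) + of_bool (two_sided m k S T))"
proof -
  let ?l = "\<lambda>m k. of_bool (cyclic_positions.left_chain (\<lambda>p a. sh p (- a)) m k S T) :: nat"
  let ?t = "\<lambda>m k. of_bool (cyclic_positions.two_sided (\<lambda>p a. sh p (- a)) m k S T) :: nat"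
  have "card {p \<in> S. sh p (-2) \<in> T} = (\<Sum>m\<in>UNIV. \<Sum>k=1..nat N. ?l m k + ?t m k)"
    using cyclic_positions.card_left[OF reflected] assms by (simp add: conf_reflected)
  also have "\<dots> = (\<Sum>k=1..nat N. (\<Sum>m\<in>UNIV. ?l m k) + (\<Sum>m\<in>UNIV. ?t m k))"
    by (subst sum.swap) (simp add: sum.distrib)
  \<comment> \<open>The base point of a reflected chain is its other end: offset \<open>3 k\<close>
    for a one-sided chain, \<open>3 k + 1\<close> if there is a letter at both ends. Each of these
    shifts permutes the circle.\<close>
  also have "\<dots> = (\<Sum>k=1..nat N. (\<Sum>m\<in>UNIV. ?l (sh m (3 * int k)) k) + (\<Sum>m\<in>UNIV. ?t (sh m (3 * int k + 1)) k))"
    by (rule sum.cong[OF refl], rule arg_cong2[where f="(+)"]) (rule sum.reindex_bij_betw[OF bij_sh, symmetric])+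
  also have "\<dots> = (\<Sum>m\<in>UNIV. \<Sum>k=1..nat N. of_bool (right_chain m k S T) + of_bool (two_sided m k S T))"
    by (subst sum.swap) (simp add: sum.distrib left_chain_reflected two_sided_reflected)
  finally show ?thesis .
qed

text \<open>Two-sided chains occur in both counts and cancel. For each position and length, the left
  and the right chains have equal total weight.\<close>

theorem sum_adjacency_zero:
  assumes "\<And>p. f (sh p 2) = f p" "\<And>p. g (sh p 2) = g p"
  shows "(\<Sum>(S, T)\<in>{(S, T). conf S T \<and> counted f a (S, T) \<and> counted g b (S, T)}.
    (real (card {p \<in> S. sh p (-2) \<in> T}) - real (card {p \<in> S. sh p 2 \<in> T})) * conf_weight u (S, T)) = 0"
proof -
  define CF where "CF = {(S, T). conf S T \<and> counted f a (S, T) \<and> counted g b (S, T)}"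
  let ?R = "\<lambda>m k. \<Sum>(S, T)\<in>CF. of_bool (right_chain m k S T) * conf_weight u (S, T)"
  let ?L = "\<lambda>m k. \<Sum>(S, T)\<in>CF. of_bool (left_chain m k S T) * conf_weight u (S, T)"
  have "?R m k = ?L m k" if "1 \<le> k" for m k
  proof -
    have *: "(\<Sum>(S, T)\<in>CF. of_bool (Q S T) * conf_weight u (S, T))
      = (\<Sum>(S, T)\<in>{(S, T). (S, T) \<in> CF \<and> Q S T}. conf_weight u (S, T))" for Q
      by (rule sum.mono_neutral_cong_right) auto
    show ?thesis unfolding *[of "right_chain m k"] *[of "left_chain m k"]
      by (rule sum_left_right[where f=f and g=g and a=a and b=b and m=m and u=u, OF that assms,
          folded CF_def, symmetric])
  qed
  then have "(\<Sum>m\<in>UNIV. \<Sum>k=1..nat N. ?R m k - ?L m k) = 0" by simp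
  moreover have "(\<Sum>(S, T)\<in>CF. (real (card {p \<in> S. sh p (-2) \<in> T}) - real (card {p \<in> S. sh p 2 \<in> T})) * conf_weight u (S, T))
    = (\<Sum>(S, T)\<in>CF. \<Sum>m\<in>UNIV. \<Sum>k=1..nat N. of_bool (right_chain m k S T) * conf_weight u (S, T)
         - of_bool (left_chain m k S T) * conf_weight u (S, T))"
  proof (rule sum.cong[OF refl], clarify)
    fix S T assume "(S, T) \<in> CF"
    then have "conf S T" by (simp add: CF_def)
    then show "(real (card {p \<in> S. sh p (-2) \<in> T}) - real (card {p \<in> S. sh p 2 \<in> T})) * conf_weight u (S, T)
      = (\<Sum>m\<in>UNIV. \<Sum>k=1..nat N. of_bool (right_chain m k S T) * conf_weight u (S, T)
         - of_bool (left_chain m k S T) * conf_weight u (S, T))"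
      unfolding card_left[OF \<open>conf S T\<close>] card_right[OF \<open>conf S T\<close>]
      by (simp add: sum.distrib sum_subtractf sum_distrib_left algebra_simps)
  qed
  moreover have "\<dots> = (\<Sum>m\<in>UNIV. \<Sum>k=1..nat N. ?R m k - ?L m k)"
  proof -
    have "(\<Sum>x\<in>CF. \<Sum>m\<in>UNIV. \<Sum>k=1..nat N. h x m k) = (\<Sum>m\<in>UNIV. \<Sum>k=1..nat N. \<Sum>x\<in>CF. h x m k)"
      for h :: "'p set \<times> 'p set \<Rightarrow> 'p \<Rightarrow> nat \<Rightarrow> real"
      by (subst sum.swap, rule sum.cong[OF refl], rule sum.swap)
    then show ?thesis unfolding case_prod_beta sum_subtractf[symmetric] .
  qed
  ultimately show ?thesis by (simp add: CF_def)
qed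

end

section \<open>Smooth functions\<close>

lemma differentiable_cong_open:
  assumes "open U" "x \<in> U" "\<And>x. x \<in> U \<Longrightarrow> f x = g x"
  shows "f differentiable at x \<longleftrightarrow> g differentiable at x"
    and "frechet_derivative f (at x) = frechet_derivative g (at x)"
proof -
  have "(f has_derivative D) (at x) \<longleftrightarrow> (g has_derivative D) (at x)" for D
    using assms has_derivative_transform_within_open[of f D x UNIV U g]
      has_derivative_transform_within_open[of g D x UNIV U f] by auto
  then show "f differentiable at x \<longleftrightarrow> g differentiable at x"
    "frechet_derivative f (at x) = frechet_derivative g (at x)"
    by (simp_all add: differentiable_def frechet_derivative_def)
qed

lemma Ck_on_cong:
  assumes "open U" "\<And>x. x \<in> U \<Longrightarrow> f x = g x"
  shows "Ck_on k U f \<longleftrightarrow> Ck_on k U g"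
  using assms(2)
proof (induction k arbitrary: f g)
  case 0
  then show ?case by (simp cong: continuous_on_cong)
next
  case (Suc k)
  have "Ck_on k U (\<lambda>x. frechet_derivative f (at x) v) \<longleftrightarrow> Ck_on k U (\<lambda>x. frechet_derivative g (at x) v)" for v
    by (rule Suc.IH) (metis differentiable_cong_open(2)[OF assms(1)] Suc.prems)
  moreover have "f differentiable at x \<longleftrightarrow> g differentiable at x" if "x \<in> U" for x
    by (rule differentiable_cong_open(1)[OF assms(1) that]) (rule Suc.prems)
  ultimately show ?case by simp
qed

lemma Ck_on_Suc_D: "Ck_on (Suc k) U f \<Longrightarrow> Ck_on k U f"
proof (induction k arbitrary: f)
  case 0
  then show ?case
    by (auto intro!: continuous_at_imp_continuous_on differentiable_imp_continuous_within)
qed auto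

lemma Ck_on_le:
  assumes "i \<le> k" "Ck_on k U f"
  shows "Ck_on i U f"
  using assms(1)
proof (induction rule: inc_induct)
  case base
  show ?case by (rule assms(2))
next
  case (step n)
  show ?case by (rule Ck_on_Suc_D[OF step.IH])
qed

lemma Ck_on_SucI:
  assumes "open U" "\<And>x. x \<in> U \<Longrightarrow> (f has_derivative f' x) (at x)" "\<And>v. Ck_on k U (\<lambda>x. f' x v)"
  shows "Ck_on (Suc k) U f"
proof -
  have "frechet_derivative f (at x) = f' x" if "x \<in> U" for x
    using frechet_derivative_at[OF assms(2)[OF that]] by simp
  then have "Ck_on k U (\<lambda>x. frechet_derivative f (at x) v)" for v
    using Ck_on_cong[OF assms(1), of "\<lambda>x. frechet_derivative f (at x) v" "\<lambda>x. f' x v"] assms(3) by simp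
  then show ?thesis using assms(2) by (auto simp: differentiable_def)
qed

lemma Ck_on_SucE:
  assumes "Ck_on (Suc k) U f" "x \<in> U"
  shows "(f has_derivative frechet_derivative f (at x)) (at x)"
  using assms by (simp add: frechet_derivative_works[symmetric])

lemma Ck_on_const: "open U \<Longrightarrow> Ck_on k U (\<lambda>x. c)"
proof (induction k arbitrary: c)
  case (Suc k)
  show ?case by (rule Ck_on_SucI[where f'="\<lambda>_ _. 0"]) (use Suc in auto)
qed simp

lemma Ck_on_bounded_linear:
  assumes "open U" "bounded_linear L"
  shows "Ck_on k U L"
proof (cases k)
  case 0
  then show ?thesis using assms by (simp add: linear_continuous_on)
next
  case (Suc i)
  show ?thesis unfolding Suc
    by (rule Ck_on_SucI[where f'="\<lambda>_. L"])
       (use assms in \<open>auto simp: bounded_linear_imp_has_derivative Ck_on_const\<close>)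
qed

lemma Ck_on_add:
  assumes "open U" "Ck_on k U f" "Ck_on k U g"
  shows "Ck_on k U (\<lambda>x. f x + g x)"
  using assms(2,3)
proof (induction k arbitrary: f g)
  case (Suc k)
  show ?case
    by (rule Ck_on_SucI[where f'="\<lambda>x v. frechet_derivative f (at x) v + frechet_derivative g (at x) v"])
       (use assms(1) Suc Ck_on_SucE in \<open>auto intro!: has_derivative_add simp del: Ck_on.simps(2)\<close>, use Suc in auto)
qed (simp add: continuous_on_add)

lemma Ck_on_bilinear:
  assumes "bounded_bilinear B" "open U" "Ck_on k U f" "Ck_on k U g"
  shows "Ck_on k U (\<lambda>x. B (f x) (g x))"
  using assms(3,4)
proof (induction k arbitrary: f g)
  case 0
  then show ?case using bounded_bilinear.continuous_on[OF assms(1)] by auto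
next
  case (Suc k)
  show ?case
  proof (rule Ck_on_SucI[where f'="\<lambda>x v. B (f x) (frechet_derivative g (at x) v) + B (frechet_derivative f (at x) v) (g x)"])
    show "((\<lambda>x. B (f x) (g x)) has_derivative
        (\<lambda>v. B (f x) (frechet_derivative g (at x) v) + B (frechet_derivative f (at x) v) (g x))) (at x)" if "x \<in> U" for x
      by (rule bounded_bilinear.FDERIV[OF assms(1)]; rule Ck_on_SucE) (use Suc that in auto)
    show "Ck_on k U (\<lambda>x. B (f x) (frechet_derivative g (at x) v) + B (frechet_derivative f (at x) v) (g x))" for v
      by (rule Ck_on_add[OF assms(2)]; rule Suc.IH) (use Suc.prems Ck_on_Suc_D in \<open>simp_all, blast+\<close>)
  qed (use assms in auto)
qed

text \<open>The premise \<open>step\<close> covers derivatives that are expressed by the function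
  itself, as for \<open>exp\<close> and \<open>inverse\<close>, and also the case of
  \<open>ln\<close>, whose derivative is already known to be smooth. The chain rule then gains one
  order of differentiability at a time.\<close>

lemma Ck_on_compose_real:
  fixes f :: "'a::real_normed_vector \<Rightarrow> real"
  assumes U: "open U" and "\<And>x. x \<in> U \<Longrightarrow> f x \<in> D" and f: "Ck_on k U f"
    and h: "\<And>t. t \<in> D \<Longrightarrow> (h has_real_derivative h' t) (at t)"
    and cont: "continuous_on D h"
    and step: "\<And>i. Suc i \<le> k \<Longrightarrow> Ck_on i U (\<lambda>x. h (f x)) \<Longrightarrow> Ck_on i U (\<lambda>x. h' (f x))"
  shows "Ck_on k U (\<lambda>x. h (f x))"
proof -
  have "i \<le> k \<Longrightarrow> Ck_on i U (\<lambda>x. h (f x))" for i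
  proof (induction i)
    case 0
    have "continuous_on U f" using Ck_on_le[OF _ f, of 0] by simp
    then show ?case using cont assms(2) by (auto intro!: continuous_on_compose2[of D h U f])
  next
    case (Suc i)
    have fi: "Ck_on (Suc i) U f"
      using Suc.prems f by (rule Ck_on_le)
    show ?case
    proof (rule Ck_on_SucI[where f'="\<lambda>x v. frechet_derivative f (at x) v * h' (f x)"])
      show "((\<lambda>x. h (f x)) has_derivative (\<lambda>v. frechet_derivative f (at x) v * h' (f x))) (at x)" if "x \<in> U" for x
        using DERIV_compose_FDERIV[OF h Ck_on_SucE[OF fi that]] assms(2)[OF that] by simp
      show "Ck_on i U (\<lambda>x. frechet_derivative f (at x) v * h' (f x))" for v
        by (rule Ck_on_bilinear[OF bounded_bilinear_mult U]) (use fi step Suc in auto)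
    qed (use U in auto)
  qed
  then show ?thesis by simp
qed

lemma smooth_on_cong: "open U \<Longrightarrow> (\<And>x. x \<in> U \<Longrightarrow> f x = g x) \<Longrightarrow> smooth_on U f \<longleftrightarrow> smooth_on U g"
  unfolding smooth_on_def by (simp only: Ck_on_cong[of U f g])

lemma smooth_on_const: "open U \<Longrightarrow> smooth_on U (\<lambda>x. c)"
  by (simp add: smooth_on_def Ck_on_const)

lemma smooth_on_bounded_linear: "open U \<Longrightarrow> bounded_linear L \<Longrightarrow> smooth_on U L"
  by (simp add: smooth_on_def Ck_on_bounded_linear)

lemma smooth_on_add: "open U \<Longrightarrow> smooth_on U f \<Longrightarrow> smooth_on U g \<Longrightarrow> smooth_on U (\<lambda>x. f x + g x)"
  by (simp add: smooth_on_def Ck_on_add)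

lemma smooth_on_mult:
  fixes f g :: "_ \<Rightarrow> real"
  shows "open U \<Longrightarrow> smooth_on U f \<Longrightarrow> smooth_on U g \<Longrightarrow> smooth_on U (\<lambda>x. f x * g x)"
  by (simp add: smooth_on_def Ck_on_bilinear[OF bounded_bilinear_mult])

lemma smooth_on_scaleR: "open U \<Longrightarrow> smooth_on U f \<Longrightarrow> smooth_on U g \<Longrightarrow> smooth_on U (\<lambda>x. f x *\<^sub>R g x)"
  by (simp add: smooth_on_def Ck_on_bilinear[OF bounded_bilinear_scaleR])

lemma smooth_on_sum:
  "open U \<Longrightarrow> (\<And>i. i \<in> I \<Longrightarrow> smooth_on U (f i)) \<Longrightarrow> smooth_on U (\<lambda>x. \<Sum>i\<in>I. f i x)"
  by (induction I rule: infinite_finite_induct) (auto intro!: smooth_on_add smooth_on_const)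

lemma smooth_on_diff:
  fixes f g :: "_ \<Rightarrow> real"
  shows "open U \<Longrightarrow> smooth_on U f \<Longrightarrow> smooth_on U g \<Longrightarrow> smooth_on U (\<lambda>x. f x - g x)"
  using smooth_on_add[of U f "\<lambda>x. (- 1) * g x"] smooth_on_mult[of U "\<lambda>x. - 1" g]
    smooth_on_const[of U "- 1 :: real"] by simp

lemma smooth_on_inner_left: "open U \<Longrightarrow> smooth_on U (\<lambda>x. x \<bullet> b)"
  by (rule smooth_on_bounded_linear, assumption, rule bounded_linear_inner_left)

lemma smooth_on_inverse:
  fixes f :: "_ \<Rightarrow> real"
  assumes "open U" "smooth_on U f" "\<And>x. x \<in> U \<Longrightarrow> f x \<noteq> 0"
  shows "smooth_on U (\<lambda>x. inverse (f x))"
  unfolding smooth_on_def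
proof
  fix k
  show "Ck_on k U (\<lambda>x. inverse (f x))"
  proof (rule Ck_on_compose_real[where f=f and h=inverse and D="- {0}" and h'="\<lambda>t. - (inverse t * inverse t)"])
    show "Ck_on i U (\<lambda>x. - (inverse (f x) * inverse (f x)))" if "Ck_on i U (\<lambda>x. inverse (f x))" for i
      using Ck_on_bilinear[OF bounded_bilinear_mult assms(1) Ck_on_const[OF assms(1)]
          Ck_on_bilinear[OF bounded_bilinear_mult assms(1) that that], of "-1"] by simp
  qed (use assms in \<open>auto simp: smooth_on_def intro!: continuous_intros derivative_eq_intros\<close>)
qed

lemma smooth_on_divide:
  fixes f g :: "_ \<Rightarrow> real"
  assumes "open U" "smooth_on U f" "smooth_on U g" "\<And>x. x \<in> U \<Longrightarrow> g x \<noteq> 0"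
  shows "smooth_on U (\<lambda>x. f x / g x)"
  unfolding divide_inverse using assms by (intro smooth_on_mult smooth_on_inverse) auto

lemma smooth_on_exp:
  fixes f :: "_ \<Rightarrow> real"
  assumes "open U" "smooth_on U f"
  shows "smooth_on U (\<lambda>x. exp (f x))"
  unfolding smooth_on_def
proof
  fix k
  show "Ck_on k U (\<lambda>x. exp (f x))"
    by (rule Ck_on_compose_real[where f=f and h=exp and D="UNIV" and h'=exp])
       (use assms in \<open>auto simp: smooth_on_def intro!: continuous_intros derivative_eq_intros\<close>)
qed

lemma has_real_derivative_ln_nonzero:
  assumes "x \<noteq> (0::real)"
  shows "(ln has_real_derivative inverse x) (at x)"
proof (cases "x > 0")
  case True
  then show ?thesis by (rule DERIV_ln)
next
  case False
  then have "((\<lambda>x. ln (- x)) has_real_derivative inverse x) (at x)"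
    using assms by (auto intro!: derivative_eq_intros simp: field_simps)
  then show ?thesis by (simp add: ln_minus)
qed

lemma smooth_on_ln:
  fixes f :: "_ \<Rightarrow> real"
  assumes "open U" "smooth_on U f" "\<And>x. x \<in> U \<Longrightarrow> f x \<noteq> 0"
  shows "smooth_on U (\<lambda>x. ln (f x))"
  unfolding smooth_on_def
proof
  fix k
  show "Ck_on k U (\<lambda>x. ln (f x))"
    by (rule Ck_on_compose_real[where f=f and h=ln and D="- {0}" and h'=inverse])
       (use assms smooth_on_inverse[OF assms] in
         \<open>auto simp: smooth_on_def has_real_derivative_ln_nonzero intro!: continuous_intros\<close>)
qed

lemma smooth_on_differentiable: "smooth_on U f \<Longrightarrow> x \<in> U \<Longrightarrow> f differentiable at x"
  unfolding smooth_on_def by (drule spec[of _ "Suc 0"]) simp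

lemma smooth_on_frechet: "smooth_on U f \<Longrightarrow> smooth_on U (\<lambda>x. frechet_derivative f (at x) v)"
  unfolding smooth_on_def by (rule allI, drule_tac x="Suc k" in spec) simp

lemma smooth_on_continuous: "smooth_on U f \<Longrightarrow> continuous_on U f"
  unfolding smooth_on_def by (drule spec[of _ 0]) simp

section \<open>Symmetry of second derivatives\<close>

abbreviation dirderiv :: "('a::real_normed_vector \<Rightarrow> 'b::real_normed_vector) \<Rightarrow> 'a \<Rightarrow> 'a \<Rightarrow> 'b" where
  "dirderiv f v x \<equiv> frechet_derivative f (at x) v"

lemma has_real_derivative_along_line:
  fixes f :: "'a::real_normed_vector \<Rightarrow> real"
  assumes "f differentiable at (c + t *\<^sub>R v)"
  shows "((\<lambda>t. f (c + t *\<^sub>R v)) has_real_derivative dirderiv f v (c + t *\<^sub>R v)) (at t)"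
proof -
  let ?D = "frechet_derivative f (at (c + t *\<^sub>R v))"
  have D: "(f has_derivative ?D) (at (c + t *\<^sub>R v))"
    using assms by (simp add: frechet_derivative_works)
  have "((\<lambda>t. c + t *\<^sub>R v) has_derivative (\<lambda>s. s *\<^sub>R v)) (at t)"
    by (auto intro!: derivative_eq_intros)
  from has_derivative_compose[OF this D]
  have "((\<lambda>t. f (c + t *\<^sub>R v)) has_derivative (\<lambda>s. ?D (s *\<^sub>R v))) (at t)" .
  moreover have "?D (s *\<^sub>R v) = ?D v * s" for s
    using linear_cmul[OF has_derivative_linear[OF D]] by simp
  ultimately show ?thesis by (simp add: has_field_derivative_def)
qed

text \<open>The mean value theorem is applied twice: in direction \<open>v\<close> to the difference
  of the values based at \<open>c + h w\<close> and at \<open>c\<close>, and then in direction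
  \<open>w\<close> to the derivative along \<open>v\<close>.\<close>

lemma second_difference:
  fixes f :: "'a::real_normed_vector \<Rightarrow> real"
  assumes f: "smooth_on V f" and V: "ball c d \<subseteq> V" and h: "0 < h" "h * (norm v + norm w) < d"
  shows "\<exists>x y. 0 < x \<and> x < h \<and> 0 < y \<and> y < h \<and>
    f (c + h *\<^sub>R w + h *\<^sub>R v) - f (c + h *\<^sub>R v) - f (c + h *\<^sub>R w) + f c
      = h * h * dirderiv (dirderiv f v) w (c + x *\<^sub>R v + y *\<^sub>R w)"
proof -
  have inV: "c + s *\<^sub>R w + t *\<^sub>R v \<in> V" if "0 \<le> s" "s \<le> h" "0 \<le> t" "t \<le> h" for s t
  proof -
    have "norm (s *\<^sub>R w + t *\<^sub>R v) \<le> s * norm w + t * norm v"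
      using that norm_triangle_ineq[of "s *\<^sub>R w" "t *\<^sub>R v"] by simp
    also have "\<dots> \<le> h * norm w + h * norm v" using that by (intro add_mono mult_right_mono) auto
    finally have "norm (s *\<^sub>R w + t *\<^sub>R v) < d" using h by (simp add: algebra_simps)
    moreover have "dist c (c + s *\<^sub>R w + t *\<^sub>R v) = norm (s *\<^sub>R w + t *\<^sub>R v)"
      by (metis add.assoc add_diff_cancel_left' dist_commute dist_norm)
    ultimately have "c + s *\<^sub>R w + t *\<^sub>R v \<in> ball c d" by simp
    then show ?thesis using V by blast
  qed
  have "\<exists>x. 0 < x \<and> x < h \<and> (f (c + h *\<^sub>R w + h *\<^sub>R v) - f (c + h *\<^sub>R v)) - (f (c + h *\<^sub>R w + 0 *\<^sub>R v) - f (c + 0 *\<^sub>R v))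
     = (h - 0) * (dirderiv f v (c + h *\<^sub>R w + x *\<^sub>R v) - dirderiv f v (c + x *\<^sub>R v))"
  proof (rule MVT2[OF h(1)])
    fix t assume t: "0 \<le> t" "t \<le> h"
    show "((\<lambda>t. f (c + h *\<^sub>R w + t *\<^sub>R v) - f (c + t *\<^sub>R v)) has_real_derivative
       (dirderiv f v (c + h *\<^sub>R w + t *\<^sub>R v) - dirderiv f v (c + t *\<^sub>R v))) (at t)"
      using inV[of h t] inV[of 0 t] t h(1)
      by (intro DERIV_diff has_real_derivative_along_line smooth_on_differentiable[OF f]) auto
  qed
  then obtain x where x: "0 < x" "x < h" "f (c + h *\<^sub>R w + h *\<^sub>R v) - f (c + h *\<^sub>R v) - f (c + h *\<^sub>R w) + f c
     = h * (dirderiv f v (c + h *\<^sub>R w + x *\<^sub>R v) - dirderiv f v (c + x *\<^sub>R v))"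
    by auto
  have "\<exists>y. 0 < y \<and> y < h \<and> dirderiv f v (c + x *\<^sub>R v + h *\<^sub>R w) - dirderiv f v (c + x *\<^sub>R v + 0 *\<^sub>R w)
     = (h - 0) * dirderiv (dirderiv f v) w (c + x *\<^sub>R v + y *\<^sub>R w)"
  proof (rule MVT2[OF h(1)])
    fix t assume t: "0 \<le> t" "t \<le> h"
    show "((\<lambda>t. dirderiv f v (c + x *\<^sub>R v + t *\<^sub>R w)) has_real_derivative
       dirderiv (dirderiv f v) w (c + x *\<^sub>R v + t *\<^sub>R w)) (at t)"
      using inV[of t x] t x
      by (intro has_real_derivative_along_line smooth_on_differentiable[OF smooth_on_frechet[OF f]]) (auto simp: algebra_simps)
  qed
  then obtain y where "0 < y" "y < h" "dirderiv f v (c + h *\<^sub>R w + x *\<^sub>R v) - dirderiv f v (c + x *\<^sub>R v)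
     = h * dirderiv (dirderiv f v) w (c + x *\<^sub>R v + y *\<^sub>R w)"
    by (auto simp: algebra_simps)
  with x show ?thesis by (intro exI[of _ x] exI[of _ y]) simp
qed

text \<open>The second difference is symmetric in the two directions. So both iterated derivatives
  take a common value at points arbitrarily close to \<open>c\<close>, and continuity gives equality
  at \<open>c\<close>.\<close>

theorem second_derivative_symmetric:
  fixes f :: "'a::real_normed_vector \<Rightarrow> real"
  assumes V: "open V" and f: "smooth_on V f" and c: "c \<in> V"
  shows "dirderiv (dirderiv f v) w c = dirderiv (dirderiv f w) v c"
proof (rule ccontr)
  let ?g = "dirderiv (dirderiv f v) w" and ?k = "dirderiv (dirderiv f w) v"
  assume ne: "?g c \<noteq> ?k c"
  define e where "e = \<bar>?g c - ?k c\<bar> / 2"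
  have e: "e > 0" using ne by (simp add: e_def)
  have cont: "continuous_on V ?g" "continuous_on V ?k"
    using smooth_on_continuous[OF smooth_on_frechet[OF smooth_on_frechet[OF f]]] by auto
  obtain d0 where d0: "d0 > 0" "ball c d0 \<subseteq> V" using V c openE by blast
  obtain d1 where d1: "d1 > 0" "\<And>x. x \<in> V \<Longrightarrow> dist x c < d1 \<Longrightarrow> \<bar>?g x - ?g c\<bar> < e"
    using cont(1) c e unfolding continuous_on_iff dist_real_def by metis
  obtain d2 where d2: "d2 > 0" "\<And>x. x \<in> V \<Longrightarrow> dist x c < d2 \<Longrightarrow> \<bar>?k x - ?k c\<bar> < e"
    using cont(2) c e unfolding continuous_on_iff dist_real_def by metis
  define d where "d = min d0 (min d1 d2)"
  have d: "d > 0" "ball c d \<subseteq> V" using d0 d1 d2 by (auto simp: d_def)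
  \<comment> \<open>Small enough to keep all points within distance \<open>d\<close>; the summand 1
    keeps the denominator positive when both directions vanish.\<close>
  define h where "h = d / (2 * (norm v + norm w + 1))"
  have "0 < 2 * (norm v + norm w + 1)" by (smt (verit) norm_ge_zero)
  then have h: "h > 0" "h * (norm v + norm w) < d"
    using d(1) by (auto simp: h_def field_simps)
       (smt (verit) mult_nonneg_nonneg norm_ge_zero)
  have h': "h * (norm w + norm v) < d" using h by (simp add: add.commute)
  obtain x y where xy: "0 < x" "x < h" "0 < y" "y < h"
    "f (c + h *\<^sub>R w + h *\<^sub>R v) - f (c + h *\<^sub>R v) - f (c + h *\<^sub>R w) + f c = h * h * ?g (c + x *\<^sub>R v + y *\<^sub>R w)"
    using second_difference[OF f d(2) h] by blast
  obtain x' y' where xy': "0 < x'" "x' < h" "0 < y'" "y' < h"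
    "f (c + h *\<^sub>R v + h *\<^sub>R w) - f (c + h *\<^sub>R w) - f (c + h *\<^sub>R v) + f c = h * h * ?k (c + x' *\<^sub>R w + y' *\<^sub>R v)"
    using second_difference[OF f d(2) h(1) h'] by blast
  have "h * h * ?g (c + x *\<^sub>R v + y *\<^sub>R w) = h * h * ?k (c + x' *\<^sub>R w + y' *\<^sub>R v)"
    using xy(5) xy'(5) by (simp add: algebra_simps)
  then have eq: "?g (c + x *\<^sub>R v + y *\<^sub>R w) = ?k (c + x' *\<^sub>R w + y' *\<^sub>R v)" using h by simp
  have near: "dist (c + s *\<^sub>R v + t *\<^sub>R w) c < d" if "0 < s" "s < h" "0 < t" "t < h" for s t
  proof -
    have "norm (s *\<^sub>R v + t *\<^sub>R w) \<le> s * norm v + t * norm w"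
      using that norm_triangle_ineq[of "s *\<^sub>R v" "t *\<^sub>R w"] by simp
    also have "\<dots> \<le> h * norm v + h * norm w" using that by (intro add_mono mult_right_mono) auto
    finally show ?thesis using h by (simp add: dist_norm algebra_simps)
  qed
  have n1: "dist (c + x *\<^sub>R v + y *\<^sub>R w) c < d" using near xy by blast
  have n2: "dist (c + x' *\<^sub>R w + y' *\<^sub>R v) c < d" using near[of y' x'] xy' by (simp add: algebra_simps)
  have "\<bar>?g (c + x *\<^sub>R v + y *\<^sub>R w) - ?g c\<bar> < e" "\<bar>?k (c + x' *\<^sub>R w + y' *\<^sub>R v) - ?k c\<bar> < e"
    using d1(2)[of "c + x *\<^sub>R v + y *\<^sub>R w"] d2(2)[of "c + x' *\<^sub>R w + y' *\<^sub>R v"] n1 n2 d(2)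
    by (auto simp: d_def dist_commute)
  then have "\<bar>?g c - ?k c\<bar> < e + e" using eq by linarith
  then show False by (simp add: e_def)
qed

section \<open>Log-canonical Poisson structures\<close>

lemma grad_inner:
  fixes f :: "'a::euclidean_space \<Rightarrow> real"
  assumes "(f has_derivative f') (at c)"
  shows "grad f c \<bullet> v = f' v"
proof -
  have lin: "linear f'" using assms by (rule has_derivative_linear)
  define D where "D = (\<Sum>b\<in>Basis. f' b *\<^sub>R b)"
  have D: "h \<bullet> D = f' h" for h
  proof -
    have "f' h = f' (\<Sum>b\<in>Basis. (h \<bullet> b) *\<^sub>R b)" by (simp add: euclidean_representation)
    also have "\<dots> = (\<Sum>b\<in>Basis. (h \<bullet> b) * f' b)" by (simp add: linear_sum[OF lin] linear_cmul[OF lin])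
    finally show ?thesis by (simp add: D_def inner_sum_right mult.commute)
  qed
  have G: "GDERIV f c :> D" using assms by (simp add: gderiv_def D)
  moreover have "D' = D" if "GDERIV f c :> D'" for D'
  proof -
    have "(\<lambda>h. h \<bullet> D') = (\<lambda>h. h \<bullet> D)"
      using that G unfolding gderiv_def by (rule has_derivative_unique)
    then have "h \<bullet> (D' - D) = 0" for h by (simp add: fun_eq_iff inner_diff_right)
    then show ?thesis by (metis inner_eq_zero_iff eq_iff_diff_eq_0)
  qed
  ultimately have "grad f c = D" unfolding grad_def by (rule the_equality)
  then show ?thesis using D[of v] by (simp add: inner_commute)
qed

lemma grad_inner_frechet:
  fixes f :: "'a::euclidean_space \<Rightarrow> real"
  assumes "f differentiable at c"
  shows "grad f c \<bullet> v = dirderiv f v c"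
  using assms by (intro grad_inner) (simp add: frechet_derivative_works)

text \<open>The bivector for which the bracket of the coordinates along \<open>a\<close> and
  \<open>b\<close> is \<open>\<pi> a b\<close> times their product.\<close>

definition log_canonical :: "('a::euclidean_space \<Rightarrow> 'a \<Rightarrow> real) \<Rightarrow> 'a \<Rightarrow> 'a \<Rightarrow> 'a \<Rightarrow> real" where
  "log_canonical \<pi> c v w =
     (\<Sum>a\<in>Basis. \<Sum>b\<in>Basis. \<pi> a b * ((c \<bullet> a) * (v \<bullet> a)) * ((c \<bullet> b) * (w \<bullet> b)))"

text \<open>The Euler operator of one coordinate: differentiation with respect to its logarithm, in
  a form that makes sense also where the coordinate vanishes.\<close>

definition log_deriv :: "'a \<Rightarrow> ('a::euclidean_space \<Rightarrow> real) \<Rightarrow> 'a \<Rightarrow> real" where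
  "log_deriv a f c = (c \<bullet> a) * dirderiv f a c"

lemma bracket_log_canonical:
  assumes "f differentiable at c" "g differentiable at c"
  shows "bracket (log_canonical \<pi>) f g c =
    (\<Sum>a\<in>Basis. \<Sum>b\<in>Basis. \<pi> a b * log_deriv a f c * log_deriv b g c)"
  using assms by (simp add: bracket_def log_canonical_def log_deriv_def grad_inner_frechet)

lemma smooth_log_deriv: "open V \<Longrightarrow> smooth_on V f \<Longrightarrow> smooth_on V (log_deriv a f)"
  unfolding log_deriv_def by (intro smooth_on_mult smooth_on_inner_left smooth_on_frechet)

lemma log_deriv_mult:
  assumes "f differentiable at c" "g differentiable at c"
  shows "log_deriv a (\<lambda>c. f c * g c) c = log_deriv a f c * g c + f c * log_deriv a g c"
proof -
  have "((\<lambda>c. f c * g c) has_derivative (\<lambda>v. f c * dirderiv g v c + dirderiv f v c * g c)) (at c)"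
    using assms by (intro has_derivative_mult) (simp_all add: frechet_derivative_works)
  from frechet_derivative_at[OF this, symmetric] show ?thesis
    by (simp add: log_deriv_def algebra_simps)
qed

lemma log_deriv_sum:
  assumes "finite I" "\<And>i. i \<in> I \<Longrightarrow> f i differentiable at c"
  shows "log_deriv a (\<lambda>c. \<Sum>i\<in>I. k i * f i c) c = (\<Sum>i\<in>I. k i * log_deriv a (f i) c)"
proof -
  have "((\<lambda>c. \<Sum>i\<in>I. k i * f i c) has_derivative (\<lambda>v. \<Sum>i\<in>I. k i * dirderiv (f i) v c)) (at c)"
    using assms by (intro has_derivative_sum has_derivative_mult_right) (simp add: frechet_derivative_works)
  from frechet_derivative_at[OF this, symmetric] show ?thesis
    by (simp add: log_deriv_def sum_distrib_left algebra_simps)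
qed

lemma log_deriv_cong:
  assumes "open V" "c \<in> V" "\<And>x. x \<in> V \<Longrightarrow> f x = g x"
  shows "log_deriv a f c = log_deriv a g c"
  using differentiable_cong_open(2)[OF assms] by (simp add: log_deriv_def)

text \<open>Composition produces an extra first-order term with the factor
  \<open>a \<bullet> b\<close>, which vanishes for distinct basis vectors; the second-order term is
  symmetric.\<close>

lemma log_deriv_commute:
  fixes f :: "'a::euclidean_space \<Rightarrow> real"
  assumes V: "open V" "c \<in> V" "smooth_on V f" and ab: "a \<in> Basis" "b \<in> Basis"
  shows "log_deriv a (log_deriv b f) c = log_deriv b (log_deriv a f) c"
proof -
  have *: "log_deriv a (log_deriv b f) c = (c \<bullet> a) * (a \<bullet> b) * dirderiv f b c + (c \<bullet> a) * (c \<bullet> b) * dirderiv (dirderiv f b) a c" for a b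
  proof -
    have "((\<lambda>c. (c \<bullet> b) * dirderiv f b c) has_derivative
      (\<lambda>v. (c \<bullet> b) * dirderiv (dirderiv f b) v c + (v \<bullet> b) * dirderiv f b c)) (at c)"
      using smooth_on_differentiable[OF smooth_on_frechet[OF V(3)] V(2)]
      by (intro has_derivative_mult has_derivative_inner_left has_derivative_ident) (simp add: frechet_derivative_works)
    from frechet_derivative_at[OF this, symmetric] show ?thesis
      unfolding log_deriv_def by (simp add: algebra_simps)
  qed
  show ?thesis
  proof (cases "a = b")
    case False
    then have "a \<bullet> b = 0" "b \<bullet> a = 0" using ab by (auto simp: inner_not_same_Basis)
    then show ?thesis unfolding * by (simp add: second_derivative_symmetric[OF V(1,3,2), of a b] algebra_simps)
  qed simp
qed

text \<open>In the logarithmic derivatives, which commute, the bracket has constant coefficients.\<close>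

lemma log_canonical_jacobi:
  assumes V: "open V" "smooth_on V f" "smooth_on V g" "smooth_on V h" "c \<in> V"
    and skew: "\<And>a b. \<pi> a b = - \<pi> b a"
  shows "bracket (log_canonical \<pi>) f (bracket (log_canonical \<pi>) g h) c +
    bracket (log_canonical \<pi>) g (bracket (log_canonical \<pi>) h f) c +
    bracket (log_canonical \<pi>) h (bracket (log_canonical \<pi>) f g) c = 0"
proof -
  let ?P = "log_canonical \<pi>"
  let ?L = "\<lambda>a f. log_deriv a f c" and ?LL = "\<lambda>a b f. log_deriv a (log_deriv b f) c"
  \<comment> \<open>A double bracket is a difference of two values of \<open>T\<close>, as the outer
    derivative hits either inner factor. \<open>T\<close> is symmetric in its first and third
    arguments: reversing all indices costs two signs of \<open>\<pi>\<close>. Hence the six terms of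
    the Jacobi sum cancel in pairs.\<close>
  define T where "T f g h = (\<Sum>a\<in>Basis. \<Sum>b\<in>Basis. \<Sum>d\<in>Basis. \<Sum>e\<in>Basis. \<pi> a b * \<pi> d e * ?L a f * ?LL b d g * ?L e h)"
    for f g h :: "'a \<Rightarrow> real"
  have sym: "T f g h = T h g f" if "smooth_on V g" for f g h :: "'a \<Rightarrow> real"
  proof -
    have "T h g f = (\<Sum>a\<in>Basis. \<Sum>b\<in>Basis. \<Sum>e\<in>Basis. \<Sum>d\<in>Basis. \<pi> a b * \<pi> d e * ?L a h * ?LL b d g * ?L e f)"
      unfolding T_def by (rule sum.cong[OF refl], rule sum.cong[OF refl], rule sum.swap)
    also have "\<dots> = (\<Sum>a\<in>Basis. \<Sum>e\<in>Basis. \<Sum>b\<in>Basis. \<Sum>d\<in>Basis. \<pi> a b * \<pi> d e * ?L a h * ?LL b d g * ?L e f)"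
      by (rule sum.cong[OF refl], rule sum.swap)
    also have "\<dots> = (\<Sum>e\<in>Basis. \<Sum>a\<in>Basis. \<Sum>b\<in>Basis. \<Sum>d\<in>Basis. \<pi> a b * \<pi> d e * ?L a h * ?LL b d g * ?L e f)"
      by (rule sum.swap)
    also have "\<dots> = (\<Sum>e\<in>Basis. \<Sum>a\<in>Basis. \<Sum>d\<in>Basis. \<Sum>b\<in>Basis. \<pi> a b * \<pi> d e * ?L a h * ?LL b d g * ?L e f)"
      by (rule sum.cong[OF refl], rule sum.cong[OF refl], rule sum.swap)
    also have "\<dots> = (\<Sum>e\<in>Basis. \<Sum>d\<in>Basis. \<Sum>a\<in>Basis. \<Sum>b\<in>Basis. \<pi> a b * \<pi> d e * ?L a h * ?LL b d g * ?L e f)"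
      by (rule sum.cong[OF refl], rule sum.swap)
    also have "\<dots> = (\<Sum>e\<in>Basis. \<Sum>d\<in>Basis. \<Sum>b\<in>Basis. \<Sum>a\<in>Basis. \<pi> a b * \<pi> d e * ?L a h * ?LL b d g * ?L e f)"
      by (rule sum.cong[OF refl], rule sum.cong[OF refl], rule sum.swap)
    also have "\<dots> = T f g h"
      unfolding T_def
    proof (intro sum.cong refl, goal_cases)
      case (1 e d b a)
      have "\<pi> a b * \<pi> d e = \<pi> e d * \<pi> b a" using skew[of a b] skew[of d e] by simp
      then show ?case using log_deriv_commute[OF V(1,5) that 1(3) 1(2)] by (simp add: algebra_simps)
    qed
    finally show ?thesis by simp
  qed
  have br: "bracket ?P f (bracket ?P g h) c = T f g h - T f h g"
    if s: "smooth_on V f" "smooth_on V g" "smooth_on V h" for f g h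
  proof -
    let ?B = "\<lambda>x. \<Sum>i\<in>Basis \<times> Basis. \<pi> (fst i) (snd i) * (log_deriv (fst i) g x * log_deriv (snd i) h x)"
    have eq: "bracket ?P g h x = ?B x" if "x \<in> V" for x
      using bracket_log_canonical[of g x h \<pi>] smooth_on_differentiable[OF s(2) that] smooth_on_differentiable[OF s(3) that]
      by (simp add: sum.cartesian_product case_prod_beta mult.assoc)
    have smB: "smooth_on V ?B"
      using s V(1) by (intro smooth_on_sum smooth_on_mult smooth_on_const smooth_log_deriv)
    have smb: "smooth_on V (bracket ?P g h)" using smooth_on_cong[OF V(1) eq] smB by simp
    have d: "log_deriv a f differentiable at c" if "smooth_on V f" for a f
      using smooth_on_differentiable[OF smooth_log_deriv[OF V(1) that] V(5)] .
    have "log_deriv b (bracket ?P g h) c = log_deriv b ?B c" for b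
      by (rule log_deriv_cong[OF V(1,5)]) (rule eq)
    also have "\<dots> b = (\<Sum>i\<in>Basis \<times> Basis. \<pi> (fst i) (snd i) * log_deriv b (\<lambda>x. log_deriv (fst i) g x * log_deriv (snd i) h x) c)" for b
      by (rule log_deriv_sum) (auto intro!: differentiable_mult d s)
    also have "\<dots> b = (\<Sum>d\<in>Basis. \<Sum>e\<in>Basis. \<pi> d e * ?LL b d g * ?L e h) + (\<Sum>d\<in>Basis. \<Sum>e\<in>Basis. \<pi> d e * ?L d g * ?LL b e h)" for b
      by (simp add: log_deriv_mult d s sum.cartesian_product case_prod_beta sum.distrib[symmetric] algebra_simps)
    also have "(\<Sum>d\<in>Basis. \<Sum>e\<in>Basis. \<pi> d e * ?L d g * ?LL b e h) = - (\<Sum>d\<in>Basis. \<Sum>e\<in>Basis. \<pi> d e * ?LL b d h * ?L e g)" for b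
    proof -
      have "(\<Sum>d\<in>Basis. \<Sum>e\<in>Basis. \<pi> d e * ?L d g * ?LL b e h) = (\<Sum>e\<in>Basis. \<Sum>d\<in>Basis. - (\<pi> e d * ?LL b e h * ?L d g))"
        by (subst sum.swap, rule sum.cong[OF refl], rule sum.cong[OF refl]) (metis (no_types, lifting) skew mult.commute mult.left_commute mult_minus_left)
      then show ?thesis by (simp add: sum_negf)
    qed
    finally have Lb: "log_deriv b (bracket ?P g h) c
      = (\<Sum>d\<in>Basis. \<Sum>e\<in>Basis. \<pi> d e * ?LL b d g * ?L e h) + - (\<Sum>d\<in>Basis. \<Sum>e\<in>Basis. \<pi> d e * ?LL b d h * ?L e g)" for b .
    have "bracket ?P f (bracket ?P g h) c = (\<Sum>a\<in>Basis. \<Sum>b\<in>Basis. \<pi> a b * ?L a f * log_deriv b (bracket ?P g h) c)"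
      using smooth_on_differentiable[OF s(1) V(5)] smooth_on_differentiable[OF smb V(5)]
      by (rule bracket_log_canonical)
    also have "\<dots> = T f g h - T f h g"
      unfolding Lb T_def by (simp add: sum_subtractf sum_distrib_left algebra_simps)
    finally show ?thesis .
  qed
  show ?thesis
    unfolding br[OF V(2,3,4)] br[OF V(3,4,2)] br[OF V(4,2,3)]
    using sym[OF V(3), of f h] sym[OF V(4), of f g] sym[OF V(2), of g h] by simp
qed

lemma bilinear_log_canonical: "bilinear (log_canonical \<pi> c)"
  unfolding bilinear_def log_canonical_def
  by (intro conjI allI bounded_linear.linear bounded_linear_sum bounded_linear_const_mult
      bounded_linear_mult_const bounded_linear_inner_left)

lemma log_canonical_skew:
  assumes skew: "\<And>a b. \<pi> a b = - \<pi> b a"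
  shows "log_canonical \<pi> c v w = - log_canonical \<pi> c w v"
proof -
  have "log_canonical \<pi> c v w = (\<Sum>b\<in>Basis. \<Sum>a\<in>Basis. \<pi> a b * ((c \<bullet> a) * (v \<bullet> a)) * ((c \<bullet> b) * (w \<bullet> b)))"
    unfolding log_canonical_def by (rule sum.swap)
  also have "\<dots> = (\<Sum>b\<in>Basis. \<Sum>a\<in>Basis. - (\<pi> b a * ((c \<bullet> b) * (w \<bullet> b)) * ((c \<bullet> a) * (v \<bullet> a))))"
    by (rule sum.cong[OF refl], rule sum.cong[OF refl]) (subst skew, simp)
  finally show ?thesis by (simp add: log_canonical_def sum_negf)
qed

theorem poisson_log_canonical:
  assumes "open U" and skew: "\<And>a b. \<pi> a b = - \<pi> b a"
  shows "poisson_structure_on U (log_canonical \<pi>)"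
  unfolding poisson_structure_on_def
proof (intro conjI ballI allI impI)
  show "log_canonical \<pi> c v w = - log_canonical \<pi> c w v" for c v w
    by (rule log_canonical_skew) (rule skew)
  show "smooth_on U (\<lambda>c. log_canonical \<pi> c v w)" for v w
    unfolding log_canonical_def using assms(1)
    by (intro smooth_on_sum smooth_on_mult smooth_on_const smooth_on_inner_left)
  show "bracket (log_canonical \<pi>) f (bracket (log_canonical \<pi>) g h) c +
    bracket (log_canonical \<pi>) g (bracket (log_canonical \<pi>) h f) c +
    bracket (log_canonical \<pi>) h (bracket (log_canonical \<pi>) f g) c = 0"
    if "open V \<and> V \<subseteq> U \<and> smooth_on V f \<and> smooth_on V g \<and> smooth_on V h" "c \<in> V" for V f g h c
    by (rule log_canonical_jacobi[of V]) (use that in \<open>simp_all\<close>, rule skew)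
qed (use assms(1) in \<open>simp_all add: bilinear_log_canonical\<close>)

section \<open>Null space and symplectic leaves\<close>

definition nonzero_coords :: "'a::euclidean_space set" where
  "nonzero_coords = {c. \<forall>b\<in>Basis. c \<bullet> b \<noteq> 0}"

lemma nonzero_coordsD: "c \<in> nonzero_coords \<Longrightarrow> b \<in> Basis \<Longrightarrow> c \<bullet> b \<noteq> 0"
  by (simp add: nonzero_coords_def)

lemma open_nonzero_coords: "open (nonzero_coords :: 'a::euclidean_space set)"
proof -
  have eq: "nonzero_coords = (\<Inter>b\<in>Basis. {c::'a. c \<bullet> b \<noteq> 0})" by (auto simp: nonzero_coords_def)
  show ?thesis
    unfolding eq by (intro open_INT finite_Basis ballI open_Collect_neq continuous_intros)
qed

lemma hamiltonian_field_component:
  assumes "b \<in> Basis"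
  shows "hamiltonian_field (log_canonical \<pi>) h c \<bullet> b = (\<Sum>a\<in>Basis. \<pi> a b * ((c \<bullet> a) * (grad h c \<bullet> a))) * (c \<bullet> b)"
proof -
  have "hamiltonian_field (log_canonical \<pi>) h c \<bullet> b = log_canonical \<pi> c (grad h c) b"
    using assms by (simp add: hamiltonian_field_def)
  also have "\<dots> = (\<Sum>a\<in>Basis. \<Sum>d\<in>Basis. \<pi> a d * ((c \<bullet> a) * (grad h c \<bullet> a)) * ((c \<bullet> d) * (if d = b then 1 else 0)))"
    unfolding log_canonical_def
    by (intro sum.cong refl) (use assms in \<open>simp add: inner_Basis\<close>)
  also have "\<dots> = (\<Sum>a\<in>Basis. \<pi> a b * ((c \<bullet> a) * (grad h c \<bullet> a)) * (c \<bullet> b))"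
    by (rule sum.cong[OF refl]) (use assms in \<open>simp add: if_distrib[of "(*) _"] sum.delta cong: if_cong\<close>)
  finally show ?thesis by (simp add: sum_distrib_right)
qed

lemma log_canonical_component:
  "log_canonical \<pi> c v w = (\<Sum>b\<in>Basis. (\<Sum>a\<in>Basis. \<pi> a b * ((c \<bullet> a) * (v \<bullet> a))) * (c \<bullet> b) * (w \<bullet> b))"
  unfolding log_canonical_def by (subst sum.swap) (simp add: sum_distrib_right mult.assoc)

text \<open>As no coordinate vanishes, the factor \<open>c \<bullet> b\<close> can be divided out.
  What remains is the kernel of a constant matrix acting on the coordinatewise product of
  \<open>c\<close> and \<open>v\<close>.\<close>

lemma null_space_log_canonical:
  assumes "c \<in> nonzero_coords"
  shows "v \<in> null_space (log_canonical \<pi>) c \<longleftrightarrow> (\<forall>b\<in>Basis. (\<Sum>a\<in>Basis. \<pi> a b * ((c \<bullet> a) * (v \<bullet> a))) = 0)"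
proof
  assume v: "v \<in> null_space (log_canonical \<pi>) c"
  show "\<forall>b\<in>Basis. (\<Sum>a\<in>Basis. \<pi> a b * ((c \<bullet> a) * (v \<bullet> a))) = 0"
  proof
    fix b :: 'a assume b: "b \<in> Basis"
    have "0 = log_canonical \<pi> c v b" using v by (simp add: null_space_def)
    also have "\<dots> = (\<Sum>d\<in>Basis. (\<Sum>a\<in>Basis. \<pi> a d * ((c \<bullet> a) * (v \<bullet> a))) * (c \<bullet> d) * (if d = b then 1 else 0))"
      unfolding log_canonical_component
      by (rule sum.cong[OF refl]) (use b in \<open>simp add: inner_Basis\<close>)
    also have "\<dots> = (\<Sum>a\<in>Basis. \<pi> a b * ((c \<bullet> a) * (v \<bullet> a))) * (c \<bullet> b)"
      using b by (simp add: if_distrib[of "(*) _"] sum.delta cong: if_cong)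
    finally show "(\<Sum>a\<in>Basis. \<pi> a b * ((c \<bullet> a) * (v \<bullet> a))) = 0"
      using nonzero_coordsD[OF assms b] by simp
  qed
qed (simp add: null_space_def log_canonical_component)

lemma subspace_null_space: "subspace (null_space (log_canonical \<pi>) c)"
  using bilinear_log_canonical[of \<pi> c]
  by (auto simp: subspace_def null_space_def bilinear_ladd bilinear_lmul bilinear_lzero)

context
  fixes \<pi> :: "'a::euclidean_space \<Rightarrow> 'a \<Rightarrow> real"
  assumes skew: "\<And>a b. \<pi> a b = - \<pi> b a"
begin

text \<open>In Isabelle \<open>ln x = ln \<bar>x\<bar>\<close>, so the function makes sense on every orthant.\<close>

definition log_casimir :: "'a \<Rightarrow> 'a \<Rightarrow> real" where
  "log_casimir \<kappa> c = (\<Sum>a\<in>Basis. (\<kappa> \<bullet> a) * ln (c \<bullet> a))"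

lemma log_casimir_derivative:
  assumes "\<gamma> t \<in> nonzero_coords" "(\<gamma> has_vector_derivative v) (at t within A)"
  shows "((\<lambda>t. log_casimir \<kappa> (\<gamma> t)) has_vector_derivative (\<Sum>a\<in>Basis. (\<kappa> \<bullet> a) * ((v \<bullet> a) / (\<gamma> t \<bullet> a)))) (at t within A)"
proof -
  have "((\<lambda>t. ln (\<gamma> t \<bullet> a)) has_real_derivative (v \<bullet> a) / (\<gamma> t \<bullet> a)) (at t within A)" if "a \<in> Basis" for a
  proof -
    have "((\<lambda>t. \<gamma> t \<bullet> a) has_real_derivative v \<bullet> a) (at t within A)"
      using assms(2) has_derivative_inner_left[of \<gamma> "\<lambda>x. x *\<^sub>R v" "at t within A" a]
      by (simp add: has_vector_derivative_def has_field_derivative_def mult_commute_abs)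
    from DERIV_chain2[OF has_real_derivative_ln_nonzero[OF nonzero_coordsD[OF assms(1) that]] this]
    show ?thesis by (simp add: field_simps)
  qed
  then have "((\<lambda>t. log_casimir \<kappa> (\<gamma> t)) has_real_derivative (\<Sum>a\<in>Basis. (\<kappa> \<bullet> a) * ((v \<bullet> a) / (\<gamma> t \<bullet> a)))) (at t within A)"
    unfolding log_casimir_def by (intro DERIV_sum DERIV_cmult)
  then show ?thesis by (simp add: has_real_derivative_iff_has_vector_derivative)
qed

text \<open>The derivative of \<open>log_casimir \<kappa>\<close> along any Hamiltonian field is a
  combination of the sums that the hypothesis on \<open>\<kappa>\<close> makes zero.\<close>

lemma log_casimir_arc:
  assumes \<kappa>: "\<And>b. b \<in> Basis \<Longrightarrow> (\<Sum>a\<in>Basis. \<pi> a b * (\<kappa> \<bullet> a)) = 0"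
    and arc: "hamiltonian_arc nonzero_coords (log_canonical \<pi>) p q"
  shows "log_casimir \<kappa> q = log_casimir \<kappa> p"
proof -
  obtain V h \<gamma> where V: "V \<subseteq> nonzero_coords" "\<gamma> 0 = p" "\<gamma> 1 = q"
    "\<And>t. t \<in> {0..1::real} \<Longrightarrow> \<gamma> t \<in> V"
    "\<And>t. t \<in> {0..1::real} \<Longrightarrow> (\<gamma> has_vector_derivative hamiltonian_field (log_canonical \<pi>) h (\<gamma> t)) (at t within {0..1})"
    using arc unfolding hamiltonian_arc_def by blast
  have "((\<lambda>t. log_casimir \<kappa> (\<gamma> t)) has_vector_derivative 0) (at t within {0..1})" if t: "t \<in> {0..1}" for t
  proof -
    have nz: "\<gamma> t \<in> nonzero_coords" using V t by auto
    have "(\<Sum>a\<in>Basis. (\<kappa> \<bullet> a) * ((hamiltonian_field (log_canonical \<pi>) h (\<gamma> t) \<bullet> a) / (\<gamma> t \<bullet> a)))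
      = (\<Sum>a\<in>Basis. \<Sum>d\<in>Basis. (\<kappa> \<bullet> a) * (\<pi> d a * ((\<gamma> t \<bullet> d) * (grad h (\<gamma> t) \<bullet> d))))"
      by (rule sum.cong[OF refl]) (simp add: hamiltonian_field_component nonzero_coordsD[OF nz] sum_distrib_left)
    also have "\<dots> = (\<Sum>d\<in>Basis. \<Sum>a\<in>Basis. (\<kappa> \<bullet> a) * (\<pi> d a * ((\<gamma> t \<bullet> d) * (grad h (\<gamma> t) \<bullet> d))))"
      by (rule sum.swap)
    also have "\<dots> = (\<Sum>d\<in>Basis. - ((\<gamma> t \<bullet> d) * (grad h (\<gamma> t) \<bullet> d)) * (\<Sum>a\<in>Basis. \<pi> a d * (\<kappa> \<bullet> a)))"
      unfolding sum_distrib_left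
      by (rule sum.cong[OF refl], rule sum.cong[OF refl]) (subst skew, simp)
    also have "\<dots> = 0" using \<kappa> by simp
    finally show ?thesis using log_casimir_derivative[OF nz V(5)[OF t], of \<kappa>] by simp
  qed
  then obtain k where "\<And>t. t \<in> {0..1} \<Longrightarrow> log_casimir \<kappa> (\<gamma> t) = k"
    using has_vector_derivative_zero_constant[of "{0..1}" "\<lambda>t. log_casimir \<kappa> (\<gamma> t)"] by auto
  then show ?thesis using V(2,3) by (metis atLeastAtMost_iff order_refl zero_le_one)
qed

lemma leaf_in_nonzero:
  assumes "p \<in> nonzero_coords" "q \<in> symplectic_leaf nonzero_coords (log_canonical \<pi>) p"
  shows "q \<in> nonzero_coords"
proof -
  have "(hamiltonian_arc nonzero_coords (log_canonical \<pi>))\<^sup>*\<^sup>* p q" using assms(2) by (simp add: symplectic_leaf_def)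
  then show ?thesis
  proof (cases rule: rtranclp.cases)
    case (rtrancl_into_rtrancl b)
    then obtain V h \<gamma> where "V \<subseteq> nonzero_coords" "\<gamma> 1 = q" "\<forall>t\<in>{0..1::real}. \<gamma> t \<in> V"
      unfolding hamiltonian_arc_def by blast
    then show ?thesis by (metis atLeastAtMost_iff order_refl subsetD zero_le_one)
  qed (use assms in simp)
qed

lemma log_casimir_leaf:
  assumes \<kappa>: "\<And>b. b \<in> Basis \<Longrightarrow> (\<Sum>a\<in>Basis. \<pi> a b * (\<kappa> \<bullet> a)) = 0"
    and "q \<in> symplectic_leaf nonzero_coords (log_canonical \<pi>) p"
  shows "log_casimir \<kappa> q = log_casimir \<kappa> p"
proof -
  have "(hamiltonian_arc nonzero_coords (log_canonical \<pi>))\<^sup>*\<^sup>* p q" using assms(2) by (simp add: symplectic_leaf_def)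
  then show ?thesis
  proof induction
    case (step y z)
    then show ?case using log_casimir_arc[OF \<kappa> step.hyps(2)] by simp
  qed simp
qed

text \<open>A null covector \<open>n\<close> at \<open>q\<close> is the gradient at \<open>q\<close>
  of the logarithmic Casimir whose \<open>\<kappa>\<close> is the coordinatewise product of
  \<open>q\<close> and \<open>n\<close>. This Casimir is constant on the leaf, so its derivative
  \<open>n \<bullet> v\<close> along a curve in the leaf is zero.\<close>

lemma velocity_orthogonal:
  assumes p: "p \<in> nonzero_coords"
    and v: "v \<in> velocities (symplectic_leaf nonzero_coords (log_canonical \<pi>) p) q"
    and n: "n \<in> null_space (log_canonical \<pi>) q"
  shows "orthogonal n v"
proof -
  obtain \<gamma> e where g: "0 < e" "\<gamma> ` {-e<..<e::real} \<subseteq> symplectic_leaf nonzero_coords (log_canonical \<pi>) p"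
    "\<gamma> 0 = q" "(\<gamma> has_vector_derivative v) (at 0)"
    using v by (auto simp: velocities_def)
  have q: "q \<in> nonzero_coords" using g leaf_in_nonzero[OF p] by (auto simp: image_subset_iff)
  define \<kappa> where "\<kappa> = (\<Sum>a\<in>Basis. ((q \<bullet> a) * (n \<bullet> a)) *\<^sub>R a)"
  have \<kappa>a: "\<kappa> \<bullet> a = (q \<bullet> a) * (n \<bullet> a)" if "a \<in> Basis" for a
    using that by (simp add: \<kappa>_def)
  have ker: "(\<Sum>a\<in>Basis. \<pi> a b * (\<kappa> \<bullet> a)) = 0" if "b \<in> Basis" for b
    using n that by (simp add: null_space_log_canonical[OF q] \<kappa>a)
  have D: "((\<lambda>t. log_casimir \<kappa> (\<gamma> t)) has_vector_derivative (\<Sum>a\<in>Basis. (\<kappa> \<bullet> a) * ((v \<bullet> a) / (q \<bullet> a)))) (at 0)"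
    using log_casimir_derivative[of \<gamma> 0 v UNIV \<kappa>] g q by simp
  have const: "log_casimir \<kappa> (\<gamma> t) = log_casimir \<kappa> p" if "t \<in> {-e<..<e}" for t
    using log_casimir_leaf[OF ker, of "\<gamma> t" p] g(2) that by blast
  have "((\<lambda>t. log_casimir \<kappa> p) has_vector_derivative 0) (at 0)" by simp
  then have "((\<lambda>t. log_casimir \<kappa> (\<gamma> t)) has_vector_derivative 0) (at 0)"
    by (rule has_vector_derivative_transform_within_open[of _ _ _ "{-e<..<e}"]) (use g(1) const in auto)
  then have "(\<Sum>a\<in>Basis. (\<kappa> \<bullet> a) * ((v \<bullet> a) / (q \<bullet> a))) = 0"
    using D vector_derivative_unique_at by blast
  moreover have "(\<Sum>a\<in>Basis. (\<kappa> \<bullet> a) * ((v \<bullet> a) / (q \<bullet> a))) = n \<bullet> v"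
    unfolding euclidean_inner[of n v]
    by (rule sum.cong[OF refl]) (simp add: \<kappa>a nonzero_coordsD[OF q])
  ultimately show ?thesis by (simp add: orthogonal_def)
qed

text \<open>A straight line with direction \<open>r\<close> in the logarithms of the
  coordinates.\<close>

definition exp_curve :: "'a \<Rightarrow> 'a \<Rightarrow> real \<Rightarrow> 'a" where
  "exp_curve q r t = (\<Sum>b\<in>Basis. ((q \<bullet> b) * exp (t * (r \<bullet> b))) *\<^sub>R b)"

lemma exp_curve_inner: "b \<in> Basis \<Longrightarrow> exp_curve q r t \<bullet> b = (q \<bullet> b) * exp (t * (r \<bullet> b))"
  by (simp add: exp_curve_def)

lemma exp_curve_nonzero: "q \<in> nonzero_coords \<Longrightarrow> exp_curve q r t \<in> nonzero_coords"
  by (simp add: nonzero_coords_def exp_curve_inner)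

lemma exp_curve_derivative:
  "((\<lambda>s. exp_curve q r (t * s)) has_vector_derivative (\<Sum>b\<in>Basis. ((t * (r \<bullet> b)) * (exp_curve q r (t * s) \<bullet> b)) *\<^sub>R b)) (at s within A)"
proof -
  have "((\<lambda>s. (q \<bullet> b) * exp (t * s * (r \<bullet> b))) has_real_derivative (t * (r \<bullet> b)) * ((q \<bullet> b) * exp (t * s * (r \<bullet> b)))) (at s within A)" for b
    by (auto intro!: derivative_eq_intros)
  from has_vector_derivative_scaleR[OF this has_vector_derivative_const]
  have "((\<lambda>s. ((q \<bullet> b) * exp (t * s * (r \<bullet> b))) *\<^sub>R b) has_vector_derivative
     ((t * (r \<bullet> b)) * ((q \<bullet> b) * exp (t * s * (r \<bullet> b)))) *\<^sub>R b) (at s within A)" for b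
    by simp
  then have "((\<lambda>s. exp_curve q r (t * s)) has_vector_derivative (\<Sum>b\<in>Basis. ((t * (r \<bullet> b)) * ((q \<bullet> b) * exp (t * s * (r \<bullet> b)))) *\<^sub>R b)) (at s within A)"
    unfolding exp_curve_def by (intro has_vector_derivative_sum)
  then show ?thesis by (simp add: exp_curve_inner)
qed

text \<open>A Hamiltonian that is linear in the logarithms moves them with constant velocity, and
  the admissible velocities are the values of the matrix \<open>\<pi>\<close>. The factor
  \<open>t\<close> in the Hamiltonian makes the trajectory of time 1 end at parameter
  \<open>t\<close>.\<close>

lemma exp_curve_arc:
  assumes q: "q \<in> nonzero_coords"
    and r: "\<And>b. b \<in> Basis \<Longrightarrow> r \<bullet> b = (\<Sum>a\<in>Basis. \<pi> a b * (g \<bullet> a))"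
  shows "hamiltonian_arc nonzero_coords (log_canonical \<pi>) q (exp_curve q r t)"
proof -
  let ?h = "\<lambda>c. \<Sum>a\<in>Basis. (t * (g \<bullet> a)) * ln (c \<bullet> a)"
  have sm: "smooth_on nonzero_coords ?h"
    by (intro smooth_on_sum smooth_on_mult smooth_on_const smooth_on_ln smooth_on_inner_left open_nonzero_coords)
       (auto simp: nonzero_coordsD)
  have gr: "(c \<bullet> a) * (grad ?h c \<bullet> a) = t * (g \<bullet> a)" if c: "c \<in> nonzero_coords" and a: "a \<in> Basis" for c a
  proof -
    have "(?h has_derivative (\<lambda>v. \<Sum>d\<in>Basis. (t * (g \<bullet> d)) * ((v \<bullet> d) * inverse (c \<bullet> d)))) (at c)"
      by (intro has_derivative_sum has_derivative_mult_right DERIV_compose_FDERIV[OF has_real_derivative_ln_nonzero]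
          has_derivative_inner_left has_derivative_ident nonzero_coordsD[OF c])
    then have "grad ?h c \<bullet> a = (\<Sum>d\<in>Basis. (t * (g \<bullet> d)) * ((a \<bullet> d) * inverse (c \<bullet> d)))"
      by (rule grad_inner)
    also have "\<dots> = (\<Sum>d\<in>Basis. if d = a then (t * (g \<bullet> d)) * inverse (c \<bullet> d) else 0)"
      by (rule sum.cong[OF refl]) (use a in \<open>auto simp: inner_Basis\<close>)
    finally show ?thesis using a nonzero_coordsD[OF c a] by (simp add: sum.delta)
  qed
  have hf: "hamiltonian_field (log_canonical \<pi>) ?h c = (\<Sum>b\<in>Basis. ((t * (r \<bullet> b)) * (c \<bullet> b)) *\<^sub>R b)"
    if c: "c \<in> nonzero_coords" for c
  proof (rule euclidean_eqI)
    fix b :: 'a assume b: "b \<in> Basis"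
    show "hamiltonian_field (log_canonical \<pi>) ?h c \<bullet> b = (\<Sum>b\<in>Basis. ((t * (r \<bullet> b)) * (c \<bullet> b)) *\<^sub>R b) \<bullet> b"
    proof -
      have "(\<Sum>a\<in>Basis. \<pi> a b * ((c \<bullet> a) * (grad ?h c \<bullet> a))) = (\<Sum>a\<in>Basis. \<pi> a b * (t * (g \<bullet> a)))"
        by (rule sum.cong[OF refl]) (simp only: gr[OF c])
      then show ?thesis
        unfolding hamiltonian_field_component[OF b]
        using b by (simp add: r sum_distrib_left algebra_simps)
    qed
  qed
  show ?thesis
    unfolding hamiltonian_arc_def
  proof (intro exI conjI ballI)
    show "open nonzero_coords" by (rule open_nonzero_coords)
    show "smooth_on nonzero_coords ?h" by (rule sm)
    show "exp_curve q r (t * 0) = q" by (simp add: exp_curve_def euclidean_representation)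
    show "exp_curve q r (t * 1) = exp_curve q r t" by simp
    show "exp_curve q r (t * s) \<in> nonzero_coords" for s using q by (rule exp_curve_nonzero)
    show "((\<lambda>s. exp_curve q r (t * s)) has_vector_derivative hamiltonian_field (log_canonical \<pi>) ?h (exp_curve q r (t * s))) (at s within {0..1})" for s
      unfolding hf[OF exp_curve_nonzero[OF q]] by (rule exp_curve_derivative)
  qed simp
qed

text \<open>The linear map \<open>L\<close> has as range its double orthogonal complement, and by
  skewness a vector orthogonal to this range lies in the null space.\<close>

lemma range_orthogonal:
  assumes q: "q \<in> nonzero_coords" and w: "\<And>n. n \<in> null_space (log_canonical \<pi>) q \<Longrightarrow> orthogonal n w"
  shows "\<exists>g. \<forall>b\<in>Basis. w \<bullet> b = (q \<bullet> b) * (\<Sum>a\<in>Basis. \<pi> a b * (g \<bullet> a))"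
proof -
  define L where "L g = (\<Sum>b\<in>Basis. ((q \<bullet> b) * (\<Sum>a\<in>Basis. \<pi> a b * (g \<bullet> a))) *\<^sub>R b)" for g :: 'a
  have lin: "linear L"
    by (rule linearI) (auto simp: L_def inner_add_left algebra_simps sum.distrib sum_distrib_left scaleR_sum_right)
  have sub: "subspace (range L)" using linear_subspace_image[OF lin subspace_UNIV] .
  have "n \<in> null_space (log_canonical \<pi>) q" if n: "n \<in> orthogonal_comp (range L)" for n
  proof -
    have "log_canonical \<pi> q v n = 0" for v
    proof -
      define g where "g = (\<Sum>a\<in>Basis. ((q \<bullet> a) * (v \<bullet> a)) *\<^sub>R a)"
      have "log_canonical \<pi> q v n = L g \<bullet> n"
        unfolding log_canonical_component euclidean_inner[of "L g" n]
        by (rule sum.cong[OF refl]) (simp add: L_def g_def)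
      then show ?thesis using n by (auto simp: orthogonal_comp_def orthogonal_def)
    qed
    then have "log_canonical \<pi> q n v = 0" for v
      using log_canonical_skew[where \<pi>=\<pi> and c=q and v=n and w=v, OF skew] by simp
    then show ?thesis by (simp add: null_space_def)
  qed
  then have "w \<in> orthogonal_comp (orthogonal_comp (range L))"
    using w by (auto simp: orthogonal_comp_def[of "orthogonal_comp _"])
  then have "w \<in> range L" using orthogonal_comp_self[OF sub] by simp
  then obtain g where "w = L g" by blast
  then show ?thesis by (intro exI[of _ g]) (simp add: L_def)
qed

lemma orthogonal_velocity:
  assumes q: "q \<in> symplectic_leaf nonzero_coords (log_canonical \<pi>) p" and p: "p \<in> nonzero_coords"
    and w: "\<And>n. n \<in> null_space (log_canonical \<pi>) q \<Longrightarrow> orthogonal n w"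
  shows "w \<in> velocities (symplectic_leaf nonzero_coords (log_canonical \<pi>) p) q"
proof -
  have nz: "q \<in> nonzero_coords" using leaf_in_nonzero[OF p q] .
  obtain g where g: "\<forall>b\<in>Basis. w \<bullet> b = (q \<bullet> b) * (\<Sum>a\<in>Basis. \<pi> a b * (g \<bullet> a))"
    using range_orthogonal[OF nz w] by blast
  define r where "r = (\<Sum>b\<in>Basis. (\<Sum>a\<in>Basis. \<pi> a b * (g \<bullet> a)) *\<^sub>R b)"
  have r: "r \<bullet> b = (\<Sum>a\<in>Basis. \<pi> a b * (g \<bullet> a))" if "b \<in> Basis" for b
    using that by (simp add: r_def)
  have q0: "exp_curve q r 0 = q" by (simp add: exp_curve_def euclidean_representation)
  have "exp_curve q r t \<in> symplectic_leaf nonzero_coords (log_canonical \<pi>) p" for t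
    using q exp_curve_arc[OF nz r, of t] by (auto simp: symplectic_leaf_def intro: rtranclp.rtrancl_into_rtrancl)
  moreover have "smooth_on {-1<..<1} (exp_curve q r)"
    unfolding exp_curve_def
    by (intro smooth_on_sum smooth_on_scaleR smooth_on_mult smooth_on_const smooth_on_exp
        smooth_on_bounded_linear bounded_linear_ident) auto
  moreover have "(exp_curve q r has_vector_derivative w) (at 0)"
  proof -
    have "(\<Sum>b\<in>Basis. ((1 * (r \<bullet> b)) * (exp_curve q r (1 * 0) \<bullet> b)) *\<^sub>R b) = w"
      by (rule euclidean_eqI) (simp add: q0 r g mult.commute)
    then show ?thesis using exp_curve_derivative[of q r 1 0 UNIV] by simp
  qed
  ultimately show ?thesis
    unfolding velocities_def using q0 by (auto intro!: exI[of _ "exp_curve q r"] exI[of _ "1::real"])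
qed

text \<open>\<open>velocity_orthogonal\<close> and \<open>orthogonal_velocity\<close> identify the
  velocities at every point of the leaf with the orthogonal complement of the null space
  there.\<close>

theorem leaf_codimension:
  assumes p: "p \<in> nonzero_coords"
    and dim: "\<And>q. q \<in> nonzero_coords \<Longrightarrow> dim (null_space (log_canonical \<pi>) q) = k"
  shows "has_codimension (symplectic_leaf nonzero_coords (log_canonical \<pi>) p) k"
  unfolding has_codimension_def
proof
  fix q assume q: "q \<in> symplectic_leaf nonzero_coords (log_canonical \<pi>) p"
  let ?N = "null_space (log_canonical \<pi>) q"
  have "velocities (symplectic_leaf nonzero_coords (log_canonical \<pi>) p) q = {y \<in> UNIV. \<forall>x\<in>?N. orthogonal x y}"
    using velocity_orthogonal[OF p] orthogonal_velocity[OF q p] by blast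
  then show "dim (velocities (symplectic_leaf nonzero_coords (log_canonical \<pi>) p) q) + k = DIM('a)"
    using dim_subspace_orthogonal_to_vectors[OF subspace_null_space[of \<pi> q] subspace_UNIV subset_UNIV]
      dim[OF leaf_in_nonzero[OF p q]] by simp
qed

end

text \<open>By the chain rule the bracket of two composites with \<open>F\<close> is determined by
  the brackets of the components of \<open>F\<close>, so testing coordinate functions is
  enough.\<close>

theorem bracket_invariant_log_canonical:
  fixes F :: "'a::euclidean_space \<Rightarrow> 'a"
  assumes "\<And>c. c \<in> W \<Longrightarrow> F differentiable at c"
    and inv: "\<And>c d e. c \<in> W \<Longrightarrow> d \<in> Basis \<Longrightarrow> e \<in> Basis \<Longrightarrow>
      (\<Sum>a\<in>Basis. \<Sum>b\<in>Basis. \<pi> a b * log_deriv a (\<lambda>c. F c \<bullet> d) c * log_deriv b (\<lambda>c. F c \<bullet> e) c)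
      = \<pi> d e * (F c \<bullet> d) * (F c \<bullet> e)"
  shows "bracket_invariant_on (log_canonical \<pi>) W F"
  unfolding bracket_invariant_on_def
proof (intro allI impI ballI)
  fix V and f g :: "'a \<Rightarrow> real" and c assume V: "open V \<and> smooth_on V f \<and> smooth_on V g" and c: "c \<in> W" and Fc: "F c \<in> V"
  have F: "F differentiable at c" using assms(1) c .
  have f: "f differentiable at (F c)" and g: "g differentiable at (F c)"
    using V Fc smooth_on_differentiable by blast+
  have Fd: "dirderiv (\<lambda>c. F c \<bullet> d) a c = dirderiv F a c \<bullet> d" for a d
  proof -
    have "((\<lambda>c. F c \<bullet> d) has_derivative (\<lambda>v. dirderiv F v c \<bullet> d)) (at c)"
      using F by (intro has_derivative_inner_left) (simp add: frechet_derivative_works)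
    from frechet_derivative_at[OF this, symmetric] show ?thesis by simp
  qed
  have comp: "log_deriv a (f \<circ> F) c = (\<Sum>d\<in>Basis. (grad f (F c) \<bullet> d) * log_deriv a (\<lambda>c. F c \<bullet> d) c)"
    if f: "f differentiable at (F c)" for f :: "'a \<Rightarrow> real" and a
  proof -
    have "dirderiv (f \<circ> F) a c = grad f (F c) \<bullet> dirderiv F a c"
      by (simp add: frechet_derivative_compose[OF F f] grad_inner_frechet[OF f])
    also have "\<dots> = (\<Sum>d\<in>Basis. (grad f (F c) \<bullet> d) * (dirderiv F a c \<bullet> d))"
      by (rule euclidean_inner)
    finally have "dirderiv (f \<circ> F) a c = (\<Sum>d\<in>Basis. (grad f (F c) \<bullet> d) * (dirderiv F a c \<bullet> d))" .
    then show ?thesis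
      unfolding log_deriv_def Fd by (simp add: sum_distrib_left mult.left_commute)
  qed
  have d: "(f \<circ> F) differentiable at c" "(g \<circ> F) differentiable at c"
    using F f g differentiable_chain_at by blast+
  let ?G = "\<lambda>f d. grad f (F c) \<bullet> d" and ?L = "\<lambda>a d. log_deriv a (\<lambda>c. F c \<bullet> d) c"
  have "bracket (log_canonical \<pi>) (f \<circ> F) (g \<circ> F) c
      = (\<Sum>a\<in>Basis. \<Sum>b\<in>Basis. \<pi> a b * (\<Sum>d\<in>Basis. ?G f d * ?L a d) * (\<Sum>e\<in>Basis. ?G g e * ?L b e))"
    unfolding bracket_log_canonical[OF d] comp[OF f] comp[OF g] ..
  also have "\<dots> = (\<Sum>a\<in>Basis. \<Sum>b\<in>Basis. \<Sum>d\<in>Basis. \<Sum>e\<in>Basis. (?G f d * ?G g e) * (\<pi> a b * ?L a d * ?L b e))"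
    by (intro sum.cong refl) (simp add: sum_product sum_distrib_left algebra_simps)
  also have "\<dots> = (\<Sum>a\<in>Basis. \<Sum>d\<in>Basis. \<Sum>b\<in>Basis. \<Sum>e\<in>Basis. (?G f d * ?G g e) * (\<pi> a b * ?L a d * ?L b e))"
    by (rule sum.cong[OF refl], rule sum.swap)
  also have "\<dots> = (\<Sum>d\<in>Basis. \<Sum>a\<in>Basis. \<Sum>e\<in>Basis. \<Sum>b\<in>Basis. (?G f d * ?G g e) * (\<pi> a b * ?L a d * ?L b e))"
    by (subst sum.swap, rule sum.cong[OF refl], rule sum.cong[OF refl], rule sum.swap)
  also have "\<dots> = (\<Sum>d\<in>Basis. \<Sum>e\<in>Basis. \<Sum>a\<in>Basis. \<Sum>b\<in>Basis. (?G f d * ?G g e) * (\<pi> a b * ?L a d * ?L b e))"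
    by (rule sum.cong[OF refl], rule sum.swap)
  also have "\<dots> = (\<Sum>d\<in>Basis. \<Sum>e\<in>Basis. (?G f d * ?G g e) * (\<pi> d e * (F c \<bullet> d) * (F c \<bullet> e)))"
  proof (intro sum.cong refl)
    fix d e :: 'a assume "d \<in> Basis" "e \<in> Basis"
    from inv[OF c this, symmetric]
    show "(\<Sum>a\<in>Basis. \<Sum>b\<in>Basis. (?G f d * ?G g e) * (\<pi> a b * ?L a d * ?L b e))
      = (?G f d * ?G g e) * (\<pi> d e * (F c \<bullet> d) * (F c \<bullet> e))"
      by (simp only: sum_distrib_left)
  qed
  also have "\<dots> = bracket (log_canonical \<pi>) f g (F c)"
    unfolding bracket_log_canonical[OF f g] log_deriv_def
    by (simp add: grad_inner_frechet[OF f] grad_inner_frechet[OF g] algebra_simps)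
  finally show "bracket (log_canonical \<pi>) (f \<circ> F) (g \<circ> F) c = bracket (log_canonical \<pi>) f g (F c)" .
qed

section \<open>Lifts of twisted polygons\<close>

lemma mem_span1: "x \<in> span {a} \<longleftrightarrow> (\<exists>r. x = r *\<^sub>R a)"
  by (auto simp: span_singleton)

lemma mem_span2: "x \<in> span {a, b} \<longleftrightarrow> (\<exists>r s. x = r *\<^sub>R a + s *\<^sub>R b)"
  unfolding span_breakdown_eq[of x a] mem_span1 by (metis add.commute diff_eq_eq)

lemma mem_span3: "x \<in> span {a, b, c} \<longleftrightarrow> (\<exists>r s t. x = r *\<^sub>R a + s *\<^sub>R b + t *\<^sub>R c)"
  unfolding span_breakdown_eq[of x a] mem_span2 by (metis add.assoc add.commute diff_eq_eq)

lemma join_span: "join (span {a}) (span {b}) = span {a, b}"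
proof
  show "join (span {a}) (span {b}) \<subseteq> span {a, b}"
    unfolding join_def by (rule span_minimal) (auto intro: span_mono[THEN subsetD])
  show "span {a, b} \<subseteq> join (span {a}) (span {b})"
    unfolding join_def by (rule span_mono) (auto simp: span_base)
qed

lemma span_scaleR_singleton: "k \<noteq> 0 \<Longrightarrow> span {k *\<^sub>R a} = span {a}"
  by (auto simp: mem_span1) (metis scaleR_scaleR nonzero_eq_divide_eq)

lemma span_eq_scaleR:
  assumes "span {a} = span {b}" "a \<noteq> 0"
  shows "\<exists>k. k \<noteq> 0 \<and> a = k *\<^sub>R b"
proof -
  have "a \<in> span {b}" using assms(1) span_base[of a "{a}"] by simp
  then show ?thesis using assms(2) by (auto simp: mem_span1)
qed

lemma solve_scaleR:
  fixes a w :: "'a::real_vector"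
  assumes "r *\<^sub>R a + w = 0" "r \<noteq> 0"
  shows "a = (- 1 / r) *\<^sub>R w"
proof -
  have "w = - (r *\<^sub>R a)" using assms(1) by (simp add: add_eq_0_iff)
  then show ?thesis using assms(2) by simp
qed

text \<open>Independence of a family rather than of a set: \<open>independent {a, b}\<close> would
  be satisfied by equal nonzero vectors.\<close>

definition indep2 :: "'a::real_vector \<Rightarrow> 'a \<Rightarrow> bool" where
  "indep2 a b \<longleftrightarrow> (\<forall>r s. r *\<^sub>R a + s *\<^sub>R b = 0 \<longrightarrow> r = 0 \<and> s = 0)"

definition indep3 :: "'a::real_vector \<Rightarrow> 'a \<Rightarrow> 'a \<Rightarrow> bool" where
  "indep3 a b c \<longleftrightarrow> (\<forall>r s t. r *\<^sub>R a + s *\<^sub>R b + t *\<^sub>R c = 0 \<longrightarrow> r = 0 \<and> s = 0 \<and> t = 0)"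

lemma indep2D: "indep2 a b \<Longrightarrow> r *\<^sub>R a + s *\<^sub>R b = 0 \<Longrightarrow> r = 0 \<and> s = 0"
  by (simp add: indep2_def)

lemma indep3D: "indep3 a b c \<Longrightarrow> r *\<^sub>R a + s *\<^sub>R b + t *\<^sub>R c = 0 \<Longrightarrow> r = 0 \<and> s = 0 \<and> t = 0"
  by (simp add: indep3_def)

lemma indep2_eqD:
  assumes "indep2 a b" "r *\<^sub>R a + s *\<^sub>R b = r' *\<^sub>R a + s' *\<^sub>R b"
  shows "r = r'" "s = s'"
proof -
  have "(r - r') *\<^sub>R a + (s - s') *\<^sub>R b = 0" using assms(2) by (simp add: algebra_simps)
  from indep2D[OF assms(1) this] show "r = r'" "s = s'" by simp_all
qed

lemma indep3_12: "indep3 a b c \<Longrightarrow> indep2 a b"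
  unfolding indep3_def indep2_def by (metis add.right_neutral scaleR_zero_left)

lemma indep3_23: "indep3 a b c \<Longrightarrow> indep2 b c"
  unfolding indep3_def indep2_def by (metis add.left_neutral scaleR_zero_left)

lemma indep2_iff: "indep2 a b \<longleftrightarrow> a \<noteq> b \<and> independent {a, b}"
proof
  assume i: "indep2 a b"
  have "a \<notin> span {b}"
  proof
    assume "a \<in> span {b}"
    then obtain k where "a = k *\<^sub>R b" by (auto simp: mem_span1)
    then have "1 *\<^sub>R a + (- k) *\<^sub>R b = 0" by simp
    from indep2D[OF i this] show False by simp
  qed
  moreover have "b \<noteq> 0" using indep2D[OF i, of 0 1] by auto
  ultimately show "a \<noteq> b \<and> independent {a, b}"
    by (auto simp: independent_insert span_base)
next
  assume "a \<noteq> b \<and> independent {a, b}"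
  then have i: "a \<notin> span {b}" "b \<noteq> 0" by (auto simp: independent_insert split: if_splits)
  show "indep2 a b" unfolding indep2_def
  proof (intro allI impI)
    fix r s assume e: "r *\<^sub>R a + s *\<^sub>R b = 0"
    have "r = 0"
    proof (rule ccontr)
      assume "r \<noteq> 0"
      then have "a = ((- 1 / r) * s) *\<^sub>R b" using solve_scaleR[OF e] by simp
      then have "a \<in> span {b}" unfolding mem_span1 by blast
      then show False using i by simp
    qed
    then show "r = 0 \<and> s = 0" using e i by simp
  qed
qed

lemma indep3_independent:
  assumes i: "indep3 a b c"
  shows "independent {a, b, c}" "card {a, b, c} = 3"
proof -
  have "a \<notin> span {b, c}"
  proof
    assume "a \<in> span {b, c}"
    then obtain s t where "a = s *\<^sub>R b + t *\<^sub>R c" by (auto simp: mem_span2)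
    then have "1 *\<^sub>R a + (- s) *\<^sub>R b + (- t) *\<^sub>R c = 0" by simp
    from indep3D[OF i this] show False by simp
  qed
  moreover have "b \<noteq> c" "independent {b, c}" using indep3_23[OF i] by (auto simp: indep2_iff)
  moreover from calculation(1) have "a \<noteq> b" "a \<noteq> c" by (auto simp: span_base)
  ultimately show "independent {a, b, c}" "card {a, b, c} = 3" by (auto simp: independent_insert)
qed

lemma indep3_span:
  fixes a b c :: "real^3"
  assumes "indep3 a b c"
  shows "span {a, b, c} = UNIV"
proof -
  have "UNIV \<subseteq> span {a, b, c}"
    by (rule card_ge_dim_independent) (use indep3_independent[OF assms] in auto)
  then show ?thesis by blast
qed

lemma indep3_expand:
  fixes a b c :: "real^3"
  assumes "indep3 a b c"
  obtains r s t where "v = r *\<^sub>R a + s *\<^sub>R b + t *\<^sub>R c"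
proof -
  have "v \<in> span {a, b, c}" using indep3_span[OF assms] by simp
  then show ?thesis using that by (auto simp: mem_span3)
qed

lemma indep3_not_collinear:
  fixes a b c :: "real^3"
  assumes "indep3 a b c"
  shows "\<not> proj_collinear (span {a}) (span {b}) (span {c})"
proof
  assume "proj_collinear (span {a}) (span {b}) (span {c})"
  then obtain l where l: "subspace l" "dim l = 2" "span {a} \<subseteq> l" "span {b} \<subseteq> l" "span {c} \<subseteq> l"
    by (auto simp: proj_collinear_def proj_line_def)
  then have "{a, b, c} \<subseteq> l" by (auto simp: span_base subset_iff)
  then have "span {a, b, c} \<subseteq> l" using l(1) by (simp add: span_minimal)
  then have "l = UNIV" using indep3_span[OF assms] by blast
  then show False using l(2) by simp
qed

lemma not_collinear_indep3:
  fixes a b c :: "real^3"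
  assumes "\<not> proj_collinear (span {a}) (span {b}) (span {c})"
  shows "indep3 a b c"
proof (rule ccontr)
  assume n: "\<not> indep3 a b c"
  then obtain r s t where e: "r *\<^sub>R a + s *\<^sub>R b + t *\<^sub>R c = 0" "\<not> (r = 0 \<and> s = 0 \<and> t = 0)"
    by (auto simp: indep3_def)
  have "\<exists>p q. {a, b, c} \<subseteq> span {p, q}"
  proof -
    consider "r \<noteq> 0" | "s \<noteq> 0" | "t \<noteq> 0" using e(2) by blast
    then show ?thesis
    proof cases
      case 1
      have "r *\<^sub>R a + (s *\<^sub>R b + t *\<^sub>R c) = 0" using e(1) by (simp add: add_ac)
      from solve_scaleR[OF this 1] have "a = ((- 1 / r) * s) *\<^sub>R b + ((- 1 / r) * t) *\<^sub>R c"
        by (simp only: scaleR_add_right scaleR_scaleR)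
      then have "a \<in> span {b, c}" unfolding mem_span2 by blast
      then show ?thesis by (intro exI[of _ b] exI[of _ c]) (auto simp: span_base)
    next
      case 2
      have "s *\<^sub>R b + (r *\<^sub>R a + t *\<^sub>R c) = 0" using e(1) by (simp add: add_ac)
      from solve_scaleR[OF this 2] have "b = ((- 1 / s) * r) *\<^sub>R a + ((- 1 / s) * t) *\<^sub>R c"
        by (simp only: scaleR_add_right scaleR_scaleR)
      then have "b \<in> span {a, c}" unfolding mem_span2 by blast
      then show ?thesis by (intro exI[of _ a] exI[of _ c]) (auto simp: span_base)
    next
      case 3
      have "t *\<^sub>R c + (r *\<^sub>R a + s *\<^sub>R b) = 0" using e(1) by (simp add: add_ac)
      from solve_scaleR[OF this 3] have "c = ((- 1 / t) * r) *\<^sub>R a + ((- 1 / t) * s) *\<^sub>R b"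
        by (simp only: scaleR_add_right scaleR_scaleR)
      then have "c \<in> span {a, b}" unfolding mem_span2 by blast
      then show ?thesis by (intro exI[of _ a] exI[of _ b]) (auto simp: span_base)
    qed
  qed
  then obtain p q where pq: "{a, b, c} \<subseteq> span {p, q}" by blast
  \<comment> \<open>The vectors lie in a plane, so they have a common normal; its orthogonal
    hyperplane is a projective line through the three points, also when their span is smaller than a
    plane.\<close>
  have "dim {a, b, c} \<le> card {p, q}" using pq by (rule dim_le_card) simp
  also have "\<dots> \<le> 2" by (simp add: card_insert_if)
  finally have "dim {a, b, c} < DIM(real^3)" by simp
  then obtain n where n: "n \<noteq> 0" "\<And>y. y \<in> span {a, b, c} \<Longrightarrow> orthogonal n y"
    using orthogonal_to_subspace_exists by blast
  have "subspace {x. n \<bullet> x = 0}" by (rule subspace_hyperplane)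
  moreover have "dim {x. n \<bullet> x = 0} = 2" using dim_hyperplane[OF n(1)] by simp
  moreover have "span {v} \<subseteq> {x. n \<bullet> x = 0}" if "v \<in> {a, b, c}" for v
    using span_mono[of "{v}" "{a, b, c}"] that n(2) by (auto simp: orthogonal_def)
  ultimately show False using assms unfolding proj_collinear_def proj_line_def by blast
qed

lemma proj_point_span:
  assumes "proj_point p"
  obtains u where "u \<noteq> 0" "p = span {u}"
proof -
  obtain B where B: "B \<subseteq> p" "independent B" "p \<subseteq> span B" "card B = dim p"
    using basis_exists by blast
  then obtain u where u: "B = {u}" using assms by (auto simp: proj_point_def card_1_singleton_iff)
  then have "p = span {u}" using B assms by (auto simp: proj_point_def intro: span_minimal[THEN subsetD])
  moreover have "u \<noteq> 0" using B u by auto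
  ultimately show ?thesis using that by blast
qed

lemma span_proj_point: "u \<noteq> 0 \<Longrightarrow> proj_point (span {u})"
  by (simp add: proj_point_def dim_eq_card_independent)

text \<open>With homogeneous parameters on the line, an affine parameter may be infinite.\<close>

lemma cross_ratio_distinct:
  assumes "is_cross_ratio p1 p2 p3 p4 r"
  shows "p1 \<noteq> p3" "p2 \<noteq> p4"
proof -
  obtain a b t1 t2 t3 t4 where ab: "a \<noteq> b" "independent {a, b}"
    and p: "p1 = span {a + t1 *\<^sub>R b}" "p2 = span {a + t2 *\<^sub>R b}" "p3 = span {a + t3 *\<^sub>R b}" "p4 = span {a + t4 *\<^sub>R b}"
    and t: "t1 \<noteq> t3" "t2 \<noteq> t4"
    using assms unfolding is_cross_ratio_def by blast
  have i: "indep2 a b" using ab by (simp add: indep2_iff)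
  have "t = t'" if "span {a + t *\<^sub>R b} = span {a + t' *\<^sub>R b}" for t t'
  proof -
    have "a + t *\<^sub>R b \<noteq> 0" using indep2D[OF i, of 1 t] by auto
    from span_eq_scaleR[OF that this] obtain k where "a + t *\<^sub>R b = k *\<^sub>R (a + t' *\<^sub>R b)" by blast
    then have "1 *\<^sub>R a + t *\<^sub>R b = k *\<^sub>R a + (k * t') *\<^sub>R b" by (simp add: algebra_simps)
    from indep2_eqD[OF i this] show ?thesis by simp
  qed
  then show "p1 \<noteq> p3" "p2 \<noteq> p4" using p t by blast+
qed

text \<open>A point \<open>a + s b\<close> different from the four given ones is sent to infinity,
  which makes all four affine parameters finite. Their differences are 2 by 2 determinants divided
  by factors that cancel in the cross ratio.\<close>

lemma cross_ratio_intro: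
  fixes a b :: "real^3"
  assumes i: "indep2 a b"
    and nz: "\<alpha>1 \<noteq> 0 \<or> \<beta>1 \<noteq> 0" "\<alpha>2 \<noteq> 0 \<or> \<beta>2 \<noteq> 0" "\<alpha>3 \<noteq> 0 \<or> \<beta>3 \<noteq> 0" "\<alpha>4 \<noteq> 0 \<or> \<beta>4 \<noteq> 0"
    and d: "\<alpha>1 * \<beta>3 - \<alpha>3 * \<beta>1 \<noteq> 0" "\<alpha>2 * \<beta>4 - \<alpha>4 * \<beta>2 \<noteq> 0"
  shows "is_cross_ratio (span {\<alpha>1 *\<^sub>R a + \<beta>1 *\<^sub>R b}) (span {\<alpha>2 *\<^sub>R a + \<beta>2 *\<^sub>R b})
     (span {\<alpha>3 *\<^sub>R a + \<beta>3 *\<^sub>R b}) (span {\<alpha>4 *\<^sub>R a + \<beta>4 *\<^sub>R b})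
     ((\<alpha>1 * \<beta>2 - \<alpha>2 * \<beta>1) * (\<alpha>3 * \<beta>4 - \<alpha>4 * \<beta>3) / ((\<alpha>1 * \<beta>3 - \<alpha>3 * \<beta>1) * (\<alpha>2 * \<beta>4 - \<alpha>4 * \<beta>2)))"
proof -
  have "infinite (UNIV :: real set)" by (rule infinite_UNIV_char_0)
  then obtain s where "s \<notin> {\<beta>1 / \<alpha>1, \<beta>2 / \<alpha>2, \<beta>3 / \<alpha>3, \<beta>4 / \<alpha>4}"
    using ex_new_if_finite[of "{\<beta>1 / \<alpha>1, \<beta>2 / \<alpha>2, \<beta>3 / \<alpha>3, \<beta>4 / \<alpha>4}"] by auto
  \<comment> \<open>For a vanishing \<open>\<alpha>\<close> the quotient has the default value 0;
    the claim is then that the corresponding \<open>\<beta>\<close> is nonzero, which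
    \<open>nz\<close> provides.\<close>
  then have w: "\<beta>1 - \<alpha>1 * s \<noteq> 0" "\<beta>2 - \<alpha>2 * s \<noteq> 0" "\<beta>3 - \<alpha>3 * s \<noteq> 0" "\<beta>4 - \<alpha>4 * s \<noteq> 0"
    using nz by (auto simp: field_simps)
  have sp: "span {\<alpha> *\<^sub>R a + \<beta> *\<^sub>R b} = span {b + (\<alpha> / (\<beta> - \<alpha> * s)) *\<^sub>R (a + s *\<^sub>R b)}" if "\<beta> - \<alpha> * s \<noteq> 0" for \<alpha> \<beta>
  proof -
    have "(\<beta> - \<alpha> * s) *\<^sub>R (b + (\<alpha> / (\<beta> - \<alpha> * s)) *\<^sub>R (a + s *\<^sub>R b)) = (\<beta> - \<alpha> * s) *\<^sub>R b + \<alpha> *\<^sub>R (a + s *\<^sub>R b)"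
      using that by (simp only: scaleR_add_right scaleR_scaleR) simp
    also have "\<dots> = \<alpha> *\<^sub>R a + \<beta> *\<^sub>R b" by (simp add: algebra_simps)
    finally show ?thesis using span_scaleR_singleton[OF that] by metis
  qed
  have t: "\<alpha> / (\<beta> - \<alpha> * s) - \<alpha>' / (\<beta>' - \<alpha>' * s) = (\<alpha> * \<beta>' - \<alpha>' * \<beta>) / ((\<beta> - \<alpha> * s) * (\<beta>' - \<alpha>' * s))"
    if "\<beta> - \<alpha> * s \<noteq> 0" "\<beta>' - \<alpha>' * s \<noteq> 0" for \<alpha> \<beta> \<alpha>' \<beta>'
    using that by (simp add: diff_frac_eq algebra_simps)
  have i': "indep2 b (a + s *\<^sub>R b)"
    unfolding indep2_def
  proof (intro allI impI)
    fix p q assume "p *\<^sub>R b + q *\<^sub>R (a + s *\<^sub>R b) = 0"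
    then have "q *\<^sub>R a + (p + q * s) *\<^sub>R b = 0" by (simp add: algebra_simps)
    from indep2D[OF i this] show "p = 0 \<and> q = 0" by auto
  qed
  show ?thesis
    unfolding is_cross_ratio_def
  proof (intro exI conjI)
    show "b \<noteq> a + s *\<^sub>R b" "independent {b, a + s *\<^sub>R b}" using i' by (auto simp: indep2_iff)
    show "\<alpha>1 / (\<beta>1 - \<alpha>1 * s) \<noteq> \<alpha>3 / (\<beta>3 - \<alpha>3 * s)" using t[OF w(1) w(3)] d(1) w by auto
    show "\<alpha>2 / (\<beta>2 - \<alpha>2 * s) \<noteq> \<alpha>4 / (\<beta>4 - \<alpha>4 * s)" using t[OF w(2) w(4)] d(2) w by auto
    show "(\<alpha>1 * \<beta>2 - \<alpha>2 * \<beta>1) * (\<alpha>3 * \<beta>4 - \<alpha>4 * \<beta>3) / ((\<alpha>1 * \<beta>3 - \<alpha>3 * \<beta>1) * (\<alpha>2 * \<beta>4 - \<alpha>4 * \<beta>2))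
      = (\<alpha>1 / (\<beta>1 - \<alpha>1 * s) - \<alpha>2 / (\<beta>2 - \<alpha>2 * s)) * (\<alpha>3 / (\<beta>3 - \<alpha>3 * s) - \<alpha>4 / (\<beta>4 - \<alpha>4 * s)) /
        ((\<alpha>1 / (\<beta>1 - \<alpha>1 * s) - \<alpha>3 / (\<beta>3 - \<alpha>3 * s)) * (\<alpha>2 / (\<beta>2 - \<alpha>2 * s) - \<alpha>4 / (\<beta>4 - \<alpha>4 * s)))"
      unfolding t[OF w(1) w(2)] t[OF w(3) w(4)] t[OF w(1) w(3)] t[OF w(2) w(4)]
      using w by (simp add: ac_simps)
  qed (use sp w in blast)+
qed

text \<open>Passing to another parametrization multiplies each difference of parameters by the
  determinant of the base change, up to one scale factor for each point. All of these
  cancel.\<close>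

lemma cross_ratio_unique:
  assumes "is_cross_ratio p1 p2 p3 p4 r" "is_cross_ratio p1 p2 p3 p4 r'"
  shows "r = r'"
proof -
  obtain a b t1 t2 t3 t4 where ab: "a \<noteq> b" "independent {a, b}"
    and p: "p1 = span {a + t1 *\<^sub>R b}" "p2 = span {a + t2 *\<^sub>R b}" "p3 = span {a + t3 *\<^sub>R b}" "p4 = span {a + t4 *\<^sub>R b}"
    and t: "t1 \<noteq> t3" "t2 \<noteq> t4" and r: "r = ((t1 - t2) * (t3 - t4)) / ((t1 - t3) * (t2 - t4))"
    using assms(1) unfolding is_cross_ratio_def by blast
  obtain a' b' s1 s2 s3 s4 where ab': "a' \<noteq> b'" "independent {a', b'}"
    and p': "p1 = span {a' + s1 *\<^sub>R b'}" "p2 = span {a' + s2 *\<^sub>R b'}" "p3 = span {a' + s3 *\<^sub>R b'}" "p4 = span {a' + s4 *\<^sub>R b'}"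
    and s: "s1 \<noteq> s3" "s2 \<noteq> s4" and r': "r' = ((s1 - s2) * (s3 - s4)) / ((s1 - s3) * (s2 - s4))"
    using assms(2) unfolding is_cross_ratio_def by blast
  have i: "indep2 a b" and i': "indep2 a' b'" using ab ab' by (simp_all add: indep2_iff)
  have ex: "\<exists>k. k \<noteq> 0 \<and> a' + s *\<^sub>R b' = k *\<^sub>R (a + t *\<^sub>R b)" if "span {a + t *\<^sub>R b} = span {a' + s *\<^sub>R b'}" for s t
  proof (rule span_eq_scaleR)
    show "a' + s *\<^sub>R b' \<noteq> 0" using indep2D[OF i', of 1 s] by auto
  qed (use that in simp)
  obtain k1 k2 k3 k4 where k0: "k1 \<noteq> 0" "k2 \<noteq> 0" "k3 \<noteq> 0" "k4 \<noteq> 0" and k: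
    "a' + s1 *\<^sub>R b' = k1 *\<^sub>R (a + t1 *\<^sub>R b)" "a' + s2 *\<^sub>R b' = k2 *\<^sub>R (a + t2 *\<^sub>R b)"
    "a' + s3 *\<^sub>R b' = k3 *\<^sub>R (a + t3 *\<^sub>R b)" "a' + s4 *\<^sub>R b' = k4 *\<^sub>R (a + t4 *\<^sub>R b)"
    using ex[of t1 s1] ex[of t2 s2] ex[of t3 s3] ex[of t4 s4] p p' by metis
  \<comment> \<open>The first and third points are distinct, so they express \<open>b'\<close>, and
    then \<open>a'\<close>, through \<open>a\<close> and \<open>b\<close>.\<close>
  define f where "f = 1 / (s3 - s1)"
  have "(s3 - s1) *\<^sub>R b' = k3 *\<^sub>R (a + t3 *\<^sub>R b) - k1 *\<^sub>R (a + t1 *\<^sub>R b)"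
    unfolding k(1,3)[symmetric] by (simp add: algebra_simps)
  then have "f *\<^sub>R ((s3 - s1) *\<^sub>R b') = f *\<^sub>R (k3 *\<^sub>R (a + t3 *\<^sub>R b) - k1 *\<^sub>R (a + t1 *\<^sub>R b))" by simp
  then have "b' = f *\<^sub>R (k3 *\<^sub>R (a + t3 *\<^sub>R b) - k1 *\<^sub>R (a + t1 *\<^sub>R b))" using s(1) by (simp add: f_def)
  then have "b' = (f * (k3 - k1)) *\<^sub>R a + (f * (k3 * t3 - k1 * t1)) *\<^sub>R b" by (simp add: algebra_simps)
  then obtain p' q' where b': "b' = p' *\<^sub>R a + q' *\<^sub>R b" by blast
  have "a' = k1 *\<^sub>R (a + t1 *\<^sub>R b) - s1 *\<^sub>R b'" using k(1) by (simp add: algebra_simps)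
  then have "a' = (k1 - s1 * p') *\<^sub>R a + (k1 * t1 - s1 * q') *\<^sub>R b" by (simp add: b' algebra_simps)
  then obtain p q where a': "a' = p *\<^sub>R a + q *\<^sub>R b" by blast
  have co: "k = p + s * p' \<and> k * t = q + s * q'" if "a' + s *\<^sub>R b' = k *\<^sub>R (a + t *\<^sub>R b)" for s k t
  proof -
    have "(p + s * p') *\<^sub>R a + (q + s * q') *\<^sub>R b = k *\<^sub>R a + (k * t) *\<^sub>R b"
      using that unfolding a' b' by (simp add: algebra_simps)
    from indep2_eqD[OF i this] show ?thesis by simp
  qed
  note c = co[OF k(1)] co[OF k(2)] co[OF k(3)] co[OF k(4)]
  have D: "k * k' * (t - t') = (s - s') * (p * q' - q * p')"
    if "k = p + s * p' \<and> k * t = q + s * q'" "k' = p + s' * p' \<and> k' * t' = q + s' * q'" for k k' t t' s s'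
  proof -
    have "k * k' * (t - t') = k' * (k * t) - k * (k' * t')" by (simp add: algebra_simps)
    also have "\<dots> = k' * (q + s * q') - k * (q + s' * q')" using that by metis
    also have "\<dots> = (p + s' * p') * (q + s * q') - (p + s * p') * (q + s' * q')" using that by metis
    finally show ?thesis by (simp add: algebra_simps)
  qed
  let ?d = "p * q' - q * p'"
  have d0: "?d \<noteq> 0" using D[OF c(1) c(3)] k0 t by auto
  have "r = (k1 * k2 * (t1 - t2) * (k3 * k4 * (t3 - t4))) / (k1 * k3 * (t1 - t3) * (k2 * k4 * (t2 - t4)))"
    unfolding r using k0 by simp
  also have "\<dots> = ((s1 - s2) * ?d * ((s3 - s4) * ?d)) / ((s1 - s3) * ?d * ((s2 - s4) * ?d))"
    unfolding D[OF c(1) c(2)] D[OF c(3) c(4)] D[OF c(1) c(3)] D[OF c(2) c(4)] ..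
  also have "\<dots> = r'" unfolding r' using d0 by simp
  finally show ?thesis .
qed

text \<open>The relation for \<open>D\<close> exhibits \<open>D - \<delta> C\<close> as a vector of
  the first plane; independence leaves no other common vectors.\<close>

lemma span_Int_adjacent:
  assumes i: "indep3 A B C" and D: "D = \<delta> *\<^sub>R C + \<beta> *\<^sub>R B + \<gamma> *\<^sub>R A"
  shows "span {A, B} \<inter> span {C, D} = span {\<beta> *\<^sub>R B + \<gamma> *\<^sub>R A}"
proof
  show "span {\<beta> *\<^sub>R B + \<gamma> *\<^sub>R A} \<subseteq> span {A, B} \<inter> span {C, D}"
  proof (rule span_minimal)
    have "\<beta> *\<^sub>R B + \<gamma> *\<^sub>R A = \<gamma> *\<^sub>R A + \<beta> *\<^sub>R B" by simp
    then have "\<beta> *\<^sub>R B + \<gamma> *\<^sub>R A \<in> span {A, B}" unfolding mem_span2 by blast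
    moreover have "\<beta> *\<^sub>R B + \<gamma> *\<^sub>R A = (- \<delta>) *\<^sub>R C + 1 *\<^sub>R D" by (simp add: D)
    then have "\<beta> *\<^sub>R B + \<gamma> *\<^sub>R A \<in> span {C, D}" unfolding mem_span2 by blast
    ultimately show "{\<beta> *\<^sub>R B + \<gamma> *\<^sub>R A} \<subseteq> span {A, B} \<inter> span {C, D}" by simp
  qed (simp add: subspace_inter)
  show "span {A, B} \<inter> span {C, D} \<subseteq> span {\<beta> *\<^sub>R B + \<gamma> *\<^sub>R A}"
  proof
    fix x assume "x \<in> span {A, B} \<inter> span {C, D}"
    then have "x \<in> span {A, B}" "x \<in> span {C, D}" by simp_all
    then obtain p q s t where x: "x = p *\<^sub>R A + q *\<^sub>R B" "x = s *\<^sub>R C + t *\<^sub>R D"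
      unfolding mem_span2 by blast
    then have "(p - t * \<gamma>) *\<^sub>R A + (q - t * \<beta>) *\<^sub>R B + (- (s + t * \<delta>)) *\<^sub>R C = 0"
      by (simp add: D algebra_simps)
    from indep3D[OF i this] have "p = t * \<gamma>" "q = t * \<beta>" by simp_all
    then have "x = t *\<^sub>R (\<beta> *\<^sub>R B + \<gamma> *\<^sub>R A)" using x(1) by (simp add: algebra_simps)
    then show "x \<in> span {\<beta> *\<^sub>R B + \<gamma> *\<^sub>R A}" by (auto simp: mem_span1)
  qed
qed

text \<open>The common vector is given in the bases of both lines: the form in \<open>A\<close>,
  \<open>B\<close> is used for the cross ratio \<open>x\<close>, the form in \<open>D\<close>,
  \<open>E\<close> for \<open>y\<close>.\<close>

lemma span_Int_skip:
  assumes i: "indep3 A B C" and D: "D = C + \<beta> *\<^sub>R B + \<gamma> *\<^sub>R A"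
    and E: "E = D + \<beta>' *\<^sub>R C + \<gamma>' *\<^sub>R B" and nz: "\<beta>' \<noteq> 0"
  shows "span {A, B} \<inter> span {D, E} = span {(\<beta>' + 1) *\<^sub>R D - E}"
    and "(\<beta>' + 1) *\<^sub>R D - E = (\<beta>' * \<gamma>) *\<^sub>R A + (\<beta>' * \<beta> - \<gamma>') *\<^sub>R B"
proof -
  show eq: "(\<beta>' + 1) *\<^sub>R D - E = (\<beta>' * \<gamma>) *\<^sub>R A + (\<beta>' * \<beta> - \<gamma>') *\<^sub>R B"
    by (simp add: E D algebra_simps)
  show "span {A, B} \<inter> span {D, E} = span {(\<beta>' + 1) *\<^sub>R D - E}"
  proof
    show "span {(\<beta>' + 1) *\<^sub>R D - E} \<subseteq> span {A, B} \<inter> span {D, E}"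
    proof (rule span_minimal)
      have "(\<beta>' + 1) *\<^sub>R D - E = (\<beta>' + 1) *\<^sub>R D + (-1) *\<^sub>R E" by simp
      then have "(\<beta>' + 1) *\<^sub>R D - E \<in> span {D, E}" unfolding mem_span2 by blast
      moreover have "(\<beta>' + 1) *\<^sub>R D - E \<in> span {A, B}" unfolding mem_span2 eq by blast
      ultimately show "{(\<beta>' + 1) *\<^sub>R D - E} \<subseteq> span {A, B} \<inter> span {D, E}" by simp
    qed (simp add: subspace_inter)
    show "span {A, B} \<inter> span {D, E} \<subseteq> span {(\<beta>' + 1) *\<^sub>R D - E}"
    proof
      fix x assume "x \<in> span {A, B} \<inter> span {D, E}"
      then have "x \<in> span {A, B}" "x \<in> span {D, E}" by simp_all
      then obtain p q s t where x: "x = p *\<^sub>R A + q *\<^sub>R B" "x = s *\<^sub>R D + t *\<^sub>R E"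
        unfolding mem_span2 by blast
      then have "(p - (s + t) * \<gamma>) *\<^sub>R A + (q - (s + t) * \<beta> - t * \<gamma>') *\<^sub>R B + (- (s + t + t * \<beta>')) *\<^sub>R C = 0"
        by (simp add: D E algebra_simps)
      from indep3D[OF i this] have "s + t + t * \<beta>' = 0" by simp
      then have s: "s = - t * (\<beta>' + 1)" by (simp add: algebra_simps)
      have "x = (- t) *\<^sub>R ((\<beta>' + 1) *\<^sub>R D - E)" unfolding x(2) s by (simp add: algebra_simps)
      then show "x \<in> span {(\<beta>' + 1) *\<^sub>R D - E}" unfolding mem_span1 by blast
    qed
  qed
qed

section \<open>Lifts with leading coefficient 1\<close>

definition normalized_lift :: "(int \<Rightarrow> real) \<Rightarrow> (int \<Rightarrow> real) \<Rightarrow> (int \<Rightarrow> real^3) \<Rightarrow> bool" where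
  "normalized_lift \<beta> \<gamma> V \<longleftrightarrow> (\<forall>i. indep3 (V i) (V (i + 1)) (V (i + 2))) \<and>
     (\<forall>i. V (i + 3) = V (i + 2) + \<beta> i *\<^sub>R V (i + 1) + \<gamma> i *\<^sub>R V i)"

text \<open>The source of the recursion: read as equations for the corner invariants, these values
  give \<open>\<beta> i = - y (i + 1)\<close> and
  \<open>\<gamma> i = x (i + 1) * y (i + 1) * y i\<close>.\<close>

lemma lift_cross_ratios:
  assumes V: "normalized_lift \<beta> \<gamma> V" and nz: "\<And>i. \<beta> i \<noteq> 0" "\<And>i. \<gamma> i \<noteq> 0"
  defines "v \<equiv> \<lambda>i. span {V i}"
  shows "is_cross_ratio (v (i - 2)) (v (i - 1)) (join (v (i - 2)) (v (i - 1)) \<inter> join (v i) (v (i + 1)))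
      (join (v (i - 2)) (v (i - 1)) \<inter> join (v (i + 1)) (v (i + 2))) (\<gamma> (i - 1) / (\<beta> (i - 1) * \<beta> (i - 2)))"
    and "is_cross_ratio (join (v (i - 2)) (v (i - 1)) \<inter> join (v (i + 1)) (v (i + 2)))
      (join (v (i - 1)) (v i) \<inter> join (v (i + 1)) (v (i + 2))) (v (i + 1)) (v (i + 2)) (- \<beta> (i - 1))"
proof -
  have ind: "indep3 (V (i - 2)) (V (i - 1)) (V i)" "indep3 (V (i - 1)) (V i) (V (i + 1))" "indep3 (V i) (V (i + 1)) (V (i + 2))"
    using V[unfolded normalized_lift_def, THEN conjunct1, rule_format, of "i - 2"]
      V[unfolded normalized_lift_def, THEN conjunct1, rule_format, of "i - 1"]
      V[unfolded normalized_lift_def, THEN conjunct1, rule_format, of i]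
    by (simp_all add: algebra_simps)
  have D: "V (i + 1) = V i + \<beta> (i - 2) *\<^sub>R V (i - 1) + \<gamma> (i - 2) *\<^sub>R V (i - 2)"
    and E: "V (i + 2) = V (i + 1) + \<beta> (i - 1) *\<^sub>R V i + \<gamma> (i - 1) *\<^sub>R V (i - 1)"
    using V[unfolded normalized_lift_def, THEN conjunct2, rule_format, of "i - 2"]
      V[unfolded normalized_lift_def, THEN conjunct2, rule_format, of "i - 1"]
    by (simp_all add: algebra_simps)
  have P: "join (v (i - 2)) (v (i - 1)) \<inter> join (v i) (v (i + 1)) = span {\<gamma> (i - 2) *\<^sub>R V (i - 2) + \<beta> (i - 2) *\<^sub>R V (i - 1)}"
    using span_Int_adjacent[OF ind(1), of "V (i + 1)" 1 "\<beta> (i - 2)" "\<gamma> (i - 2)"] D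
    by (simp add: v_def join_span add.commute)
  note S = span_Int_skip[OF ind(1) D E nz(1)]
  have Q: "join (v (i - 2)) (v (i - 1)) \<inter> join (v (i + 1)) (v (i + 2)) =
      span {(\<beta> (i - 1) * \<gamma> (i - 2)) *\<^sub>R V (i - 2) + (\<beta> (i - 1) * \<beta> (i - 2) - \<gamma> (i - 1)) *\<^sub>R V (i - 1)}"
    using S(1) unfolding S(2) by (simp add: v_def join_span)
  have Q': "join (v (i - 2)) (v (i - 1)) \<inter> join (v (i + 1)) (v (i + 2)) =
      span {(-1) *\<^sub>R V (i + 2) + (\<beta> (i - 1) + 1) *\<^sub>R V (i + 1)}"
    using S(1) by (simp add: v_def join_span)
  have R: "join (v (i - 1)) (v i) \<inter> join (v (i + 1)) (v (i + 2)) = span {1 *\<^sub>R V (i + 2) + (-1) *\<^sub>R V (i + 1)}"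
  proof -
    have "join (v (i - 1)) (v i) \<inter> join (v (i + 1)) (v (i + 2)) = span {\<beta> (i - 1) *\<^sub>R V i + \<gamma> (i - 1) *\<^sub>R V (i - 1)}"
      using span_Int_adjacent[OF ind(2), of "V (i + 2)" 1 "\<beta> (i - 1)" "\<gamma> (i - 1)"] E by (simp add: v_def join_span)
    moreover have "\<beta> (i - 1) *\<^sub>R V i + \<gamma> (i - 1) *\<^sub>R V (i - 1) = 1 *\<^sub>R V (i + 2) + (-1) *\<^sub>R V (i + 1)"
      using E by simp
    ultimately show ?thesis by metis
  qed
  have "v (i - 2) = span {1 *\<^sub>R V (i - 2) + 0 *\<^sub>R V (i - 1)}" "v (i - 1) = span {0 *\<^sub>R V (i - 2) + 1 *\<^sub>R V (i - 1)}"
    by (simp_all add: v_def)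
  then show "is_cross_ratio (v (i - 2)) (v (i - 1)) (join (v (i - 2)) (v (i - 1)) \<inter> join (v i) (v (i + 1)))
      (join (v (i - 2)) (v (i - 1)) \<inter> join (v (i + 1)) (v (i + 2))) (\<gamma> (i - 1) / (\<beta> (i - 1) * \<beta> (i - 2)))"
    unfolding P Q
    using cross_ratio_intro[OF indep3_12[OF ind(1)], of 1 0 0 1 "\<gamma> (i - 2)" "\<beta> (i - 2)" "\<beta> (i - 1) * \<gamma> (i - 2)" "\<beta> (i - 1) * \<beta> (i - 2) - \<gamma> (i - 1)"]
      nz by (simp add: algebra_simps)
  have "indep2 (V (i + 2)) (V (i + 1))"
    using indep3_23[OF ind(3)] unfolding indep2_def by (metis add.commute)
  moreover have "v (i + 1) = span {0 *\<^sub>R V (i + 2) + 1 *\<^sub>R V (i + 1)}" "v (i + 2) = span {1 *\<^sub>R V (i + 2) + 0 *\<^sub>R V (i + 1)}"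
    by (simp_all add: v_def)
  ultimately show "is_cross_ratio (join (v (i - 2)) (v (i - 1)) \<inter> join (v (i + 1)) (v (i + 2)))
      (join (v (i - 1)) (v i) \<inter> join (v (i + 1)) (v (i + 2))) (v (i + 1)) (v (i + 2)) (- \<beta> (i - 1))"
    unfolding Q' R
    using cross_ratio_intro[of "V (i + 2)" "V (i + 1)" "-1" "\<beta> (i - 1) + 1" 1 "-1" 0 1 1 0] by simp
qed

lemma int_recursion:
  fixes g :: "int \<Rightarrow> 'a \<Rightarrow> 'a"
  assumes "\<And>i. bij (g i)"
  obtains s where "s 0 = s0" "\<And>i. s (i + 1) = g i (s i)"
proof -
  define f where "f = rec_nat s0 (\<lambda>n. g (int n))"
  \<comment> \<open>The negative side undoes the step with index \<open>- n - 1\<close>, which leads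
    from position \<open>- n - 1\<close> to \<open>- n\<close>.\<close>
  define h where "h = rec_nat s0 (\<lambda>n. inv_into UNIV (g (- int n - 1)))"
  define s where "s i = (if i \<ge> 0 then f (nat i) else h (nat (- i)))" for i
  have f: "f 0 = s0" "f (Suc n) = g (int n) (f n)" for n by (simp_all add: f_def)
  have h: "h 0 = s0" "h (Suc n) = inv_into UNIV (g (- int n - 1)) (h n)" for n by (simp_all add: h_def)
  have "s (i + 1) = g i (s i)" for i
  proof (cases "i \<ge> 0")
    case True
    then show ?thesis by (simp add: s_def nat_add_distrib f)
  next
    case False
    define n where "n = nat (- i - 1)"
    have n: "- i = int (Suc n)" using False by (simp add: n_def)
    have i: "i + 1 = - int n" using n by simp
    have "s (i + 1) = h n" unfolding i by (cases "n = 0") (simp_all add: s_def f(1) h(1))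
    moreover have "s i = inv_into UNIV (g i) (h n)"
    proof -
      have "nat (- i) = Suc n" "- int n - 1 = i" using n by auto
      then show ?thesis using False h(2)[of n] by (simp add: s_def)
    qed
    ultimately show ?thesis using assms[of i] by (simp add: bij_is_surj surj_f_inv_f)
  qed
  then show ?thesis using that[of s] by (simp add: s_def f)
qed

lemma lift_indep: "normalized_lift \<beta> \<gamma> V \<Longrightarrow> indep3 (V i) (V (i + 1)) (V (i + 2))"
  by (simp add: normalized_lift_def)

lemma lift_step: "normalized_lift \<beta> \<gamma> V \<Longrightarrow> V (i + 3) = V (i + 2) + \<beta> i *\<^sub>R V (i + 1) + \<gamma> i *\<^sub>R V i"
  by (simp add: normalized_lift_def)

lemma indep3_step:
  fixes A B C :: "'a::real_vector"
  assumes "\<gamma> \<noteq> 0"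
  shows "indep3 B C (\<alpha> *\<^sub>R C + \<beta> *\<^sub>R B + \<gamma> *\<^sub>R A) \<longleftrightarrow> indep3 A B C"
proof
  assume i: "indep3 A B C"
  show "indep3 B C (\<alpha> *\<^sub>R C + \<beta> *\<^sub>R B + \<gamma> *\<^sub>R A)"
    unfolding indep3_def
  proof (intro allI impI)
    fix r s t assume "r *\<^sub>R B + s *\<^sub>R C + t *\<^sub>R (\<alpha> *\<^sub>R C + \<beta> *\<^sub>R B + \<gamma> *\<^sub>R A) = 0"
    then have "(t * \<gamma>) *\<^sub>R A + (r + t * \<beta>) *\<^sub>R B + (s + t * \<alpha>) *\<^sub>R C = 0" by (simp add: algebra_simps)
    from indep3D[OF i this] show "r = 0 \<and> s = 0 \<and> t = 0" using assms by auto
  qed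
next
  assume i: "indep3 B C (\<alpha> *\<^sub>R C + \<beta> *\<^sub>R B + \<gamma> *\<^sub>R A)"
  show "indep3 A B C"
    unfolding indep3_def
  proof (intro allI impI)
    fix r s t assume e: "r *\<^sub>R A + s *\<^sub>R B + t *\<^sub>R C = 0"
    have "(s - r / \<gamma> * \<beta>) *\<^sub>R B + (t - r / \<gamma> * \<alpha>) *\<^sub>R C + (r / \<gamma>) *\<^sub>R (\<alpha> *\<^sub>R C + \<beta> *\<^sub>R B + \<gamma> *\<^sub>R A) = r *\<^sub>R A + s *\<^sub>R B + t *\<^sub>R C"
      using assms by (simp add: algebra_simps)
    from indep3D[OF i this[unfolded e]] show "r = 0 \<and> s = 0 \<and> t = 0" using assms by auto
  qed
qed

text \<open>The recursion is run both ways from the standard basis, the backward step dividing by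
  \<open>\<gamma> i\<close>. By \<open>indep3_step\<close> independence of three consecutive vectors
  also passes in both directions.\<close>

lemma lift_exists:
  assumes nz: "\<And>i. \<gamma> i \<noteq> 0"
  shows "\<exists>V. normalized_lift \<beta> \<gamma> V"
proof -
  define g :: "int \<Rightarrow> (real^3) \<times> (real^3) \<times> (real^3) \<Rightarrow> (real^3) \<times> (real^3) \<times> (real^3)"
    where "g i = (\<lambda>(A, B, C). (B, C, C + \<beta> i *\<^sub>R B + \<gamma> i *\<^sub>R A))" for i
  define h :: "int \<Rightarrow> (real^3) \<times> (real^3) \<times> (real^3) \<Rightarrow> (real^3) \<times> (real^3) \<times> (real^3)"
    where "h i = (\<lambda>(B, C, D). ((1 / \<gamma> i) *\<^sub>R (D - C - \<beta> i *\<^sub>R B), B, C))" for i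
  have "bij (g i)" for i
    by (rule o_bij[of "h i"]) (use nz[of i] in \<open>auto simp: g_def h_def fun_eq_iff\<close>)
  then obtain s where s: "s 0 = (axis 1 1, axis 2 1, axis 3 1)" "\<And>i. s (i + 1) = g i (s i)"
    using int_recursion[of g "(axis 1 1, axis 2 1, axis 3 1)"] by metis
  define V where "V i = fst (s i)" for i
  have V1: "V (i + 1) = fst (snd (s i))" and V2: "fst (snd (s (i + 1))) = snd (snd (s i))" for i
    using s(2)[of i] by (auto simp: V_def g_def split: prod.splits)
  have V3: "V (i + 2) = snd (snd (s i))" for i
    using V1[of "i + 1"] V2[of i] by (simp add: add.assoc)
  have step: "V (i + 3) = V (i + 2) + \<beta> i *\<^sub>R V (i + 1) + \<gamma> i *\<^sub>R V i" for i
  proof -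
    have "V (i + 3) = snd (snd (s (i + 1)))" using V3[of "i + 1"] by (simp add: add.assoc)
    also have "\<dots> = V (i + 2) + \<beta> i *\<^sub>R V (i + 1) + \<gamma> i *\<^sub>R V i"
      unfolding s(2) V1 V3 by (auto simp: g_def V_def split: prod.splits)
    finally show ?thesis .
  qed
  have "V 0 = axis 1 1" by (simp add: V_def s(1))
  moreover have "V 1 = axis 2 1" using V1[of 0] by (simp add: s(1))
  moreover have "V 2 = axis 3 1" using V3[of 0] by (simp add: s(1))
  ultimately have base: "indep3 (V 0) (V (0 + 1)) (V (0 + 2))"
    by (auto simp: indep3_def vec_eq_iff axis_def forall_3)
  have ind: "indep3 (V i) (V (i + 1)) (V (i + 2)) \<longleftrightarrow> indep3 (V (i + 1)) (V (i + 2)) (V (i + 3))" for i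
    using indep3_step[OF nz[of i], of "V (i + 1)" "V (i + 2)" 1 "\<beta> i" "V i"] by (simp add: step)
  have "indep3 (V i) (V (i + 1)) (V (i + 2))" for i
  proof (induction i rule: int_induct[where k=0])
    case (step1 i)
    then show ?case using ind[of i] by (simp add: add.assoc)
  next
    case (step2 i)
    then show ?case using ind[of "i - 1"] by (simp add: algebra_simps)
  qed (rule base)
  then show ?thesis using step by (auto simp: normalized_lift_def)
qed

lemma lift_unique:
  assumes V: "normalized_lift \<beta> \<gamma> V" and V': "normalized_lift \<beta> \<gamma> V'" and nz: "\<And>i. \<gamma> i \<noteq> 0"
  shows "\<exists>f. invertible_linear f \<and> (\<forall>i. V' i = f (V i))"
proof -
  have i: "indep3 (V 0) (V 1) (V 2)" and i': "indep3 (V' 0) (V' 1) (V' 2)"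
    using lift_indep[OF V, of 0] lift_indep[OF V', of 0] by simp_all
  note ind = indep3_independent[OF i]
  have ne: "V 0 \<noteq> V 1" "V 0 \<noteq> V 2" "V 1 \<noteq> V 2" using ind(2) by (auto simp: card_insert_if split: if_splits)
  obtain f where f: "linear f" "\<forall>x\<in>{V 0, V 1, V 2}. f x = (if x = V 0 then V' 0 else if x = V 1 then V' 1 else V' 2)"
    using linear_independent_extend[OF ind(1), of "\<lambda>x. if x = V 0 then V' 0 else if x = V 1 then V' 1 else V' 2"] by blast
  then have f0: "f (V 0) = V' 0" "f (V 1) = V' 1" "f (V 2) = V' 2" using ne by auto
  have "x = 0" if "f x = 0" for x
  proof -
    obtain r s t where x: "x = r *\<^sub>R V 0 + s *\<^sub>R V 1 + t *\<^sub>R V 2" using indep3_expand[OF i] by blast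
    have "r *\<^sub>R V' 0 + s *\<^sub>R V' 1 + t *\<^sub>R V' 2 = 0"
      using that unfolding x linear_add[OF f(1)] linear_cmul[OF f(1)] f0 .
    from indep3D[OF i' this] show ?thesis by (simp add: x)
  qed
  then have "inj f" using linear_injective_0[OF f(1)] by blast
  then have "bij f" using linear_injective_imp_surjective[OF f(1)] by (simp add: bij_def)
  have "V' i = f (V i) \<and> V' (i + 1) = f (V (i + 1)) \<and> V' (i + 2) = f (V (i + 2))" for i
  proof (induction i rule: int_induct[where k=0])
    case base
    then show ?case using f0 by simp
  next
    case (step1 i)
    then have "V' (i + 3) = f (V (i + 3))"
      unfolding lift_step[OF V] lift_step[OF V'] linear_add[OF f(1)] linear_cmul[OF f(1)] by simp
    then show ?case using step1 by (simp add: add.assoc)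
  next
    case (step2 i)
    have e: "\<gamma> (i - 1) *\<^sub>R V (i - 1) = V (i + 2) - V (i + 1) - \<beta> (i - 1) *\<^sub>R V i"
      "\<gamma> (i - 1) *\<^sub>R V' (i - 1) = V' (i + 2) - V' (i + 1) - \<beta> (i - 1) *\<^sub>R V' i"
      using lift_step[OF V, of "i - 1"] lift_step[OF V', of "i - 1"] by (simp_all add: algebra_simps)
    have "\<gamma> (i - 1) *\<^sub>R V' (i - 1) = f (\<gamma> (i - 1) *\<^sub>R V (i - 1))"
      unfolding e linear_diff[OF f(1)] linear_cmul[OF f(1)] using step2 by simp
    also have "\<dots> = \<gamma> (i - 1) *\<^sub>R f (V (i - 1))" by (rule linear_cmul[OF f(1)])
    finally have "V' (i - 1) = f (V (i - 1))" using nz[of "i - 1"] by simp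
    then show ?case using step2 by (simp add: algebra_simps)
  qed
  then show ?thesis using f(1) \<open>bij f\<close> by (auto simp: invertible_linear_def)
qed

lemma lift_image:
  assumes V: "normalized_lift \<beta> \<gamma> V" and f: "invertible_linear f"
  shows "normalized_lift \<beta> \<gamma> (\<lambda>i. f (V i))"
proof -
  have lin: "linear f" and inj: "inj f" using f by (auto simp: invertible_linear_def bij_is_inj)
  have "indep3 (f (V i)) (f (V (i + 1))) (f (V (i + 2)))" for i
    unfolding indep3_def
  proof (intro allI impI)
    fix r s t assume "r *\<^sub>R f (V i) + s *\<^sub>R f (V (i + 1)) + t *\<^sub>R f (V (i + 2)) = 0"
    then have "f (r *\<^sub>R V i + s *\<^sub>R V (i + 1) + t *\<^sub>R V (i + 2)) = 0"
      by (simp only: linear_add[OF lin] linear_cmul[OF lin])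
    then have "r *\<^sub>R V i + s *\<^sub>R V (i + 1) + t *\<^sub>R V (i + 2) = 0"
      using linear_injective_0[OF lin] inj by blast
    then show "r = 0 \<and> s = 0 \<and> t = 0" using indep3D[OF lift_indep[OF V]] by blast
  qed
  moreover have "f (V (i + 3)) = f (V (i + 2)) + \<beta> i *\<^sub>R f (V (i + 1)) + \<gamma> i *\<^sub>R f (V i)" for i
    by (simp only: lift_step[OF V] linear_add[OF lin] linear_cmul[OF lin])
  ultimately show ?thesis by (simp add: normalized_lift_def)
qed

lemma invertible_image_span: "invertible_linear f \<Longrightarrow> f ` span {a} = span {f a}"
  using linear_span_image[of f "{a}"] by (simp add: invertible_linear_def)

text \<open>With periodic coefficients, the lift shifted by \<open>n\<close> is a lift for the same
  recursion, and the linear map from \<open>lift_unique\<close> is the monodromy.\<close>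

lemma lift_twisted:
  assumes V: "normalized_lift \<beta> \<gamma> V" and nz: "\<And>i. \<gamma> i \<noteq> 0"
    and per: "\<And>i. \<beta> (i + int n) = \<beta> i" "\<And>i. \<gamma> (i + int n) = \<gamma> i"
  shows "twisted_polygon n (\<lambda>i. span {V i})"
proof -
  have "normalized_lift \<beta> \<gamma> (\<lambda>i. V (i + int n))"
    unfolding normalized_lift_def
  proof (intro conjI allI)
    fix i
    show "indep3 (V (i + int n)) (V (i + 1 + int n)) (V (i + 2 + int n))"
      using lift_indep[OF V, of "i + int n"] by (simp add: algebra_simps)
    show "V (i + 3 + int n) = V (i + 2 + int n) + \<beta> i *\<^sub>R V (i + 1 + int n) + \<gamma> i *\<^sub>R V (i + int n)"
      using lift_step[OF V, of "i + int n"] by (simp add: per algebra_simps)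
  qed
  from lift_unique[OF V this nz] obtain M where M: "invertible_linear M" "\<And>i. V (i + int n) = M (V i)" by blast
  have "proj_point (span {V k})" for k
    by (rule span_proj_point) (use indep3D[OF lift_indep[OF V, of k], of 1 0 0] in auto)
  moreover have "\<not> proj_collinear (span {V (i - 1)}) (span {V i}) (span {V (i + 1)})" for i
    using indep3_not_collinear[OF lift_indep[OF V, of "i - 1"]] by (simp add: algebra_simps)
  moreover have "span {V (k + int n)} = M ` span {V k}" for k
    using M by (simp add: invertible_image_span)
  ultimately show ?thesis
    using M(1) unfolding twisted_polygon_def by blast
qed

text \<open>Any representatives satisfy a recursion with three coefficients. All are nonzero: the
  last by independence, the other two because a defined cross ratio separates its first and third
  and its second and fourth points. Rescaling makes the leading one 1, and
  \<open>cross_ratio_unique\<close> identifies the rest.\<close>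

lemma twisted_polygon_lift:
  assumes tw: "twisted_polygon n v"
    and x: "\<And>i. is_cross_ratio (v (i - 2)) (v (i - 1)) (join (v (i - 2)) (v (i - 1)) \<inter> join (v i) (v (i + 1)))
      (join (v (i - 2)) (v (i - 1)) \<inter> join (v (i + 1)) (v (i + 2))) (x i)"
    and y: "\<And>i. is_cross_ratio (join (v (i - 2)) (v (i - 1)) \<inter> join (v (i + 1)) (v (i + 2)))
      (join (v (i - 1)) (v i) \<inter> join (v (i + 1)) (v (i + 2))) (v (i + 1)) (v (i + 2)) (y i)"
  shows "\<exists>V. normalized_lift (\<lambda>i. - y (i + 1)) (\<lambda>i. x (i + 1) * y (i + 1) * y i) V \<and> v = (\<lambda>i. span {V i})"
proof -
  have "\<forall>i. \<exists>u. u \<noteq> 0 \<and> v i = span {u}"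
    using tw proj_point_span by (metis twisted_polygon_def)
  then obtain U where U: "\<And>i. U i \<noteq> 0" "\<And>i. v i = span {U i}" by metis
  have ind: "indep3 (U i) (U (i + 1)) (U (i + 2))" for i
  proof (rule not_collinear_indep3)
    have "\<not> proj_collinear (v (i + 1 - 1)) (v (i + 1)) (v (i + 1 + 1))" using tw unfolding twisted_polygon_def by blast
    then show "\<not> proj_collinear (span {U i}) (span {U (i + 1)}) (span {U (i + 2)})"
      by (simp add: U(2) add.assoc)
  qed
  have "\<forall>i. \<exists>a b c. U (i + 3) = a *\<^sub>R U (i + 2) + b *\<^sub>R U (i + 1) + c *\<^sub>R U i"
  proof
    fix i
    obtain r s t where "U (i + 3) = r *\<^sub>R U i + s *\<^sub>R U (i + 1) + t *\<^sub>R U (i + 2)"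
      using indep3_expand[OF ind[of i]] by blast
    then have "U (i + 3) = t *\<^sub>R U (i + 2) + s *\<^sub>R U (i + 1) + r *\<^sub>R U i" by (simp add: algebra_simps)
    then show "\<exists>a b c. U (i + 3) = a *\<^sub>R U (i + 2) + b *\<^sub>R U (i + 1) + c *\<^sub>R U i" by blast
  qed
  then obtain a b c where rec: "\<And>i. U (i + 3) = a i *\<^sub>R U (i + 2) + b i *\<^sub>R U (i + 1) + c i *\<^sub>R U i" by metis
  have c0: "c i \<noteq> 0" for i
  proof
    assume "c i = 0"
    then have "(b i) *\<^sub>R U (i + 1) + (a i) *\<^sub>R U (i + 2) + (-1) *\<^sub>R U (i + 3) = 0" using rec[of i] by simp
    then show False using indep3D[OF ind[of "i + 1"], of "b i" "a i" "-1"] by (simp add: add.assoc)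
  qed
  have P: "join (v i) (v (i + 1)) \<inter> join (v (i + 2)) (v (i + 3)) = span {b i *\<^sub>R U (i + 1) + c i *\<^sub>R U i}" for i
    using span_Int_adjacent[OF ind rec, of i] by (simp add: U(2) join_span)
  have b0: "b i \<noteq> 0" for i
  proof
    assume "b i = 0"
    then have "join (v i) (v (i + 1)) \<inter> join (v (i + 2)) (v (i + 3)) = v i"
      using P[of i] span_scaleR_singleton[OF c0[of i], of "U i"] U(2) by simp
    then show False using cross_ratio_distinct(1)[OF x[of "i + 2"]] by (simp add: algebra_simps)
  qed
  have a0: "a i \<noteq> 0" for i
  proof
    assume "a i = 0"
    then have "join (v i) (v (i + 1)) \<inter> join (v (i + 2)) (v (i + 3)) = v (i + 3)"
      using P[of i] rec[of i] by (simp add: U(2))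
    then show False using cross_ratio_distinct(2)[OF y[of "i + 1"]] by (simp add: algebra_simps)
  qed
  have "bij ((*) (1 / a (i - 2)))" for i
    by (rule o_bij[of "(*) (a (i - 2))"]) (use a0 in \<open>auto simp: fun_eq_iff\<close>)
  \<comment> \<open>These factors satisfy \<open>l (i + 3) * a i = l (i + 2)\<close>, which is the
    condition for leading coefficient 1 after rescaling.\<close>
  then obtain l where l: "l 0 = (1::real)" "\<And>i. l (i + 1) = (1 / a (i - 2)) * l i"
    using int_recursion[of "\<lambda>i. (*) (1 / a (i - 2))" 1] by metis
  have l0: "l i \<noteq> 0" for i
  proof (induction i rule: int_induct[where k=0])
    case (step2 i)
    then show ?case using l(2)[of "i - 1"] by auto
  qed (use l a0 in auto)
  define V where "V i = l i *\<^sub>R U i" for i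
  define \<beta> where "\<beta> i = l (i + 3) * b i / l (i + 1)" for i
  define \<gamma> where "\<gamma> i = l (i + 3) * c i / l i" for i
  have V: "normalized_lift \<beta> \<gamma> V"
    unfolding normalized_lift_def
  proof (intro conjI allI)
    fix i
    show "indep3 (V i) (V (i + 1)) (V (i + 2))"
      unfolding indep3_def V_def scaleR_scaleR
    proof (intro allI impI)
      fix r s t assume "(r * l i) *\<^sub>R U i + (s * l (i + 1)) *\<^sub>R U (i + 1) + (t * l (i + 2)) *\<^sub>R U (i + 2) = 0"
      from indep3D[OF ind this] show "r = 0 \<and> s = 0 \<and> t = 0" using l0 by simp
    qed
    have "l (i + 3) * a i = l (i + 2)" using l(2)[of "i + 2"] a0[of i] by (simp add: add.assoc)
    then show "V (i + 3) = V (i + 2) + \<beta> i *\<^sub>R V (i + 1) + \<gamma> i *\<^sub>R V i"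
      unfolding V_def rec \<beta>_def \<gamma>_def using l0 by (simp add: scaleR_add_right)
  qed
  have nz: "\<beta> i \<noteq> 0" "\<gamma> i \<noteq> 0" for i using l0 b0 c0 by (simp_all add: \<beta>_def \<gamma>_def)
  have vV: "v = (\<lambda>i. span {V i})" by (simp add: fun_eq_iff U(2) V_def span_scaleR_singleton l0)
  note cr = lift_cross_ratios[OF V nz, folded vV]
  have yi: "y i = - \<beta> (i - 1)" for i
    using cross_ratio_unique[OF y[of i]] cr(2)[of i] unfolding vV by simp
  have xi: "x i = \<gamma> (i - 1) / (\<beta> (i - 1) * \<beta> (i - 2))" for i
    using cross_ratio_unique[OF x[of i]] cr(1)[of i] unfolding vV by simp
  have "\<beta> = (\<lambda>i. - y (i + 1))" using yi by (simp add: fun_eq_iff)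
  moreover have "\<gamma> = (\<lambda>i. x (i + 1) * y (i + 1) * y i)"
    using nz by (simp add: fun_eq_iff yi xi add.commute diff_add_eq)
  ultimately show ?thesis using V vV by blast
qed

text \<open>By the recursion the vector also equals
  \<open>V (i + 1) + (x i * y i * y (i - 1)) V (i - 1)\<close>, so it lies on both
  diagonals.\<close>

lemma pentagram_lift:
  assumes V: "normalized_lift (\<lambda>i. - y (i + 1)) (\<lambda>i. x (i + 1) * y (i + 1) * y i) V"
  shows "pentagram (\<lambda>i. span {V i}) = (\<lambda>i. span {V (i + 2) + y i *\<^sub>R V i})"
proof
  fix i
  have i: "indep3 (V (i - 1)) (V (i + 1)) (V i)"
  proof -
    have "indep3 (V (i - 1)) (V i) (V (i + 1))" using lift_indep[OF V, of "i - 1"] by (simp add: algebra_simps)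
    then have *: "r = 0 \<and> s = 0 \<and> t = 0" if "r *\<^sub>R V (i - 1) + t *\<^sub>R V i + s *\<^sub>R V (i + 1) = 0" for r s t
      using indep3D that by blast
    show ?thesis
      unfolding indep3_def
    proof (intro allI impI)
      fix r s t assume "r *\<^sub>R V (i - 1) + s *\<^sub>R V (i + 1) + t *\<^sub>R V i = 0"
      then have "r *\<^sub>R V (i - 1) + t *\<^sub>R V i + s *\<^sub>R V (i + 1) = 0" by (simp add: add_ac)
      then show "r = 0 \<and> s = 0 \<and> t = 0" by (rule *)
    qed
  qed
  have st: "V (i + 2) = V (i + 1) + (- y i) *\<^sub>R V i + (x i * y i * y (i - 1)) *\<^sub>R V (i - 1)"
    using lift_step[OF V, of "i - 1"] by (simp add: algebra_simps)
  then have "V (i + 2) = (- y i) *\<^sub>R V i + 1 *\<^sub>R V (i + 1) + (x i * y i * y (i - 1)) *\<^sub>R V (i - 1)" by simp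
  from span_Int_adjacent[OF i this]
  have "span {V (i - 1), V (i + 1)} \<inter> span {V i, V (i + 2)} = span {1 *\<^sub>R V (i + 1) + (x i * y i * y (i - 1)) *\<^sub>R V (i - 1)}" .
  moreover have "1 *\<^sub>R V (i + 1) + (x i * y i * y (i - 1)) *\<^sub>R V (i - 1) = V (i + 2) + y i *\<^sub>R V i"
    using st by simp
  ultimately show "pentagram (\<lambda>i. span {V i}) i = span {V (i + 2) + y i *\<^sub>R V i}"
    unfolding pentagram_def join_span by metis
qed

text \<open>Write \<open>W i\<close> for the new vectors and \<open>p\<close> for
  \<open>x (i + 1) * y (i + 1)\<close>. Both \<open>W i\<close> and \<open>W (i + 1)\<close> are
  combinations of \<open>V i\<close> and \<open>V (i + 2)\<close>, and
  \<open>W (i + 1) - p W i = (1 - p) V (i + 2)\<close>. As \<open>W (i + 3) - W (i + 2)\<close> is a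
  multiple of \<open>V (i + 2)\<close>, it is a combination of \<open>W (i + 1)\<close> and
  \<open>W i\<close>; the coefficients are the new ones.\<close>

lemma pentagram_normalized_lift:
  fixes x y :: "int \<Rightarrow> real"
  assumes V: "normalized_lift (\<lambda>i. - y (i + 1)) (\<lambda>i. x (i + 1) * y (i + 1) * y i) V"
    and nz: "\<And>i. y i \<noteq> 0" "\<And>i. x i * y i \<noteq> 1"
    and y': "\<And>i. y' i = y (i + 1) * (1 - x (i + 2) * y (i + 2)) / (1 - x i * y i)"
    and x': "\<And>i. x' i = x i * (1 - x (i - 1) * y (i - 1)) / (1 - x (i + 1) * y (i + 1))"
  shows "normalized_lift (\<lambda>i. - y' (i + 1)) (\<lambda>i. x' (i + 1) * y' (i + 1) * y' i) (\<lambda>i. V (i + 2) + y i *\<^sub>R V i)"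
  unfolding normalized_lift_def
proof (intro conjI allI)
  fix i
  let ?A = "V i" and ?B = "V (i + 1)" and ?C = "V (i + 2)"
  have ind: "indep3 ?A ?B ?C" by (rule lift_indep[OF V])
  have V3: "V (i + 3) = ?C + (- y (i + 1)) *\<^sub>R ?B + (x (i + 1) * y (i + 1) * y i) *\<^sub>R ?A"
    by (rule lift_step[OF V])
  have V4: "V (i + 4) = V (i + 3) + (- y (i + 2)) *\<^sub>R ?C + (x (i + 2) * y (i + 2) * y (i + 1)) *\<^sub>R ?B"
    using lift_step[OF V, of "i + 1"] by (simp add: add.assoc)
  have V5: "V (i + 5) = V (i + 4) + (- y (i + 3)) *\<^sub>R V (i + 3) + (x (i + 3) * y (i + 3) * y (i + 2)) *\<^sub>R ?C"
    using lift_step[OF V, of "i + 2"] by (simp add: add.assoc)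
  have d: "1 - x j * y j \<noteq> 0" for j using nz(2)[of j] by simp
  have W0: "V (i + 2) + y i *\<^sub>R V i = ?C + y i *\<^sub>R ?A" ..
  have W1: "V (i + 1 + 2) + y (i + 1) *\<^sub>R V (i + 1) = ?C + (x (i + 1) * y (i + 1) * y i) *\<^sub>R ?A"
    using V3 by (simp add: add.assoc)
  have W2: "V (i + 2 + 2) + y (i + 2) *\<^sub>R V (i + 2) = ?C + (- y (i + 1) * (1 - x (i + 2) * y (i + 2))) *\<^sub>R ?B + (x (i + 1) * y (i + 1) * y i) *\<^sub>R ?A"
    using V4 V3 by (simp add: add.assoc algebra_simps)
  have W3: "V (i + 3 + 2) + y (i + 3) *\<^sub>R V (i + 3) = (V (i + 2 + 2) + y (i + 2) *\<^sub>R V (i + 2)) + (- y (i + 2) * (1 - x (i + 3) * y (i + 3))) *\<^sub>R ?C"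
    using V5 V4 by (simp add: add.assoc algebra_simps)
  show "indep3 (V (i + 2) + y i *\<^sub>R V i) (V (i + 1 + 2) + y (i + 1) *\<^sub>R V (i + 1)) (V (i + 2 + 2) + y (i + 2) *\<^sub>R V (i + 2))"
    unfolding W1 W2 indep3_def
  proof (intro allI impI)
    fix r s t
    assume "r *\<^sub>R (?C + y i *\<^sub>R ?A) + s *\<^sub>R (?C + (x (i + 1) * y (i + 1) * y i) *\<^sub>R ?A)
      + t *\<^sub>R (?C + (- y (i + 1) * (1 - x (i + 2) * y (i + 2))) *\<^sub>R ?B + (x (i + 1) * y (i + 1) * y i) *\<^sub>R ?A) = 0"
    then have "(r * y i + (s + t) * (x (i + 1) * y (i + 1) * y i)) *\<^sub>R ?A + (t * (- y (i + 1) * (1 - x (i + 2) * y (i + 2)))) *\<^sub>R ?B + (r + s + t) *\<^sub>R ?C = 0"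
      by (simp add: algebra_simps)
    from indep3D[OF ind this] have e: "r * y i + (s + t) * (x (i + 1) * y (i + 1) * y i) = 0"
      "t * (- y (i + 1) * (1 - x (i + 2) * y (i + 2))) = 0" "r + s + t = 0" by simp_all
    have t: "t = 0" using e(2) nz(1) d by auto
    have s: "s = - r" using e(3) t by simp
    have "r * y i * (1 - x (i + 1) * y (i + 1)) = 0" using e(1) unfolding t s by (simp add: algebra_simps)
    then have "r = 0" using nz(1) d by simp
    then show "r = 0 \<and> s = 0 \<and> t = 0" using t s by simp
  qed
  have y1: "y' (i + 1) = y (i + 2) * (1 - x (i + 3) * y (i + 3)) / (1 - x (i + 1) * y (i + 1))"
    using y'[of "i + 1"] by (simp add: add.assoc)
  \<comment> \<open>This identity puts the two new coefficients in the ratio required for a multiple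
    of \<open>V (i + 2)\<close>.\<close>
  have xy: "x' (i + 1) * y' i = x (i + 1) * y (i + 1)"
  proof -
    have "x' (i + 1) = x (i + 1) * (1 - x i * y i) / (1 - x (i + 2) * y (i + 2))"
      using x'[of "i + 1"] by (simp add: add.assoc)
    then show ?thesis unfolding y' using d[of i] d[of "i + 2"] by simp
  qed
  have k: "- y (i + 2) * (1 - x (i + 3) * y (i + 3)) = - y' (i + 1) + x (i + 1) * y (i + 1) * y' (i + 1)"
  proof -
    have "- y' (i + 1) * (1 - x (i + 1) * y (i + 1)) = - y (i + 2) * (1 - x (i + 3) * y (i + 3))"
      unfolding y1 using d[of "i + 1"] by simp
    then show ?thesis by (simp add: algebra_simps)
  qed
  have g: "x' (i + 1) * y' (i + 1) * y' i = x (i + 1) * y (i + 1) * y' (i + 1)"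
    using xy by (simp add: algebra_simps)
  show "V (i + 3 + 2) + y (i + 3) *\<^sub>R V (i + 3) = V (i + 2 + 2) + y (i + 2) *\<^sub>R V (i + 2)
     + (- y' (i + 1)) *\<^sub>R (V (i + 1 + 2) + y (i + 1) *\<^sub>R V (i + 1))
     + (x' (i + 1) * y' (i + 1) * y' i) *\<^sub>R (V (i + 2) + y i *\<^sub>R V i)"
    unfolding W3 W1 k g by (simp add: algebra_simps)
qed

section \<open>Indices modulo n\<close>

lemma mod_ring_of_int_eq_iff:
  "(of_int a :: 'n::nontriv mod_ring) = of_int b \<longleftrightarrow> int CARD('n) dvd a - b"
proof -
  have "(of_int a :: 'n mod_ring) = of_int b \<longleftrightarrow> a mod int CARD('n) = b mod int CARD('n)"
    by transfer simp
  then show ?thesis by (simp add: mod_eq_dvd_iff)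
qed

lemma mod_ring_of_int_surj: "\<exists>a. (i :: 'n::nontriv mod_ring) = of_int a"
  by (metis of_int_mod_ring_to_int_mod_ring of_int_of_int_mod_ring)

lemma mod_ring_of_int_period: "(of_int (i + int CARD('n::nontriv)) :: 'n mod_ring) = of_int i"
  unfolding mod_ring_of_int_eq_iff by simp

lemma mod_ring_small_neq_0:
  assumes "3 \<le> CARD('n::nontriv)"
  shows "(1 :: 'n mod_ring) \<noteq> 0" "(2 :: 'n mod_ring) \<noteq> 0"
proof -
  have "(of_int 1 :: 'n mod_ring) \<noteq> of_int 0" "(of_int 2 :: 'n mod_ring) \<noteq> of_int 0"
    unfolding mod_ring_of_int_eq_iff using assms zdvd_imp_le[of "int CARD('n)" 1] zdvd_imp_le[of "int CARD('n)" 2] by auto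
  then show "(1 :: 'n mod_ring) \<noteq> 0" "(2 :: 'n mod_ring) \<noteq> 0" by simp_all
qed

lemma sum_shift:
  fixes f :: "'n::nontriv mod_ring \<Rightarrow> 'b::comm_monoid_add"
  shows "(\<Sum>i\<in>UNIV. f (i + k)) = (\<Sum>i\<in>UNIV. f i)"
  by (rule sum.reindex_bij_betw) (rule o_bij[of "\<lambda>i. i - k"], auto simp: fun_eq_iff)

section \<open>The bracket in corner coordinates\<close>

definition ex :: "'n::nontriv mod_ring \<Rightarrow> 'n coords" where "ex i = (axis i 1, 0)"
definition ey :: "'n::nontriv mod_ring \<Rightarrow> 'n coords" where "ey i = (0, axis i 1)"

lemma inner_ex: "c \<bullet> ex i = fst c $ i" and inner_ey: "c \<bullet> ey i = snd c $ i"
  by (simp_all add: ex_def ey_def inner_Pair_0 inner_axis inner_prod_def)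

lemma ex_in_Basis [simp]: "ex i \<in> Basis" and ey_in_Basis [simp]: "ey i \<in> Basis"
  by (auto simp: ex_def ey_def Basis_prod_def Basis_vec_def)

lemma Basis_coords: "(Basis :: 'n::nontriv coords set) = range ex \<union> range ey"
  by (auto simp: ex_def ey_def Basis_prod_def Basis_vec_def image_iff)

lemma ex_inj [simp]: "ex i = ex j \<longleftrightarrow> i = j" and ey_inj [simp]: "ey i = ey j \<longleftrightarrow> i = j"
  and ex_ey [simp]: "ex i \<noteq> ey j" "ey j \<noteq> ex i"
  by (auto simp: ex_def ey_def axis_eq_axis axis_eq_0_iff)

lemma sum_Basis_coords:
  fixes f :: "'n::nontriv coords \<Rightarrow> 'b::comm_monoid_add"
  shows "(\<Sum>b\<in>Basis. f b) = (\<Sum>i\<in>UNIV. f (ex i)) + (\<Sum>i\<in>UNIV. f (ey i))"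
proof -
  have "(\<Sum>b\<in>Basis. f b) = sum f (range ex) + sum f (range ey)"
    unfolding Basis_coords by (rule sum.union_disjoint) auto
  moreover have "inj (ex :: 'n mod_ring \<Rightarrow> _)" "inj (ey :: 'n mod_ring \<Rightarrow> _)" by (auto simp: inj_def)
  ultimately show ?thesis by (simp add: sum.reindex)
qed

text \<open>The skew form of the oriented cycle on the indices; it will be applied to exponents and
  to logarithmic derivatives.\<close>

definition cyc :: "('n::nontriv mod_ring \<Rightarrow> real) \<Rightarrow> ('n mod_ring \<Rightarrow> real) \<Rightarrow> real" where
  "cyc \<alpha> \<beta> = (\<Sum>i\<in>UNIV. \<alpha> i * \<beta> (i + 1) - \<alpha> (i + 1) * \<beta> i)"

definition pent_matrix :: "'n::nontriv coords \<Rightarrow> 'n coords \<Rightarrow> real" where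
  "pent_matrix a b = cyc (\<lambda>i. a \<bullet> ey i) (\<lambda>i. b \<bullet> ey i) - cyc (\<lambda>i. a \<bullet> ex i) (\<lambda>i. b \<bullet> ex i)"

lemma cyc_skew: "cyc \<alpha> \<beta> = - cyc \<beta> \<alpha>"
  by (simp add: cyc_def sum_negf[symmetric] algebra_simps)

lemma pent_matrix_skew: "pent_matrix a b = - pent_matrix b a"
  unfolding pent_matrix_def by (subst (1 2) cyc_skew) simp

lemma cyc_add_left: "cyc (\<lambda>i. \<alpha> i + \<alpha>' i) \<beta> = cyc \<alpha> \<beta> + cyc \<alpha>' \<beta>"
  by (simp add: cyc_def sum.distrib[symmetric] algebra_simps)

lemma cyc_add_right: "cyc \<alpha> (\<lambda>i. \<beta> i + \<beta>' i) = cyc \<alpha> \<beta> + cyc \<alpha> \<beta>'"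
  by (simp add: cyc_def sum.distrib[symmetric] algebra_simps)

lemma cyc_mult_left: "cyc (\<lambda>i. k * \<alpha> i) \<beta> = k * cyc \<alpha> \<beta>"
  by (simp add: cyc_def sum_distrib_left algebra_simps)

lemma cyc_mult_right: "cyc \<alpha> (\<lambda>i. k * \<beta> i) = k * cyc \<alpha> \<beta>"
  by (simp add: cyc_def sum_distrib_left algebra_simps)

lemma cyc_diff_left: "cyc (\<lambda>i. \<alpha> i - \<alpha>' i) \<beta> = cyc \<alpha> \<beta> - cyc \<alpha>' \<beta>"
  by (simp add: cyc_def sum_subtractf[symmetric] algebra_simps)

lemma cyc_diff_right: "cyc \<alpha> (\<lambda>i. \<beta> i - \<beta>' i) = cyc \<alpha> \<beta> - cyc \<alpha> \<beta>'"
  by (simp add: cyc_def sum_subtractf[symmetric] algebra_simps)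

lemma cyc_minus_left: "cyc (\<lambda>i. - \<alpha> i) \<beta> = - cyc \<alpha> \<beta>"
  by (simp add: cyc_def sum_negf[symmetric] algebra_simps)

lemma cyc_minus_right: "cyc \<alpha> (\<lambda>i. - \<beta> i) = - cyc \<alpha> \<beta>"
  by (simp add: cyc_def sum_negf[symmetric] algebra_simps)

lemma cyc_sum_left: "cyc (\<lambda>i. \<Sum>a\<in>A. \<alpha> a i) \<beta> = (\<Sum>a\<in>A. cyc (\<alpha> a) \<beta>)"
proof -
  have "(\<Sum>a\<in>A. cyc (\<alpha> a) \<beta>) = (\<Sum>i\<in>UNIV. \<Sum>a\<in>A. \<alpha> a i * \<beta> (i + 1) - \<alpha> a (i + 1) * \<beta> i)"
    unfolding cyc_def by (rule sum.swap)
  then show ?thesis by (simp add: cyc_def sum_distrib_right sum_subtractf)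
qed

lemma cyc_sum_right: "cyc \<alpha> (\<lambda>i. \<Sum>b\<in>B. \<beta> b i) = (\<Sum>b\<in>B. cyc \<alpha> (\<beta> b))"
proof -
  have "(\<Sum>b\<in>B. cyc \<alpha> (\<beta> b)) = (\<Sum>i\<in>UNIV. \<Sum>b\<in>B. \<alpha> i * \<beta> b (i + 1) - \<alpha> (i + 1) * \<beta> b i)"
    unfolding cyc_def by (rule sum.swap)
  then show ?thesis by (simp add: cyc_def sum_distrib_left sum_subtractf)
qed

lemma sum_Basis_inner:
  fixes e :: "'a::euclidean_space"
  assumes "e \<in> Basis"
  shows "(\<Sum>a\<in>Basis. \<alpha> a * (a \<bullet> e)) = (\<alpha> e :: real)"
proof -
  have "(\<Sum>a\<in>Basis. \<alpha> a * (a \<bullet> e)) = (\<Sum>a\<in>Basis. if a = e then \<alpha> a else 0)"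
    by (rule sum.cong[OF refl]) (use assms in \<open>auto simp: inner_Basis\<close>)
  then show ?thesis using assms by (simp add: sum.delta)
qed

lemma pent_matrix_sum:
  fixes \<alpha> \<beta> :: "'n::nontriv coords \<Rightarrow> real"
  shows "(\<Sum>a\<in>Basis. \<Sum>b\<in>Basis. pent_matrix a b * \<alpha> a * \<beta> b)
    = cyc (\<lambda>i. \<alpha> (ey i)) (\<lambda>i. \<beta> (ey i)) - cyc (\<lambda>i. \<alpha> (ex i)) (\<lambda>i. \<beta> (ex i))"
proof -
  have *: "(\<Sum>a\<in>Basis. \<Sum>b\<in>Basis. cyc (\<lambda>i. a \<bullet> e i) (\<lambda>i. b \<bullet> e i) * \<alpha> a * \<beta> b) = cyc (\<lambda>i. \<alpha> (e i)) (\<lambda>i. \<beta> (e i))"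
    if e: "\<And>i. e i \<in> Basis" for e :: "'n mod_ring \<Rightarrow> 'n coords"
  proof -
    have "(\<Sum>a\<in>Basis. \<Sum>b\<in>Basis. cyc (\<lambda>i. a \<bullet> e i) (\<lambda>i. b \<bullet> e i) * \<alpha> a * \<beta> b)
      = (\<Sum>a\<in>Basis. \<Sum>b\<in>Basis. cyc (\<lambda>i. \<alpha> a * (a \<bullet> e i)) (\<lambda>i. \<beta> b * (b \<bullet> e i)))"
      unfolding cyc_mult_left cyc_mult_right by (simp add: mult_ac)
    also have "\<dots> = cyc (\<lambda>i. \<Sum>a\<in>Basis. \<alpha> a * (a \<bullet> e i)) (\<lambda>i. \<Sum>b\<in>Basis. \<beta> b * (b \<bullet> e i))"
      by (simp only: cyc_sum_left cyc_sum_right)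
    finally show ?thesis by (simp add: sum_Basis_inner[OF e])
  qed
  show ?thesis
    unfolding pent_matrix_def left_diff_distrib sum_subtractf by (simp only: * ey_in_Basis ex_in_Basis)
qed

lemma bracket_pent:
  assumes "f differentiable at c" "g differentiable at c"
  shows "bracket (log_canonical pent_matrix) f g c =
    cyc (\<lambda>i. log_deriv (ey i) f c) (\<lambda>i. log_deriv (ey i) g c) - cyc (\<lambda>i. log_deriv (ex i) f c) (\<lambda>i. log_deriv (ex i) g c)"
  unfolding bracket_log_canonical[OF assms] pent_matrix_sum ..

definition \<delta> :: "'n::nontriv mod_ring \<Rightarrow> 'n mod_ring \<Rightarrow> real" where "\<delta> k i = of_bool (i = k)"

lemma cyc_\<delta>_left: "cyc (\<delta> k) \<beta> = \<beta> (k + 1) - \<beta> (k - 1)"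
proof -
  have "(\<Sum>i\<in>UNIV. \<delta> k i * \<beta> (i + 1)) = \<beta> (k + 1)" by (simp add: \<delta>_def)
  moreover have "(\<Sum>i\<in>UNIV. \<delta> k (i + 1) * \<beta> i) = \<beta> (k - 1)"
  proof -
    have "i + 1 = k \<longleftrightarrow> i = k - 1" for i by (auto simp: algebra_simps)
    then show ?thesis by (simp add: \<delta>_def)
  qed
  ultimately show ?thesis by (simp add: cyc_def sum_subtractf)
qed

lemma cyc_\<delta>_right: "cyc \<beta> (\<delta> k) = \<beta> (k - 1) - \<beta> (k + 1)"
  using cyc_\<delta>_left[of k \<beta>] cyc_skew[of \<beta> "\<delta> k"] by simp

lemma cyc_shift: "cyc (\<lambda>i. \<alpha> (i + k)) (\<lambda>i. \<beta> (i + k)) = cyc \<alpha> \<beta>"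
  using sum_shift[of "\<lambda>i. \<alpha> i * \<beta> (i + 1) - \<alpha> (i + 1) * \<beta> i" k] by (simp add: cyc_def add_ac)

section \<open>Logarithmic derivatives\<close>

lemma log_deriv_has_derivative:
  assumes "(f has_derivative f') (at c)"
  shows "log_deriv a f c = (c \<bullet> a) * f' a"
  using frechet_derivative_at[OF assms] by (simp add: log_deriv_def)

lemma coord_has_derivative:
  "((\<lambda>c. fst c $ k) has_derivative (\<lambda>v. fst v $ k)) F" "((\<lambda>c. snd c $ k) has_derivative (\<lambda>v. snd v $ k)) F"
  by (rule bounded_linear_imp_has_derivative, rule bounded_linear_compose[OF bounded_linear_vec_nth bounded_linear_fst])
     (rule bounded_linear_imp_has_derivative, rule bounded_linear_compose[OF bounded_linear_vec_nth bounded_linear_snd])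

lemma log_deriv_ex: "log_deriv (ex i) (\<lambda>c. fst c $ k) c = \<delta> k i * (fst c $ k)"
  and log_deriv_ex_y: "log_deriv (ex i) (\<lambda>c. snd c $ k) c = 0"
  and log_deriv_ey: "log_deriv (ey i) (\<lambda>c. snd c $ k) c = \<delta> k i * (snd c $ k)"
  and log_deriv_ey_x: "log_deriv (ey i) (\<lambda>c. fst c $ k) c = 0"
proof -
  note d = log_deriv_has_derivative[OF coord_has_derivative(1)] log_deriv_has_derivative[OF coord_has_derivative(2)]
  show "log_deriv (ex i) (\<lambda>c. fst c $ k) c = \<delta> k i * (fst c $ k)" "log_deriv (ex i) (\<lambda>c. snd c $ k) c = 0"
    "log_deriv (ey i) (\<lambda>c. snd c $ k) c = \<delta> k i * (snd c $ k)" "log_deriv (ey i) (\<lambda>c. fst c $ k) c = 0"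
    unfolding d by (auto simp: inner_ex inner_ey \<delta>_def) (auto simp: ex_def ey_def axis_def)
qed

lemma differentiable_coord: "(\<lambda>c. fst c $ k) differentiable at c" "(\<lambda>c. snd c $ k) differentiable at c"
  for c :: "'n::nontriv coords"
  by (rule differentiableI, rule coord_has_derivative)+

lemma log_deriv_quotient:
  assumes f: "f differentiable at c" and g: "g differentiable at c" "g c \<noteq> 0"
  shows "log_deriv a (\<lambda>c. f c / g c) c = (log_deriv a f c * g c - f c * log_deriv a g c) / (g c)\<^sup>2"
proof -
  have "((\<lambda>c. f c / g c) has_derivative (\<lambda>v. (dirderiv f v c * g c - f c * dirderiv g v c) / (g c * g c))) (at c)"
    using f g by (intro has_derivative_divide') (simp_all add: frechet_derivative_works)
  from log_deriv_has_derivative[OF this] show ?thesis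
    by (simp add: log_deriv_def power2_eq_square algebra_simps)
qed

lemma log_deriv_one_minus:
  assumes "f differentiable at c"
  shows "log_deriv a (\<lambda>c. 1 - f c) c = - log_deriv a f c"
proof -
  have "((\<lambda>c. 1 - f c) has_derivative (\<lambda>v. 0 - dirderiv f v c)) (at c)"
    using assms by (intro has_derivative_diff has_derivative_const) (simp add: frechet_derivative_works)
  from log_deriv_has_derivative[OF this] show ?thesis by (simp add: log_deriv_def)
qed

section \<open>The pentagram map\<close>

definition pent_map :: "'n::nontriv coords \<Rightarrow> 'n coords" where
  "pent_map c = ((\<chi> i. fst c $ i * (1 - fst c $ (i - 1) * snd c $ (i - 1)) / (1 - fst c $ (i + 1) * snd c $ (i + 1))),
    (\<chi> i. snd c $ (i + 1) * (1 - fst c $ (i + 2) * snd c $ (i + 2)) / (1 - fst c $ i * snd c $ i)))"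

definition pent_domain :: "'n::nontriv coords set" where
  "pent_domain = {c. (\<forall>i. fst c $ i \<noteq> 0) \<and> (\<forall>i. snd c $ i \<noteq> 0) \<and> (\<forall>i. fst c $ i * snd c $ i \<noteq> 1)}"

text \<open>The derivative of the logarithm of \<open>1 - x\<^sub>i y\<^sub>i\<close> with respect
  to the logarithm of \<open>x\<^sub>i\<close>, and equally with respect to that of
  \<open>y\<^sub>i\<close>.\<close>

definition flow :: "'n::nontriv coords \<Rightarrow> 'n mod_ring \<Rightarrow> real" where
  "flow c i = - (fst c $ i * snd c $ i) / (1 - fst c $ i * snd c $ i)"

text \<open>The logarithmic derivative, in either letter of index \<open>i\<close>, of the quotient
  of the factors \<open>1 - x y\<close> at \<open>k - 1\<close> and \<open>k + 1\<close>. The map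
  multiplies \<open>x\<^sub>k\<close> by this quotient, and its y coordinate of index
  \<open>k\<close> carries the inverse quotient taken at \<open>k + 1\<close>.\<close>

definition pent_shift :: "'n::nontriv coords \<Rightarrow> 'n mod_ring \<Rightarrow> 'n mod_ring \<Rightarrow> real" where
  "pent_shift c k i = flow c (k - 1) * \<delta> (k - 1) i - flow c (k + 1) * \<delta> (k + 1) i"

lemma log_deriv_xy:
  "log_deriv (ex i) (\<lambda>c. 1 - fst c $ k * snd c $ k) c = - \<delta> k i * (fst c $ k * snd c $ k)"
  "log_deriv (ey i) (\<lambda>c. 1 - fst c $ k * snd c $ k) c = - \<delta> k i * (fst c $ k * snd c $ k)"
  by (subst log_deriv_one_minus; simp add: differentiable_coord differentiable_mult log_deriv_mult
      log_deriv_ex log_deriv_ey log_deriv_ex_y log_deriv_ey_x)+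

lemma log_deriv_product_quotient:
  assumes "f differentiable at c" "g differentiable at c" "h differentiable at c" "g c \<noteq> 0" "h c \<noteq> 0"
    and "log_deriv a f c = p * f c" "log_deriv a g c = q * g c" "log_deriv a h c = r * h c"
  shows "log_deriv a (\<lambda>c. f c * g c / h c) c = (p + q - r) * (f c * g c / h c)"
proof -
  have "log_deriv a (\<lambda>c. f c * g c / h c) c = (log_deriv a (\<lambda>c. f c * g c) c * h c - f c * g c * log_deriv a h c) / (h c)\<^sup>2"
    using assms(1-5) by (intro log_deriv_quotient) (auto intro: differentiable_mult)
  also have "\<dots> = (p + q - r) * (f c * g c / h c)"
    using assms by (simp add: log_deriv_mult power2_eq_square field_simps)
  finally show ?thesis .
qed

lemma flow_eq:
  assumes "c \<in> pent_domain"
  shows "- \<delta> k i * (fst c $ k * snd c $ k) = \<delta> k i * flow c k * (1 - fst c $ k * snd c $ k)"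
  using assms by (simp add: flow_def pent_domain_def)

lemma log_deriv_pent_map:
  fixes c :: "'n::nontriv coords"
  assumes c: "c \<in> pent_domain"
  shows "log_deriv (ex i) (\<lambda>c. fst (pent_map c) $ k) c = (\<delta> k i + pent_shift c k i) * fst (pent_map c) $ k"
    "log_deriv (ey i) (\<lambda>c. fst (pent_map c) $ k) c = pent_shift c k i * fst (pent_map c) $ k"
    "log_deriv (ex i) (\<lambda>c. snd (pent_map c) $ k) c = - pent_shift c (k + 1) i * snd (pent_map c) $ k"
    "log_deriv (ey i) (\<lambda>c. snd (pent_map c) $ k) c = (\<delta> (k + 1) i - pent_shift c (k + 1) i) * snd (pent_map c) $ k"
proof -
  have nz: "1 - fst c $ j * snd c $ j \<noteq> 0" for j using c by (auto simp: pent_domain_def)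
  have d: "(\<lambda>c. 1 - fst c $ j * snd c $ j) differentiable at c" for j
    by (intro differentiable_diff differentiable_const differentiable_mult differentiable_coord)
  note pq = log_deriv_product_quotient[OF _ d d nz nz]
  have k2: "k + 1 + 1 = k + 2" "k + 1 - 1 = k" by (simp_all add: add.assoc)
  show "log_deriv (ex i) (\<lambda>c. fst (pent_map c) $ k) c = (\<delta> k i + pent_shift c k i) * fst (pent_map c) $ k"
    unfolding pent_map_def fst_conv vec_lambda_beta
    by (subst pq[where p="\<delta> k i" and q="\<delta> (k - 1) i * flow c (k - 1)" and r="\<delta> (k + 1) i * flow c (k + 1)"])
       (auto simp: differentiable_coord log_deriv_ex log_deriv_xy flow_eq[OF c, simplified] pent_shift_def algebra_simps)
  show "log_deriv (ey i) (\<lambda>c. fst (pent_map c) $ k) c = pent_shift c k i * fst (pent_map c) $ k"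
    unfolding pent_map_def fst_conv vec_lambda_beta
    by (subst pq[where p="0" and q="\<delta> (k - 1) i * flow c (k - 1)" and r="\<delta> (k + 1) i * flow c (k + 1)"])
       (auto simp: differentiable_coord log_deriv_ey_x log_deriv_xy flow_eq[OF c, simplified] pent_shift_def algebra_simps)
  show "log_deriv (ex i) (\<lambda>c. snd (pent_map c) $ k) c = - pent_shift c (k + 1) i * snd (pent_map c) $ k"
    unfolding pent_map_def snd_conv vec_lambda_beta
    by (subst pq[where p="0" and q="\<delta> (k + 2) i * flow c (k + 2)" and r="\<delta> k i * flow c k"])
       (auto simp: differentiable_coord log_deriv_ex_y log_deriv_xy flow_eq[OF c, simplified] pent_shift_def k2 algebra_simps)
  show "log_deriv (ey i) (\<lambda>c. snd (pent_map c) $ k) c = (\<delta> (k + 1) i - pent_shift c (k + 1) i) * snd (pent_map c) $ k"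
    unfolding pent_map_def snd_conv vec_lambda_beta
    by (subst pq[where p="\<delta> (k + 1) i" and q="\<delta> (k + 2) i * flow c (k + 2)" and r="\<delta> k i * flow c k"])
       (auto simp: differentiable_coord log_deriv_ey log_deriv_xy flow_eq[OF c, simplified] pent_shift_def k2 algebra_simps)
qed

text \<open>Each of the eight terms is a value of \<open>flow\<close> present only if two indices
  coincide. Coincidence is symmetric, so the terms cancel in pairs.\<close>

lemma cyc_pent_shift: "cyc (\<delta> k) (pent_shift c l) + cyc (pent_shift c k) (\<delta> l) = 0"
proof -
  define g where "g a b = flow c a * of_bool (b = a)" for a b
  have g: "g a b = g b a" for a b by (auto simp: g_def)
  have "cyc (\<delta> k) (pent_shift c l) = g (l - 1) (k + 1) - g (l + 1) (k + 1) - (g (l - 1) (k - 1) - g (l + 1) (k - 1))"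
    unfolding cyc_\<delta>_left pent_shift_def \<delta>_def g_def ..
  moreover have "cyc (pent_shift c k) (\<delta> l) = g (k - 1) (l - 1) - g (k + 1) (l - 1) - (g (k - 1) (l + 1) - g (k + 1) (l + 1))"
    unfolding cyc_\<delta>_right pent_shift_def \<delta>_def g_def ..
  ultimately show ?thesis
    using g[of "l - 1" "k + 1"] g[of "l + 1" "k + 1"] g[of "l - 1" "k - 1"] g[of "l + 1" "k - 1"] by linarith
qed

lemma pent_matrix_ex: "pent_matrix (ex k) (ex l) = - cyc (\<delta> k) (\<delta> l)"
  and pent_matrix_ey: "pent_matrix (ey k) (ey l) = cyc (\<delta> k) (\<delta> l)"
  and pent_matrix_ex_ey: "pent_matrix (ex k) (ey l) = 0"
proof -
  have *: "(\<lambda>i. ex k \<bullet> ex i) = \<delta> k" "(\<lambda>i. ey k \<bullet> ey i) = \<delta> k" "(\<lambda>i. ex k \<bullet> ey i) = (\<lambda>i. 0)" "(\<lambda>i. ey k \<bullet> ex i) = (\<lambda>i. 0)"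
    for k :: "'n::nontriv mod_ring"
    by (auto simp: fun_eq_iff inner_Basis \<delta>_def)
  show "pent_matrix (ex k) (ex l) = - cyc (\<delta> k) (\<delta> l)" "pent_matrix (ey k) (ey l) = cyc (\<delta> k) (\<delta> l)"
    "pent_matrix (ex k) (ey l) = 0"
    unfolding pent_matrix_def * by (simp_all add: cyc_def)
qed

lemma smooth_on_coord:
  assumes "open U"
  shows "smooth_on U (\<lambda>c. fst c $ k)" "smooth_on U (\<lambda>c. snd c $ k)"
  by (rule smooth_on_bounded_linear[OF assms], rule bounded_linear_compose[OF bounded_linear_vec_nth bounded_linear_fst])
     (rule smooth_on_bounded_linear[OF assms], rule bounded_linear_compose[OF bounded_linear_vec_nth bounded_linear_snd])

lemma open_pent_domain: "open (pent_domain :: 'n::nontriv coords set)"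
proof -
  have eq: "pent_domain = (\<Inter>i. {c. fst c $ i \<noteq> 0} \<inter> {c. snd c $ i \<noteq> 0} \<inter> {c::'n coords. fst c $ i * snd c $ i \<noteq> 1})"
    by (auto simp: pent_domain_def)
  show ?thesis
    unfolding eq by (intro open_INT ballI open_Int open_Collect_neq continuous_intros) auto
qed

lemma coords_representation: "(\<Sum>i\<in>UNIV. (fst c $ i) *\<^sub>R ex i) + (\<Sum>i\<in>UNIV. (snd c $ i) *\<^sub>R ey i) = c"
  using sum_Basis_coords[of "\<lambda>b. (c \<bullet> b) *\<^sub>R b"] by (simp add: euclidean_representation inner_ex inner_ey)

lemma smooth_pent_map: "smooth_on pent_domain (pent_map :: 'n::nontriv coords \<Rightarrow> 'n coords)"
proof -
  note o = open_pent_domain[where 'n='n]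
  have nz: "1 - fst c $ j * snd c $ j \<noteq> 0" if "c \<in> pent_domain" for c :: "'n coords" and j
    using that by (auto simp: pent_domain_def)
  have "smooth_on pent_domain (\<lambda>c::'n coords. fst (pent_map c) $ i)" for i
    unfolding pent_map_def fst_conv vec_lambda_beta
    by (intro smooth_on_divide smooth_on_mult smooth_on_diff smooth_on_const smooth_on_coord o nz)
  moreover have "smooth_on pent_domain (\<lambda>c::'n coords. snd (pent_map c) $ i)" for i
    unfolding pent_map_def snd_conv vec_lambda_beta
    by (intro smooth_on_divide smooth_on_mult smooth_on_diff smooth_on_const smooth_on_coord o nz)
  ultimately have "smooth_on pent_domain (\<lambda>c::'n coords. (\<Sum>i\<in>UNIV. (fst (pent_map c) $ i) *\<^sub>R ex i) + (\<Sum>i\<in>UNIV. (snd (pent_map c) $ i) *\<^sub>R ey i))"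
    by (intro smooth_on_add smooth_on_sum smooth_on_scaleR smooth_on_const o)
  then show ?thesis unfolding coords_representation .
qed

lemma nonzero_coords_iff: "c \<in> nonzero_coords \<longleftrightarrow> (\<forall>i. fst c $ i \<noteq> 0) \<and> (\<forall>i. snd c $ i \<noteq> 0)"
  for c :: "'n::nontriv coords"
  by (simp add: nonzero_coords_def Basis_coords ball_Un inner_ex inner_ey)

text \<open>Shift terms are the same in the x and y derivatives, and the two parts of the bracket
  have opposite signs, so products of two shifts cancel. Products of a shift with a unit vector
  cancel by \<open>cyc_pent_shift\<close>, leaving the bracket of the coordinates.\<close>

theorem pent_map_bracket_invariant:
  "bracket_invariant_on (log_canonical pent_matrix) pent_domain (pent_map :: 'n::nontriv coords \<Rightarrow> 'n coords)"
proof (rule bracket_invariant_log_canonical)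
  show "pent_map differentiable at c" if "c \<in> pent_domain" for c :: "'n coords"
    using smooth_on_differentiable[OF smooth_pent_map that] .
  fix c d e :: "'n coords" assume c: "c \<in> pent_domain" and d: "d \<in> Basis" and e: "e \<in> Basis"
  let ?S = "\<lambda>d e. cyc (\<lambda>i. log_deriv (ey i) (\<lambda>c. pent_map c \<bullet> d) c) (\<lambda>i. log_deriv (ey i) (\<lambda>c. pent_map c \<bullet> e) c)
      - cyc (\<lambda>i. log_deriv (ex i) (\<lambda>c. pent_map c \<bullet> d) c) (\<lambda>i. log_deriv (ex i) (\<lambda>c. pent_map c \<bullet> e) c)"
  note L = log_deriv_pent_map[OF c] and X = inner_ex inner_ey
  have m: "(\<lambda>i. f i * k) = (\<lambda>i. k * f i)" for f :: "'n mod_ring \<Rightarrow> real" and k by (simp add: mult.commute)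
  have sk: "cyc (pent_shift c k) (\<delta> l) = - cyc (\<delta> k) (pent_shift c l)" for k l
    using cyc_pent_shift[of k c l] by simp
  have sh: "cyc (\<delta> (k + 1)) (\<delta> (l + 1)) = cyc (\<delta> k) (\<delta> l)" for k l :: "'n mod_ring"
    using cyc_shift[of "\<delta> (k + 1)" 1 "\<delta> (l + 1)"] by (simp add: \<delta>_def[abs_def])
  have xx: "?S (ex k) (ex l) = pent_matrix (ex k) (ex l) * (pent_map c \<bullet> ex k) * (pent_map c \<bullet> ex l)" for k l
    unfolding X L pent_matrix_ex by (simp only: m cyc_mult_left cyc_mult_right cyc_add_left cyc_add_right sk) (simp add: algebra_simps)
  have yy: "?S (ey k) (ey l) = pent_matrix (ey k) (ey l) * (pent_map c \<bullet> ey k) * (pent_map c \<bullet> ey l)" for k l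
    unfolding X L pent_matrix_ey by (simp only: m cyc_mult_left cyc_mult_right cyc_add_left cyc_add_right cyc_diff_left cyc_diff_right cyc_minus_left cyc_minus_right sk sh) (simp add: algebra_simps)
  have xy: "?S (ex k) (ey l) = pent_matrix (ex k) (ey l) * (pent_map c \<bullet> ex k) * (pent_map c \<bullet> ey l)" for k l
    unfolding X L pent_matrix_ex_ey by (simp only: m cyc_mult_left cyc_mult_right cyc_add_left cyc_add_right cyc_diff_left cyc_diff_right cyc_minus_left cyc_minus_right sk) (simp add: algebra_simps)
  have yx: "?S (ey k) (ex l) = pent_matrix (ey k) (ex l) * (pent_map c \<bullet> ey k) * (pent_map c \<bullet> ex l)" for k l
  proof -
    have "?S (ey k) (ex l) = - ?S (ex l) (ey k)" by (subst (1 2) cyc_skew) simp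
    also have "\<dots> = pent_matrix (ey k) (ex l) * (pent_map c \<bullet> ey k) * (pent_map c \<bullet> ex l)"
      unfolding xy pent_matrix_skew[of "ey k"] by simp
    finally show ?thesis .
  qed
  have "(\<exists>k. d = ex k) \<or> (\<exists>k. d = ey k)" "(\<exists>k. e = ex k) \<or> (\<exists>k. e = ey k)"
    using d e by (auto simp: Basis_coords)
  then have "?S d e = pent_matrix d e * (pent_map c \<bullet> d) * (pent_map c \<bullet> e)"
    using xx yy xy yx by blast
  then show "(\<Sum>a\<in>Basis. \<Sum>b\<in>Basis. pent_matrix a b * log_deriv a (\<lambda>c. pent_map c \<bullet> d) c * log_deriv b (\<lambda>c. pent_map c \<bullet> e) c)
      = pent_matrix d e * (pent_map c \<bullet> d) * (pent_map c \<bullet> e)"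
    unfolding pent_matrix_sum .
qed

section \<open>Commutation of the monodromy invariants\<close>

context overlap_relation
begin

definition indep_sets :: "nat \<Rightarrow> 't set set" where
  "indep_sets k = {A. (\<forall>s\<in>A. \<forall>t\<in>A. \<not> N s t) \<and> card A = k}"

lemma imbalance_pair:
  "real_of_int (imbalance (A \<times> {True} \<union> B \<times> {False})) = (\<Sum>s\<in>A. \<Sum>t\<in>B. of_bool (N t s) - of_bool (N s t))"
proof -
  let ?V = "A \<times> {True} \<union> B \<times> {False}"
  have c: "real (card {(s, t). s \<in> A \<and> t \<in> B \<and> Q s t}) = (\<Sum>s\<in>A. \<Sum>t\<in>B. of_bool (Q s t))" for Q
  proof -
    have "{(s, t). s \<in> A \<and> t \<in> B \<and> Q s t} = (A \<times> B) \<inter> {p. Q (fst p) (snd p)}" by auto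
    then have "real (card {(s, t). s \<in> A \<and> t \<in> B \<and> Q s t}) = (\<Sum>p\<in>A \<times> B. of_bool (Q (fst p) (snd p)))"
      by simp
    also have "\<dots> = (\<Sum>s\<in>A. \<Sum>t\<in>B. of_bool (Q s t))"
      unfolding sum.cartesian_product case_prod_beta ..
    finally show ?thesis .
  qed
  have "{(v, u). (v, u) \<in> conf_edge N ?V \<and> snd u} = (\<lambda>(s, t). ((t, False), (s, True))) ` {(s, t). s \<in> A \<and> t \<in> B \<and> N t s}"
    by (auto simp: conf_edge_def image_iff)
  then have 1: "card {(v, u). (v, u) \<in> conf_edge N ?V \<and> snd u} = card {(s, t). s \<in> A \<and> t \<in> B \<and> N t s}"
    by (simp add: card_image inj_on_def)
  have "{(v, u). (v, u) \<in> conf_edge N ?V \<and> snd v} = (\<lambda>(s, t). ((s, True), (t, False))) ` {(s, t). s \<in> A \<and> t \<in> B \<and> N s t}"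
    by (auto simp: conf_edge_def image_iff)
  then have 2: "card {(v, u). (v, u) \<in> conf_edge N ?V \<and> snd v} = card {(s, t). s \<in> A \<and> t \<in> B \<and> N s t}"
    by (simp add: card_image inj_on_def)
  show ?thesis
    unfolding imbalance_def 1 2 of_int_diff of_int_of_nat_eq c by (simp add: sum_subtractf)
qed

text \<open>\<open>sum_imbalance_zero\<close> in the form in which it meets brackets: the flagged
  configuration is split back into the pair of monomials.\<close>

theorem sum_pairs_zero:
  fixes w :: "'t \<Rightarrow> real"
  shows "(\<Sum>A\<in>indep_sets k. \<Sum>B\<in>indep_sets l. (\<Sum>s\<in>A. \<Sum>t\<in>B. of_bool (N t s) - of_bool (N s t)) * ((\<Prod>t\<in>A. w t) * (\<Prod>t\<in>B. w t))) = 0"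
proof -
  let ?h = "\<lambda>(A, B). (\<Sum>s\<in>A. \<Sum>t\<in>B. of_bool (N t s) - of_bool (N s t)) * ((\<Prod>t\<in>A. w t) * (\<Prod>t\<in>B. w t))"
  have "(\<Sum>p\<in>indep_sets k \<times> indep_sets l. ?h p) = (\<Sum>V\<in>confs k l. of_int (imbalance V) * (\<Prod>v\<in>V. w (fst v)))"
  proof (rule sum.reindex_bij_witness[where j="\<lambda>(A, B). A \<times> {True} \<union> B \<times> {False}"
        and i="\<lambda>V. ({t. (t, True) \<in> V}, {t. (t, False) \<in> V})"])
    fix p assume "p \<in> indep_sets k \<times> indep_sets l"
    then obtain A B where p: "p = (A, B)" and A: "\<forall>s\<in>A. \<forall>t\<in>A. \<not> N s t" "card A = k"
      and B: "\<forall>s\<in>B. \<forall>t\<in>B. \<not> N s t" "card B = l" by (auto simp: indep_sets_def)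
    let ?V = "A \<times> {True} \<union> B \<times> {False}"
    show "(\<lambda>V. ({t. (t, True) \<in> V}, {t. (t, False) \<in> V})) ((\<lambda>(A, B). A \<times> {True} \<union> B \<times> {False}) p) = p"
      by (simp add: p)
    have "{v \<in> ?V. snd v} = A \<times> {True}" "{v \<in> ?V. \<not> snd v} = B \<times> {False}" by auto
    moreover have "indep_conf N ?V" using A B by (auto simp: indep_conf_def)
    ultimately show "(\<lambda>(A, B). A \<times> {True} \<union> B \<times> {False}) p \<in> confs k l"
      using A B by (simp add: p confs_def card_cartesian_product)
    have "(\<Prod>v\<in>?V. w (fst v)) = (\<Prod>v\<in>A \<times> {True}. w (fst v)) * (\<Prod>v\<in>B \<times> {False}. w (fst v))"
      by (rule prod.union_disjoint) auto
    also have "\<dots> = (\<Prod>t\<in>A. w t) * (\<Prod>t\<in>B. w t)"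
    proof -
      have "X \<times> {b} = (\<lambda>t. (t, b)) ` X" for X :: "'t set" and b :: bool by auto
      then show ?thesis by (simp add: prod.reindex inj_on_def)
    qed
    finally show "of_int (imbalance ((\<lambda>(A, B). A \<times> {True} \<union> B \<times> {False}) p)) * (\<Prod>v\<in>(\<lambda>(A, B). A \<times> {True} \<union> B \<times> {False}) p. w (fst v)) = ?h p"
      by (simp add: p imbalance_pair)
  next
    fix V assume V: "V \<in> confs k l"
    let ?A = "{t. (t, True) \<in> V}" and ?B = "{t. (t, False) \<in> V}"
    have VAB: "V = ?A \<times> {True} \<union> ?B \<times> {False}"
    proof (rule Set.set_eqI)
      fix v show "v \<in> V \<longleftrightarrow> v \<in> ?A \<times> {True} \<union> ?B \<times> {False}" by (cases v; cases "snd v") auto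
    qed
    then show "(\<lambda>(A, B). A \<times> {True} \<union> B \<times> {False}) ({t. (t, True) \<in> V}, {t. (t, False) \<in> V}) = V"
      by simp
    have "v \<in> {v \<in> V. snd v} \<longleftrightarrow> v \<in> ?A \<times> {True}" "v \<in> {v \<in> V. \<not> snd v} \<longleftrightarrow> v \<in> ?B \<times> {False}" for v
      by (cases v; cases "snd v"; simp)+
    then have "{v \<in> V. snd v} = ?A \<times> {True}" "{v \<in> V. \<not> snd v} = ?B \<times> {False}"
      by (metis (no_types, lifting) Set.set_eqI)+
    then have "card ?A = k" "card ?B = l" using V by (auto simp: confs_def card_cartesian_product)
    moreover have *: "\<not> N (fst v) (fst u)" if "v \<in> V" "u \<in> V" "snd v = snd u" for v u
      using V that unfolding confs_def indep_conf_def by blast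
    have "\<forall>s\<in>?A. \<forall>t\<in>?A. \<not> N s t" "\<forall>s\<in>?B. \<forall>t\<in>?B. \<not> N s t"
      using *[of "(_, True)" "(_, True)"] *[of "(_, False)" "(_, False)"] by simp_all
    ultimately show "({t. (t, True) \<in> V}, {t. (t, False) \<in> V}) \<in> indep_sets k \<times> indep_sets l"
      by (simp add: indep_sets_def)
  qed
  then show ?thesis using sum_imbalance_zero[of w k l] by (simp add: sum.cartesian_product)
qed

end

section \<open>Two invariants of the same family\<close>

text \<open>\<open>Inl i\<close> stands for \<open>X\<^sub>i\<close> or \<open>Y\<^sub>i\<close>, and \<open>Inr j\<close> for \<open>x\<^sub>j\<close> or \<open>y\<^sub>j\<close>.\<close>

type_synonym 'n tile = "'n mod_ring + 'n mod_ring"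

text \<open>The forward half of the consecutivity rules. For n = 3 and n = 4 it can hold in both
  directions between the same tiles.\<close>

fun precedes :: "'n::nontriv tile \<Rightarrow> 'n tile \<Rightarrow> bool" where
  "precedes (Inl i) (Inl j) \<longleftrightarrow> j = i + 1 \<or> j = i + 2"
| "precedes (Inl i) (Inr j) \<longleftrightarrow> j = i + 1 \<or> j = i + 2"
| "precedes (Inr i) (Inl j) \<longleftrightarrow> j = i \<or> j = i + 1"
| "precedes (Inr i) (Inr j) \<longleftrightarrow> j = i + 1"

lemma tiles_overlap: "overlap_relation (precedes :: 'n::nontriv tile \<Rightarrow> _)"
proof
  have two: "i + 2 = i + 1 + 1" for i :: "'n mod_ring" by (simp add: add.assoc)
  fix a b b' :: "'n tile"
  show "precedes a b \<Longrightarrow> precedes a b' \<Longrightarrow> b = b' \<or> precedes b b' \<or> precedes b' b"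
    by (cases a; cases b; cases b') (auto simp: two)
  show "precedes a b \<Longrightarrow> precedes b' b \<Longrightarrow> a = b' \<or> precedes a b' \<or> precedes b' a"
    by (cases a; cases b; cases b') (auto simp: two)
qed

interpretation tiles: overlap_relation precedes
  by (rule tiles_overlap)

lemma indep_tiles_iff:
  assumes n: "3 \<le> CARD('n::nontriv)"
  shows "(\<forall>s\<in>A. \<forall>t\<in>A. \<not> precedes s t) \<longleftrightarrow> admissible {i. Inl i \<in> A} {j :: 'n mod_ring. Inr j \<in> A}"
proof -
  note [simp] = mod_ring_small_neq_0[OF n]
  have s: "(\<forall>s\<in>A. \<forall>t\<in>A. \<not> precedes s t) \<longleftrightarrow>
    (\<forall>i j. Inl i \<in> A \<and> Inl j \<in> A \<longrightarrow> j \<noteq> i + 1 \<and> j \<noteq> i + 2) \<and>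
    (\<forall>i j. Inl i \<in> A \<and> Inr j \<in> A \<longrightarrow> j \<noteq> i + 1 \<and> j \<noteq> i + 2 \<and> i \<noteq> j \<and> i \<noteq> j + 1) \<and>
    (\<forall>i j. Inr i \<in> A \<and> Inr j \<in> A \<longrightarrow> j \<noteq> i + 1)" (is "?L \<longleftrightarrow> ?R")
  proof
    assume L: ?L
    then have *: "\<And>s t. s \<in> A \<Longrightarrow> t \<in> A \<Longrightarrow> \<not> precedes s t" by blast
    show ?R
      using *[of "Inl _" "Inl _"] *[of "Inl _" "Inr _"] *[of "Inr _" "Inl _"] *[of "Inr _" "Inr _"] by simp
  next
    assume R: ?R
    show ?L
    proof (intro ballI)
      fix s t assume "s \<in> A" "t \<in> A"
      then show "\<not> precedes s t" using R by (cases s; cases t) auto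
    qed
  qed
  have e: "(j = i - 1) = (i = j + 1)" "(j = i - 2) = (i = j + 2)" for i j :: "'n mod_ring" by auto
  show ?thesis
    unfolding s unfolding admissible_def mem_Collect_eq insert_iff empty_iff e Ball_def
  proof (intro arg_cong2[where f="(\<and>)"], goal_cases)
    case 1
    have "i \<noteq> i + 1" "i \<noteq> i + 2" for i :: "'n mod_ring" by simp_all
    then show ?case by blast
  qed blast+
qed

lemma tile_split: "A = Inl ` {i. Inl i \<in> A} \<union> Inr ` {j. Inr j \<in> A}"
proof (rule Set.set_eqI)
  fix x show "x \<in> A \<longleftrightarrow> x \<in> Inl ` {i. Inl i \<in> A} \<union> Inr ` {j. Inr j \<in> A}"
    by (cases x) auto
qed

lemma prod_tiles:
  fixes f :: "'a::finite + 'b::finite \<Rightarrow> 'c::comm_monoid_mult"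
  shows "(\<Prod>t\<in>A. f t) = (\<Prod>i | Inl i \<in> A. f (Inl i)) * (\<Prod>j | Inr j \<in> A. f (Inr j))"
proof -
  have "(\<Prod>t\<in>A. f t) = (\<Prod>t\<in>Inl ` {i. Inl i \<in> A} \<union> Inr ` {j. Inr j \<in> A}. f t)"
    using tile_split[of A] by simp
  also have "\<dots> = (\<Prod>t\<in>Inl ` {i. Inl i \<in> A}. f t) * (\<Prod>t\<in>Inr ` {j. Inr j \<in> A}. f t)"
    by (rule prod.union_disjoint) auto
  finally show ?thesis by (simp add: prod.reindex)
qed

lemma sum_tiles:
  fixes f :: "'a::finite + 'b::finite \<Rightarrow> 'c::comm_monoid_add"
  shows "(\<Sum>t\<in>A. f t) = (\<Sum>i | Inl i \<in> A. f (Inl i)) + (\<Sum>j | Inr j \<in> A. f (Inr j))"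
proof -
  have "(\<Sum>t\<in>A. f t) = (\<Sum>t\<in>Inl ` {i. Inl i \<in> A} \<union> Inr ` {j. Inr j \<in> A}. f t)"
    using tile_split[of A] by simp
  also have "\<dots> = (\<Sum>t\<in>Inl ` {i. Inl i \<in> A}. f t) + (\<Sum>t\<in>Inr ` {j. Inr j \<in> A}. f t)"
    by (rule sum.union_disjoint) auto
  finally show ?thesis by (simp add: sum.reindex)
qed

lemma card_tiles: "card (A :: ('a::finite + 'b::finite) set) = card {i. Inl i \<in> A} + card {j. Inr j \<in> A}"
  using sum_tiles[of "\<lambda>_. 1 :: nat" A] by simp

lemma admissible_sum_tiles:
  assumes n: "3 \<le> CARD('n::nontriv)"
  shows "admissible_sum k X x = (\<Sum>A\<in>tiles.indep_sets k. \<Prod>t\<in>A. case t of Inl i \<Rightarrow> X i | Inr j \<Rightarrow> - x (j :: 'n mod_ring))"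
  unfolding admissible_sum_def
proof (rule sum.reindex_bij_witness[where i="\<lambda>A. ({i. Inl i \<in> A}, {j. Inr j \<in> A})" and j="\<lambda>(I, J). Inl ` I \<union> Inr ` J"])
  fix A assume "A \<in> (tiles.indep_sets k :: 'n tile set set)"
  then show "({i. Inl i \<in> A}, {j. Inr j \<in> A}) \<in> {(I, J). admissible I J \<and> card I + card J = k}"
    by (simp add: tiles.indep_sets_def indep_tiles_iff[OF n] card_tiles[of A])
  show "(\<lambda>(I, J). Inl ` I \<union> Inr ` J) ({i. Inl i \<in> A}, {j. Inr j \<in> A}) = A"
    unfolding split by (rule tile_split[symmetric])
next
  fix p assume p: "p \<in> {(I, J :: 'n mod_ring set). admissible I J \<and> card I + card J = k}"
  obtain I J where IJ: "p = (I, J)" by (metis prod.exhaust)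
  have s: "{i. Inl i \<in> Inl ` I \<union> Inr ` J} = I" "{j. Inr j \<in> Inl ` I \<union> Inr ` J} = J" by auto
  show "({i. Inl i \<in> (\<lambda>(I, J). Inl ` I \<union> Inr ` J) p}, {j. Inr j \<in> (\<lambda>(I, J). Inl ` I \<union> Inr ` J) p}) = p"
    unfolding IJ split s ..
  show "(\<lambda>(I, J). Inl ` I \<union> Inr ` J) p \<in> tiles.indep_sets k"
    using p unfolding IJ split tiles.indep_sets_def mem_Collect_eq indep_tiles_iff[OF n] card_tiles s by simp
  show "(\<Prod>t\<in>(\<lambda>(I, J). Inl ` I \<union> Inr ` J) p. case t of Inl i \<Rightarrow> X i | Inr j \<Rightarrow> - x j) =
      (case p of (I, J) \<Rightarrow> (- 1) ^ card J * ((\<Prod>i\<in>I. X i) * (\<Prod>j\<in>J. x j)))"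
    unfolding IJ split prod_tiles s by (simp add: prod_uminus)
qed

definition O_tile :: "'n::nontriv coords \<Rightarrow> 'n tile \<Rightarrow> real" where
  "O_tile c t = (case t of Inl i \<Rightarrow> fst c $ i * snd c $ i * fst c $ (i + 1) | Inr j \<Rightarrow> - (fst c $ j))"

definition E_tile :: "'n::nontriv coords \<Rightarrow> 'n tile \<Rightarrow> real" where
  "E_tile c t = (case t of Inl i \<Rightarrow> snd c $ i * fst c $ (i + 1) * snd c $ (i + 1) | Inr j \<Rightarrow> - (snd c $ j))"

lemma O_inv_tiles: "3 \<le> CARD('n::nontriv) \<Longrightarrow> O_inv k = (\<lambda>c :: 'n coords. \<Sum>A\<in>tiles.indep_sets k. \<Prod>t\<in>A. O_tile c t)"
  and E_inv_tiles: "3 \<le> CARD('n::nontriv) \<Longrightarrow> E_inv k = (\<lambda>c :: 'n coords. \<Sum>A\<in>tiles.indep_sets k. \<Prod>t\<in>A. E_tile c t)"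
  unfolding O_inv_def E_inv_def O_tile_def E_tile_def case_prod_beta' by (simp_all only: admissible_sum_tiles)

text \<open>\<open>Ox t j\<close> is the exponent of \<open>x\<^sub>j\<close> in \<open>O_tile c t\<close>, and similarly for the others.\<close>

fun Ox :: "'n::nontriv tile \<Rightarrow> 'n mod_ring \<Rightarrow> real" where
  "Ox (Inl i) j = \<delta> i j + \<delta> (i + 1) j" | "Ox (Inr i) j = \<delta> i j"
fun Oy :: "'n::nontriv tile \<Rightarrow> 'n mod_ring \<Rightarrow> real" where
  "Oy (Inl i) j = \<delta> i j" | "Oy (Inr i) j = 0"
fun Ex :: "'n::nontriv tile \<Rightarrow> 'n mod_ring \<Rightarrow> real" where
  "Ex (Inl i) j = \<delta> (i + 1) j" | "Ex (Inr i) j = 0"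
fun Ey :: "'n::nontriv tile \<Rightarrow> 'n mod_ring \<Rightarrow> real" where
  "Ey (Inl i) j = \<delta> i j + \<delta> (i + 1) j" | "Ey (Inr i) j = \<delta> i j"

lemma log_deriv_minus: "f differentiable at c \<Longrightarrow> log_deriv a (\<lambda>c. - f c) c = - log_deriv a f c"
  using log_deriv_has_derivative[OF has_derivative_minus, of f "frechet_derivative f (at c)" c a]
  by (simp add: frechet_derivative_works[symmetric] log_deriv_def)

lemma differentiable_O_tile: "(\<lambda>c. O_tile c t) differentiable at c"
  and differentiable_E_tile: "(\<lambda>c. E_tile c t) differentiable at c"
  by (cases t; simp add: O_tile_def E_tile_def; intro differentiable_mult differentiable_coord differentiable_minus)+

lemma log_deriv_O_tile: "log_deriv (ex j) (\<lambda>c. O_tile c t) c = Ox t j * O_tile c t"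
    "log_deriv (ey j) (\<lambda>c. O_tile c t) c = Oy t j * O_tile c t"
  and log_deriv_E_tile: "log_deriv (ex j) (\<lambda>c. E_tile c t) c = Ex t j * E_tile c t"
    "log_deriv (ey j) (\<lambda>c. E_tile c t) c = Ey t j * E_tile c t"
  by (cases t; simp add: O_tile_def E_tile_def log_deriv_minus log_deriv_mult differentiable_mult differentiable_coord
      log_deriv_ex log_deriv_ey log_deriv_ex_y log_deriv_ey_x algebra_simps)+

lemma differentiable_prod:
  fixes w :: "'a::real_normed_vector \<Rightarrow> 't \<Rightarrow> real"
  assumes "\<And>t. (\<lambda>c. w c t) differentiable at c"
  shows "(\<lambda>c. \<Prod>t\<in>A. w c t) differentiable at c"
  by (induction A rule: infinite_finite_induct) (auto intro!: differentiable_mult assms)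

lemma log_deriv_prod:
  fixes w :: "'a::euclidean_space \<Rightarrow> 't \<Rightarrow> real"
  assumes "finite A" "\<And>t. (\<lambda>c. w c t) differentiable at c" "\<And>t. log_deriv a (\<lambda>c. w c t) c = \<epsilon> t * w c t"
  shows "log_deriv a (\<lambda>c. \<Prod>t\<in>A. w c t) c = (\<Sum>t\<in>A. \<epsilon> t) * (\<Prod>t\<in>A. w c t)"
  using assms(1)
proof induction
  case empty
  show ?case by (simp add: log_deriv_def)
next
  case (insert t A)
  then show ?case
    by (simp add: log_deriv_mult differentiable_prod assms algebra_simps)
qed

lemma log_deriv_sum_prod:
  fixes w :: "'a::euclidean_space \<Rightarrow> 't::finite \<Rightarrow> real"
  assumes d: "\<And>t. (\<lambda>c. w c t) differentiable at c" and l: "\<And>t. log_deriv a (\<lambda>c. w c t) c = \<epsilon> t * w c t"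
  shows "log_deriv a (\<lambda>c. \<Sum>A\<in>S. \<Prod>t\<in>A. w c t) c = (\<Sum>A\<in>S. \<Sum>t\<in>A. (\<Prod>t\<in>A. w c t) * \<epsilon> t)"
proof -
  have "log_deriv a (\<lambda>c. \<Sum>A\<in>S. 1 * (\<Prod>t\<in>A. w c t)) c = (\<Sum>A\<in>S. 1 * log_deriv a (\<lambda>c. \<Prod>t\<in>A. w c t) c)"
    by (rule log_deriv_sum[OF finite]) (rule differentiable_prod[OF d])
  also have "\<dots> = (\<Sum>A\<in>S. \<Sum>t\<in>A. (\<Prod>t\<in>A. w c t) * \<epsilon> t)"
    using log_deriv_prod[where w=w and c=c and a=a and \<epsilon>=\<epsilon>, OF finite d l] by (simp add: sum_distrib_right mult.commute)
  finally show ?thesis by simp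
qed

lemma bracket_tile_sums:
  fixes w w' :: "'n::nontriv coords \<Rightarrow> 'n tile \<Rightarrow> real"
  assumes d: "\<And>t. (\<lambda>c. w c t) differentiable at c" "\<And>t. (\<lambda>c. w' c t) differentiable at c"
    and l: "\<And>t j. log_deriv (ex j) (\<lambda>c. w c t) c = ax t j * w c t" "\<And>t j. log_deriv (ey j) (\<lambda>c. w c t) c = ay t j * w c t"
    and l': "\<And>t j. log_deriv (ex j) (\<lambda>c. w' c t) c = bx t j * w' c t" "\<And>t j. log_deriv (ey j) (\<lambda>c. w' c t) c = by' t j * w' c t"
  shows "bracket (log_canonical pent_matrix) (\<lambda>c. \<Sum>A\<in>S. \<Prod>t\<in>A. w c t) (\<lambda>c. \<Sum>B\<in>S'. \<Prod>t\<in>B. w' c t) c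
    = (\<Sum>A\<in>S. \<Sum>B\<in>S'. (\<Sum>s\<in>A. \<Sum>t\<in>B. cyc (ay s) (by' t) - cyc (ax s) (bx t)) * ((\<Prod>t\<in>A. w c t) * (\<Prod>t\<in>B. w' c t)))"
proof -
  have df: "(\<lambda>c. \<Sum>A\<in>S. \<Prod>t\<in>A. w c t) differentiable at c" "(\<lambda>c. \<Sum>B\<in>S'. \<Prod>t\<in>B. w' c t) differentiable at c"
    by (intro differentiable_sum finite ballI differentiable_prod d)+
  note L = log_deriv_sum_prod[where S=S and w=w, OF d(1)] log_deriv_sum_prod[where S=S' and w=w', OF d(2)]
  have "bracket (log_canonical pent_matrix) (\<lambda>c. \<Sum>A\<in>S. \<Prod>t\<in>A. w c t) (\<lambda>c. \<Sum>B\<in>S'. \<Prod>t\<in>B. w' c t) c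
    = cyc (\<lambda>i. \<Sum>A\<in>S. \<Sum>s\<in>A. (\<Prod>t\<in>A. w c t) * ay s i) (\<lambda>i. \<Sum>B\<in>S'. \<Sum>t\<in>B. (\<Prod>t\<in>B. w' c t) * by' t i)
     - cyc (\<lambda>i. \<Sum>A\<in>S. \<Sum>s\<in>A. (\<Prod>t\<in>A. w c t) * ax s i) (\<lambda>i. \<Sum>B\<in>S'. \<Sum>t\<in>B. (\<Prod>t\<in>B. w' c t) * bx t i)"
    unfolding bracket_pent[OF df] L(1)[OF l(1)] L(1)[OF l(2)] L(2)[OF l'(1)] L(2)[OF l'(2)] ..
  also have "\<dots> = (\<Sum>A\<in>S. \<Sum>B\<in>S'. \<Sum>s\<in>A. \<Sum>t\<in>B. (\<Prod>t\<in>A. w c t) * ((\<Prod>t\<in>B. w' c t) * cyc (ay s) (by' t)))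
     - (\<Sum>A\<in>S. \<Sum>B\<in>S'. \<Sum>s\<in>A. \<Sum>t\<in>B. (\<Prod>t\<in>A. w c t) * ((\<Prod>t\<in>B. w' c t) * cyc (ax s) (bx t)))"
  proof -
    have "cyc (\<lambda>i. \<Sum>A\<in>S. \<Sum>s\<in>A. (\<Prod>t\<in>A. w c t) * p s i) (\<lambda>i. \<Sum>B\<in>S'. \<Sum>t\<in>B. (\<Prod>t\<in>B. w' c t) * q t i)
      = (\<Sum>A\<in>S. \<Sum>B\<in>S'. \<Sum>s\<in>A. \<Sum>t\<in>B. (\<Prod>t\<in>A. w c t) * ((\<Prod>t\<in>B. w' c t) * cyc (p s) (q t)))" for p q :: "'n tile \<Rightarrow> 'n mod_ring \<Rightarrow> real"
      unfolding cyc_sum_left cyc_sum_right cyc_mult_left cyc_mult_right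
      by (rule sum.cong[OF refl]) (subst sum.swap, simp add: sum_distrib_left)
    note * = this
    show ?thesis by (rule arg_cong2[where f="(-)"]; rule *)
  qed
  finally show ?thesis
    by (simp add: sum_subtractf sum_distrib_left sum_distrib_right algebra_simps)
qed

lemma cyc_\<delta>_\<delta>: "cyc (\<delta> i) (\<delta> j) = of_bool (j = i + 1) - of_bool (i = j + 1)"
  unfolding cyc_\<delta>_left \<delta>_def by (auto simp: algebra_simps)

lemma cyc_fun_zero: "cyc (\<lambda>i. 0) \<beta> = 0" "cyc \<alpha> (\<lambda>i. 0) = 0"
  by (simp_all add: cyc_def)

lemma exponent_eqs:
  "Ox (Inl i) = (\<lambda>j. \<delta> i j + \<delta> (i + 1) j)" "Ox (Inr i) = \<delta> i" "Oy (Inl i) = \<delta> i" "Oy (Inr i) = (\<lambda>j. 0)"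
  "Ex (Inl i) = \<delta> (i + 1)" "Ex (Inr i) = (\<lambda>j. 0)" "Ey (Inl i) = (\<lambda>j. \<delta> i j + \<delta> (i + 1) j)" "Ey (Inr i) = \<delta> i"
  by (simp_all add: fun_eq_iff)

text \<open>The bracket of the logarithms of two factors is their signed adjacency. Exchanging the
  roles of the letters x and y reverses the bracket, hence the opposite sign for the second
  family.\<close>

lemma tile_pairing:
  fixes s t :: "'n::nontriv tile"
  assumes n: "3 \<le> CARD('n)"
  shows "cyc (Oy s) (Oy t) - cyc (Ox s) (Ox t) = of_bool (precedes t s) - of_bool (precedes s t)"
    and "cyc (Ey s) (Ey t) - cyc (Ex s) (Ex t) = of_bool (precedes s t) - of_bool (precedes t s)"
proof -
  note [simp] = mod_ring_small_neq_0[OF n]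
  have two: "i + 2 = i + 1 + 1" for i :: "'n mod_ring" by (simp add: add.assoc)
  have "(2 :: 'n mod_ring) \<noteq> 1" by (metis add_cancel_left_left mod_ring_small_neq_0(1)[OF n] one_add_one)
  then have ne: "i + 1 + 1 \<noteq> i + 1" "i + 1 \<noteq> i" "(1 :: 'n mod_ring) \<noteq> 2" "(2 :: 'n mod_ring) \<noteq> 1" for i :: "'n mod_ring" by auto
  have "(4 :: 'n mod_ring) = 3 + 1" by simp
  \<comment> \<open>Serves n = 3, where offsets 1 and 4 coincide and a pair can be adjacent on both
    sides.\<close>
  then have f34: "(3 :: 'n mod_ring) = 0 \<Longrightarrow> (4 :: 'n mod_ring) = 1" by simp
  show "cyc (Oy s) (Oy t) - cyc (Ox s) (Ox t) = of_bool (precedes t s) - of_bool (precedes s t)"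
    by (cases s; cases t)
       (auto simp: exponent_eqs cyc_add_left cyc_add_right cyc_fun_zero cyc_\<delta>_\<delta> two of_bool_def ne f34)
  show "cyc (Ey s) (Ey t) - cyc (Ex s) (Ex t) = of_bool (precedes s t) - of_bool (precedes t s)"
    by (cases s; cases t)
       (auto simp: exponent_eqs cyc_add_left cyc_add_right cyc_fun_zero cyc_\<delta>_\<delta> two of_bool_def ne f34)
qed

theorem O_O_commute:
  assumes n: "3 \<le> CARD('n::nontriv)"
  shows "bracket (log_canonical pent_matrix) (O_inv k) (O_inv l) (c :: 'n coords) = 0"
  unfolding O_inv_tiles[OF n]
    bracket_tile_sums[OF differentiable_O_tile differentiable_O_tile log_deriv_O_tile log_deriv_O_tile]
    tile_pairing[OF n]
  by (rule tiles.sum_pairs_zero)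

theorem E_E_commute:
  assumes n: "3 \<le> CARD('n::nontriv)"
  shows "bracket (log_canonical pent_matrix) (E_inv k) (E_inv l) (c :: 'n coords) = 0"
proof -
  have "bracket (log_canonical pent_matrix) (E_inv k) (E_inv l) c =
     - (\<Sum>A\<in>tiles.indep_sets k. \<Sum>B\<in>tiles.indep_sets l. (\<Sum>s\<in>A. \<Sum>t\<in>B. of_bool (precedes t s) - of_bool (precedes s t))
        * ((\<Prod>t\<in>A. E_tile c t) * (\<Prod>t\<in>B. E_tile c t)))"
    unfolding E_inv_tiles[OF n]
      bracket_tile_sums[OF differentiable_E_tile differentiable_E_tile log_deriv_E_tile log_deriv_E_tile]
      tile_pairing[OF n]
    by (simp add: sum_negf[symmetric] sum_subtractf algebra_simps)
  then show ?thesis by (simp add: tiles.sum_pairs_zero)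
qed

section \<open>One invariant from each family\<close>

text \<open>The letters \<open>x\<^sub>i\<close>, \<open>y\<^sub>i\<close> in the cyclic order \<open>x\<^sub>1, y\<^sub>1, x\<^sub>2, y\<^sub>2, \<dots>\<close>; \<open>(i, True)\<close> stands for \<open>y\<^sub>i\<close>.\<close>

definition letter_shift :: "'n::nontriv mod_ring \<times> bool \<Rightarrow> int \<Rightarrow> 'n mod_ring \<times> bool" where
  "letter_shift p a = (fst p + of_int ((a + of_bool (snd p)) div 2), odd (a + of_bool (snd p)))"

text \<open>With \<open>x\<^sub>i\<close> at position \<open>2 i\<close> and
  \<open>y\<^sub>i\<close> at \<open>2 i + 1\<close>, the shift is addition modulo
  \<open>2 n\<close>, split into an index and a parity.\<close>

lemma letters_cyclic:
  assumes n: "3 \<le> CARD('n::nontriv)"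
  shows "cyclic_positions (2 * int CARD('n)) (letter_shift :: 'n mod_ring \<times> bool \<Rightarrow> _)"
proof
  show "6 \<le> 2 * int CARD('n)" using n by simp
  fix p q :: "'n mod_ring \<times> bool" and a b :: int
  have d: "z div 2 + (b + of_bool (odd z)) div 2 = (z + b) div 2" for z :: int
    by (cases "odd z") (auto elim!: oddE evenE simp: add_ac)
  have o: "odd (b + of_bool (odd z)) = odd (z + b)" for z :: int by auto
  show "letter_shift (letter_shift p a) b = letter_shift p (a + b)"
    unfolding letter_shift_def fst_conv snd_conv o add.assoc of_int_add[symmetric] d
    by (simp add: add_ac)
  show "(letter_shift p a = letter_shift p b) = (2 * int CARD('n) dvd a - b)"
  proof -
    let ?z = "a + of_bool (snd p)" and ?w = "b + of_bool (snd p)"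
    have "letter_shift p a = letter_shift p b \<longleftrightarrow> int CARD('n) dvd ?z div 2 - ?w div 2 \<and> odd ?z = odd ?w"
      by (simp add: letter_shift_def mod_ring_of_int_eq_iff)
    also have "\<dots> \<longleftrightarrow> 2 * int CARD('n) dvd ?z - ?w"
    proof -
      have half: "z - w = 2 * (z div 2 - w div 2)" if "odd z = odd w" for z w :: int
        using that by presburger
      show ?thesis
    proof
      assume *: "int CARD('n) dvd ?z div 2 - ?w div 2 \<and> odd ?z = odd ?w"
      then have "?z - ?w = 2 * (?z div 2 - ?w div 2)" by (intro half) blast
      then show "2 * int CARD('n) dvd ?z - ?w" using * by (metis mult_dvd_mono dvd_refl)
    next
      assume *: "2 * int CARD('n) dvd ?z - ?w"
      then have "even (?z - ?w)" by (rule dvd_trans[rotated]) simp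
      then have e: "odd ?z = odd ?w" by (simp only: even_diff even_add)
      have "2 * int CARD('n) dvd 2 * (?z div 2 - ?w div 2)" using * half[OF e] by metis
      then have "int CARD('n) dvd ?z div 2 - ?w div 2" by (simp only: dvd_times_left_cancel_iff[of "2::int"])
      then show "int CARD('n) dvd ?z div 2 - ?w div 2 \<and> odd ?z = odd ?w" using e by blast
    qed
    qed
    finally show ?thesis by simp
  qed
  obtain m where m: "fst q - fst p = of_int m" using mod_ring_of_int_surj by blast
  have "letter_shift p (2 * m + of_bool (snd q) - of_bool (snd p)) = q"
    by (cases q; cases "snd q") (use m in \<open>auto simp: letter_shift_def algebra_simps\<close>)
  then show "\<exists>a. q = letter_shift p a" by metis
qed

lemma letter_shift_simps:
  "letter_shift (i, True) 1 = (i + 1, False)" "letter_shift (i, True) 2 = (i + 1, True)"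
  "letter_shift (i, True) 3 = (i + 2, False)" "letter_shift (i, True) 4 = (i + 2, True)"
  "letter_shift (i, True) (-1) = (i, False)" "letter_shift (i, True) (-2) = (i - 1, True)"
  "letter_shift (i, True) (-3) = (i - 1, False)"
  "letter_shift (i, False) 1 = (i, True)" "letter_shift (i, False) 2 = (i + 1, False)"
  "letter_shift (i, False) 3 = (i + 1, True)" "letter_shift (i, False) 4 = (i + 2, False)"
  "letter_shift (i, False) (-1) = (i - 1, True)" "letter_shift (i, False) (-2) = (i - 1, False)"
  "letter_shift (i, False) (-3) = (i - 2, True)"
  by (simp_all add: letter_shift_def)

text \<open>\<open>A\<close> is the tile set of a monomial of the O family and \<open>B\<close> that
  of a monomial of the E family.\<close>

definition singles :: "'n::nontriv tile set \<Rightarrow> 'n tile set \<Rightarrow> ('n mod_ring \<times> bool) set" where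
  "singles A B = {p. Inr (fst p) \<in> (if snd p then B else A)}"

text \<open>Triples are recorded by their middle letters: \<open>X\<^sub>i\<close> by
  \<open>y\<^sub>i\<close>, and \<open>Y\<^sub>i\<close> by the x letter of index
  \<open>i + 1\<close>, which explains the shift by one for \<open>B\<close>.\<close>

definition triples :: "'n::nontriv tile set \<Rightarrow> 'n tile set \<Rightarrow> ('n mod_ring \<times> bool) set" where
  "triples A B = {p. if snd p then Inl (fst p) \<in> A else Inl (fst p - 1) \<in> B}"

lemma singles_iff: "(j, False) \<in> singles A B \<longleftrightarrow> Inr j \<in> A" "(j, True) \<in> singles A B \<longleftrightarrow> Inr j \<in> B"
  and triples_iff: "(i, True) \<in> triples A B \<longleftrightarrow> Inl i \<in> A" "(i, False) \<in> triples A B \<longleftrightarrow> Inl (i - 1) \<in> B"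
  by (simp_all add: singles_def triples_def)

lemma prod_letters:
  fixes f :: "'a::finite \<times> bool \<Rightarrow> 'c::comm_monoid_mult"
  shows "(\<Prod>p\<in>X. f p) = (\<Prod>i | (i, False) \<in> X. f (i, False)) * (\<Prod>i | (i, True) \<in> X. f (i, True))"
proof -
  have "X = (\<lambda>i. (i, False)) ` {i. (i, False) \<in> X} \<union> (\<lambda>i. (i, True)) ` {i. (i, True) \<in> X}" (is "_ = ?Y \<union> ?Z")
  proof (rule Set.set_eqI)
    fix x show "x \<in> X \<longleftrightarrow> x \<in> ?Y \<union> ?Z" by (cases x; cases "snd x") auto
  qed
  then have "(\<Prod>p\<in>X. f p) = (\<Prod>p\<in>?Y \<union> ?Z. f p)" by simp
  also have "\<dots> = (\<Prod>p\<in>?Y. f p) * (\<Prod>p\<in>?Z. f p)" by (rule prod.union_disjoint) auto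
  finally show ?thesis by (simp add: prod.reindex inj_on_def)
qed

lemma sum_letters:
  fixes f :: "'a::finite \<times> bool \<Rightarrow> 'c::comm_monoid_add"
  shows "(\<Sum>p\<in>X. f p) = (\<Sum>i | (i, False) \<in> X. f (i, False)) + (\<Sum>i | (i, True) \<in> X. f (i, True))"
proof -
  have "X = (\<lambda>i. (i, False)) ` {i. (i, False) \<in> X} \<union> (\<lambda>i. (i, True)) ` {i. (i, True) \<in> X}" (is "_ = ?Y \<union> ?Z")
  proof (rule Set.set_eqI)
    fix x show "x \<in> X \<longleftrightarrow> x \<in> ?Y \<union> ?Z" by (cases x; cases "snd x") auto
  qed
  then have "(\<Sum>p\<in>X. f p) = (\<Sum>p\<in>?Y \<union> ?Z. f p)" by simp
  also have "\<dots> = (\<Sum>p\<in>?Y. f p) + (\<Sum>p\<in>?Z. f p)" by (rule sum.union_disjoint) auto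
  finally show ?thesis by (simp add: sum.reindex inj_on_def)
qed

lemma shifted_index_set:
  "{i :: 'n::nontriv mod_ring. Q (i - 1)} = (\<lambda>i. i + 1) ` {i. Q i}"
  by (auto simp: image_iff intro!: exI[of _ "_ - 1"])

text \<open>The offsets in \<open>conf\<close> relate only factors of one family, so a configuration
  is a pair of independent sets with no condition linking them.\<close>

lemma conf_tiles:
  assumes n: "3 \<le> CARD('n::nontriv)"
  shows "cyclic_positions.conf letter_shift (singles A B) (triples A B) \<longleftrightarrow>
    (\<forall>s\<in>A. \<forall>t\<in>A. \<not> precedes s t) \<and> (\<forall>s\<in>B. \<forall>t\<in>B. \<not> precedes s (t :: 'n tile))"
proof -
  interpret cp: cyclic_positions "2 * int CARD('n)" "letter_shift :: 'n mod_ring \<times> bool \<Rightarrow> _"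
    by (rule letters_cyclic[OF n])
  have p2: "i + 2 - 1 = i + 1" "i + 1 - 2 = i - 1" for i :: "'n mod_ring" by simp_all
  show ?thesis
  proof
    assume c: "cp.conf (singles A B) (triples A B)"
    have tt: "letter_shift p 2 \<notin> triples A B" "letter_shift p 4 \<notin> triples A B"
      and ts: "letter_shift p 1 \<notin> singles A B" "letter_shift p 3 \<notin> singles A B"
        "letter_shift p (-1) \<notin> singles A B" "letter_shift p (-3) \<notin> singles A B"
      if "p \<in> triples A B" for p
      using c that unfolding cp.conf_def by blast+
    have ss: "letter_shift p 2 \<notin> singles A B" if "p \<in> singles A B" for p
      using c that unfolding cp.conf_def by blast
    note t = tt[of "(i, True)" for i] ts[of "(i, True)" for i] ss[of "(i, False)" for i]
    note u = tt[of "(i + 1, False)" for i] ts[of "(i + 1, False)" for i] ss[of "(i, True)" for i]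
    note R = letter_shift_simps singles_iff triples_iff
    have A: "\<not> precedes s r" if "s \<in> A" "r \<in> A" for s r
    proof (cases s; cases r)
      fix i j assume "s = Inl i" "r = Inl j"
      then show ?thesis using that t(1,2)[of i, unfolded R] by auto
    next
      fix i j assume "s = Inl i" "r = Inr j"
      then show ?thesis using that t(3,4)[of i, unfolded R] by auto
    next
      fix i j assume "s = Inr i" "r = Inl j"
      then show ?thesis using that t(5,6)[of j, unfolded R] by auto
    next
      fix i j assume "s = Inr i" "r = Inr j"
      then show ?thesis using that t(7)[of i, unfolded R] by auto
    qed
    have B: "\<not> precedes s r" if "s \<in> B" "r \<in> B" for s r
    proof (cases s; cases r)
      fix i j assume "s = Inl i" "r = Inl j"
      then show ?thesis using that u(1,2)[of i, unfolded R] by (auto simp: add_ac)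
    next
      fix i j assume "s = Inl i" "r = Inr j"
      then show ?thesis using that u(3,4)[of i, unfolded R] by (auto simp: add_ac)
    next
      fix i j assume "s = Inr i" "r = Inl j"
      then show ?thesis using that u(5,6)[of j, unfolded R] by (auto simp: p2)
    next
      fix i j assume "s = Inr i" "r = Inr j"
      then show ?thesis using that u(7)[of i, unfolded R] by auto
    qed
    show "(\<forall>s\<in>A. \<forall>t\<in>A. \<not> precedes s t) \<and> (\<forall>s\<in>B. \<forall>t\<in>B. \<not> precedes s t)" using A B by blast
  next
    assume "(\<forall>s\<in>A. \<forall>t\<in>A. \<not> precedes s t) \<and> (\<forall>s\<in>B. \<forall>t\<in>B. \<not> precedes s t)"
    then have A: "\<And>s t. s \<in> A \<Longrightarrow> t \<in> A \<Longrightarrow> \<not> precedes s t" and B: "\<And>s t. s \<in> B \<Longrightarrow> t \<in> B \<Longrightarrow> \<not> precedes s t"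
      by blast+
    have AA: "Inl i \<in> A \<Longrightarrow> Inl (i + 1) \<notin> A \<and> Inl (i + 2) \<notin> A" "Inl i \<in> A \<Longrightarrow> Inr (i + 1) \<notin> A \<and> Inr (i + 2) \<notin> A"
      "Inl i \<in> A \<Longrightarrow> Inr i \<notin> A \<and> Inr (i - 1) \<notin> A" "Inr i \<in> A \<Longrightarrow> Inr (i + 1) \<notin> A" for i
      using A[of "Inl i" "Inl (i + 1)"] A[of "Inl i" "Inl (i + 2)"] A[of "Inl i" "Inr (i + 1)"] A[of "Inl i" "Inr (i + 2)"]
        A[of "Inr i" "Inl i"] A[of "Inr (i - 1)" "Inl i"] A[of "Inr i" "Inr (i + 1)"] by auto
    have BB: "Inl i \<in> B \<Longrightarrow> Inl (i + 1) \<notin> B \<and> Inl (i + 2) \<notin> B" "Inl i \<in> B \<Longrightarrow> Inr (i + 1) \<notin> B \<and> Inr (i + 2) \<notin> B"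
      "Inl i \<in> B \<Longrightarrow> Inr i \<notin> B \<and> Inr (i - 1) \<notin> B" "Inr i \<in> B \<Longrightarrow> Inr (i + 1) \<notin> B" for i
      using B[of "Inl i" "Inl (i + 1)"] B[of "Inl i" "Inl (i + 2)"] B[of "Inl i" "Inr (i + 1)"] B[of "Inl i" "Inr (i + 2)"]
        B[of "Inr i" "Inl i"] B[of "Inr (i - 1)" "Inl i"] B[of "Inr i" "Inr (i + 1)"] by auto
    show "cp.conf (singles A B) (triples A B)"
    proof (rule cp.confI)
      fix p a assume p: "p \<in> triples A B" and a: "a \<in> {2::int, 4}"
      obtain i b where ib: "p = (i, b)" by fastforce
      show "letter_shift p a \<notin> triples A B"
        using p a AA(1)[of i] BB(1)[of "i - 1"]
        by (cases b) (auto simp: ib letter_shift_simps triples_iff algebra_simps)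
    next
      fix p a assume p: "p \<in> triples A B" and a: "a \<in> {-3, -1, 1, 3::int}"
      obtain i b where ib: "p = (i, b)" by fastforce
      show "letter_shift p a \<notin> singles A B"
        using p a AA(2,3)[of i] BB(2,3)[of "i - 1"]
        by (cases b) (auto simp: ib letter_shift_simps triples_iff singles_iff algebra_simps)
    next
      fix p assume p: "p \<in> singles A B"
      obtain i b where ib: "p = (i, b)" by fastforce
      show "letter_shift p 2 \<notin> singles A B"
        using p AA(4)[of i] BB(4)[of i]
        by (cases b) (auto simp: ib letter_shift_simps singles_iff)
    qed
  qed
qed

text \<open>Across the families, two triples pair to zero, and so do two single letters. A letter
  and a triple pair nontrivially only when the letter stands right next to the triple, that is, two
  positions from its centre.\<close>

lemma tile_pairing_mixed:
  fixes A B :: "'n::nontriv tile set"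
  shows "(\<Sum>s\<in>A. \<Sum>t\<in>B. cyc (Oy s) (Ey t) - cyc (Ox s) (Ex t)) =
    real (card {p \<in> singles A B. letter_shift p (-2) \<in> triples A B}) - real (card {p \<in> singles A B. letter_shift p 2 \<in> triples A B})"
proof -
  have r: "cyc (Oy s) (Ey t) - cyc (Ox s) (Ex t) = (case s of
      Inl i \<Rightarrow> (case t of Inl j \<Rightarrow> 0 | Inr j \<Rightarrow> of_bool (i = j - 1) - of_bool (i = j + 1))
    | Inr i \<Rightarrow> (case t of Inl j \<Rightarrow> of_bool (j = i - 2) - of_bool (j = i) | Inr j \<Rightarrow> 0))" for s t :: "'n tile"
  proof (cases s; cases t)
    fix i j assume "s = Inl i" "t = Inl j"
    then show ?thesis by (simp add: exponent_eqs cyc_add_left cyc_add_right cyc_\<delta>_\<delta> add.commute[of _ 1])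
  next
    fix i j assume s: "s = Inl i" "t = Inr j"
    have "j = i + 1 \<longleftrightarrow> i = j - 1" by auto
    then show ?thesis by (simp add: s exponent_eqs cyc_fun_zero cyc_\<delta>_\<delta>)
  next
    fix i j assume s: "s = Inr i" "t = Inl j"
    have "i = j + 1 + 1 \<longleftrightarrow> j = i - 2" by (auto simp: add.assoc)
    then show ?thesis by (simp add: s exponent_eqs cyc_fun_zero cyc_\<delta>_\<delta>)
  next
    fix i j assume "s = Inr i" "t = Inr j"
    then show ?thesis by (simp add: exponent_eqs cyc_fun_zero)
  qed
  have b: "(\<Sum>i | Q i. of_bool (i = k) :: real) = of_bool (Q k)" for Q and k :: "'n mod_ring"
    by (simp add: of_bool_def)
  have "(\<Sum>s\<in>A. \<Sum>t\<in>B. cyc (Oy s) (Ey t) - cyc (Ox s) (Ex t)) =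
      (\<Sum>i | Inl i \<in> A. \<Sum>j | Inr j \<in> B. of_bool (i = j - 1) - of_bool (i = j + 1)) +
      (\<Sum>i | Inr i \<in> A. \<Sum>j | Inl j \<in> B. of_bool (j = i - 2) - of_bool (j = i))"
    unfolding r sum_tiles[of _ A] sum_tiles[of _ B] by simp
  also have "(\<Sum>i | Inl i \<in> A. \<Sum>j | Inr j \<in> B. of_bool (i = j - 1) - of_bool (i = j + 1) :: real)
     = (\<Sum>j | Inr j \<in> B. of_bool (Inl (j - 1) \<in> A) - of_bool (Inl (j + 1) \<in> A))"
    by (subst sum.swap) (simp only: sum_subtractf b)
  also have "(\<Sum>i | Inr i \<in> A. \<Sum>j | Inl j \<in> B. of_bool (j = i - 2) - of_bool (j = i) :: real)
     = (\<Sum>i | Inr i \<in> A. of_bool (Inl (i - 2) \<in> B) - of_bool (Inl i \<in> B))"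
    by (simp only: sum_subtractf b)
  finally have L: "(\<Sum>s\<in>A. \<Sum>t\<in>B. cyc (Oy s) (Ey t) - cyc (Ox s) (Ex t)) =
     (\<Sum>j | Inr j \<in> B. of_bool (Inl (j - 1) \<in> A) - of_bool (Inl (j + 1) \<in> A)) +
     (\<Sum>i | Inr i \<in> A. of_bool (Inl (i - 2) \<in> B) - of_bool (Inl i \<in> B))" .
  have c: "real (card {p \<in> X. Q p}) = (\<Sum>p\<in>X. of_bool (Q p))" for X :: "('n mod_ring \<times> bool) set" and Q
    by (simp add: Collect_conj_eq)
  have m2: "i - 1 - 1 = i - 2" for i :: "'n mod_ring" by simp
  show ?thesis
    unfolding L c sum_letters[of _ "singles A B"] singles_iff letter_shift_simps triples_iff m2
    by (simp add: sum_subtractf)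
qed

theorem O_E_commute:
  assumes n: "3 \<le> CARD('n::nontriv)"
  shows "bracket (log_canonical pent_matrix) (O_inv k) (E_inv l) (c :: 'n coords) = 0"
proof -
  interpret cp: cyclic_positions "2 * int CARD('n)" "letter_shift :: 'n mod_ring \<times> bool \<Rightarrow> _"
    by (rule letters_cyclic[OF n])
  define u where "u p = (if snd p then snd c $ fst p else fst c $ fst p)" for p
  \<comment> \<open>\<open>f\<close> marks the x letters and \<open>g\<close> the y letters. A
    triple is tested at the letter after its centre, so the two counts are the numbers of factors
    from the O and from the E monomial.\<close>
  define f g :: "'n mod_ring \<times> bool \<Rightarrow> nat" where "f p = of_bool (\<not> snd p)" and "g p = of_bool (snd p)" for p
  have fg: "f (letter_shift p 2) = f p" "g (letter_shift p 2) = g p" for p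
    by (auto simp: f_def g_def letter_shift_def)
  define CF where "CF = {(S, T). cp.conf S T \<and> cp.counted f k (S, T) \<and> cp.counted g l (S, T)}"
  let ?h = "\<lambda>(A, B). (\<Sum>s\<in>A. \<Sum>t\<in>B. cyc (Oy s) (Ey t) - cyc (Ox s) (Ex t)) * ((\<Prod>t\<in>A. O_tile c t) * (\<Prod>t\<in>B. E_tile c t))"
  have sh: "(\<Sum>i | Inl (i - 1) \<in> B. q i) = (\<Sum>i | Inl i \<in> B. q (i + 1))"
    "(\<Prod>i | Inl (i - 1) \<in> B. r i) = (\<Prod>i | Inl i \<in> B. r (i + 1))"
    for B :: "'n tile set" and q :: "'n mod_ring \<Rightarrow> nat" and r :: "'n mod_ring \<Rightarrow> real"
    unfolding shifted_index_set[of "\<lambda>i. Inl i \<in> B"] by (simp_all add: sum.reindex prod.reindex)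
  have cnt: "cp.counted f k (singles A B, triples A B) \<longleftrightarrow> card A = k" "cp.counted g l (singles A B, triples A B) \<longleftrightarrow> card B = l"
    for A B
    unfolding cp.counted_def split sum_letters singles_iff triples_iff letter_shift_simps sh
    by (simp_all add: f_def g_def card_tiles[of A] card_tiles[of B] add.commute)
  have wt: "cp.conf_weight u (singles A B, triples A B) = (\<Prod>t\<in>A. O_tile c t) * (\<Prod>t\<in>B. E_tile c t)" for A B
    unfolding cp.conf_weight_def split prod_letters singles_iff triples_iff letter_shift_simps sh prod_tiles[of _ A] prod_tiles[of _ B]
    by (simp add: u_def O_tile_def E_tile_def mult_ac)
  have "(\<Sum>p\<in>tiles.indep_sets k \<times> tiles.indep_sets l. ?h p) =
    (\<Sum>(S, T)\<in>CF. (real (card {p \<in> S. letter_shift p (-2) \<in> T}) - real (card {p \<in> S. letter_shift p 2 \<in> T})) * cp.conf_weight u (S, T))"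
  proof (rule sum.reindex_bij_witness[where j="\<lambda>(A, B). (singles A B, triples A B)"
        and i="\<lambda>(S, T). ({t. case t of Inl i \<Rightarrow> (i, True) \<in> T | Inr j \<Rightarrow> (j, False) \<in> S}, {t. case t of Inl i \<Rightarrow> (i + 1, False) \<in> T | Inr j \<Rightarrow> (j, True) \<in> S})"],
      goal_cases)
    case (1 p)
    obtain A B where p: "p = (A, B)" by fastforce
    have "t \<in> {t. case t of Inl i \<Rightarrow> (i, True) \<in> triples A B | Inr j \<Rightarrow> (j, False) \<in> singles A B} \<longleftrightarrow> t \<in> A"
      "t \<in> {t. case t of Inl i \<Rightarrow> (i + 1, False) \<in> triples A B | Inr j \<Rightarrow> (j, True) \<in> singles A B} \<longleftrightarrow> t \<in> B" for t
      by (cases t; simp add: singles_iff triples_iff)+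
    then show ?case unfolding p split by (metis (no_types, lifting) Set.set_eqI)
  next
    case (2 p)
    obtain A B where p: "p = (A, B)" by fastforce
    show ?case
      using 2 unfolding p split CF_def mem_Collect_eq cnt conf_tiles[OF n] tiles.indep_sets_def by blast
  next
    case (3 x)
    obtain S T where x: "x = (S, T)" by fastforce
    let ?A = "{t. case t of Inl i \<Rightarrow> (i, True) \<in> T | Inr j \<Rightarrow> (j, False) \<in> S}"
      and ?B = "{t. case t of Inl i \<Rightarrow> (i + 1, False) \<in> T | Inr j \<Rightarrow> (j, True) \<in> S}"
    have "p \<in> singles ?A ?B \<longleftrightarrow> p \<in> S" "p \<in> triples ?A ?B \<longleftrightarrow> p \<in> T" for p
      by (cases p; cases "snd p"; simp add: singles_iff triples_iff)+
    then show ?case unfolding x split by (metis (no_types, lifting) Set.set_eqI)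
  next
    case (4 x)
    obtain S T where x: "x = (S, T)" by fastforce
    let ?A = "{t. case t of Inl i \<Rightarrow> (i, True) \<in> T | Inr j \<Rightarrow> (j, False) \<in> S}"
      and ?B = "{t. case t of Inl i \<Rightarrow> (i + 1, False) \<in> T | Inr j \<Rightarrow> (j, True) \<in> S}"
    have "p \<in> singles ?A ?B \<longleftrightarrow> p \<in> S" "p \<in> triples ?A ?B \<longleftrightarrow> p \<in> T" for p
      by (cases p; cases "snd p"; simp add: singles_iff triples_iff)+
    then have "S = singles ?A ?B" "T = triples ?A ?B" by (metis (no_types, lifting) Set.set_eqI)+
    then have "(singles ?A ?B, triples ?A ?B) \<in> CF" using 4 x by metis
    then have "?A \<in> tiles.indep_sets k" "?B \<in> tiles.indep_sets l"
      unfolding CF_def mem_Collect_eq split cnt conf_tiles[OF n] tiles.indep_sets_def by blast+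
    then show ?case unfolding x split by blast
  next
    case (5 p)
    obtain A B where p: "p = (A, B)" by fastforce
    show ?case unfolding p split wt tile_pairing_mixed ..
  qed
  also have "\<dots> = 0" unfolding CF_def by (rule cp.sum_adjacency_zero[where f=f and g=g and a=k and b=l, OF fg])
  finally show ?thesis
    unfolding O_inv_tiles[OF n] E_inv_tiles[OF n]
      bracket_tile_sums[OF differentiable_O_tile differentiable_E_tile log_deriv_O_tile log_deriv_E_tile]
    by (simp add: sum.cartesian_product)
qed

section \<open>Null space\<close>

text \<open>Pairing with a unit vector under \<open>cyc\<close> leaves the difference of its two
  neighbours' entries.\<close>

lemma null_space_pent:
  fixes c :: "'n::nontriv coords"
  assumes c: "c \<in> nonzero_coords"
  shows "v \<in> null_space (log_canonical pent_matrix) c \<longleftrightarrow>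
    (\<forall>k. fst c $ (k + 1) * fst v $ (k + 1) = fst c $ (k - 1) * fst v $ (k - 1)) \<and>
    (\<forall>k. snd c $ (k + 1) * snd v $ (k + 1) = snd c $ (k - 1) * snd v $ (k - 1))"
proof -
  let ?\<alpha> = "\<lambda>a. (c \<bullet> a) * (v \<bullet> a)"
  have s: "(\<Sum>a\<in>Basis. pent_matrix a b * ?\<alpha> a) =
      cyc (\<lambda>i. ?\<alpha> (ey i)) (\<lambda>i. ey i \<bullet> b) - cyc (\<lambda>i. ?\<alpha> (ex i)) (\<lambda>i. ex i \<bullet> b)" if b: "b \<in> Basis" for b
  proof -
    have "(\<Sum>a\<in>Basis. pent_matrix a b * ?\<alpha> a) = (\<Sum>a\<in>Basis. \<Sum>b'\<in>Basis. pent_matrix a b' * ?\<alpha> a * (b' \<bullet> b))"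
      by (rule sum.cong[OF refl]) (simp only: sum_Basis_inner[OF b])
    then show ?thesis by (simp only: pent_matrix_sum)
  qed
  have e: "(\<lambda>i. ey i \<bullet> ey k) = \<delta> k" "(\<lambda>i. ex i \<bullet> ex k) = \<delta> k" "(\<lambda>i. ex i \<bullet> ey k) = (\<lambda>i. 0)" "(\<lambda>i. ey i \<bullet> ex k) = (\<lambda>i. 0)"
    for k :: "'n mod_ring"
    by (auto simp: fun_eq_iff inner_Basis \<delta>_def)
  have ball: "(\<forall>b\<in>Basis. P b) \<longleftrightarrow> (\<forall>k. P (ex k)) \<and> (\<forall>k. P (ey k))" for P :: "'n coords \<Rightarrow> bool"
    unfolding Basis_coords by blast
  show ?thesis
    unfolding null_space_log_canonical[OF c] ball s[OF ex_in_Basis] s[OF ey_in_Basis] e cyc_\<delta>_right cyc_fun_zero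
    by (simp add: inner_ex inner_ey) (metis (no_types, lifting))
qed

lemma period_two:
  fixes \<alpha> :: "'n::nontriv mod_ring \<Rightarrow> 'b"
  assumes "\<And>k. \<alpha> (k + 1) = \<alpha> (k - 1)"
  shows "\<alpha> (of_int m) = \<alpha> (of_int (m mod 2))"
proof -
  have p: "\<alpha> (k + 2) = \<alpha> k" for k using assms[of "k + 1"] by (simp add: add.assoc)
  have "\<alpha> (of_int (r + 2 * q)) = \<alpha> (of_int r)" for r q
  proof (induction q rule: int_induct[where k=0])
    case (step1 i)
    have "(of_int (r + 2 * (i + 1)) :: 'n mod_ring) = of_int (r + 2 * i) + 2" by (simp add: algebra_simps)
    then show ?case using p step1 by metis
  next
    case (step2 i)
    have "(of_int (r + 2 * i) :: 'n mod_ring) = of_int (r + 2 * (i - 1)) + 2" by (simp add: algebra_simps)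
    then show ?case using p step2 by metis
  qed simp
  from this[of "m mod 2" "m div 2"] show ?thesis by simp
qed

text \<open>For odd n the numbers 1 and \<open>1 + n\<close> denote the same index but have
  different parities, so the two classes of period two merge.\<close>

lemma period_two_odd:
  fixes \<alpha> :: "'n::nontriv mod_ring \<Rightarrow> 'b"
  assumes p: "\<And>k. \<alpha> (k + 1) = \<alpha> (k - 1)" and odd: "odd CARD('n)"
  shows "\<alpha> k = \<alpha> 0"
proof -
  have "(of_int 1 :: 'n mod_ring) = of_int (1 + int CARD('n))" by (simp only: mod_ring_of_int_period)
  then have "\<alpha> (of_int 1) = \<alpha> (of_int ((1 + int CARD('n)) mod 2))" using period_two[of \<alpha>, OF p] by metis
  also have "(1 + int CARD('n)) mod 2 = 0" using odd by presburger
  finally have 1: "\<alpha> (of_int 1) = \<alpha> (of_int 0)" .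
  obtain m where m: "k = of_int m" using mod_ring_of_int_surj by blast
  have "m mod 2 = 0 \<or> m mod 2 = 1" by presburger
  then show ?thesis using period_two[of \<alpha> m, OF p] 1 unfolding m by auto
qed

text \<open>Taken from the representative of the index. It is compatible with index arithmetic when
  n is even, see \<open>parity_of_int\<close>.\<close>

definition parity :: "'n::nontriv mod_ring \<Rightarrow> bool" where
  "parity k \<longleftrightarrow> even (to_int_mod_ring k)"

lemma parity_of_int:
  assumes "even CARD('n::nontriv)"
  shows "parity (of_int m :: 'n mod_ring) \<longleftrightarrow> even m"
proof -
  have "(of_int (to_int_mod_ring (of_int m :: 'n mod_ring)) :: 'n mod_ring) = of_int m"
    by (simp add: of_int_of_int_mod_ring)
  then have "int CARD('n) dvd to_int_mod_ring (of_int m :: 'n mod_ring) - m"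
    unfolding mod_ring_of_int_eq_iff .
  then have "even (to_int_mod_ring (of_int m :: 'n mod_ring) - m)"
    using assms by (meson dvd_trans even_of_nat)
  then show ?thesis by (simp add: parity_def)
qed

lemma parity_add_one:
  assumes "even CARD('n::nontriv)"
  shows "parity (k + 1 :: 'n mod_ring) \<longleftrightarrow> \<not> parity k" "parity (k - 1 :: 'n mod_ring) \<longleftrightarrow> \<not> parity k"
proof -
  obtain m where m: "k = of_int m" using mod_ring_of_int_surj by blast
  have "k + 1 = of_int (m + 1)" "k - 1 = of_int (m - 1)" by (simp_all add: m)
  then show "parity (k + 1) \<longleftrightarrow> \<not> parity k" "parity (k - 1) \<longleftrightarrow> \<not> parity k"
    using parity_of_int[OF assms] m by (metis even_plus_one_iff, metis even_diff odd_one even_add)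
qed

lemma parity_0: "even CARD('n::nontriv) \<Longrightarrow> parity (0 :: 'n mod_ring)"
  and parity_1: "even CARD('n::nontriv) \<Longrightarrow> \<not> parity (1 :: 'n mod_ring)"
  using parity_of_int[of 0, where 'n='n] parity_of_int[of 1, where 'n='n] by simp_all

lemma period_two_even:
  fixes \<alpha> :: "'n::nontriv mod_ring \<Rightarrow> 'b"
  assumes p: "\<And>k. \<alpha> (k + 1) = \<alpha> (k - 1)" and ev: "even CARD('n)"
  shows "\<alpha> k = (if parity k then \<alpha> 0 else \<alpha> 1)"
proof -
  obtain m where m: "k = of_int m" using mod_ring_of_int_surj by blast
  have "parity k \<longleftrightarrow> m mod 2 = 0" unfolding m parity_of_int[OF ev] by presburger
  moreover have "m mod 2 = 0 \<or> m mod 2 = 1" by presburger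
  ultimately show ?thesis using period_two[of \<alpha> m, OF p] unfolding m by auto
qed

text \<open>At points with nonzero coordinates, the gradient of the logarithm of the product of
  those \<open>x\<^sub>i\<close> for which \<open>Q i\<close> holds.\<close>

definition kernel_x :: "'n::nontriv coords \<Rightarrow> ('n mod_ring \<Rightarrow> bool) \<Rightarrow> 'n coords" where
  "kernel_x c Q = ((\<chi> i. if Q i then 1 / (fst c $ i) else 0), 0)"

definition kernel_y :: "'n::nontriv coords \<Rightarrow> ('n mod_ring \<Rightarrow> bool) \<Rightarrow> 'n coords" where
  "kernel_y c Q = (0, (\<chi> i. if Q i then 1 / (snd c $ i) else 0))"

lemma coords_eqI: "(\<And>i. fst v $ i = fst w $ i) \<Longrightarrow> (\<And>i. snd v $ i = snd w $ i) \<Longrightarrow> v = w"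
  by (simp add: prod_eq_iff vec_eq_iff)

lemma kernel_orthogonal:
  "kernel_x c Q \<bullet> kernel_y c R = 0" "kernel_y c R \<bullet> kernel_x c Q = 0"
  "(\<And>i. \<not> (Q i \<and> R i)) \<Longrightarrow> kernel_x c Q \<bullet> kernel_x c R = 0"
  "(\<And>i. \<not> (Q i \<and> R i)) \<Longrightarrow> kernel_y c Q \<bullet> kernel_y c R = 0"
  unfolding kernel_x_def kernel_y_def inner_prod_def inner_vec_def
  by (auto intro!: sum.neutral)

lemma kernel_nonzero:
  assumes "c \<in> nonzero_coords" "Q i"
  shows "kernel_x c Q \<noteq> 0" "kernel_y c Q \<noteq> 0"
  using assms by (auto simp: kernel_x_def kernel_y_def prod_eq_iff vec_eq_iff nonzero_coords_iff intro!: exI[of _ i])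

lemma dim_orthogonal_four:
  fixes a b c d :: "'a::euclidean_space"
  assumes "a \<noteq> 0" "b \<noteq> 0" "c \<noteq> 0" "d \<noteq> 0"
    and "a \<bullet> b = 0" "a \<bullet> c = 0" "a \<bullet> d = 0" "b \<bullet> c = 0" "b \<bullet> d = 0" "c \<bullet> d = 0"
  shows "dim (span {a, b, c, d}) = 4"
proof -
  have "pairwise orthogonal {a, b, c, d}" "0 \<notin> {a, b, c, d}"
    using assms by (auto simp: pairwise_def orthogonal_def inner_commute)
  then have "independent {a, b, c, d}" by (rule pairwise_orthogonal_independent)
  moreover have "a \<noteq> b" "a \<noteq> c" "a \<noteq> d" "b \<noteq> c" "b \<noteq> d" "c \<noteq> d" using assms by auto
  ultimately show ?thesis by (simp add: dim_eq_card_independent)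
qed

lemma dim_orthogonal_two:
  fixes a b :: "'a::euclidean_space"
  assumes "a \<noteq> 0" "b \<noteq> 0" "a \<bullet> b = 0"
  shows "dim (span {a, b}) = 2"
proof -
  have "pairwise orthogonal {a, b}" "0 \<notin> {a, b}"
    using assms by (auto simp: pairwise_def orthogonal_def inner_commute)
  then have "independent {a, b}" by (rule pairwise_orthogonal_independent)
  moreover have "a \<noteq> b" using assms by auto
  ultimately show ?thesis by (simp add: dim_eq_card_independent)
qed

lemma null_space_span:
  fixes c :: "'n::nontriv coords"
  assumes c: "c \<in> nonzero_coords"
  shows "odd CARD('n) \<Longrightarrow> null_space (log_canonical pent_matrix) c = span {kernel_x c (\<lambda>_. True), kernel_y c (\<lambda>_. True)}"
    and "even CARD('n) \<Longrightarrow> null_space (log_canonical pent_matrix) c =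
      span {kernel_x c parity, kernel_x c (\<lambda>i. \<not> parity i), kernel_y c parity, kernel_y c (\<lambda>i. \<not> parity i)}"
proof -
  let ?N = "null_space (log_canonical pent_matrix) c"
  have nz: "fst c $ i \<noteq> 0" "snd c $ i \<noteq> 0" for i using c by (simp_all add: nonzero_coords_iff)
  have div: "b = d / a" if "a \<noteq> 0" "a * b = d" for a b d :: real using that by (auto simp: field_simps)
  note sp = span_minimal[OF _ subspace_null_space[of pent_matrix c]]
  have kN: "kernel_x c Q \<in> ?N" "kernel_y c Q \<in> ?N" if "\<And>k. Q (k + 1) = Q (k - 1)" for Q
    unfolding null_space_pent[OF c] using nz that by (auto simp: kernel_x_def kernel_y_def)
  {
    assume o: "odd CARD('n)"
    show "?N = span {kernel_x c (\<lambda>_. True), kernel_y c (\<lambda>_. True)}"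
    proof
      show "span {kernel_x c (\<lambda>_. True), kernel_y c (\<lambda>_. True)} \<subseteq> ?N" by (rule sp) (use kN in auto)
      show "?N \<subseteq> span {kernel_x c (\<lambda>_. True), kernel_y c (\<lambda>_. True)}"
      proof
        fix v assume "v \<in> ?N"
        then have p: "\<And>k. fst c $ (k + 1) * fst v $ (k + 1) = fst c $ (k - 1) * fst v $ (k - 1)"
          "\<And>k. snd c $ (k + 1) * snd v $ (k + 1) = snd c $ (k - 1) * snd v $ (k - 1)"
          unfolding null_space_pent[OF c] by blast+
        define a b where "a = fst c $ 0 * fst v $ 0" and "b = snd c $ 0 * snd v $ 0"
        have m: "fst c $ k * fst v $ k = a" "snd c $ k * snd v $ k = b" for k
          using period_two_odd[of "\<lambda>k. fst c $ k * fst v $ k", OF p(1) o, of k]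
            period_two_odd[of "\<lambda>k. snd c $ k * snd v $ k", OF p(2) o, of k] by (simp_all only: a_def b_def)
        have "fst v $ k = a / fst c $ k" "snd v $ k = b / snd c $ k" for k
          by (rule div[OF nz(1) m(1)], rule div[OF nz(2) m(2)])
        then have "v = a *\<^sub>R kernel_x c (\<lambda>_. True) + b *\<^sub>R kernel_y c (\<lambda>_. True)"
          by (intro coords_eqI) (simp_all add: kernel_x_def kernel_y_def)
        then show "v \<in> span {kernel_x c (\<lambda>_. True), kernel_y c (\<lambda>_. True)}"
          unfolding mem_span2 by blast
      qed
    qed
  }
  {
    assume ev: "even CARD('n)"
    let ?S = "{kernel_x c parity, kernel_x c (\<lambda>i. \<not> parity i), kernel_y c parity, kernel_y c (\<lambda>i. \<not> parity i)}"
    show "?N = span ?S"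
    proof
      show "span ?S \<subseteq> ?N" by (rule sp) (use kN parity_add_one[OF ev] in auto)
      show "?N \<subseteq> span ?S"
      proof
        fix v assume "v \<in> ?N"
        then have p: "\<And>k. fst c $ (k + 1) * fst v $ (k + 1) = fst c $ (k - 1) * fst v $ (k - 1)"
          "\<And>k. snd c $ (k + 1) * snd v $ (k + 1) = snd c $ (k - 1) * snd v $ (k - 1)"
          unfolding null_space_pent[OF c] by blast+
        define a0 a1 b0 b1 where "a0 = fst c $ 0 * fst v $ 0" and "a1 = fst c $ 1 * fst v $ 1"
          and "b0 = snd c $ 0 * snd v $ 0" and "b1 = snd c $ 1 * snd v $ 1"
        have m: "fst c $ k * fst v $ k = (if parity k then a0 else a1)" "snd c $ k * snd v $ k = (if parity k then b0 else b1)" for k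
          using period_two_even[of "\<lambda>k. fst c $ k * fst v $ k", OF p(1) ev, of k]
            period_two_even[of "\<lambda>k. snd c $ k * snd v $ k", OF p(2) ev, of k]
          by (simp_all only: a0_def a1_def b0_def b1_def)
        have q: "fst v $ k = (if parity k then a0 else a1) / fst c $ k" "snd v $ k = (if parity k then b0 else b1) / snd c $ k" for k
          by (rule div[OF nz(1) m(1)], rule div[OF nz(2) m(2)])
        have v: "v = a0 *\<^sub>R kernel_x c parity + a1 *\<^sub>R kernel_x c (\<lambda>i. \<not> parity i) + b0 *\<^sub>R kernel_y c parity + b1 *\<^sub>R kernel_y c (\<lambda>i. \<not> parity i)"
          (is "_ = ?w")
        proof (rule coords_eqI)
          fix i
          show "fst v $ i = fst ?w $ i" "snd v $ i = snd ?w $ i"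
            by (cases "parity i"; simp add: q kernel_x_def kernel_y_def)+
        qed
        have "kernel_x c parity \<in> span ?S" "kernel_x c (\<lambda>i. \<not> parity i) \<in> span ?S"
          "kernel_y c parity \<in> span ?S" "kernel_y c (\<lambda>i. \<not> parity i) \<in> span ?S"
          by (rule span_base, blast)+
        then show "v \<in> span ?S" unfolding v by (intro span_add span_scale)
      qed
    qed
  }
qed

lemma dim_null_space_pent:
  fixes c :: "'n::nontriv coords"
  assumes c: "c \<in> nonzero_coords"
  shows "dim (null_space (log_canonical pent_matrix) c) = (if odd CARD('n) then 2 else 4)"
proof (cases "odd CARD('n)")
  case True
  have "dim (span {kernel_x c (\<lambda>_. True), kernel_y c (\<lambda>_. True)}) = 2"
    by (rule dim_orthogonal_two) (simp_all add: kernel_nonzero[OF c] kernel_orthogonal)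
  then show ?thesis using True null_space_span(1)[OF c True] by simp
next
  case False
  then have ev: "even CARD('n)" by simp
  have "dim (span {kernel_x c parity, kernel_x c (\<lambda>i. \<not> parity i), kernel_y c parity, kernel_y c (\<lambda>i. \<not> parity i)}) = 4"
    by (rule dim_orthogonal_four)
       (use kernel_nonzero[OF c, of parity 0] kernel_nonzero[OF c, of "\<lambda>i. \<not> parity i" 1] parity_0[OF ev] parity_1[OF ev]
        in \<open>simp_all add: kernel_orthogonal\<close>)
  then show ?thesis using ev null_space_span(2)[OF c ev] by simp
qed

section \<open>The exceptional invariants\<close>

text \<open>The set \<open>I \<union> J\<close> is disjoint from its shift by one, so with n/2
  elements it fills the circle together with that shift. An index \<open>i\<close> in
  \<open>I\<close> would exclude both \<open>i + 1\<close> and \<open>i + 2\<close> from the set and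
  leave \<open>i + 2\<close> uncovered. So only single letters at alternate indices remain.\<close>

lemma admissible_half:
  assumes n: "3 \<le> CARD('n::nontriv)" and ev: "even CARD('n)"
  shows "{(I, J :: 'n mod_ring set). admissible I J \<and> card I + card J = CARD('n) div 2}
    = {({}, {i. parity i}), ({}, {i. \<not> parity i})}"
proof -
  note ne = mod_ring_small_neq_0[OF n]
  have inj: "inj (\<lambda>i :: 'n mod_ring. i + 1)" by (simp add: inj_def)
  have cp: "card {i :: 'n mod_ring. parity i} = CARD('n) div 2" "card {i :: 'n mod_ring. \<not> parity i} = CARD('n) div 2"
  proof -
    have "{i :: 'n mod_ring. \<not> parity i} = (\<lambda>i. i + 1) ` {i. parity i}"
    proof (intro equalityI subsetI)
      fix i :: "'n mod_ring" assume "i \<in> {i. \<not> parity i}"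
      then show "i \<in> (\<lambda>i. i + 1) ` {i. parity i}"
        using parity_add_one(2)[OF ev, of i] by (intro image_eqI[of _ _ "i - 1"]) auto
    qed (use parity_add_one(1)[OF ev] in auto)
    then have "card {i :: 'n mod_ring. \<not> parity i} = card {i :: 'n mod_ring. parity i}"
      using card_image[OF inj_on_subset[OF inj subset_UNIV]] by metis
    moreover have "card {i :: 'n mod_ring. parity i} + card {i :: 'n mod_ring. \<not> parity i} = CARD('n)"
    proof -
      have "{i :: 'n mod_ring. parity i} \<union> {i. \<not> parity i} = UNIV" "{i :: 'n mod_ring. parity i} \<inter> {i. \<not> parity i} = {}"
        by blast+
      then show ?thesis using card_Un_disjoint[OF finite finite, of "{i :: 'n mod_ring. parity i}" "{i. \<not> parity i}"] by simp
    qed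
    ultimately show "card {i :: 'n mod_ring. parity i} = CARD('n) div 2" "card {i :: 'n mod_ring. \<not> parity i} = CARD('n) div 2"
      by simp_all
  qed
  have "(I = {} \<and> (J = {i. parity i} \<or> J = {i. \<not> parity i}))" if a: "admissible I J" and k: "card I + card J = CARD('n) div 2" for I J :: "'n mod_ring set"
  proof -
    have a1: "i \<in> I \<Longrightarrow> j \<in> I \<Longrightarrow> i \<noteq> j \<Longrightarrow> j \<noteq> i + 1 \<and> j \<noteq> i + 2"
      and a2: "i \<in> I \<Longrightarrow> j \<in> J \<Longrightarrow> j \<noteq> i - 1 \<and> j \<noteq> i \<and> j \<noteq> i + 1 \<and> j \<noteq> i + 2"
      and a3: "i \<in> J \<Longrightarrow> j \<in> J \<Longrightarrow> j \<noteq> i + 1" for i j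
      using a unfolding admissible_def by blast+
    let ?A = "I \<union> J" and ?B = "(\<lambda>i. i + 1) ` (I \<union> J)"
    have "i + 1 \<notin> ?A" if "i \<in> ?A" for i
      using that a1[of i "i + 1"] a2[of i "i + 1"] a2[of "i + 1" i] a3[of i "i + 1"] ne by auto
    then have dis: "?A \<inter> ?B = {}" by blast
    have "I \<inter> J = {}" using a2 by blast
    then have cA: "card ?A = CARD('n) div 2" using k by (simp add: card_Un_disjoint)
    moreover have "card ?B = card ?A" by (rule card_image) (rule inj_on_subset[OF inj subset_UNIV])
    ultimately have "card (?A \<union> ?B) = CARD('n mod_ring)"
      using card_Un_disjoint[OF finite finite dis] ev by (simp add: even_two_times_div_two flip: mult_2)
    then have U: "?A \<union> ?B = UNIV" by (intro card_subset_eq) auto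
    have I: "I = {}"
    proof (rule ccontr)
      assume "I \<noteq> {}"
      then obtain i where i: "i \<in> I" by blast
      have "i + 2 \<in> ?A \<union> ?B" unfolding U by simp
      moreover have "i + 2 \<in> ?B \<longleftrightarrow> i + 1 \<in> ?A" using inj_image_mem_iff[OF inj, of "i + 1" ?A] by (simp add: add.assoc)
      ultimately have "i + 2 \<in> ?A \<or> i + 1 \<in> ?A" by blast
      then show False using i a1[of i "i + 1"] a1[of i "i + 2"] a2[of i "i + 1"] a2[of i "i + 2"] ne by auto
    qed
    have J: "j + 1 \<in> J \<longleftrightarrow> j \<notin> J" for j
    proof
      show "j + 1 \<in> J \<Longrightarrow> j \<notin> J" using a3 by blast
      assume "j \<notin> J"
      moreover have "j + 1 \<in> ?A \<union> ?B" unfolding U by simp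
      ultimately show "j + 1 \<in> J" using I by auto
    qed
    have m: "j \<in> J \<longleftrightarrow> (if parity j then 0 \<in> J else 1 \<in> J)" for j
    proof (rule period_two_even[where \<alpha>="\<lambda>j. j \<in> J", OF _ ev])
      show "(k + 1 \<in> J) = (k - 1 \<in> J)" for k using J[of k] J[of "k - 1"] by simp
    qed
    have m1: "(1 \<in> J) = (0 \<notin> J)" using J[of 0] by simp
    have "J = {i. parity i} \<or> J = {i. \<not> parity i}"
    proof (cases "0 \<in> J")
      case True
      then have "j \<in> J \<longleftrightarrow> parity j" for j using m[of j] m1 by (cases "parity j") simp_all
      then show ?thesis by blast
    next
      case False
      then have "j \<in> J \<longleftrightarrow> \<not> parity j" for j using m[of j] m1 by (cases "parity j") simp_all
      then show ?thesis by blast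
    qed
    then show ?thesis using I by blast
  qed
  moreover have "admissible {} {i :: 'n mod_ring. parity i}" "admissible {} {i :: 'n mod_ring. \<not> parity i}"
    using parity_add_one[OF ev] by (auto simp: admissible_def)
  ultimately show ?thesis using cp by auto
qed

lemma admissible_sum_half:
  assumes n: "3 \<le> CARD('n::nontriv)" and ev: "even CARD('n)"
  shows "admissible_sum (CARD('n) div 2) X (x :: 'n mod_ring \<Rightarrow> real)
    = (-1) ^ (CARD('n) div 2) * ((\<Prod>i | parity i. x i) + (\<Prod>i | \<not> parity i. x i))"
proof -
  have card: "card {i :: 'n mod_ring. parity i} = CARD('n) div 2" "card {i :: 'n mod_ring. \<not> parity i} = CARD('n) div 2"
  proof -
    have "({}, {i :: 'n mod_ring. parity i}) \<in> {(I, J). admissible I J \<and> card I + card J = CARD('n) div 2}"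
      "({}, {i :: 'n mod_ring. \<not> parity i}) \<in> {(I, J). admissible I J \<and> card I + card J = CARD('n) div 2}"
      unfolding admissible_half[OF n ev] by simp_all
    then show "card {i :: 'n mod_ring. parity i} = CARD('n) div 2" "card {i :: 'n mod_ring. \<not> parity i} = CARD('n) div 2"
      by simp_all
  qed
  have "{i :: 'n mod_ring. parity i} \<noteq> {i. \<not> parity i}" using parity_0[OF ev] by auto
  then show ?thesis
    unfolding admissible_sum_def admissible_half[OF n ev] by (simp add: card algebra_simps)
qed

lemma log_deriv_monomial:
  "log_deriv (ex j) (\<lambda>c. \<Prod>i\<in>A. fst c $ i) c = of_bool (j \<in> A) * (\<Prod>i\<in>A. fst c $ i)"
  "log_deriv (ey j) (\<lambda>c. \<Prod>i\<in>A. fst c $ i) c = 0"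
  "log_deriv (ex j) (\<lambda>c. \<Prod>i\<in>A. snd c $ i) c = 0"
  "log_deriv (ey j) (\<lambda>c. \<Prod>i\<in>A. snd c $ i) c = of_bool (j \<in> A) * (\<Prod>i\<in>A. snd c $ i)"
proof -
  have s: "(\<Sum>i\<in>A. \<delta> i j) = of_bool (j \<in> A)" by (simp add: \<delta>_def)
  show "log_deriv (ex j) (\<lambda>c. \<Prod>i\<in>A. fst c $ i) c = of_bool (j \<in> A) * (\<Prod>i\<in>A. fst c $ i)"
    using log_deriv_prod[where w="\<lambda>c i. fst c $ i" and \<epsilon>="\<lambda>i. \<delta> i j", OF finite differentiable_coord(1) log_deriv_ex] by (simp add: s)
  show "log_deriv (ey j) (\<lambda>c. \<Prod>i\<in>A. fst c $ i) c = 0"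
    using log_deriv_prod[where w="\<lambda>c i. fst c $ i" and \<epsilon>="\<lambda>i. 0" and a="ey j", OF finite differentiable_coord(1)] by (simp add: log_deriv_ey_x)
  show "log_deriv (ex j) (\<lambda>c. \<Prod>i\<in>A. snd c $ i) c = 0"
    using log_deriv_prod[where w="\<lambda>c i. snd c $ i" and \<epsilon>="\<lambda>i. 0" and a="ex j", OF finite differentiable_coord(2)] by (simp add: log_deriv_ex_y)
  show "log_deriv (ey j) (\<lambda>c. \<Prod>i\<in>A. snd c $ i) c = of_bool (j \<in> A) * (\<Prod>i\<in>A. snd c $ i)"
    using log_deriv_prod[where w="\<lambda>c i. snd c $ i" and \<epsilon>="\<lambda>i. \<delta> i j", OF finite differentiable_coord(2) log_deriv_ey] by (simp add: s)
qed

lemma differentiable_monomial: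
  fixes c :: "'n::nontriv coords"
  shows "(\<lambda>c. \<Prod>i\<in>A. fst c $ i) differentiable at c" "(\<lambda>c. \<Prod>i\<in>A. snd c $ i) differentiable at c"
  by (rule differentiable_prod, rule differentiable_coord)+

lemma grad_log_deriv:
  assumes "f differentiable at c"
  shows "(c \<bullet> a) * (grad f c \<bullet> a) = log_deriv a f c"
  by (simp add: log_deriv_def grad_inner_frechet[OF assms])

lemma log_deriv_binomial:
  assumes "f differentiable at c" "g differentiable at c"
  shows "log_deriv a (\<lambda>c. s * (f c + g c)) c = s * (log_deriv a f c + log_deriv a g c)"
proof -
  have "((\<lambda>c. s * (f c + g c)) has_derivative (\<lambda>v. s * (dirderiv f v c + dirderiv g v c))) (at c)"
    using assms by (intro has_derivative_mult_right has_derivative_add) (simp_all add: frechet_derivative_works)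
  from log_deriv_has_derivative[OF this] show ?thesis by (simp add: log_deriv_def algebra_simps)
qed

lemma grad_eq_kernel:
  fixes c :: "'n::nontriv coords"
  assumes c: "c \<in> nonzero_coords" and f: "f differentiable at c"
  shows "(\<And>i. log_deriv (ex i) f c = (if Q i then s else t)) \<Longrightarrow> (\<And>i. log_deriv (ey i) f c = 0) \<Longrightarrow>
      grad f c = s *\<^sub>R kernel_x c Q + t *\<^sub>R kernel_x c (\<lambda>i. \<not> Q i)"
    and "(\<And>i. log_deriv (ey i) f c = (if Q i then s else t)) \<Longrightarrow> (\<And>i. log_deriv (ex i) f c = 0) \<Longrightarrow>
      grad f c = s *\<^sub>R kernel_y c Q + t *\<^sub>R kernel_y c (\<lambda>i. \<not> Q i)"
proof -
  have nz: "fst c $ i \<noteq> 0" "snd c $ i \<noteq> 0" for i using c by (simp_all add: nonzero_coords_iff)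
  have g: "fst (grad f c) $ i = log_deriv (ex i) f c / fst c $ i" "snd (grad f c) $ i = log_deriv (ey i) f c / snd c $ i" for i
    using grad_log_deriv[OF f, of "ex i"] grad_log_deriv[OF f, of "ey i"] nz by (simp_all add: inner_ex inner_ey field_simps)
  show "(\<And>i. log_deriv (ex i) f c = (if Q i then s else t)) \<Longrightarrow> (\<And>i. log_deriv (ey i) f c = 0) \<Longrightarrow>
      grad f c = s *\<^sub>R kernel_x c Q + t *\<^sub>R kernel_x c (\<lambda>i. \<not> Q i)"
    by (rule coords_eqI) (simp_all add: g kernel_x_def)
  show "(\<And>i. log_deriv (ey i) f c = (if Q i then s else t)) \<Longrightarrow> (\<And>i. log_deriv (ex i) f c = 0) \<Longrightarrow>
      grad f c = s *\<^sub>R kernel_y c Q + t *\<^sub>R kernel_y c (\<lambda>i. \<not> Q i)"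
    by (rule coords_eqI) (simp_all add: g kernel_y_def)
qed

definition half_x :: "bool \<Rightarrow> 'n::nontriv coords \<Rightarrow> real" where "half_x b c = (\<Prod>i | parity i = b. fst c $ i)"
definition half_y :: "bool \<Rightarrow> 'n::nontriv coords \<Rightarrow> real" where "half_y b c = (\<Prod>i | parity i = b. snd c $ i)"

text \<open>The free predicate \<open>Q\<close> lets one formula serve both cases: it is taken to be
  always true for odd n, and \<open>parity\<close> for even n.\<close>

lemma grad_full:
  fixes c :: "'n::nontriv coords"
  assumes c: "c \<in> nonzero_coords"
  shows "grad O_full c = O_full c *\<^sub>R kernel_x c Q + O_full c *\<^sub>R kernel_x c (\<lambda>i. \<not> Q i)"
    "grad E_full c = E_full c *\<^sub>R kernel_y c Q + E_full c *\<^sub>R kernel_y c (\<lambda>i. \<not> Q i)"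
proof -
  have e: "O_full = (\<lambda>c :: 'n coords. \<Prod>i\<in>UNIV. fst c $ i)" "E_full = (\<lambda>c :: 'n coords. \<Prod>i\<in>UNIV. snd c $ i)"
    by (simp_all add: O_full_def E_full_def case_prod_beta')
  show "grad O_full c = O_full c *\<^sub>R kernel_x c Q + O_full c *\<^sub>R kernel_x c (\<lambda>i. \<not> Q i)"
    unfolding e by (rule grad_eq_kernel(1)[OF c differentiable_monomial(1)]) (simp_all add: log_deriv_monomial)
  show "grad E_full c = E_full c *\<^sub>R kernel_y c Q + E_full c *\<^sub>R kernel_y c (\<lambda>i. \<not> Q i)"
    unfolding e by (rule grad_eq_kernel(2)[OF c differentiable_monomial(2)]) (simp_all add: log_deriv_monomial)
qed

lemma grad_half:
  fixes c :: "'n::nontriv coords"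
  assumes n: "3 \<le> CARD('n)" and ev: "even CARD('n)" and c: "c \<in> nonzero_coords"
  defines "s \<equiv> (-1) ^ (CARD('n) div 2)"
  shows "grad (O_inv (CARD('n) div 2)) c = (s * half_x True c) *\<^sub>R kernel_x c parity + (s * half_x False c) *\<^sub>R kernel_x c (\<lambda>i. \<not> parity i)"
    "grad (E_inv (CARD('n) div 2)) c = (s * half_y True c) *\<^sub>R kernel_y c parity + (s * half_y False c) *\<^sub>R kernel_y c (\<lambda>i. \<not> parity i)"
proof -
  have e: "O_inv (CARD('n) div 2) = (\<lambda>c :: 'n coords. s * ((\<Prod>i | parity i. fst c $ i) + (\<Prod>i | \<not> parity i. fst c $ i)))"
    "E_inv (CARD('n) div 2) = (\<lambda>c :: 'n coords. s * ((\<Prod>i | parity i. snd c $ i) + (\<Prod>i | \<not> parity i. snd c $ i)))"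
    unfolding O_inv_def E_inv_def case_prod_beta' admissible_sum_half[OF n ev] s_def by simp_all
  have d: "(\<lambda>c :: 'n coords. s * ((\<Prod>i | parity i. fst c $ i) + (\<Prod>i | \<not> parity i. fst c $ i))) differentiable at c"
    "(\<lambda>c :: 'n coords. s * ((\<Prod>i | parity i. snd c $ i) + (\<Prod>i | \<not> parity i. snd c $ i))) differentiable at c"
    by (intro differentiable_mult differentiable_add differentiable_const differentiable_monomial)+
  show "grad (O_inv (CARD('n) div 2)) c = (s * half_x True c) *\<^sub>R kernel_x c parity + (s * half_x False c) *\<^sub>R kernel_x c (\<lambda>i. \<not> parity i)"
    unfolding e by (rule grad_eq_kernel(1)[OF c d(1)])
      (simp_all add: log_deriv_binomial differentiable_monomial log_deriv_monomial half_x_def)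
  show "grad (E_inv (CARD('n) div 2)) c = (s * half_y True c) *\<^sub>R kernel_y c parity + (s * half_y False c) *\<^sub>R kernel_y c (\<lambda>i. \<not> parity i)"
    unfolding e by (rule grad_eq_kernel(2)[OF c d(2)])
      (simp_all add: log_deriv_binomial differentiable_monomial log_deriv_monomial half_y_def)
qed

lemma span_two_by_two:
  fixes u v :: "'a::real_vector"
  assumes "p * s - q * r \<noteq> 0"
  shows "span {p *\<^sub>R u + q *\<^sub>R v, r *\<^sub>R u + s *\<^sub>R v} = span {u, v}"
proof
  show "span {p *\<^sub>R u + q *\<^sub>R v, r *\<^sub>R u + s *\<^sub>R v} \<subseteq> span {u, v}"
    by (rule span_minimal) (auto simp: mem_span2)
  let ?S = "span {p *\<^sub>R u + q *\<^sub>R v, r *\<^sub>R u + s *\<^sub>R v}"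
  have u: "s *\<^sub>R (p *\<^sub>R u + q *\<^sub>R v) + (- q) *\<^sub>R (r *\<^sub>R u + s *\<^sub>R v) = (p * s - q * r) *\<^sub>R u"
    and v: "(- r) *\<^sub>R (p *\<^sub>R u + q *\<^sub>R v) + p *\<^sub>R (r *\<^sub>R u + s *\<^sub>R v) = (p * s - q * r) *\<^sub>R v"
    by (simp_all add: algebra_simps)
  have "(p * s - q * r) *\<^sub>R u \<in> ?S" "(p * s - q * r) *\<^sub>R v \<in> ?S"
    unfolding u[symmetric] v[symmetric] mem_span2 by blast+
  then have "u \<in> ?S" "v \<in> ?S"
    using assms span_scale[of "(p * s - q * r) *\<^sub>R u" _ "1 / (p * s - q * r)"]
      span_scale[of "(p * s - q * r) *\<^sub>R v" _ "1 / (p * s - q * r)"] by simp_all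
  then show "span {u, v} \<subseteq> ?S" by (intro span_minimal) auto
qed

text \<open>For even n the gradients of \<open>O_full\<close> and of the half-degree invariant come
  from the two kernel vectors by a matrix whose determinant is, up to sign, \<open>O_full c\<close>
  times the difference of the half products; similarly for y. This is the origin of the condition
  \<open>gen\<close>.\<close>

lemma span_grad_exceptional:
  fixes c :: "'n::nontriv coords"
  assumes n: "3 \<le> CARD('n)" and c: "c \<in> nonzero_coords"
    and gen: "even CARD('n) \<Longrightarrow> half_x True c \<noteq> half_x False c \<and> half_y True c \<noteq> half_y False c"
  shows "span ((\<lambda>f. grad f c) ` exceptional_invariants) = null_space (log_canonical pent_matrix) c"
proof -
  have nz: "O_full c \<noteq> 0" "E_full c \<noteq> 0"
    using c by (auto simp: O_full_def E_full_def case_prod_beta' nonzero_coords_iff)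
  show ?thesis
  proof (cases "odd CARD('n)")
    case True
    have z: "kernel_x c (\<lambda>i. \<not> True) = 0" "kernel_y c (\<lambda>i. \<not> True) = 0"
      by (auto simp: kernel_x_def kernel_y_def prod_eq_iff vec_eq_iff)
    have "grad O_full c = O_full c *\<^sub>R kernel_x c (\<lambda>_. True) + 0 *\<^sub>R kernel_y c (\<lambda>_. True)"
      "grad E_full c = 0 *\<^sub>R kernel_x c (\<lambda>_. True) + E_full c *\<^sub>R kernel_y c (\<lambda>_. True)"
      using grad_full[OF c, of "\<lambda>_. True"] unfolding z by simp_all
    then have "(\<lambda>f. grad f c) ` exceptional_invariants = {O_full c *\<^sub>R kernel_x c (\<lambda>_. True) + 0 *\<^sub>R kernel_y c (\<lambda>_. True),
        0 *\<^sub>R kernel_x c (\<lambda>_. True) + E_full c *\<^sub>R kernel_y c (\<lambda>_. True)}"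
      using True by (simp add: exceptional_invariants_def)
    then show ?thesis
      unfolding null_space_span(1)[OF c True] using span_two_by_two[of "O_full c" "E_full c" 0 0] nz by simp
  next
    case False
    then have ev: "even CARD('n)" by simp
    let ?s = "(-1) ^ (CARD('n) div 2) :: real"
    let ?k = "CARD('n) div 2"
    have s: "?s \<noteq> 0" by simp
    have im: "(\<lambda>f. grad f c) ` exceptional_invariants = {grad O_full c, grad (O_inv ?k) c} \<union> {grad E_full c, grad (E_inv ?k) c}"
      using ev by (auto simp: exceptional_invariants_def)
    have X: "span {grad O_full c, grad (O_inv ?k) c} = span {kernel_x c parity, kernel_x c (\<lambda>i. \<not> parity i)}"
      unfolding grad_full(1)[OF c, of parity] grad_half(1)[OF n ev c]
      by (rule span_two_by_two) (use nz s gen[OF ev] in \<open>auto simp: mult.assoc right_diff_distrib[symmetric]\<close>)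
    have Y: "span {grad E_full c, grad (E_inv ?k) c} = span {kernel_y c parity, kernel_y c (\<lambda>i. \<not> parity i)}"
      unfolding grad_full(2)[OF c, of parity] grad_half(2)[OF n ev c]
      by (rule span_two_by_two) (use nz s gen[OF ev] in \<open>auto simp: mult.assoc right_diff_distrib[symmetric]\<close>)
    have "span ({grad O_full c, grad (O_inv ?k) c} \<union> {grad E_full c, grad (E_inv ?k) c})
      = span ({kernel_x c parity, kernel_x c (\<lambda>i. \<not> parity i)} \<union> {kernel_y c parity, kernel_y c (\<lambda>i. \<not> parity i)})"
      unfolding span_Un X Y ..
    also have "{kernel_x c parity, kernel_x c (\<lambda>i. \<not> parity i)} \<union> {kernel_y c parity, kernel_y c (\<lambda>i. \<not> parity i)}
      = {kernel_x c parity, kernel_x c (\<lambda>i. \<not> parity i), kernel_y c parity, kernel_y c (\<lambda>i. \<not> parity i)}" by auto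
    finally show ?thesis unfolding im null_space_span(2)[OF c ev] .
  qed
qed

section \<open>Genericity\<close>

text \<open>Leaving a zero in a direction of nonzero derivative makes the function nonzero at
  once.\<close>

lemma closure_nonvanishing:
  fixes f :: "'a::real_normed_vector \<Rightarrow> real"
  assumes f: "f differentiable at c" and v: "dirderiv f v c \<noteq> 0"
  shows "c \<in> closure {x. f x \<noteq> 0}"
proof (cases "f c = 0")
  case True
  have D: "((\<lambda>t. f (c + t *\<^sub>R v)) has_real_derivative dirderiv f v c) (at 0)"
    using has_real_derivative_along_line[of f c 0 v] f by simp
  have "\<exists>d>0. \<forall>t>0. t < d \<longrightarrow> f (c + t *\<^sub>R v) \<noteq> 0"
  proof (cases "dirderiv f v c > 0")
    case pos: True
    then show ?thesis using DERIV_pos_inc_right[OF D pos] True by force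
  next
    case False
    then have neg: "dirderiv f v c < 0" using v by simp
    then show ?thesis using DERIV_neg_dec_right[OF D neg] True by force
  qed
  then obtain d where d: "d > 0" "\<And>t. 0 < t \<Longrightarrow> t < d \<Longrightarrow> f (c + t *\<^sub>R v) \<noteq> 0" by blast
  show ?thesis
    unfolding closure_approachable
  proof (intro allI impI)
    fix e :: real assume e: "e > 0"
    define t where "t = min (d / 2) (e / (2 * (norm v + 1)))"
    have nv: "norm v + 1 > 0" by (simp add: add_nonneg_pos)
    have t: "0 < t" "t < d" using d(1) e nv by (auto simp: t_def)
    have "t * norm v \<le> t * (norm v + 1)" using t by simp
    also have "\<dots> \<le> e / (2 * (norm v + 1)) * (norm v + 1)" using nv by (intro mult_right_mono) (auto simp: t_def)
    also have "\<dots> = e / 2" using nv by (simp add: field_simps)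
    also have "\<dots> < e" using e by simp
    finally have "dist (c + t *\<^sub>R v) c < e" using t by (simp add: dist_norm)
    then show "\<exists>y\<in>{x. f x \<noteq> 0}. dist y c < e" using d(2)[OF t] by blast
  qed
next
  case False
  then show ?thesis using closure_subset[of "{x. f x \<noteq> 0}"] by auto
qed

lemma dense_Int:
  assumes "open A" "closure A = UNIV" "closure B = (UNIV :: 'a::topological_space set)"
  shows "closure (A \<inter> B) = UNIV"
  using closure_open_Int_superset[of A B] assms by simp

lemma dense_INT:
  assumes "finite I" "\<And>i. i \<in> I \<Longrightarrow> open (D i)" "\<And>i. i \<in> I \<Longrightarrow> closure (D i) = (UNIV :: 'a::topological_space set)"
  shows "closure (\<Inter>i\<in>I. D i) = UNIV"
  using assms
proof (induction rule: finite_induct)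
  case (insert i I)
  then show ?case using dense_Int[of "D i" "\<Inter>i\<in>I. D i"] by simp
qed simp

lemma dense_from_dense:
  assumes "closure A = UNIV" "A \<subseteq> closure B"
  shows "closure B = (UNIV :: 'a::topological_space set)"
  using closure_minimal[OF assms(2) closed_closure] assms(1) by blast

lemma dense_nonzero_coords: "closure (nonzero_coords :: 'a::euclidean_space set) = UNIV"
proof -
  have eq: "nonzero_coords = (\<Inter>b\<in>Basis. {c::'a. c \<bullet> b \<noteq> 0})" by (auto simp: nonzero_coords_def)
  have "closure {c::'a. c \<bullet> b \<noteq> 0} = UNIV" if b: "b \<in> Basis" for b
  proof -
    have "c \<in> closure {c. c \<bullet> b \<noteq> 0}" for c :: 'a
    proof (rule closure_nonvanishing)
      have D: "((\<lambda>c. c \<bullet> b) has_derivative (\<lambda>v. v \<bullet> b)) (at c)"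
        by (rule bounded_linear_imp_has_derivative) (rule bounded_linear_inner_left)
      then show "(\<lambda>c. c \<bullet> b) differentiable at c" by (rule differentiableI)
      show "dirderiv (\<lambda>c. c \<bullet> b) b c \<noteq> 0" using frechet_derivative_at[OF D] b by (metis inner_same_Basis zero_neq_one)
    qed
    then show ?thesis by blast
  qed
  then show ?thesis
    unfolding eq by (intro dense_INT) (auto intro!: open_Collect_neq continuous_intros)
qed

lemma log_deriv_nonvanishing:
  assumes "f differentiable at c" "log_deriv a f c \<noteq> 0"
  shows "c \<in> closure {x. f x \<noteq> 0}"
proof (rule closure_nonvanishing[OF assms(1)])
  show "dirderiv f a c \<noteq> 0" using assms(2) unfolding log_deriv_def by force
qed

text \<open>At points with nonzero coordinates, the logarithmic derivative of \<open>1 - x y\<close>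
  is \<open>- x y\<close> and thus nonzero. Such points form a dense set, so density has to be
  checked only there.\<close>

lemma dense_pent_domain: "closure (pent_domain :: 'n::nontriv coords set) = UNIV"
proof -
  have eq: "pent_domain = nonzero_coords \<inter> (\<Inter>i. {c::'n coords. 1 - fst c $ i * snd c $ i \<noteq> 0})"
    by (auto simp: pent_domain_def nonzero_coords_iff)
  have "closure {c::'n coords. 1 - fst c $ i * snd c $ i \<noteq> 0} = UNIV" for i
  proof (rule dense_from_dense[OF dense_nonzero_coords], rule subsetI)
    fix c :: "'n coords" assume c: "c \<in> nonzero_coords"
    show "c \<in> closure {c. 1 - fst c $ i * snd c $ i \<noteq> 0}"
    proof (rule log_deriv_nonvanishing)
      show "(\<lambda>c. 1 - fst c $ i * snd c $ i) differentiable at c"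
        by (intro differentiable_diff differentiable_const differentiable_mult differentiable_coord)
      show "log_deriv (ex i) (\<lambda>c. 1 - fst c $ i * snd c $ i) c \<noteq> 0"
        unfolding log_deriv_xy using c by (simp add: \<delta>_def nonzero_coords_iff)
    qed
  qed
  then show ?thesis
    unfolding eq
    by (intro dense_Int open_nonzero_coords dense_nonzero_coords dense_INT) (auto intro!: open_Collect_neq continuous_intros)
qed

text \<open>Differentiating by the logarithm of the coordinate of index 0 keeps the product over
  even indices and removes the other one, so the difference of the two has a nonzero derivative
  wherever no coordinate vanishes.\<close>

lemma generic_halves:
  assumes ev: "even CARD('n::nontriv)"
  defines "G \<equiv> {c :: 'n coords. half_x True c - half_x False c \<noteq> 0} \<inter> {c. half_y True c - half_y False c \<noteq> 0}"
  shows "open (nonzero_coords \<inter> G)" "closure (nonzero_coords \<inter> G) = UNIV"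
proof -
  have c: "continuous_on UNIV (half_x b :: 'n coords \<Rightarrow> real)" "continuous_on UNIV (half_y b :: 'n coords \<Rightarrow> real)" for b
    unfolding half_x_def half_y_def by (intro continuous_intros)+
  have o: "open {c :: 'n coords. half_x True c - half_x False c \<noteq> 0}" "open {c :: 'n coords. half_y True c - half_y False c \<noteq> 0}"
    by (intro open_Collect_neq continuous_intros c)+
  show "open (nonzero_coords \<inter> G)" unfolding G_def by (intro open_Int o open_nonzero_coords)
  have d: "half_x b differentiable at c" "half_y b differentiable at c" for b and c :: "'n coords"
    unfolding half_x_def half_y_def by (rule differentiable_monomial)+
  have l: "log_deriv a (\<lambda>c. f c - g c) c = log_deriv a f c - log_deriv a g c"
    if "f differentiable at c" "g differentiable at c" for a c :: "'n coords" and f g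
  proof -
    have "((\<lambda>c. f c - g c) has_derivative (\<lambda>v. dirderiv f v c - dirderiv g v c)) (at c)"
      using that by (intro has_derivative_diff) (simp_all add: frechet_derivative_works)
    from log_deriv_has_derivative[OF this] show ?thesis by (simp add: log_deriv_def algebra_simps)
  qed
  have nz: "half_x b c \<noteq> 0" "half_y b c \<noteq> 0" if "c \<in> nonzero_coords" for b and c :: "'n coords"
    using that by (auto simp: half_x_def half_y_def nonzero_coords_iff)
  have lx: "log_deriv (ex 0) (half_x b) c = of_bool b * half_x b c" "log_deriv (ey 0) (half_y b) c = of_bool b * half_y b c"
    for b and c :: "'n coords"
    unfolding half_x_def half_y_def by (simp_all add: log_deriv_monomial parity_0[OF ev])
  have "closure {c :: 'n coords. half_x True c - half_x False c \<noteq> 0} = UNIV"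
  proof (rule dense_from_dense[OF dense_nonzero_coords], rule subsetI)
    fix c :: "'n coords" assume c: "c \<in> nonzero_coords"
    show "c \<in> closure {c. half_x True c - half_x False c \<noteq> 0}"
      by (rule log_deriv_nonvanishing[of _ _ "ex 0"]) (use nz[OF c] in \<open>simp_all add: d l lx differentiable_diff\<close>)
  qed
  moreover have "closure {c :: 'n coords. half_y True c - half_y False c \<noteq> 0} = UNIV"
  proof (rule dense_from_dense[OF dense_nonzero_coords], rule subsetI)
    fix c :: "'n coords" assume c: "c \<in> nonzero_coords"
    show "c \<in> closure {c. half_y True c - half_y False c \<noteq> 0}"
      by (rule log_deriv_nonvanishing[of _ _ "ey 0"]) (use nz[OF c] in \<open>simp_all add: d l lx differentiable_diff\<close>)
  qed
  ultimately show "closure (nonzero_coords \<inter> G) = UNIV"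
    unfolding G_def by (intro dense_Int open_nonzero_coords dense_nonzero_coords o)
qed

section \<open>Classes of twisted polygons with given corner invariants\<close>

definition corner_lift :: "'n::nontriv coords \<Rightarrow> (int \<Rightarrow> real^3) \<Rightarrow> bool" where
  "corner_lift c = normalized_lift (\<lambda>i. - (snd c $ of_int (i + 1)))
     (\<lambda>i. fst c $ of_int (i + 1) * snd c $ of_int (i + 1) * snd c $ of_int i)"

text \<open>Defined through lifts; \<open>corner_class_moduli\<close> and
  \<open>corner_class_unique\<close> show that it is the only class with corner invariants
  \<open>c\<close>.\<close>

definition corner_class :: "'n::nontriv coords \<Rightarrow> polygon set" where
  "corner_class c = {(\<lambda>i. span {V i}) | V. corner_lift c V}"

lemma corner_lift_polygon:
  fixes c :: "'n::nontriv coords"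
  assumes c: "c \<in> nonzero_coords" and V: "corner_lift c V"
  shows "twisted_polygon CARD('n) (\<lambda>i. span {V i})" "has_corner_invariants (\<lambda>i. span {V i}) c"
proof -
  have nz: "fst c $ i \<noteq> 0" "snd c $ i \<noteq> 0" for i using c by (simp_all add: nonzero_coords_iff)
  have per: "(of_int (i + int CARD('n) + 1) :: 'n mod_ring) = of_int (i + 1)" for i
    using mod_ring_of_int_period[of "i + 1", where 'n='n] by (simp only: add_ac)
  show "twisted_polygon CARD('n) (\<lambda>i. span {V i})"
    by (rule lift_twisted[OF V[unfolded corner_lift_def]]) (simp_all only: per mod_ring_of_int_period, use nz in simp)
  show "has_corner_invariants (\<lambda>i. span {V i}) c"
    unfolding has_corner_invariants_def
    using lift_cross_ratios[OF V[unfolded corner_lift_def]] nz by simp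
qed

lemma has_corner_invariants_lift:
  assumes "twisted_polygon CARD('n) v" "has_corner_invariants v (c :: 'n::nontriv coords)"
  shows "v \<in> corner_class c"
proof -
  have "\<exists>V. normalized_lift (\<lambda>i. - (snd c $ of_int (i + 1))) (\<lambda>i. fst c $ of_int (i + 1) * snd c $ of_int (i + 1) * snd c $ of_int i) V
     \<and> v = (\<lambda>i. span {V i})"
    by (rule twisted_polygon_lift[OF assms(1), of "\<lambda>i. fst c $ of_int i" "\<lambda>i. snd c $ of_int i"])
       (use assms(2) in \<open>simp_all add: has_corner_invariants_def\<close>)
  then show ?thesis by (auto simp: corner_class_def corner_lift_def)
qed

text \<open>Linear images of a lift are lifts for the same coefficients, and by
  \<open>lift_unique\<close> any two lifts differ by an invertible linear map.\<close>

lemma corner_class_equivalence: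
  fixes c :: "'n::nontriv coords"
  assumes c: "c \<in> nonzero_coords" and v: "v \<in> corner_class c"
  shows "proj_equivalence CARD('n) `` {v} = corner_class c"
proof -
  have nz: "fst c $ i \<noteq> 0" "snd c $ i \<noteq> 0" for i using c by (simp_all add: nonzero_coords_iff)
  obtain V where V: "corner_lift c V" "v = (\<lambda>i. span {V i})" using v by (auto simp: corner_class_def)
  have tv: "twisted_polygon CARD('n) v" using corner_lift_polygon(1)[OF c V(1)] V(2) by simp
  show ?thesis
  proof (intro equalityI subsetI)
    fix w assume "w \<in> proj_equivalence CARD('n) `` {v}"
    then obtain f where f: "invertible_linear f" "\<And>k. w k = f ` v k" by (auto simp: proj_equivalence_def)
    have "corner_lift c (\<lambda>i. f (V i))" using lift_image[OF V(1)[unfolded corner_lift_def] f(1)] by (simp add: corner_lift_def)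
    moreover have "w = (\<lambda>i. span {f (V i)})" using f by (simp add: fun_eq_iff V(2) invertible_image_span)
    ultimately show "w \<in> corner_class c" by (auto simp: corner_class_def)
  next
    fix w assume "w \<in> corner_class c"
    then obtain V' where V': "corner_lift c V'" "w = (\<lambda>i. span {V' i})" by (auto simp: corner_class_def)
    obtain f where f: "invertible_linear f" "\<And>i. V' i = f (V i)"
      using lift_unique[OF V(1)[unfolded corner_lift_def] V'(1)[unfolded corner_lift_def]] nz by auto
    have "w k = f ` v k" for k using f by (simp add: V(2) V'(2) invertible_image_span)
    moreover have "twisted_polygon CARD('n) w" using corner_lift_polygon(1)[OF c V'(1)] V'(2) by simp
    ultimately show "w \<in> proj_equivalence CARD('n) `` {v}" using tv f(1) by (auto simp: proj_equivalence_def)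
  qed
qed

lemma corner_class_moduli:
  fixes c :: "'n::nontriv coords"
  assumes c: "c \<in> nonzero_coords"
  shows "corner_class c \<noteq> {}" "corner_class c \<in> twisted_moduli CARD('n)" "class_coords (corner_class c) c"
proof -
  have nz: "fst c $ i \<noteq> 0" "snd c $ i \<noteq> 0" for i using c by (simp_all add: nonzero_coords_iff)
  have "\<exists>V. corner_lift c V" unfolding corner_lift_def by (rule lift_exists) (use nz in simp)
  then obtain V where V: "corner_lift c V" by blast
  then have v: "(\<lambda>i. span {V i}) \<in> corner_class c" by (auto simp: corner_class_def)
  then show "corner_class c \<noteq> {}" by blast
  show "corner_class c \<in> twisted_moduli CARD('n)"
    unfolding twisted_moduli_def corner_class_equivalence[OF c v, symmetric]
    by (rule quotientI) (simp add: corner_lift_polygon(1)[OF c V])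
  show "class_coords (corner_class c) c"
    using corner_lift_polygon(2)[OF c] by (auto simp: class_coords_def corner_class_def)
qed

lemma corner_class_unique:
  fixes c :: "'n::nontriv coords"
  assumes c: "c \<in> nonzero_coords" and C: "C \<in> twisted_moduli CARD('n)" "class_coords C c"
  shows "C = corner_class c"
proof -
  obtain v where v: "twisted_polygon CARD('n) v" "C = proj_equivalence CARD('n) `` {v}"
    using C(1) by (auto simp: twisted_moduli_def quotient_def)
  have "invertible_linear id" by (simp add: invertible_linear_def linear_id)
  then have "v \<in> C" using v by (auto simp: proj_equivalence_def intro!: exI[of _ id])
  then have "v \<in> corner_class c" using has_corner_invariants_lift[OF v(1)] C(2) by (simp add: class_coords_def)
  then show ?thesis using corner_class_equivalence[OF c] v(2) by simp
qed

lemma corner_chart_nonzero: "corner_chart (nonzero_coords :: 'n::nontriv coords set)"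
  unfolding corner_chart_def
  using open_nonzero_coords dense_nonzero_coords corner_class_moduli corner_class_unique by metis

lemma pent_map_nonzero: "c \<in> pent_domain \<Longrightarrow> pent_map c \<in> nonzero_coords"
  by (auto simp: nonzero_coords_iff pent_map_def pent_domain_def)

lemma pentagram_corner_class:
  fixes c :: "'n::nontriv coords"
  assumes c: "c \<in> pent_domain" and v: "v \<in> corner_class c"
  shows "pentagram v \<in> corner_class (pent_map c)"
proof -
  obtain V where V: "corner_lift c V" "v = (\<lambda>i. span {V i})" using v by (auto simp: corner_class_def)
  have "corner_lift (pent_map c) (\<lambda>i. V (i + 2) + snd c $ of_int i *\<^sub>R V i)"
    unfolding corner_lift_def
    by (rule pentagram_normalized_lift[OF V(1)[unfolded corner_lift_def]])
       (use c in \<open>simp_all add: pent_domain_def pent_map_def\<close>)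
  then show ?thesis
    unfolding V(2) pentagram_lift[OF V(1)[unfolded corner_lift_def]] corner_class_def
    by (intro CollectI exI[of _ "\<lambda>i. V (i + 2) + snd c $ of_int i *\<^sub>R V i"] conjI refl)
qed

text \<open>The pentagram images of a class all lie in \<open>corner_class (pent_map c)\<close>, so
  their saturation under equivalence is this single class.\<close>

lemma pentagram_in_coords_pent_map:
  "pentagram_in_coords nonzero_coords pent_domain (pent_map :: 'n::nontriv coords \<Rightarrow> 'n coords)"
  unfolding pentagram_in_coords_def
proof (intro conjI ballI impI)
  show sub: "pent_domain \<subseteq> (nonzero_coords :: 'n coords set)" by (auto simp: pent_domain_def nonzero_coords_iff)
  show "pent_map ` pent_domain \<subseteq> (nonzero_coords :: 'n coords set)" using pent_map_nonzero by blast
  fix c :: "'n coords" and C assume c: "c \<in> pent_domain" and C: "C \<in> twisted_moduli CARD('n)" "class_coords C c"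
  have cn: "c \<in> nonzero_coords" using c sub by blast
  have "C = corner_class c" by (rule corner_class_unique[OF cn C])
  then have "pentagram ` C \<subseteq> corner_class (pent_map c)" and ne: "pentagram ` C \<noteq> {}"
    using pentagram_corner_class[OF c] corner_class_moduli(1)[OF cn] by auto
  then have "proj_equivalence CARD('n) `` {v} = corner_class (pent_map c)" if "v \<in> pentagram ` C" for v
    using corner_class_equivalence[OF pent_map_nonzero[OF c]] that by (metis subsetD)
  then have "pentagram_class CARD('n) C = (\<Union>v\<in>pentagram ` C. corner_class (pent_map c))"
    unfolding pentagram_class_def by (subst Image_eq_UN) (rule SUP_cong[OF refl])
  \<comment> \<open>Nonemptiness enters here: an empty union would not be a class.\<close>
  then have "pentagram_class CARD('n) C = corner_class (pent_map c)" using ne by simp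
  then show "pentagram_class CARD('n) C \<in> twisted_moduli CARD('n)" "class_coords (pentagram_class CARD('n) C) (pent_map c)"
    using corner_class_moduli(2,3)[OF pent_map_nonzero[OF c]] by simp_all
qed (rule open_pent_domain dense_pent_domain smooth_pent_map)+

theorem theorem1:
  assumes "3 \<le> CARD('n::nontriv)"
  shows "\<exists>(U :: 'n coords set) P.
    corner_chart U \<and>
    poisson_structure_on U P \<and>
    has_corank U P (if odd CARD('n) then 2 else 4) \<and>
    generically (\<lambda>c. c \<in> U \<and> span ((\<lambda>f. grad f c) ` exceptional_invariants) = null_space P c) \<and>
    (\<forall>f\<in>remaining_invariants. \<forall>g\<in>remaining_invariants. \<forall>c\<in>U. bracket P f g c = 0) \<and>
    (\<exists>W F. pentagram_in_coords U W F \<and> bracket_invariant_on P W F)"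
proof (intro exI conjI)
  let ?U = "nonzero_coords :: 'n coords set" and ?P = "log_canonical pent_matrix :: 'n coords \<Rightarrow> _"
  show "corner_chart ?U" by (rule corner_chart_nonzero)
  show "poisson_structure_on ?U ?P"
    by (rule poisson_log_canonical[OF open_nonzero_coords]) (rule pent_matrix_skew)
  show "has_corank ?U ?P (if odd CARD('n) then 2 else 4)"
    unfolding has_corank_def generically_def
  \<comment> \<open>The null space has the same dimension at all points with nonzero coordinates, so
    every leaf there has the stated codimension.\<close>
  proof (intro exI[of _ ?U] conjI ballI)
    fix p :: "'n coords" assume p: "p \<in> ?U"
    show "has_codimension (symplectic_leaf ?U ?P p) (if odd CARD('n) then 2 else 4)"
      by (rule leaf_codimension[OF pent_matrix_skew p dim_null_space_pent])
  qed (rule open_nonzero_coords dense_nonzero_coords, assumption?)+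
  show "generically (\<lambda>c. c \<in> ?U \<and> span ((\<lambda>f. grad f c) ` exceptional_invariants) = null_space ?P c)"
  \<comment> \<open>For even n the points where two half products coincide are removed, as the
    gradients become dependent there.\<close>
  proof (cases "even CARD('n)")
    case True
    from generic_halves[OF this] show ?thesis
      unfolding generically_def using span_grad_exceptional[OF assms]
      by (intro exI[of _ "?U \<inter> ({c. half_x True c - half_x False c \<noteq> 0} \<inter> {c. half_y True c - half_y False c \<noteq> 0})"]) auto
  next
    case False
    then show ?thesis
      unfolding generically_def using span_grad_exceptional[OF assms] open_nonzero_coords dense_nonzero_coords
      by (intro exI[of _ ?U]) auto
  qed
  show "\<forall>f\<in>remaining_invariants. \<forall>g\<in>remaining_invariants. \<forall>c\<in>?U. bracket ?P f g c = 0"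
  proof -
    have eo: "bracket ?P (E_inv k) (O_inv l) c = 0" for k l c
      using O_E_commute[OF assms, of l k c] log_canonical_skew[where \<pi>=pent_matrix, OF pent_matrix_skew]
      unfolding bracket_def by (metis neg_equal_0_iff_equal)
    show ?thesis
      using O_O_commute[OF assms] E_E_commute[OF assms] O_E_commute[OF assms] eo
      by (auto simp: remaining_invariants_def)
  qed
  show "pentagram_in_coords ?U pent_domain pent_map" by (rule pentagram_in_coords_pent_map)
  show "bracket_invariant_on ?P pent_domain pent_map" by (rule pent_map_bracket_invariant)
qed

end
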